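(* The following convergence of random analytic functions (of the variable $\beta$) holds weakly on $\mathcal{H}\left(E_1\cap\{\beta:\operatorname{Re}\beta>\frac{\sigma_1}{2}\}\right)$ as $n\to\infty$: $$\frac{\mathcal{Z}_n(\beta)-\mathbb{E}\mathcal{Z}_n(\beta)}{e^{\beta\sqrt{na_1}\,u_{n,1}+\tilde c_n(\beta)}}\longrightarrow\zeta_P\left(\frac{\beta}{\sigma_1}\right),$$ where $\zeta_P$ is the (one-variable) Poisson process zeta function.
   Context: GREM. Fix $d\in\mathbb{N}$, variances $a_1,\dots,a_d>0$, branching exponents $\alpha_1,\dots,\alpha_d>1$, and sequences of natural numbers $N_{n,1},\dots,N_{n,d}$ with $\lim_{n\to\infty}N_{n,j}/\alpha_j^n=1$ for each $j$. Let $\mathbb{S}_n=\{\varepsilon=(\varepsilon_1,\dots,\varepsilon_d)\in\mathbb{N}^d:1\le\varepsilon_j\le N_{n,j},\ 1\le j\le d\}$. Let $\{\xi_{\varepsilon_1\dots\varepsilon_j}:1\le j\le d,\ 1\le\varepsilon_i\le N_{n,i}\}$ be independent real standard normal random variables, $X_\varepsilon=\sum_{j=1}^d\sqrt{a_j}\,\xi_{\varepsilon_1\dots\varepsilon_j}$, and $\mathcal{Z}_n(\beta)=\sum_{\varepsilon\in\mathbb{S}_n}e^{\beta\sqrt n X_\varepsilon}$, $\beta=\sigma+i\tau\in\mathbb{C}$. Put $\sigma_j=\sqrt{2\log\alpha_j/a_j}$; it is assumed throughout that $\sigma_1<\dots<\sigma_d$. $E_1=\mathbb{C}\setminus\overline{G_1\cup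 F_1}$, where $G_1=\{\beta:2|\sigma|>\sigma_1,\ |\sigma|+|\tau|>\sigma_1\}$ and $F_1=\{\beta:2|\sigma|<\sigma_1,\ 2(\sigma^2+\tau^2)>\sigma_1^2\}$. Normalization: $u_{n,1}$ is a real sequence with $N_{n,1}\sim\sqrt{2\pi}\,u_{n,1}e^{u_{n,1}^2/2}$ as $n\to\infty$; $\tilde c_n(\beta)=\sum_{k=2}^d\left(\log N_{n,k}+\frac12a_k\beta^2n\right)$ (this is the normalization for levels $2,\dots,d$, all of which are in the expectation phase for $\beta\in E_1$). Poisson process zeta function: let $P_1<P_2<\dots$ be the points of a unit intensity Poisson point process on $(0,\infty)$; $\zeta_P(z)=\sum_{k=1}^\infty P_k^{-z}$ for $\operatorname{Re}z>1$, and $\zeta_P$ also denotes its almost surely existing meromorphic continuation to $\{\operatorname{Re}z>1/2\}$, which satisfies $\zeta_P(z)-\frac1{z-1}=\lim_{T\to\infty}\left(\sum_{P_k\le T}P_k^{-z}-\int_1^Tt^{-z}\,dt\right)$ locally uniformly on $\{\operatorname{Re}z>1/2\}$ a.s. For open $D\subset\mathbb{C}$, $\mathcal{H}(D)$ is the space of analytic functions on $D$ with the topology of locally uniform convergence; weak convergence on $\mathcal{H}(D)$ means convergence in distribution of random elements. *)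

theory Defs
  imports "HOL-Probability.Probability" "HOL-Complex_Analysis.Complex_Analysis"
    "HOL-Library.Landau_Symbols"
begin

section \<open>Convergence in distribution of random elements of a topological space\<close>

definition borel_of :: "'c topology \<Rightarrow> 'c measure" where
  "borel_of T = sigma (topspace T) {U. openin T U}"

text \<open>Random elements may be defined only almost surely: the map \<open>X\<close> itself need be neither
  measurable nor everywhere valued in the space, but it must agree almost surely with a Borel
  measurable \<open>Y\<close>. The expectations below do not depend on which \<open>Y\<close> is taken.\<close>

definition random_element_version ::
    "'c topology \<Rightarrow> 'a measure \<Rightarrow> ('a \<Rightarrow> 'c) \<Rightarrow> ('a \<Rightarrow> 'c) \<Rightarrow> bool" where
  "random_element_version T M X Y \<longleftrightarrow>
     Y \<in> measurable M (borel_of T) \<and> (AE \<omega> in M. X \<omega> = Y \<omega>)"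

definition converges_in_distribution ::
    "'c topology \<Rightarrow> (nat \<Rightarrow> 'a measure) \<Rightarrow> (nat \<Rightarrow> 'a \<Rightarrow> 'c) \<Rightarrow> 'b measure \<Rightarrow> ('b \<Rightarrow> 'c) \<Rightarrow> bool" where
  "converges_in_distribution T M X M' X' \<longleftrightarrow>
     (\<exists>Y Y'. (\<forall>n. random_element_version T (M n) (X n) (Y n)) \<and>
             random_element_version T M' X' Y' \<and>
             (\<forall>\<phi>. continuous_map T euclideanreal \<phi> \<and> bounded (\<phi> ` topspace T) \<longrightarrow>
                (\<lambda>n. \<integral>\<omega>. \<phi> (Y n \<omega>) \<partial>M n) \<longlonglongrightarrow> (\<integral>\<omega>. \<phi> (Y' \<omega>) \<partial>M')))"


section \<open>The space of analytic functions on an open set\<close>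

text \<open>A function on \<open>D\<close> is represented by its extension with the value \<open>undefined\<close> outside \<open>D\<close>.\<close>

definition analytic_functions :: "complex set \<Rightarrow> (complex \<Rightarrow> complex) set" where
  "analytic_functions D = {f. f holomorphic_on D \<and> f \<in> extensional D}"

definition locally_uniform_topology :: "complex set \<Rightarrow> (complex \<Rightarrow> complex) topology" where
  "locally_uniform_topology D = topology_generated_by
     {{g \<in> analytic_functions D. \<forall>z\<in>K. dist (g z) (f z) < e} | f K e.
        f \<in> analytic_functions D \<and> compact K \<and> K \<subseteq> D \<and> 0 < e}"

lemma topspace_locally_uniform_topology:
  "topspace (locally_uniform_topology D) = analytic_functions D" (is "?L = ?R")
proof
  show "?L \<subseteq> ?R"
    unfolding locally_uniform_topology_def topology_generated_by_topspace by blast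
next
  show "?R \<subseteq> ?L"
  proof
    fix f assume f: "f \<in> ?R"
    then have "{g \<in> analytic_functions D. \<forall>z\<in>{}. dist (g z) (f z) < 1} \<in>
      {{g \<in> analytic_functions D. \<forall>z\<in>K. dist (g z) (f z) < e} | f K e.
        f \<in> analytic_functions D \<and> compact K \<and> K \<subseteq> D \<and> (0::real) < e}"
      by (intro CollectI exI[of _ f] exI[of _ "{}"] exI[of _ "1::real"]) auto
    with f show "f \<in> ?L"
      unfolding locally_uniform_topology_def topology_generated_by_topspace by blast
  qed
qed


section \<open>The generalized random energy model\<close>

text \<open>Levels are numbered \<open>1, \<dots>, d\<close>. A multi-index is a list whose entry number \<open>j - 1\<close> is
  the coordinate \<open>\<epsilon>\<^sub>j\<close>, so that \<open>take j \<epsilon>\<close> is \<open>\<epsilon>\<^sub>1\<dots>\<epsilon>\<^sub>j\<close>. The argument \<open>N\<close> is the family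
  \<open>j \<mapsto> N\<^sub>n\<^sub>,\<^sub>j\<close> for a fixed \<open>n\<close>.\<close>

definition grem_level :: "nat \<Rightarrow> (nat \<Rightarrow> nat) \<Rightarrow> nat list set" where
  "grem_level j N = {\<epsilon>. length \<epsilon> = j \<and> (\<forall>i\<in>{1..j}. 1 \<le> \<epsilon> ! (i - 1) \<and> \<epsilon> ! (i - 1) \<le> N i)}"

definition grem_field ::
    "nat \<Rightarrow> (nat \<Rightarrow> real) \<Rightarrow> (nat list \<Rightarrow> 'a \<Rightarrow> real) \<Rightarrow> nat list \<Rightarrow> 'a \<Rightarrow> real" where
  "grem_field d a \<xi> \<epsilon> \<omega> = (\<Sum>j=1..d. sqrt (a j) * \<xi> (take j \<epsilon>) \<omega>)"

definition grem_partition ::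
    "nat \<Rightarrow> (nat \<Rightarrow> real) \<Rightarrow> (nat \<Rightarrow> nat) \<Rightarrow> (nat list \<Rightarrow> 'a \<Rightarrow> real) \<Rightarrow> nat \<Rightarrow> complex \<Rightarrow> 'a \<Rightarrow> complex" where
  "grem_partition d a N \<xi> n \<beta> \<omega> =
     (\<Sum>\<epsilon>\<in>grem_level d N. exp (\<beta> * complex_of_real (sqrt (real n) * grem_field d a \<xi> \<epsilon> \<omega>)))"

definition grem_sigma :: "(nat \<Rightarrow> real) \<Rightarrow> (nat \<Rightarrow> real) \<Rightarrow> nat \<Rightarrow> real" where
  "grem_sigma a \<alpha> j = sqrt (2 * ln (\<alpha> j) / a j)"

definition glassy_phase :: "real \<Rightarrow> complex set" where
  "glassy_phase s = {\<beta>. 2 * \<bar>Re \<beta>\<bar> > s \<and> \<bar>Re \<beta>\<bar> + \<bar>Im \<beta>\<bar> > s}"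

definition fluctuation_phase :: "real \<Rightarrow> complex set" where
  "fluctuation_phase s = {\<beta>. 2 * \<bar>Re \<beta>\<bar> < s \<and> 2 * ((Re \<beta>)\<^sup>2 + (Im \<beta>)\<^sup>2) > s\<^sup>2}"

definition expectation_phase :: "real \<Rightarrow> complex set" where
  "expectation_phase s = UNIV - closure (glassy_phase s \<union> fluctuation_phase s)"

definition grem_c_tilde ::
    "nat \<Rightarrow> (nat \<Rightarrow> real) \<Rightarrow> (nat \<Rightarrow> nat) \<Rightarrow> nat \<Rightarrow> complex \<Rightarrow> complex" where
  "grem_c_tilde d a N n \<beta> =
     (\<Sum>k=2..d. complex_of_real (ln (real (N k))) + complex_of_real (a k) * \<beta>\<^sup>2 * of_nat n / 2)"


section \<open>The Poisson process zeta function\<close>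

text \<open>\<open>P 0 < P 1 < \<dots>\<close> are the points, in increasing order, of a homogeneous Poisson point process
  of intensity 1 on the positive half-line: counts of points in sets of finite Lebesgue measure are
  Poisson distributed, and counts in disjoint sets are independent. The Poisson weights are
  written out because \<^const>\<open>poisson_pmf\<close> does not cover rate 0. Finiteness of the counts is
  required separately since \<^const>\<open>card\<close> of an infinite set is 0.\<close>

definition unit_poisson_points :: "'b measure \<Rightarrow> (nat \<Rightarrow> 'b \<Rightarrow> real) \<Rightarrow> bool" where
  "unit_poisson_points M P \<longleftrightarrow>
     (\<forall>k. P k \<in> borel_measurable M) \<and>
     (AE \<omega> in M. 0 < P 0 \<omega> \<and> strict_mono (\<lambda>k. P k \<omega>)) \<and>
     (\<forall>A. A \<in> sets borel \<and> A \<subseteq> {0<..} \<and> emeasure lborel A < \<infinity> \<longrightarrow>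
        (AE \<omega> in M. finite {k. P k \<omega> \<in> A}) \<and>
        (\<forall>m. measure M {\<omega> \<in> space M. card {k. P k \<omega> \<in> A} = m} =
               measure lborel A ^ m / fact m * exp (- measure lborel A))) \<and>
     (\<forall>A :: nat \<Rightarrow> real set.
        (\<forall>i. A i \<in> sets borel \<and> A i \<subseteq> {0<..} \<and> emeasure lborel (A i) < \<infinity>) \<and>
        disjoint_family A \<longrightarrow>
        prob_space.indep_vars M (\<lambda>_. count_space UNIV) (\<lambda>i \<omega>. card {k. P k \<omega> \<in> A i}) UNIV)"

text \<open>For a deterministic sequence \<open>p\<close>, \<open>f\<close> is the meromorphic continuation of
  \<open>\<Sum>\<^sub>k p\<^sub>k powr (-z)\<close> from \<open>Re z > 1\<close> to \<open>Re z > 1/2\<close>. \<^const>\<open>nicely_meromorphic_on\<close> excludes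
  removable singularities, so the values of \<open>f\<close> on \<open>Re z > 1/2\<close> are unique.\<close>

definition is_zeta_continuation :: "(nat \<Rightarrow> real) \<Rightarrow> (complex \<Rightarrow> complex) \<Rightarrow> bool" where
  "is_zeta_continuation p f \<longleftrightarrow>
     f nicely_meromorphic_on {z. Re z > 1/2} \<and>
     (\<forall>z. Re z > 1 \<longrightarrow> (\<lambda>k. complex_of_real (p k) powr (- z)) sums f z)"

text \<open>For the points of a unit intensity Poisson process the continuation exists almost surely;
  the value 0 is a dummy for the remaining sequences.\<close>

definition poisson_zeta :: "(nat \<Rightarrow> real) \<Rightarrow> complex \<Rightarrow> complex" where
  "poisson_zeta p =
     (if \<exists>f. is_zeta_continuation p f then SOME f. is_zeta_continuation p f else (\<lambda>_. 0))"

end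

theory Submission imports Defs "HOL-Real_Asymp.Real_Asymp" "HOL-Combinatorics.Multiset_Permutations"
begin

text \<open>With \<open>v = - u (\<xi> - u)\<close> for the first-level variables, the points \<open>e\<^sup>v\<close> form asymptotically a
  unit Poisson process and the first-level term of the normalized partition function is
  \<open>\<Sum> (e\<^sup>v) powr (- \<beta> / \<sigma>\<^sub>1)\<close>, up to \<open>sqrt (n a\<^sub>1) / u \<rightarrow> 1 / \<sigma>\<^sub>1\<close>. The fluctuations of the deeper
  levels and of the points beyond \<open>r\<close> are martingale differences; by the von Bahr--Esseen inequality
  their \<open>p\<close>-th moments are small for a suitable \<open>p\<close> between 1 and 2, which exists exactly
  because \<open>|\<sigma>| + |\<tau>| < \<sigma>\<^sub>1\<close>. Cauchy's formula makes these estimates locally uniform in \<open>\<beta>\<close>. The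
  points below \<open>r\<close> are grouped into small cells, whose multinomial counts converge to independent
  Poisson variables, and the resulting approximations converge to the zeta function as \<open>r\<close> tends to
  infinity.\<close>

section \<open>The metric of locally uniform convergence\<close>

text \<open>Variances do not work on the whole triangle: for \<open>p = 2\<close> the rate of the
  deeper levels, at the critical growth given by \<sigma>_1, is 2|\<beta>|^2 - \<sigma>_1^2, which
  is positive near the corner \<beta> = \<sigma>_1. Even for \<open>p\<close> below 2 the points
  close to 0 carry terms with huge p-th moments. Since points below \<delta> exist only with
  probability of order \<delta>, the moment estimates are made after discarding them. The centring,
  in contrast, keeps the untruncated mean. This is consistent because Re(\<beta>/\<sigma>_1) < 1
  makes t^(-z) integrable at 0: the mean of the points below r tends to r^(1-z)/(1-z), the integral
  of t^(-z) over (0,r], and the sum minus this value tends to \<zeta>_P(z); the summand 1/(z-1) in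
  the definition of \<zeta>_P is minus the integral over (0,1]. For fixed r the approximations
  depend on finitely many counts, so their convergence in law is a matter of point masses. The limit
  in n is taken before the limit in r, with \<delta> fixed by the tolerance.\<close>

text \<open>The weight \<open>infdist z (- D)\<close> vanishes at the boundary of \<open>D\<close>, so a single supremum controls all
  compact subsets of a bounded open set.\<close>

definition hol_dist :: "complex set \<Rightarrow> (complex \<Rightarrow> complex) \<Rightarrow> (complex \<Rightarrow> complex) \<Rightarrow> real" where
  "hol_dist D f g = (SUP z\<in>D. min (infdist z (- D)) (norm (f z - g z)))"

locale bounded_open_set =
  fixes D :: "complex set"
  assumes open_D: "open D" and bounded_D: "bounded D" and D_nonempty: "D \<noteq> {}"
begin

lemma compl_nonempty: "- D \<noteq> {}"
proof
  assume "- D = {}"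
  then have "D = UNIV" by auto
  then show False using bounded_D not_bounded_UNIV by auto
qed

lemma weight_pos: "z \<in> D \<Longrightarrow> 0 < infdist z (- D)"
  by (metis ComplD closed_Compl compl_nonempty in_closed_iff_infdist_zero infdist_nonneg
      less_eq_real_def open_D)

lemma weight_bdd: "bdd_above ((\<lambda>z. min (infdist z (- D)) (norm (f z - g z))) ` D)"
proof -
  obtain a where a: "a \<in> - D" using compl_nonempty by auto
  obtain B where B: "\<And>z. z \<in> D \<Longrightarrow> dist a z \<le> B"
    using bounded_D unfolding bounded_any_center[of _ a] by auto
  show ?thesis
  proof (rule bdd_aboveI2)
    fix z assume z: "z \<in> D"
    have "infdist z (- D) \<le> dist z a" using a by (rule infdist_le)
    also have "\<dots> \<le> B" using B[OF z] by (simp add: dist_commute)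
    finally show "min (infdist z (- D)) (norm (f z - g z)) \<le> B" by simp
  qed
qed

lemma hol_dist_upper: "z \<in> D \<Longrightarrow> min (infdist z (- D)) (norm (f z - g z)) \<le> hol_dist D f g"
  unfolding hol_dist_def by (rule cSUP_upper[OF _ weight_bdd])

lemma hol_dist_le:
  assumes "\<And>z. z \<in> D \<Longrightarrow> min (infdist z (- D)) (norm (f z - g z)) \<le> e"
  shows "hol_dist D f g \<le> e"
  unfolding hol_dist_def using assms D_nonempty by (intro cSUP_least) auto

lemma hol_dist_le_on_core:
  assumes "\<And>z. z \<in> D \<Longrightarrow> e \<le> infdist z (- D) \<Longrightarrow> norm (f z - g z) \<le> e"
  shows "hol_dist D f g \<le> e"
  by (rule hol_dist_le) (use assms in \<open>force simp: min_def\<close>)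

definition core :: "real \<Rightarrow> complex set" where
  "core e = {z. e \<le> infdist z (- D)}"

lemma core_subset: "0 < e \<Longrightarrow> core e \<subseteq> D"
proof
  fix z assume e: "0 < e" and z: "z \<in> core e"
  show "z \<in> D"
  proof (rule ccontr)
    assume "z \<notin> D"
    then have "infdist z (- D) = 0" by (intro infdist_zero) auto
    then show False using e z unfolding core_def by simp
  qed
qed

lemma compact_core: "0 < e \<Longrightarrow> compact (core e)"
proof -
  assume e: "0 < e"
  have "closed (core e)" unfolding core_def
    by (intro closed_Collect_le continuous_intros)
  moreover have "bounded (core e)" using core_subset[OF e] bounded_D bounded_subset by blast
  ultimately show ?thesis by (simp add: compact_eq_bounded_closed)
qed

lemma hol_dist_nonneg: "0 \<le> hol_dist D f g"
proof -
  obtain z where z: "z \<in> D" using D_nonempty by auto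
  have "0 \<le> min (infdist z (- D)) (norm (f z - g z))" by (simp add: infdist_nonneg)
  also have "\<dots> \<le> hol_dist D f g" by (rule hol_dist_upper[OF z])
  finally show ?thesis .
qed

sublocale hol: Metric_space "analytic_functions D" "hol_dist D"
proof
  fix f g h :: "complex \<Rightarrow> complex"
  show "0 \<le> hol_dist D f g" by (rule hol_dist_nonneg)
  show "hol_dist D f g = hol_dist D g f" unfolding hol_dist_def by (simp add: norm_minus_commute)
  show "hol_dist D f h \<le> hol_dist D f g + hol_dist D g h"
  proof (rule hol_dist_le)
    fix z assume z: "z \<in> D"
    have w: "0 \<le> infdist z (- D)" by (rule infdist_nonneg)
    have "norm (f z - h z) \<le> norm (f z - g z) + norm (g z - h z)"
      using norm_triangle_ineq[of "f z - g z" "g z - h z"] by simp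
    then have "min (infdist z (- D)) (norm (f z - h z))
        \<le> min (infdist z (- D)) (norm (f z - g z)) + min (infdist z (- D)) (norm (g z - h z))"
      using w norm_ge_zero[of "f z - g z"] norm_ge_zero[of "g z - h z"] by linarith
    also have "\<dots> \<le> hol_dist D f g + hol_dist D g h"
      by (intro add_mono hol_dist_upper z)
    finally show "min (infdist z (- D)) (norm (f z - h z)) \<le> hol_dist D f g + hol_dist D g h" .
  qed
  assume f: "f \<in> analytic_functions D" and g: "g \<in> analytic_functions D"
  show "hol_dist D f g = 0 \<longleftrightarrow> f = g"
  proof
    assume 0: "hol_dist D f g = 0"
    have "f z = g z" if z: "z \<in> D" for z
      using hol_dist_upper[OF z, of f g] weight_pos[OF z] 0 by (auto simp: min_def split: if_splits)
    with f g show "f = g" unfolding analytic_functions_def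
      by (auto intro: extensionalityI[of _ D])
  next
    assume "f = g"
    then have "hol_dist D f g \<le> 0" by (intro hol_dist_le) (auto simp: infdist_nonneg)
    then show "hol_dist D f g = 0" using hol_dist_nonneg[of f g] by simp
  qed
qed

text \<open>On a compact subset of \<open>D\<close> the weight is bounded below, so small balls
  control the supremum there; conversely a ball of radius \<open>e\<close> contains the basic set
  given by the compact \<open>core (e/2)\<close> and the tolerance \<open>e/2\<close>.\<close>

lemma locally_uniform_topology_eq: "locally_uniform_topology D = hol.mtopology"
proof (rule topology_eq[THEN iffD2], intro allI iffI)
  fix U
  let ?S = "{{g \<in> analytic_functions D. \<forall>z\<in>K. dist (g z) (f z) < e} | f K e.
        f \<in> analytic_functions D \<and> compact K \<and> K \<subseteq> D \<and> 0 < e}"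
  assume "openin (locally_uniform_topology D) U"
  then have "generate_topology_on ?S U"
    unfolding locally_uniform_topology_def openin_topology_generated_by_iff by simp
  moreover have "openin hol.mtopology B" if "B \<in> ?S" for B
  proof -
    from that obtain f K e where B: "B = {g \<in> analytic_functions D. \<forall>z\<in>K. dist (g z) (f z) < e}"
      and f: "f \<in> analytic_functions D" and K: "compact K" "K \<subseteq> D" and e: "0 < e" by auto
    have "\<exists>r>0. hol.mball g r \<subseteq> B" if g: "g \<in> B" for g
    proof (cases "K = {}")
      case True
      then show ?thesis by (intro exI[of _ 1]) (auto simp: B)
    next
      case False
      have cont: "continuous_on K f" "continuous_on K g"
        using f g K(2) unfolding B analytic_functions_def
        by (auto intro: holomorphic_on_imp_continuous_on continuous_on_subset)
      have "continuous_on K (\<lambda>z. dist (g z) (f z))" by (intro continuous_intros cont)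
      then obtain z0 where z0: "z0 \<in> K" "\<And>z. z \<in> K \<Longrightarrow> dist (g z) (f z) \<le> dist (g z0) (f z0)"
        using continuous_attains_sup[OF K(1) False] by blast
      have "continuous_on K (\<lambda>z. infdist z (- D))" by (intro continuous_intros)
      then obtain z1 where z1: "z1 \<in> K" "\<And>z. z \<in> K \<Longrightarrow> infdist z1 (- D) \<le> infdist z (- D)"
        using continuous_attains_inf[OF K(1) False] by blast
      \<comment> \<open>The first entry makes the truncation by the weight inactive on
        \<open>K\<close>; the second is the room left by the largest distance of \<open>g\<close>
        and \<open>f\<close> on \<open>K\<close>, which is attained and hence strictly below
        \<open>e\<close>.\<close>
      define r where "r = min (infdist z1 (- D)) (e - dist (g z0) (f z0))"
      have r: "0 < r" using weight_pos z1(1) K(2) g z0(1) unfolding r_def B by auto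
      have "hol.mball g r \<subseteq> B"
      proof
        fix h assume h: "h \<in> hol.mball g r"
        have "dist (h z) (f z) < e" if z: "z \<in> K" for z
        proof -
          have "min (infdist z (- D)) (norm (g z - h z)) < r"
            using hol_dist_upper[of z g h] z K(2) h by fastforce
          then have "norm (g z - h z) < r" using z1(2)[OF z] unfolding r_def by linarith
          then have "dist (g z) (h z) < e - dist (g z0) (f z0)" unfolding r_def by (simp add: dist_norm)
          with z0(2)[OF z] show ?thesis using dist_triangle[of "h z" "f z" "g z"] by (simp add: dist_commute)
        qed
        then show "h \<in> B" using h unfolding B by auto
      qed
      with r show ?thesis by blast
    qed
    then show ?thesis unfolding hol.openin_mtopology B by auto
  qed
  ultimately show "openin hol.mtopology U"
    by (induction rule: generate_topology_on.induct) auto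
next
  fix U assume U: "openin hol.mtopology U"
  show "openin (locally_uniform_topology D) U"
  proof (subst openin_subopen, intro ballI)
    fix f assume f: "f \<in> U"
    then have fH: "f \<in> analytic_functions D" using U hol.openin_mtopology by auto
    obtain e where e: "0 < e" "hol.mball f e \<subseteq> U" using U f hol.openin_mtopology by blast
    define B where "B = {g \<in> analytic_functions D. \<forall>z\<in>core (e/2). dist (g z) (f z) < e/2}"
    have "openin (locally_uniform_topology D) B"
      unfolding locally_uniform_topology_def
      using fH e(1) compact_core[of "e/2"] core_subset[of "e/2"]
      by (intro topology_generated_by_Basis CollectI exI[of _ f] exI[of _ "core (e/2)"] exI[of _ "e/2"])
        (auto simp: B_def)
    moreover have "f \<in> B" using fH e(1) by (auto simp: B_def)
    moreover have "B \<subseteq> U"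
    proof
      fix g assume g: "g \<in> B"
      have "hol_dist D f g \<le> e/2"
        using g unfolding B_def core_def
        by (intro hol_dist_le_on_core) (auto simp: dist_norm norm_minus_commute intro: less_imp_le)
      then have "hol_dist D f g < e" using e(1) by linarith
      then have "g \<in> hol.mball f e" using fH g by (auto simp: B_def)
      then show "g \<in> U" using e(2) by auto
    qed
    ultimately show "\<exists>B. openin (locally_uniform_topology D) B \<and> f \<in> B \<and> B \<subseteq> U" by blast
  qed
qed

lemma tendsto_hol_distI:
  assumes "\<And>K e. compact K \<Longrightarrow> K \<subseteq> D \<Longrightarrow> 0 < e \<Longrightarrow> \<forall>\<^sub>F n in F. \<forall>z\<in>K. norm (f n z - g z) \<le> e"
  shows "((\<lambda>n. hol_dist D (f n) g) \<longlongrightarrow> 0) F"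
proof (rule tendstoI)
  fix e :: real assume e: "0 < e"
  have "\<forall>\<^sub>F n in F. \<forall>z\<in>core (e/2). norm (f n z - g z) \<le> e/2"
    using e by (intro assms compact_core core_subset) auto
  then show "\<forall>\<^sub>F n in F. dist (hol_dist D (f n) g) 0 < e"
  proof eventually_elim
    case (elim n)
    then have "hol_dist D (f n) g \<le> e/2" by (intro hol_dist_le_on_core) (auto simp: core_def)
    then show ?case using e hol_dist_nonneg[of "f n" g] by simp
  qed
qed

lemma continuous_map_tendsto:
  fixes \<phi> :: "(complex \<Rightarrow> complex) \<Rightarrow> real"
  assumes \<phi>: "continuous_map (locally_uniform_topology D) euclideanreal \<phi>"
    and f: "\<And>n. f n \<in> analytic_functions D" and g: "g \<in> analytic_functions D"
    and lim: "((\<lambda>n. hol_dist D (f n) g) \<longlongrightarrow> 0) F"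
  shows "((\<lambda>n. \<phi> (f n)) \<longlongrightarrow> \<phi> g) F"
proof -
  have "limitin hol.mtopology f g F"
    unfolding hol.limitin_metric
  proof (intro conjI allI impI g)
    fix e :: real assume "0 < e"
    with lim have "\<forall>\<^sub>F n in F. dist (hol_dist D (f n) g) 0 < e" by (rule tendstoD)
    then show "\<forall>\<^sub>F n in F. f n \<in> analytic_functions D \<and> hol_dist D (f n) g < e"
      by eventually_elim (use f in auto)
  qed
  then have "limitin euclideanreal (\<phi> \<circ> f) (\<phi> g) F"
    using \<phi> unfolding locally_uniform_topology_eq by (rule continuous_map_limit[rotated])
  then show ?thesis by (simp add: o_def)
qed

end

section \<open>Measurability and weak convergence in metric spaces\<close>

lemma borel_of_measurable_continuous:
  assumes "continuous_map T euclideanreal \<phi>"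
  shows "\<phi> \<in> borel_measurable (borel_of T)"
proof (rule borel_measurableI)
  fix S :: "real set" assume "open S"
  then have "openin T {x \<in> topspace T. \<phi> x \<in> S}" using assms unfolding continuous_map by auto
  then have "{x \<in> topspace T. \<phi> x \<in> S} \<in> sets (borel_of T)"
    unfolding borel_of_def by (subst sets_measure_of) (auto dest: openin_subset)
  moreover have "\<phi> -` S \<inter> space (borel_of T) = {x \<in> topspace T. \<phi> x \<in> S}"
    unfolding borel_of_def by (subst space_measure_of) (auto dest: openin_subset)
  ultimately show "\<phi> -` S \<inter> space (borel_of T) \<in> sets (borel_of T)" by simp
qed

context Metric_space
begin

text \<open>The witness is the distance to the complement, which is 1-Lipschitz. Borel measurability
  of a map into the space thereby reduces to measurability of its compositions with real continuous
  functions.\<close>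

lemma openin_eq_positive_set:
  assumes U: "openin mtopology U" and ne: "M - U \<noteq> {}"
  shows "continuous_map mtopology euclideanreal (\<lambda>x. INF y\<in>M - U. d x y)"
    and "U = {x \<in> M. 0 < (INF y\<in>M - U. d x y)}"
proof -
  let ?\<phi> = "\<lambda>x. INF y\<in>M - U. d x y"
  have bdd: "bdd_below ((\<lambda>y. d x y) ` (M - U))" for x by (rule bdd_belowI2[of _ 0]) simp
  have lip: "?\<phi> x \<le> ?\<phi> y + d x y" if "x \<in> M" "y \<in> M" for x y
  proof -
    have "?\<phi> x - d x y \<le> ?\<phi> y"
    proof (rule cINF_greatest[OF ne])
      fix z assume z: "z \<in> M - U"
      have "?\<phi> x \<le> d x z" by (rule cINF_lower[OF bdd z])
      also have "\<dots> \<le> d x y + d y z" using that z triangle by auto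
      finally show "?\<phi> x - d x y \<le> d y z" by simp
    qed
    then show ?thesis by simp
  qed
  show "continuous_map mtopology euclideanreal ?\<phi>"
    unfolding mtopology_is_euclidean[symmetric]
  proof (subst metric_continuous_map[OF Met_TC.Metric_space_axioms], intro conjI ballI allI impI)
    fix x e assume x: "x \<in> M" and e: "(0::real) < e"
    show "\<exists>\<delta>>0. \<forall>y. y \<in> M \<and> d x y < \<delta> \<longrightarrow> dist (?\<phi> x) (?\<phi> y) < e"
    proof (intro exI[of _ e] conjI e allI impI)
      fix y assume y: "y \<in> M \<and> d x y < e"
      then show "dist (?\<phi> x) (?\<phi> y) < e"
        using lip[OF x, of y] lip[of y x] x commute[of x y] by (auto simp: dist_real_def)
    qed
  qed auto
  show "U = {x \<in> M. 0 < ?\<phi> x}"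
  proof (intro set_eqI iffI)
    fix x assume x: "x \<in> U"
    then obtain r where r: "0 < r" "mball x r \<subseteq> U" using U openin_mtopology by blast
    have xM: "x \<in> M" using U x openin_mtopology by auto
    have "r \<le> ?\<phi> x"
    proof (rule cINF_greatest[OF ne])
      fix y assume y: "y \<in> M - U"
      then have "y \<notin> mball x r" using r by auto
      then show "r \<le> d x y" using xM y by auto
    qed
    then show "x \<in> {x \<in> M. 0 < ?\<phi> x}" using xM r by auto
  next
    fix x assume x: "x \<in> {x \<in> M. 0 < ?\<phi> x}"
    show "x \<in> U"
    proof (rule ccontr)
      assume "x \<notin> U"
      then have "?\<phi> x \<le> d x x" using x by (intro cINF_lower[OF bdd]) auto
      then show False using x by auto
    qed
  qed
qed

lemma measurable_borel_ofI:
  assumes Y: "\<And>\<omega>. \<omega> \<in> space N \<Longrightarrow> Y \<omega> \<in> M"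
    and \<phi>: "\<And>\<phi>. continuous_map mtopology euclideanreal \<phi> \<Longrightarrow> (\<lambda>\<omega>. \<phi> (Y \<omega>)) \<in> borel_measurable N"
  shows "Y \<in> measurable N (borel_of mtopology)"
  unfolding borel_of_def
proof (rule measurable_measure_of)
  show "{U. openin mtopology U} \<subseteq> Pow (topspace mtopology)" using openin_subset by blast
  show "Y \<in> space N \<rightarrow> topspace mtopology" using Y by auto
  fix U assume "U \<in> {U. openin mtopology U}"
  then have U: "openin mtopology U" by simp
  show "Y -` U \<inter> space N \<in> sets N"
  proof (cases "M - U = {}")
    case True
    then have "Y -` U \<inter> space N = space N" using Y by auto
    then show ?thesis by simp
  next
    case False
    note * = openin_eq_positive_set[OF U False]
    have "Y -` U \<inter> space N = {\<omega> \<in> space N. 0 < (INF y\<in>M - U. d (Y \<omega>) y)}"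
      by (subst (1) *(2)) (use Y in auto)
    also have "\<dots> \<in> sets N" using \<phi>[OF *(1)] by measurable
    finally show ?thesis .
  qed
qed

text \<open>Inf-convolutions with multiples of the distance are Lipschitz minorants increasing to a given
  bounded continuous function; this reduces weak convergence to Lipschitz test functions.\<close>

definition inf_conv :: "('a \<Rightarrow> real) \<Rightarrow> real \<Rightarrow> 'a \<Rightarrow> real" where
  "inf_conv \<phi> k x = (INF y\<in>M. \<phi> y + k * d x y)"

context
  fixes \<phi> :: "'a \<Rightarrow> real" and B :: real
  assumes cont: "continuous_map mtopology euclideanreal \<phi>"
    and bound: "\<And>x. x \<in> M \<Longrightarrow> \<bar>\<phi> x\<bar> \<le> B"
begin

lemma inf_conv_bdd_below: "0 \<le> k \<Longrightarrow> bdd_below ((\<lambda>y. \<phi> y + k * d x y) ` M)"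
proof (rule bdd_belowI2[of _ "- B"])
  fix y assume "0 \<le> k" "y \<in> M"
  then show "- B \<le> \<phi> y + k * d x y"
    using bound[of y] mult_nonneg_nonneg[of k "d x y"] nonneg[of x y] by linarith
qed

lemma inf_conv_le:
  assumes "0 \<le> k" "x \<in> M" shows "inf_conv \<phi> k x \<le> \<phi> x"
proof -
  have "inf_conv \<phi> k x \<le> \<phi> x + k * d x x"
    unfolding inf_conv_def by (intro cINF_lower inf_conv_bdd_below assms)
  then show ?thesis using assms by simp
qed

lemma inf_conv_ge:
  assumes "0 \<le> k" "x \<in> M" shows "- B \<le> inf_conv \<phi> k x"
  unfolding inf_conv_def
proof (rule cINF_greatest)
  show "M \<noteq> {}" using assms by auto
  fix y assume "y \<in> M"
  then show "- B \<le> \<phi> y + k * d x y"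
    using bound[of y] mult_nonneg_nonneg[of k "d x y"] nonneg[of x y] assms(1) by linarith
qed

lemma inf_conv_abs_le: "0 \<le> k \<Longrightarrow> x \<in> M \<Longrightarrow> \<bar>inf_conv \<phi> k x\<bar> \<le> B"
  using inf_conv_le[of k x] inf_conv_ge[of k x] bound[of x] by linarith

lemma inf_conv_lipschitz:
  assumes k: "0 \<le> k" and x: "x \<in> M" and y: "y \<in> M"
  shows "\<bar>inf_conv \<phi> k x - inf_conv \<phi> k y\<bar> \<le> k * d x y"
proof -
  have *: "inf_conv \<phi> k x - k * d x y \<le> inf_conv \<phi> k y" if x: "x \<in> M" and y: "y \<in> M" for x y
    unfolding inf_conv_def[of \<phi> k y]
  proof (rule cINF_greatest)
    show "M \<noteq> {}" using x by auto
    fix z assume z: "z \<in> M"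
    have "inf_conv \<phi> k x \<le> \<phi> z + k * d x z"
      unfolding inf_conv_def by (intro cINF_lower inf_conv_bdd_below k z)
    also have "k * d x z \<le> k * (d x y + d y z)" by (intro mult_left_mono triangle x y z k)
    finally show "inf_conv \<phi> k x - k * d x y \<le> \<phi> z + k * d y z" by (simp add: algebra_simps)
  qed
  show ?thesis using *[OF x y] *[OF y x] commute[of x y] by simp
qed

lemma inf_conv_tendsto:
  assumes x: "x \<in> M"
  shows "(\<lambda>k. inf_conv \<phi> (real k) x) \<longlonglongrightarrow> \<phi> x"
proof (rule LIMSEQ_I)
  fix e :: real assume e: "0 < e"
  have "openin mtopology {y \<in> M. \<phi> y \<in> {\<phi> x - e/2<..}}"
    using cont openin_continuous_map_preimage[of mtopology euclideanreal \<phi> "{\<phi> x - e/2<..}"] by simp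
  then obtain r where r: "0 < r" "mball x r \<subseteq> {y \<in> M. \<phi> y \<in> {\<phi> x - e/2<..}}"
    using x e unfolding openin_mtopology by force
  \<comment> \<open>Points at distance at least \<open>r\<close> from \<open>x\<close> pay a penalty
    of at least 2B, a bound for the oscillation of \<phi>; nearer points have \<phi> above \<phi>(x)
    - e/2.\<close>
  obtain k0 :: nat where k0: "2 * B / r < real k0" using reals_Archimedean2 by blast
  show "\<exists>k0. \<forall>k\<ge>k0. norm (inf_conv \<phi> (real k) x - \<phi> x) < e"
  proof (intro exI allI impI)
    fix k assume k: "k0 \<le> k"
    have kr: "2 * B \<le> real k * r"
    proof -
      have "2 * B < real k0 * r" using k0 r(1) by (simp add: field_simps)
      also have "\<dots> \<le> real k * r" using k r(1) by simp
      finally show ?thesis by simp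
    qed
    have "\<phi> x - e/2 \<le> inf_conv \<phi> (real k) x"
      unfolding inf_conv_def
    proof (rule cINF_greatest)
      show "M \<noteq> {}" using x by auto
      fix y assume y: "y \<in> M"
      show "\<phi> x - e/2 \<le> \<phi> y + real k * d x y"
      proof (cases "d x y < r")
        case True
        then have "\<phi> x - e/2 < \<phi> y" using r(2) x y by (auto simp: subset_iff)
        moreover have "0 \<le> real k * d x y" by simp
        ultimately show ?thesis by linarith
      next
        case False
        then have "real k * r \<le> real k * d x y" by (intro mult_left_mono) auto
        then show ?thesis using bound[OF x] bound[OF y] kr e by linarith
      qed
    qed
    then show "norm (inf_conv \<phi> (real k) x - \<phi> x) < e"
      using inf_conv_le[of "real k" x] x e by simp
  qed
qed

lemma continuous_map_inf_conv:
  assumes k: "0 \<le> k"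
  shows "continuous_map mtopology euclideanreal (inf_conv \<phi> k)"
  unfolding mtopology_is_euclidean[symmetric]
proof (subst metric_continuous_map[OF Met_TC.Metric_space_axioms], intro conjI ballI allI impI)
  fix x e assume x: "x \<in> M" and e: "(0::real) < e"
  show "\<exists>\<delta>>0. \<forall>y. y \<in> M \<and> d x y < \<delta> \<longrightarrow> dist (inf_conv \<phi> k x) (inf_conv \<phi> k y) < e"
  proof (intro exI[of _ "e / (k + 1)"] conjI allI impI)
    show "0 < e / (k + 1)" using e k by simp
    fix y assume y: "y \<in> M \<and> d x y < e / (k + 1)"
    have "dist (inf_conv \<phi> k x) (inf_conv \<phi> k y) \<le> k * d x y"
      using inf_conv_lipschitz[OF k x, of y] y by (simp add: dist_real_def)
    also have "\<dots> \<le> (k + 1) * d x y" by (simp add: mult_right_mono)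
    also have "\<dots> < e" using y k by (simp add: field_simps)
    finally show "dist (inf_conv \<phi> k x) (inf_conv \<phi> k y) < e" .
  qed
qed auto

end

text \<open>For Lipschitz test functions the three approximation errors simply add up; general test
  functions are squeezed by the Lipschitz minorants of \<phi> and -\<phi>. The spaces
  \<open>N n\<close> and \<open>N'\<close> are unrelated, so closeness in probability is asked only
  inside each \<open>N n\<close>, and almost sure convergence only on \<open>N'\<close>.\<close>

lemma converging_together:
  fixes N :: "nat \<Rightarrow> 'b measure" and N' :: "'c measure"
  assumes N: "\<And>n. prob_space (N n)" and N': "prob_space N'"
    and Y: "\<And>n. Y n \<in> measurable (N n) (borel_of mtopology)"
    and Y': "Y' \<in> measurable N' (borel_of mtopology)"
    and Z: "\<And>r n. Z r n \<in> measurable (N n) (borel_of mtopology)"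
    and Z': "\<And>r. Z' r \<in> measurable N' (borel_of mtopology)"
    and ZZ': "\<And>r \<phi>. continuous_map mtopology euclideanreal \<phi> \<Longrightarrow> bounded (\<phi> ` M) \<Longrightarrow>
       (\<lambda>n. \<integral>\<omega>. \<phi> (Z r n \<omega>) \<partial>N n) \<longlonglongrightarrow> (\<integral>\<omega>. \<phi> (Z' r \<omega>) \<partial>N')"
    and Z'Y': "AE \<omega> in N'. (\<lambda>r. d (Z' r \<omega>) (Y' \<omega>)) \<longlonglongrightarrow> 0"
    and YZ: "\<And>e. 0 < e \<Longrightarrow> \<exists>r0::nat. \<forall>r\<ge>r0. \<forall>\<^sub>F n in sequentially.
        \<exists>B\<in>sets (N n). measure (N n) B \<le> e \<and> (\<forall>\<omega>\<in>space (N n) - B. d (Y n \<omega>) (Z r n \<omega>) \<le> e)"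
    and \<phi>: "continuous_map mtopology euclideanreal \<phi>" "bounded (\<phi> ` M)"
  shows "(\<lambda>n. \<integral>\<omega>. \<phi> (Y n \<omega>) \<partial>N n) \<longlonglongrightarrow> (\<integral>\<omega>. \<phi> (Y' \<omega>) \<partial>N')"
proof -
  have sp: "space (borel_of mtopology) = M"
    unfolding borel_of_def by (subst space_measure_of) (use openin_subset in blast, simp)
  have YM: "\<omega> \<in> space (N n) \<Longrightarrow> Y n \<omega> \<in> M" for n \<omega> using measurable_space[OF Y] sp by auto
  have Y'M: "\<omega> \<in> space N' \<Longrightarrow> Y' \<omega> \<in> M" for \<omega> using measurable_space[OF Y'] sp by auto
  have ZM: "\<omega> \<in> space (N n) \<Longrightarrow> Z r n \<omega> \<in> M" for r n \<omega> using measurable_space[OF Z] sp by auto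
  have Z'M: "\<omega> \<in> space N' \<Longrightarrow> Z' r \<omega> \<in> M" for r \<omega> using measurable_space[OF Z'] sp by auto
  have meas: "(\<lambda>\<omega>. \<psi> (Y n \<omega>)) \<in> borel_measurable (N n)" "(\<lambda>\<omega>. \<psi> (Z r n \<omega>)) \<in> borel_measurable (N n)"
    "(\<lambda>\<omega>. \<psi> (Y' \<omega>)) \<in> borel_measurable N'" "(\<lambda>\<omega>. \<psi> (Z' r \<omega>)) \<in> borel_measurable N'"
    if "continuous_map mtopology euclideanreal \<psi>" for \<psi> r n
    using borel_of_measurable_continuous[OF that] Y Y' Z Z' by (auto intro: measurable_compose)
  have int: "integrable (N n) (\<lambda>\<omega>. \<psi> (Y n \<omega>))" "integrable (N n) (\<lambda>\<omega>. \<psi> (Z r n \<omega>))"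
    "integrable N' (\<lambda>\<omega>. \<psi> (Y' \<omega>))" "integrable N' (\<lambda>\<omega>. \<psi> (Z' r \<omega>))"
    if c: "continuous_map mtopology euclideanreal \<psi>" and b: "\<And>x. x \<in> M \<Longrightarrow> \<bar>\<psi> x\<bar> \<le> B" for \<psi> B r n
  proof -
    interpret Nn: prob_space "N n" by (rule N)
    interpret N': prob_space N' by (rule N')
    show "integrable (N n) (\<lambda>\<omega>. \<psi> (Y n \<omega>))" "integrable (N n) (\<lambda>\<omega>. \<psi> (Z r n \<omega>))"
      by (intro Nn.integrable_const_bound[of _ B] AE_I2; use b YM ZM meas[OF c] in simp)+
    show "integrable N' (\<lambda>\<omega>. \<psi> (Y' \<omega>))" "integrable N' (\<lambda>\<omega>. \<psi> (Z' r \<omega>))"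
      by (intro N'.integrable_const_bound[of _ B] AE_I2; use b Y'M Z'M meas[OF c] in simp)+
  qed
  have lip: "(\<lambda>n. \<integral>\<omega>. \<psi> (Y n \<omega>) \<partial>N n) \<longlonglongrightarrow> (\<integral>\<omega>. \<psi> (Y' \<omega>) \<partial>N')"
    if c: "continuous_map mtopology euclideanreal \<psi>" and b: "\<And>x. x \<in> M \<Longrightarrow> \<bar>\<psi> x\<bar> \<le> B"
      and L: "0 \<le> L" "\<And>x y. x \<in> M \<Longrightarrow> y \<in> M \<Longrightarrow> \<bar>\<psi> x - \<psi> y\<bar> \<le> L * d x y" for \<psi> B L
  proof (rule LIMSEQ_I)
    fix e :: real assume e: "0 < e"
    interpret N': prob_space N' by (rule N')
    have B: "0 \<le> B"
    proof -
      obtain \<omega> where "\<omega> \<in> space N'" using N'.not_empty by auto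
      then show ?thesis using b[OF Y'M] by fastforce
    qed
    have "(\<lambda>r. \<integral>\<omega>. \<psi> (Z' r \<omega>) \<partial>N') \<longlonglongrightarrow> (\<integral>\<omega>. \<psi> (Y' \<omega>) \<partial>N')"
    proof (rule integral_dominated_convergence[where w = "\<lambda>_. B"])
      show "AE \<omega> in N'. (\<lambda>r. \<psi> (Z' r \<omega>)) \<longlonglongrightarrow> \<psi> (Y' \<omega>)"
        using Z'Y' AE_space
      proof eventually_elim
        case (elim \<omega>)
        have "(\<lambda>r. L * d (Z' r \<omega>) (Y' \<omega>)) \<longlonglongrightarrow> L * 0" by (intro tendsto_intros elim)
        then show ?case
          using elim(2) L Y'M Z'M
          by (intro Lim_null_comparison[of "\<lambda>r. \<psi> (Z' r \<omega>) - \<psi> (Y' \<omega>)", THEN LIM_zero_cancel]) auto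
      qed
    qed (use meas[OF c] b Z'M in auto)
    then obtain r1 where r1: "\<And>r. r \<ge> r1 \<Longrightarrow> norm ((\<integral>\<omega>. \<psi> (Z' r \<omega>) \<partial>N') - (\<integral>\<omega>. \<psi> (Y' \<omega>) \<partial>N')) < e/4"
      using LIMSEQ_D[of _ _ "e/4"] e by (metis zero_less_divide_iff zero_less_numeral)
    \<comment> \<open>Off the exceptional event the test function changes by at most L\<epsilon>, on
      it by at most 2B; altogether (L + 2B)\<epsilon> \<le> e/4.\<close>
    define \<epsilon> where "\<epsilon> = e / (4 * (L + 2 * B + 1))"
    have \<epsilon>: "0 < \<epsilon>" unfolding \<epsilon>_def using e L B by auto
    obtain r0 where r0: "\<forall>r\<ge>r0. \<forall>\<^sub>F n in sequentially.
        \<exists>A\<in>sets (N n). measure (N n) A \<le> \<epsilon> \<and> (\<forall>\<omega>\<in>space (N n) - A. d (Y n \<omega>) (Z r n \<omega>) \<le> \<epsilon>)"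
      using YZ[OF \<epsilon>] by blast
    define r where "r = max r0 r1"
    have "\<forall>\<^sub>F n in sequentially. norm ((\<integral>\<omega>. \<psi> (Z r n \<omega>) \<partial>N n) - (\<integral>\<omega>. \<psi> (Z' r \<omega>) \<partial>N')) < e/4"
    proof -
      have "bounded (\<psi> ` M)" using b by (auto simp: bounded_iff)
      from tendstoD[OF ZZ'[OF c this, of r], of "e/4"] e show ?thesis by (simp add: dist_norm)
    qed
    moreover have "\<forall>\<^sub>F n in sequentially.
        \<exists>A\<in>sets (N n). measure (N n) A \<le> \<epsilon> \<and> (\<forall>\<omega>\<in>space (N n) - A. d (Y n \<omega>) (Z r n \<omega>) \<le> \<epsilon>)"
      using r0 unfolding r_def by simp
    ultimately have "\<forall>\<^sub>F n in sequentially. norm ((\<integral>\<omega>. \<psi> (Y n \<omega>) \<partial>N n) - (\<integral>\<omega>. \<psi> (Y' \<omega>) \<partial>N')) < e"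
    proof eventually_elim
      case (elim n)
      interpret Nn: prob_space "N n" by (rule N)
      from elim(2) obtain A where A: "A \<in> sets (N n)" "measure (N n) A \<le> \<epsilon>"
        "\<And>\<omega>. \<omega> \<in> space (N n) - A \<Longrightarrow> d (Y n \<omega>) (Z r n \<omega>) \<le> \<epsilon>" by blast
      have "norm ((\<integral>\<omega>. \<psi> (Y n \<omega>) \<partial>N n) - (\<integral>\<omega>. \<psi> (Z r n \<omega>) \<partial>N n))
          = norm (\<integral>\<omega>. \<psi> (Y n \<omega>) - \<psi> (Z r n \<omega>) \<partial>N n)"
        using int[OF c b] by (subst Bochner_Integration.integral_diff) auto
      also have "\<dots> \<le> (\<integral>\<omega>. norm (\<psi> (Y n \<omega>) - \<psi> (Z r n \<omega>)) \<partial>N n)" by (rule integral_norm_bound)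
      also have "\<dots> \<le> (\<integral>\<omega>. L * \<epsilon> + 2 * B * indicator A \<omega> \<partial>N n)"
      proof (rule integral_mono)
        show "integrable (N n) (\<lambda>\<omega>. norm (\<psi> (Y n \<omega>) - \<psi> (Z r n \<omega>)))"
          using int[OF c b] by (intro integrable_norm Bochner_Integration.integrable_diff) auto
        show "integrable (N n) (\<lambda>\<omega>. L * \<epsilon> + 2 * B * indicator A \<omega>)"
          using A(1) by (intro Bochner_Integration.integrable_add integrable_mult_right) (auto simp: Nn.emeasure_eq_measure)
        fix \<omega> assume \<omega>: "\<omega> \<in> space (N n)"
        show "norm (\<psi> (Y n \<omega>) - \<psi> (Z r n \<omega>)) \<le> L * \<epsilon> + 2 * B * indicator A \<omega>"
        proof (cases "\<omega> \<in> A")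
          case True
          have "\<bar>\<psi> (Y n \<omega>) - \<psi> (Z r n \<omega>)\<bar> \<le> 2 * B"
            using b[OF YM[OF \<omega>]] b[OF ZM[OF \<omega>], of r] by linarith
          moreover have "0 \<le> L * \<epsilon>" using L \<epsilon> by simp
          ultimately show ?thesis using True by simp
        next
          case False
          have "\<bar>\<psi> (Y n \<omega>) - \<psi> (Z r n \<omega>)\<bar> \<le> L * d (Y n \<omega>) (Z r n \<omega>)"
            by (intro L YM ZM \<omega>)
          also have "\<dots> \<le> L * \<epsilon>" using A(3) False \<omega> L by (intro mult_left_mono) auto
          finally show ?thesis using False by simp
        qed
      qed
      also have "\<dots> = L * \<epsilon> + 2 * B * measure (N n) A"
        using A(1) by (subst Bochner_Integration.integral_add) (auto simp: Nn.emeasure_eq_measure Nn.prob_space)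
      also have "\<dots> \<le> L * \<epsilon> + 2 * B * \<epsilon>" using A(2) B by (intro add_left_mono mult_left_mono) auto
      also have "\<dots> \<le> (L + 2 * B + 1) * \<epsilon>" using \<epsilon> by (simp add: algebra_simps)
      also have "\<dots> = e/4" unfolding \<epsilon>_def using L B by (auto simp: field_simps)
      finally show ?case using elim(1) r1[of r] e unfolding r_def real_norm_def by linarith
    qed
    then show "\<exists>n0. \<forall>n\<ge>n0. norm ((\<integral>\<omega>. \<psi> (Y n \<omega>) \<partial>N n) - (\<integral>\<omega>. \<psi> (Y' \<omega>) \<partial>N')) < e"
      unfolding eventually_sequentially .
  qed
  \<comment> \<open>Minorants yield only the lower half of the limit; the upper half is this
    statement for the negative of the test function.\<close>
  have below: "\<forall>\<^sub>F n in sequentially. (\<integral>\<omega>. \<psi> (Y' \<omega>) \<partial>N') - e < (\<integral>\<omega>. \<psi> (Y n \<omega>) \<partial>N n)"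
    if c: "continuous_map mtopology euclideanreal \<psi>" and b: "\<And>x. x \<in> M \<Longrightarrow> \<bar>\<psi> x\<bar> \<le> B"
      and e: "0 < e" for \<psi> B e
  proof -
    interpret N': prob_space N' by (rule N')
    note ck = continuous_map_inf_conv[OF c b] and bk = inf_conv_abs_le[OF c b]
    have "(\<lambda>k. \<integral>\<omega>. inf_conv \<psi> (real k) (Y' \<omega>) \<partial>N') \<longlonglongrightarrow> (\<integral>\<omega>. \<psi> (Y' \<omega>) \<partial>N')"
    proof (rule integral_dominated_convergence[where w = "\<lambda>_. B"])
      show "AE \<omega> in N'. (\<lambda>k. inf_conv \<psi> (real k) (Y' \<omega>)) \<longlonglongrightarrow> \<psi> (Y' \<omega>)"
        using Y'M inf_conv_tendsto[OF c b] by (intro AE_I2) auto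
      show "AE \<omega> in N'. norm (inf_conv \<psi> (real k) (Y' \<omega>)) \<le> B" for k
        using Y'M bk by (intro AE_I2) auto
    qed (use meas c ck in auto)
    then have "\<forall>\<^sub>F k in sequentially. norm ((\<integral>\<omega>. inf_conv \<psi> (real k) (Y' \<omega>) \<partial>N') - (\<integral>\<omega>. \<psi> (Y' \<omega>) \<partial>N')) < e/2"
      using e by (auto dest: tendstoD[of _ _ _ "e/2"] simp: dist_norm)
    then obtain k where k: "norm ((\<integral>\<omega>. inf_conv \<psi> (real k) (Y' \<omega>) \<partial>N') - (\<integral>\<omega>. \<psi> (Y' \<omega>) \<partial>N')) < e/2"
      using eventually_happens'[of sequentially] by auto
    have "(\<lambda>n. \<integral>\<omega>. inf_conv \<psi> (real k) (Y n \<omega>) \<partial>N n) \<longlonglongrightarrow> (\<integral>\<omega>. inf_conv \<psi> (real k) (Y' \<omega>) \<partial>N')"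
      by (rule lip[of _ B "real k"]) (use ck bk inf_conv_lipschitz[OF c b] in auto)
    then have "\<forall>\<^sub>F n in sequentially. norm ((\<integral>\<omega>. inf_conv \<psi> (real k) (Y n \<omega>) \<partial>N n) - (\<integral>\<omega>. inf_conv \<psi> (real k) (Y' \<omega>) \<partial>N')) < e/2"
      using e by (auto dest: tendstoD[of _ _ _ "e/2"] simp: dist_norm)
    then show ?thesis
    proof eventually_elim
      case (elim n)
      have "(\<integral>\<omega>. inf_conv \<psi> (real k) (Y n \<omega>) \<partial>N n) \<le> (\<integral>\<omega>. \<psi> (Y n \<omega>) \<partial>N n)"
        by (intro integral_mono int[OF c b] int[OF ck bk] inf_conv_le[OF c b] YM) auto
      then show ?case using elim k unfolding real_norm_def by linarith
    qed
  qed
  obtain B where B: "\<And>x. x \<in> M \<Longrightarrow> \<bar>\<phi> x\<bar> \<le> B" using \<phi>(2) unfolding bounded_iff by auto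
  have c': "continuous_map mtopology euclideanreal (\<lambda>x. - \<phi> x)"
    using \<phi>(1) by (intro continuous_intros) auto
  show ?thesis
  proof (rule order_tendstoI)
    fix l assume "l < (\<integral>\<omega>. \<phi> (Y' \<omega>) \<partial>N')"
    then show "\<forall>\<^sub>F n in sequentially. l < (\<integral>\<omega>. \<phi> (Y n \<omega>) \<partial>N n)"
      using below[OF \<phi>(1) B, of "(\<integral>\<omega>. \<phi> (Y' \<omega>) \<partial>N') - l"] by simp
  next
    fix l assume "(\<integral>\<omega>. \<phi> (Y' \<omega>) \<partial>N') < l"
    then show "\<forall>\<^sub>F n in sequentially. (\<integral>\<omega>. \<phi> (Y n \<omega>) \<partial>N n) < l"
      using below[OF c', of B "l - (\<integral>\<omega>. \<phi> (Y' \<omega>) \<partial>N')"] B by simp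
  qed
qed

end

section \<open>Moment inequalities\<close>

lemma norm_exp_diff_le:
  fixes a b :: complex
  shows "norm (exp a - exp b) \<le> norm (a - b) * exp (max (Re a) (Re b))"
proof -
  let ?S = "{w. Re w \<le> max (Re a) (Re b)}"
  have "norm (exp a - exp b) \<le> exp (max (Re a) (Re b)) * norm (a - b)"
  proof (rule field_differentiable_bound[of ?S exp exp])
    show "convex ?S" by (rule convex_halfspace_Re_le)
  qed (auto intro: DERIV_exp has_field_derivative_at_within)
  then show ?thesis by (simp add: mult.commute)
qed

text \<open>Concavity of the power, obtained from Young's inequality. The value \<open>b = 0\<close>
  is included because \<open>b\<close> will be the squared norm of a sum that may vanish.\<close>

lemma powr_le_tangent:
  fixes a b q :: real
  assumes "0 < a" "0 \<le> b" "0 \<le> q" "q \<le> 1"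
  shows "b powr q \<le> a powr q + q * a powr (q - 1) * (b - a)"
proof (cases "b = 0")
  case True
  have "q * (a * a powr (q - 1)) \<le> 1 * (a * a powr (q - 1))" using assms by (intro mult_right_mono) auto
  then show ?thesis using True assms powr_mult_base[of a "q - 1"] by (simp add: algebra_simps)
next
  case False
  have "b powr q * a powr (1 - q) \<le> q * b + (1 - q) * a"
    using assms False by (intro Youngs_inequality_0) auto
  then have "b powr q * a powr (1 - q) * a powr (q - 1) \<le> (q * b + (1 - q) * a) * a powr (q - 1)"
    by (rule mult_right_mono) simp
  also have "b powr q * a powr (1 - q) * a powr (q - 1) = b powr q"
    using assms(1) by (simp add: mult.assoc powr_add[symmetric])
  also have "(q * b + (1 - q) * a) * a powr (q - 1) = a * a powr (q - 1) + q * a powr (q - 1) * (b - a)"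
    by (simp add: algebra_simps)
  also have "a * a powr (q - 1) = a powr q" using assms(1) by (simp add: powr_mult_base)
  finally show ?thesis .
qed

lemma tangent_le_powr:
  fixes a m p :: real
  assumes "0 < m" "0 \<le> a" "1 \<le> p"
  shows "m powr p + p * m powr (p - 1) * (a - m) \<le> a powr p"
proof (cases "a = 0")
  case True
  have "1 * (m * m powr (p - 1)) \<le> p * (m * m powr (p - 1))" using assms by (intro mult_right_mono) auto
  then show ?thesis using True assms powr_mult_base[of m "p - 1"] by (simp add: algebra_simps)
next
  case False
  have "(a powr p) powr (1/p) * (m powr p) powr (1 - 1/p) \<le> (1/p) * a powr p + (1 - 1/p) * m powr p"
    using assms False by (intro Youngs_inequality_0) auto
  also have "(a powr p) powr (1/p) = a" using assms by (simp add: powr_powr)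
  also have "(m powr p) powr (1 - 1/p) = m powr (p - 1)"
    using assms by (simp add: powr_powr right_diff_distrib)
  finally have "p * (a * m powr (p - 1)) \<le> p * ((1/p) * a powr p + (1 - 1/p) * m powr p)"
    using assms by (intro mult_left_mono) auto
  also have "\<dots> = a powr p + (p - 1) * m powr p" using assms by (simp add: algebra_simps)
  finally show ?thesis
    using assms powr_mult_base[of m "p - 1"] by (simp add: algebra_simps)
qed

text \<open>Jensen's inequality, by integrating the tangent line at the mean.\<close>

lemma (in prob_space) powr_expectation_le:
  fixes X :: "'a \<Rightarrow> real"
  assumes X: "integrable M X" "integrable M (\<lambda>\<omega>. X \<omega> powr p)" "\<And>\<omega>. 0 \<le> X \<omega>" and p: "1 \<le> p"
  shows "(expectation X) powr p \<le> expectation (\<lambda>\<omega>. X \<omega> powr p)"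
proof (cases "expectation X = 0")
  case True
  then show ?thesis by simp
next
  case False
  have "0 \<le> expectation X" using X(3) by simp
  with False have m: "0 < expectation X" by simp
  let ?m = "expectation X"
  have "?m powr p = expectation (\<lambda>\<omega>. ?m powr p + p * ?m powr (p - 1) * (X \<omega> - ?m))"
    using X(1) by (simp add: prob_space)
  also have "\<dots> \<le> expectation (\<lambda>\<omega>. X \<omega> powr p)"
    using X by (intro integral_mono tangent_le_powr m p) auto
  finally show ?thesis .
qed

lemma powr_add_le_two_powr:
  fixes a b p :: real
  assumes "0 \<le> a" "0 \<le> b" "0 \<le> p"
  shows "(a + b) powr p \<le> 2 powr p * (a powr p + b powr p)"
proof -
  have "(a + b) powr p \<le> (2 * max a b) powr p" using assms by (intro powr_mono2) auto
  also have "\<dots> = 2 powr p * max a b powr p" using assms by (simp add: powr_mult)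
  also have "max a b powr p \<le> a powr p + b powr p" by (simp add: max_def)
  finally show ?thesis by simp
qed

text \<open>The pointwise core of the von Bahr--Esseen inequality: a first-order expansion whose
  error involves |y|^p only. If |y| \<le> |x|, concavity of t^(p/2) is applied to the squared norms,
  and |x|^(p-2) \<le> |y|^(p-2) because p \<le> 2. Otherwise |x+y|^p \<le> 4|y|^p and the linear
  term is at most 2|y|^p in absolute value, whence the constant 6.\<close>

lemma norm_powr_add_le:
  fixes x y :: complex and p :: real
  assumes p: "1 < p" "p \<le> 2"
  shows "norm (x + y) powr p \<le> norm x powr p + p * Re (cnj (norm x powr (p - 2) *\<^sub>R x) * y) + 6 * norm y powr p"
proof (cases "norm y \<le> norm x")
  case True
  show ?thesis
  proof (cases "y = 0")
    case True
    then show ?thesis by simp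
  next
    case False
    then have x: "0 < norm x" and y: "0 < norm y" using True by auto
    have sq: "(norm (x + y))\<^sup>2 = (norm x)\<^sup>2 + (2 * Re (cnj x * y) + (norm y)\<^sup>2)"
      unfolding cmod_power2 by (simp add: power2_eq_square algebra_simps)
    have root: "((norm w)\<^sup>2) powr (p/2) = norm w powr p" for w :: complex
      by (simp add: powr_powr flip: powr_numeral)
    have "((norm (x + y))\<^sup>2) powr (p/2) \<le> ((norm x)\<^sup>2) powr (p/2)
        + p/2 * ((norm x)\<^sup>2) powr (p/2 - 1) * ((norm (x + y))\<^sup>2 - (norm x)\<^sup>2)"
      using x p by (intro powr_le_tangent) auto
    also have "((norm x)\<^sup>2) powr (p/2 - 1) = norm x powr (p - 2)"
      using x by (simp add: powr_powr right_diff_distrib flip: powr_numeral)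
    finally have "norm (x + y) powr p \<le> norm x powr p
        + p/2 * norm x powr (p - 2) * ((norm (x + y))\<^sup>2 - (norm x)\<^sup>2)"
      unfolding root .
    then have *: "norm (x + y) powr p \<le> norm x powr p
        + p/2 * norm x powr (p - 2) * (2 * Re (cnj x * y) + (norm y)\<^sup>2)"
      unfolding sq by (simp only: add_diff_cancel_left')
    have "p/2 * (norm x powr (p - 2) * (norm y)\<^sup>2) \<le> 1 * (norm y powr (p - 2) * (norm y)\<^sup>2)"
      using p x y True by (intro mult_mono powr_mono2') auto
    also have "norm y powr (p - 2) * (norm y)\<^sup>2 = norm y powr p"
      using y by (simp add: powr_add[symmetric] flip: powr_numeral)
    finally have "p/2 * (norm x powr (p - 2) * (norm y)\<^sup>2) \<le> 6 * norm y powr p"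
      using powr_ge_zero[of "norm y" p] by linarith
    then show ?thesis using * by (simp add: algebra_simps)
  qed
next
  case False
  then have xy: "norm x \<le> norm y" and y: "0 < norm y" by auto
  have "norm (x + y) powr p \<le> (2 * norm y) powr p"
    using norm_triangle_ineq[of x y] xy p by (intro powr_mono2) auto
  also have "\<dots> = 2 powr p * norm y powr p" by (simp add: powr_mult)
  also have "\<dots> \<le> 4 * norm y powr p"
    using powr_mono[of p 2 2] p by (intro mult_right_mono) auto
  finally have 1: "norm (x + y) powr p \<le> 4 * norm y powr p" .
  have "\<bar>Re (cnj (norm x powr (p - 2) *\<^sub>R x) * y)\<bar> \<le> norm (cnj (norm x powr (p - 2) *\<^sub>R x) * y)"
    by (rule abs_Re_le_cmod)
  also have "\<dots> = norm x powr (p - 1) * norm y"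
    using powr_mult_base[of "norm x" "p - 2"] by (cases "x = 0") (auto simp: norm_mult mult.commute)
  also have "\<dots> \<le> norm y powr (p - 1) * norm y"
    using p xy by (intro mult_right_mono powr_mono2) auto
  also have "\<dots> = norm y powr p" using y powr_mult_base[of "norm y" "p - 1"] by (simp add: mult.commute)
  finally have "p * \<bar>Re (cnj (norm x powr (p - 2) *\<^sub>R x) * y)\<bar> \<le> 2 * norm y powr p"
    using p by (intro mult_mono) auto
  moreover have "- (p * \<bar>Re (cnj (norm x powr (p - 2) *\<^sub>R x) * y)\<bar>)
      \<le> p * Re (cnj (norm x powr (p - 2) *\<^sub>R x) * y)"
    using p abs_ge_minus_self[of "p * Re (cnj (norm x powr (p - 2) *\<^sub>R x) * y)"] by (simp add: abs_mult)
  ultimately show ?thesis using 1 powr_ge_zero[of "norm x" p] by linarith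
qed

lemma le_one_plus_powr:
  fixes x p :: real assumes "0 \<le> x" "1 \<le> p" shows "x \<le> 1 + x powr p"
proof (cases "x \<le> 1")
  case False
  then have "x powr 1 \<le> x powr p" using assms by (intro powr_mono) auto
  then show ?thesis using False by simp
qed (use powr_ge_zero[of x p] in linarith)

text \<open>The martingale form of the von Bahr--Esseen inequality: the weights \<open>A i\<close> depend only on
  variables which are independent of all the centred factors.\<close>

lemma (in prob_space) von_Bahr_Esseen:
  fixes X :: "'i \<Rightarrow> 'a \<Rightarrow> real" and A :: "'i \<Rightarrow> ('i \<Rightarrow> real) \<Rightarrow> complex" and f :: "'i \<Rightarrow> real \<Rightarrow> complex"
  assumes p: "1 < p" "p \<le> 2"
    and ind: "indep_vars (\<lambda>_. borel) X (J \<union> I)" and fin: "finite I" and disj: "J \<inter> I = {}"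
    and A: "\<And>i. i \<in> I \<Longrightarrow> A i \<in> borel_measurable (PiM J (\<lambda>_. borel))"
    and f: "\<And>i. i \<in> I \<Longrightarrow> f i \<in> borel_measurable borel"
    and intA: "\<And>i. i \<in> I \<Longrightarrow> integrable M (\<lambda>\<omega>. norm (A i (restrict (\<lambda>j. X j \<omega>) J)) powr p)"
    and intf: "\<And>i. i \<in> I \<Longrightarrow> integrable M (\<lambda>\<omega>. norm (f i (X i \<omega>)) powr p)"
    and mean: "\<And>i. i \<in> I \<Longrightarrow> expectation (\<lambda>\<omega>. f i (X i \<omega>)) = 0"
  shows "integrable M (\<lambda>\<omega>. norm (\<Sum>i\<in>I. A i (restrict (\<lambda>j. X j \<omega>) J) * f i (X i \<omega>)) powr p)"
    and "expectation (\<lambda>\<omega>. norm (\<Sum>i\<in>I. A i (restrict (\<lambda>j. X j \<omega>) J) * f i (X i \<omega>)) powr p)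
      \<le> 6 * (\<Sum>i\<in>I. expectation (\<lambda>\<omega>. norm (A i (restrict (\<lambda>j. X j \<omega>) J)) powr p)
               * expectation (\<lambda>\<omega>. norm (f i (X i \<omega>)) powr p))"
proof -
  define a where "a i \<omega> = A i (restrict (\<lambda>j. X j \<omega>) J)" for i \<omega>
  define y where "y i \<omega> = f i (X i \<omega>)" for i \<omega>
  have X: "i \<in> J \<union> I \<Longrightarrow> X i \<in> borel_measurable M" for i using ind unfolding indep_vars_def by auto
  have a_meas: "i \<in> I \<Longrightarrow> a i \<in> borel_measurable M" for i
    unfolding a_def using X by (intro measurable_compose[OF _ A] measurable_restrict) auto
  have y_meas: "i \<in> I \<Longrightarrow> y i \<in> borel_measurable M" for i
    unfolding y_def by (rule measurable_compose[OF X f]) auto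
  have y_int: "integrable M (y i)" if "i \<in> I" for i
  proof (rule Bochner_Integration.integrable_bound[of M "\<lambda>\<omega>. 1 + norm (y i \<omega>) powr p"])
    show "integrable M (\<lambda>\<omega>. 1 + norm (y i \<omega>) powr p)" using intf[OF that] unfolding y_def by simp
    show "AE \<omega> in M. norm (y i \<omega>) \<le> norm (1 + norm (y i \<omega>) powr p)"
    proof (rule AE_I2)
      fix \<omega>
      have "norm (y i \<omega>) \<le> 1 + norm (y i \<omega>) powr p" using p by (intro le_one_plus_powr) auto
      then show "norm (y i \<omega>) \<le> norm (1 + norm (y i \<omega>) powr p)" by simp
    qed
  qed (use y_meas[OF that] in auto)
  \<comment> \<open>Induction over the factors. In the expansion of |x + a y|^p the linear term is
    the centred factor times a function of the other variables, so its mean vanishes and only the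
    p-th moment of the new summand is added.\<close>
  have "integrable M (\<lambda>\<omega>. norm (\<Sum>i\<in>I'. a i \<omega> * y i \<omega>) powr p) \<and>
    expectation (\<lambda>\<omega>. norm (\<Sum>i\<in>I'. a i \<omega> * y i \<omega>) powr p)
      \<le> 6 * (\<Sum>i\<in>I'. expectation (\<lambda>\<omega>. norm (a i \<omega>) powr p) * expectation (\<lambda>\<omega>. norm (y i \<omega>) powr p))"
    if "I' \<subseteq> I" for I'
    using finite_subset[OF that fin] that
  proof (induction I' rule: finite_induct)
    case empty
    then show ?case using p by simp
  next
    case (insert k I')
    define x where "x \<omega> = (\<Sum>i\<in>I'. a i \<omega> * y i \<omega>)" for \<omega>
    \<comment> \<open>As a function of the coordinates in J \<union> I' the partial sum inherits
      independence of coordinate \<open>k\<close> from the independence of the two blocks.\<close>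
    define \<Phi> where "\<Phi> w = (\<Sum>i\<in>I'. A i (restrict w J) * f i (w i))" for w
    have k: "k \<in> I" "k \<notin> I'" "k \<notin> J" and I': "I' \<subseteq> I" "finite I'" using insert disj by auto
    have IH: "integrable M (\<lambda>\<omega>. norm (x \<omega>) powr p)"
      "expectation (\<lambda>\<omega>. norm (x \<omega>) powr p)
      \<le> 6 * (\<Sum>i\<in>I'. expectation (\<lambda>\<omega>. norm (a i \<omega>) powr p) * expectation (\<lambda>\<omega>. norm (y i \<omega>) powr p))"
      using insert.IH[OF I'(1)] unfolding x_def by auto
    let ?P = "\<lambda>J. PiM J (\<lambda>_. borel :: real measure)"
    have ind2: "indep_var (?P (J \<union> I')) (\<lambda>\<omega>. restrict (\<lambda>i. X i \<omega>) (J \<union> I')) (?P {k}) (\<lambda>\<omega>. restrict (\<lambda>i. X i \<omega>) {k})"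
      using k I' by (intro indep_var_restrict[OF ind]) auto
    have A_meas: "i \<in> I \<Longrightarrow> (\<lambda>w. A i (restrict w J)) \<in> borel_measurable (?P (J \<union> I'))" for i
      by (intro measurable_compose[OF measurable_restrict_subset A]) auto
    have fw_meas: "i \<in> I \<Longrightarrow> i \<in> K \<Longrightarrow> (\<lambda>w. f i (w i)) \<in> borel_measurable (?P K)" for i K
      using f by (auto intro: measurable_compose[OF measurable_component_singleton])
    have \<Phi>_meas: "\<Phi> \<in> borel_measurable (?P (J \<union> I'))"
      unfolding \<Phi>_def using I'
      by (intro borel_measurable_sum borel_measurable_times A_meas fw_meas) auto
    have x_eq: "\<Phi> (restrict (\<lambda>i. X i \<omega>) (J \<union> I')) = x \<omega>" for \<omega>
      unfolding \<Phi>_def x_def a_def y_def by (intro sum.cong) (auto simp: Int_absorb1)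
    have a_eq: "A k (restrict (restrict (\<lambda>i. X i \<omega>) (J \<union> I')) J) = a k \<omega>" for \<omega>
      unfolding a_def by (simp add: Int_absorb1)
    have indc: "indep_var borel (\<lambda>\<omega>. g (\<Phi> (restrict (\<lambda>i. X i \<omega>) (J \<union> I'))) (A k (restrict (restrict (\<lambda>i. X i \<omega>) (J \<union> I')) J)))
        borel (\<lambda>\<omega>. h (f k (restrict (\<lambda>i. X i \<omega>) {k} k)))"
      if g: "case_prod g \<in> borel_measurable borel" and h: "h \<in> borel_measurable borel"
      for g :: "complex \<Rightarrow> complex \<Rightarrow> 'c::{banach,second_countable_topology}" and h :: "complex \<Rightarrow> 'c"
    proof -
      have 1: "(\<lambda>w. g (\<Phi> w) (A k (restrict w J))) \<in> borel_measurable (?P (J \<union> I'))"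
        using measurable_compose[OF borel_measurable_Pair[OF \<Phi>_meas A_meas[OF k(1)]] g] by simp
      have 2: "(\<lambda>w. h (f k (w k))) \<in> borel_measurable (?P {k})"
        by (intro measurable_compose[OF _ h] fw_meas) (use k in auto)
      show ?thesis using indep_var_compose[OF ind2 1 2] by (simp add: o_def)
    qed
    \<comment> \<open>The gradient direction of |w|^p. Its norm is |w|^(p-1), so its product with
      \<open>a k\<close> is at most the p-th power of the larger of |x| and |a|, hence
      integrable.\<close>
    define S where "S w = norm w powr (p - 2) *\<^sub>R w" for w :: complex
    have S_meas: "S \<in> borel_measurable borel" unfolding S_def by measurable
    have S_norm: "norm (S w) = norm w powr (p - 1)" for w
      unfolding S_def using powr_mult_base[of "norm w" "p - 2"]
      by (cases "w = 0") (auto simp: mult.commute)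
    have ind3: "indep_var borel (\<lambda>\<omega>. cnj (S (x \<omega>)) * a k \<omega>) borel (y k)"
    proof -
      have "cnj \<in> borel_measurable borel"
        by (intro borel_measurable_continuous_onI continuous_intros)
      from measurable_compose[OF measurable_compose[OF measurable_fst S_meas] this]
      have "case_prod (\<lambda>w v. cnj (S w) * v) \<in> borel_measurable (borel \<Otimes>\<^sub>M borel)"
        unfolding case_prod_unfold by (intro borel_measurable_times) auto
      then have "case_prod (\<lambda>w v. cnj (S w) * v) \<in> borel_measurable borel"
        by (simp add: borel_prod)
      from indc[OF this, of "\<lambda>v. v"] show ?thesis by (simp only: x_eq a_eq) (simp add: y_def[abs_def])
    qed
    have ind4: "indep_var borel (\<lambda>\<omega>. norm (a k \<omega>) powr p) borel (\<lambda>\<omega>. norm (y k \<omega>) powr p)"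
    proof -
      have "case_prod (\<lambda>w v. norm v powr p) \<in> borel_measurable (borel :: (complex \<times> complex) measure)"
        unfolding borel_prod[symmetric] by (simp add: case_prod_unfold)
      from indc[OF this, of "\<lambda>v. norm v powr p"] show ?thesis
        by (simp only: x_eq a_eq) (simp add: y_def[abs_def])
    qed
    have int_a: "integrable M (\<lambda>\<omega>. norm (a k \<omega>) powr p)" using intA[OF k(1)] unfolding a_def .
    have int_y: "integrable M (\<lambda>\<omega>. norm (y k \<omega>) powr p)" using intf[OF k(1)] unfolding y_def .
    have x_meas: "x \<in> borel_measurable M"
      unfolding x_def using I' a_meas y_meas by (intro borel_measurable_sum borel_measurable_times) auto
    have Sx_meas: "(\<lambda>\<omega>. S (x \<omega>)) \<in> borel_measurable M" by (rule measurable_compose[OF x_meas S_meas])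
    have int_Sxa: "integrable M (\<lambda>\<omega>. cnj (S (x \<omega>)) * a k \<omega>)"
    proof (rule Bochner_Integration.integrable_bound[of M "\<lambda>\<omega>. norm (x \<omega>) powr p + norm (a k \<omega>) powr p"])
      show "integrable M (\<lambda>\<omega>. norm (x \<omega>) powr p + norm (a k \<omega>) powr p)"
        by (intro Bochner_Integration.integrable_add IH int_a)
      show "(\<lambda>\<omega>. cnj (S (x \<omega>)) * a k \<omega>) \<in> borel_measurable M"
      proof -
        have "cnj \<in> borel_measurable borel"
          by (intro borel_measurable_continuous_onI continuous_intros)
        from measurable_compose[OF Sx_meas this] show ?thesis
          using a_meas[OF k(1)] by (rule borel_measurable_times)
      qed
      show "AE \<omega> in M. norm (cnj (S (x \<omega>)) * a k \<omega>) \<le> norm (norm (x \<omega>) powr p + norm (a k \<omega>) powr p)"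
      proof (rule AE_I2)
        fix \<omega>
        define m where "m = max (norm (x \<omega>)) (norm (a k \<omega>))"
        have "norm (cnj (S (x \<omega>)) * a k \<omega>) = norm (x \<omega>) powr (p - 1) * norm (a k \<omega>)"
          by (simp add: norm_mult S_norm)
        also have "\<dots> \<le> m powr (p - 1) * m"
          using p unfolding m_def by (intro mult_mono powr_mono2) auto
        also have "\<dots> = m powr p"
          using powr_mult_base[of m "p - 1"] by (simp add: m_def mult.commute le_max_iff_disj)
        also have "\<dots> \<le> norm (x \<omega>) powr p + norm (a k \<omega>) powr p" unfolding m_def by (simp add: max_def)
        finally show "norm (cnj (S (x \<omega>)) * a k \<omega>) \<le> norm (norm (x \<omega>) powr p + norm (a k \<omega>) powr p)" by simp
      qed
    qed
    have cross0: "expectation (\<lambda>\<omega>. cnj (S (x \<omega>)) * a k \<omega> * y k \<omega>) = 0"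
      using indep_var_lebesgue_integral[OF ind3 int_Sxa y_int[OF k(1)]] mean[OF k(1)]
      by (simp add: y_def)
    have int_cross: "integrable M (\<lambda>\<omega>. cnj (S (x \<omega>)) * a k \<omega> * y k \<omega>)"
      by (rule indep_var_integrable[OF ind3 int_Sxa y_int[OF k(1)]])
    have int_ay: "integrable M (\<lambda>\<omega>. norm (a k \<omega>) powr p * norm (y k \<omega>) powr p)"
      by (rule indep_var_integrable[OF ind4 int_a int_y])
    define U where "U \<omega> = norm (x \<omega>) powr p + p * Re (cnj (S (x \<omega>)) * a k \<omega> * y k \<omega>)
        + 6 * (norm (a k \<omega>) powr p * norm (y k \<omega>) powr p)" for \<omega>
    have int_U: "integrable M U"
      unfolding U_def using IH(1) int_cross int_ay by (intro Bochner_Integration.integrable_add integrable_mult_right integrable_Re)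
    have EU: "expectation U = expectation (\<lambda>\<omega>. norm (x \<omega>) powr p)
        + 6 * (expectation (\<lambda>\<omega>. norm (a k \<omega>) powr p) * expectation (\<lambda>\<omega>. norm (y k \<omega>) powr p))"
    proof -
      define V where "V \<omega> = Re (cnj (S (x \<omega>)) * a k \<omega> * y k \<omega>)" for \<omega>
      have "integrable M V" "expectation V = 0"
        unfolding V_def using integrable_Re[OF int_cross] integral_Re[OF int_cross] cross0 by simp_all
      then show ?thesis
        unfolding U_def V_def[symmetric] using IH(1) int_ay
        by (simp add: indep_var_lebesgue_integral[OF ind4 int_a int_y])
    qed
    have bnd: "norm (\<Sum>i\<in>insert k I'. a i \<omega> * y i \<omega>) powr p \<le> U \<omega>" for \<omega>
      using norm_powr_add_le[OF p, of "x \<omega>" "a k \<omega> * y k \<omega>"] k(2) I'(2)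
      unfolding U_def S_def x_def by (simp add: norm_mult powr_mult mult.assoc add.commute)
    have int_new: "integrable M (\<lambda>\<omega>. norm (\<Sum>i\<in>insert k I'. a i \<omega> * y i \<omega>) powr p)"
    proof (rule Bochner_Integration.integrable_bound[OF int_U])
      show "(\<lambda>\<omega>. norm (\<Sum>i\<in>insert k I'. a i \<omega> * y i \<omega>) powr p) \<in> borel_measurable M"
      proof -
        have "(\<lambda>\<omega>. \<Sum>i\<in>insert k I'. a i \<omega> * y i \<omega>) \<in> borel_measurable M"
          using k I' a_meas y_meas by (intro borel_measurable_sum borel_measurable_times) auto
        then show ?thesis by measurable
      qed
      show "AE \<omega> in M. norm (norm (\<Sum>i\<in>insert k I'. a i \<omega> * y i \<omega>) powr p) \<le> norm (U \<omega>)"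
        using bnd by (intro AE_I2) (smt (verit) powr_ge_zero real_norm_def)
    qed
    have "expectation (\<lambda>\<omega>. norm (\<Sum>i\<in>insert k I'. a i \<omega> * y i \<omega>) powr p) \<le> expectation U"
      by (rule integral_mono[OF int_new int_U bnd])
    then show ?case using int_new IH(2) EU k(2) I'(2) by (simp add: algebra_simps)
  qed
  from this[of I] show "integrable M (\<lambda>\<omega>. norm (\<Sum>i\<in>I. A i (restrict (\<lambda>j. X j \<omega>) J) * f i (X i \<omega>)) powr p)"
    "expectation (\<lambda>\<omega>. norm (\<Sum>i\<in>I. A i (restrict (\<lambda>j. X j \<omega>) J) * f i (X i \<omega>)) powr p)
      \<le> 6 * (\<Sum>i\<in>I. expectation (\<lambda>\<omega>. norm (A i (restrict (\<lambda>j. X j \<omega>) J)) powr p)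
               * expectation (\<lambda>\<omega>. norm (f i (X i \<omega>)) powr p))"
    unfolding a_def y_def by auto
qed

text \<open>Cauchy's integral formula and Fubini's theorem turn pointwise first moment bounds on a circle
  into a bound in probability that is uniform on a smaller disc.\<close>

lemma norm_le_circle_average:
  fixes f :: "complex \<Rightarrow> complex"
  assumes hol: "f holomorphic_on S" and S: "open S" "cball z0 (2 * R) \<subseteq> S" and R: "0 < R" and z: "z \<in> cball z0 R"
  shows "ennreal (norm (f z)) \<le> 2 * (\<integral>\<^sup>+t. ennreal (norm (f (circlepath z0 (2 * R) t))) * indicator {0..1} t \<partial>lborel)"
proof -
  let ?c = "circlepath z0 (2 * R)"
  have contf: "continuous_on (cball z0 (2 * R)) f"
    using hol S by (meson continuous_on_subset holomorphic_on_imp_continuous_on)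
  have "((\<lambda>u. f u / (u - z)) has_contour_integral (2 * of_real pi * \<i> * f z)) ?c"
  proof (intro Cauchy_integral_circlepath contf)
    show "f holomorphic_on ball z0 (2 * R)" using hol by (rule holomorphic_on_subset) (use S(2) in auto)
    show "norm (z - z0) < 2 * R" using z R by (auto simp: dist_norm norm_minus_commute)
  qed
  then have *: "((\<lambda>t. f (?c t) / (?c t - z) * (2 * of_real pi * \<i> * of_real (2 * R) * exp (2 * of_real pi * \<i> * of_real t)))
      has_integral (2 * of_real pi * \<i> * f z)) {0..1}"
    unfolding has_contour_integral_def
    by (rule has_integral_eq[rotated]) (simp add: vector_derivative_circlepath01)
  have nc: "norm (?c t - z0) = 2 * R" for t
    using R by (simp add: circlepath norm_mult)
  \<comment> \<open>The contour has radius 2R while \<open>z\<close> is within R of the centre; the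
    ratio 2R/R is the factor 2 in the conclusion.\<close>
  have dz: "R \<le> norm (?c t - z)" for t
    using norm_triangle_ineq[of "?c t - z" "z - z0"] nc[of t] z by (simp add: dist_norm norm_minus_commute)
  have cf: "continuous_on {0..1} (\<lambda>t. norm (f (?c t)))"
  proof (intro continuous_on_norm continuous_on_compose2[OF contf])
    show "continuous_on {0..1} ?c" unfolding circlepath by (intro continuous_intros)
    show "?c ` {0..1} \<subseteq> cball z0 (2 * R)" using nc by (auto simp: dist_norm norm_minus_commute)
  qed
  have "norm (2 * of_real pi * \<i> * f z) \<le> integral {0..1} (\<lambda>t. 4 * pi * norm (f (?c t)))"
    unfolding integral_unique[OF *, symmetric]
  proof (rule integral_norm_bound_integral)
    show "(\<lambda>t. 4 * pi * norm (f (?c t))) integrable_on {0..1}"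
      by (intro integrable_continuous_interval continuous_intros cf)
    fix t :: real assume "t \<in> {0..1}"
    have "norm (f (?c t) / (?c t - z) * (2 * of_real pi * \<i> * of_real (2 * R) * exp (2 * of_real pi * \<i> * of_real t)))
        = norm (f (?c t)) * (4 * pi) * (R / norm (?c t - z))"
      using R by (simp add: norm_mult norm_divide)
    also have "\<dots> \<le> norm (f (?c t)) * (4 * pi) * 1"
      using dz[of t] R by (intro mult_left_mono) (auto simp: divide_le_eq_1)
    finally show "norm (f (?c t) / (?c t - z) * (2 * of_real pi * \<i> * of_real (2 * R) * exp (2 * of_real pi * \<i> * of_real t)))
        \<le> 4 * pi * norm (f (?c t))" by (simp add: mult.commute)
  qed (use * in blast)
  then have le: "norm (f z) \<le> 2 * integral {0..1} (\<lambda>t. norm (f (?c t)))" by (simp add: norm_mult)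
  have "((\<lambda>t. norm (f (?c t))) has_integral integral {0..1} (\<lambda>t. norm (f (?c t)))) {0..1}"
    by (intro integrable_integral integrable_continuous_interval cf)
  then have "ennreal (integral {0..1} (\<lambda>t. norm (f (?c t)))) = (\<integral>\<^sup>+t. ennreal (norm (f (?c t))) * indicator {0..1} t \<partial>lborel)"
    by (intro nn_integral_has_integral_lebesgue'[symmetric]) auto
  then show ?thesis using ennreal_leI[OF le] integral_nonneg[of "\<lambda>t. norm (f (?c t))" "{0..1}"]
    by (simp add: ennreal_mult')
qed

lemma (in prob_space) uniform_Markov:
  fixes f :: "complex \<Rightarrow> 'a \<Rightarrow> complex"
  assumes hol: "\<And>\<omega>. \<omega> \<in> space M \<Longrightarrow> (\<lambda>z. f z \<omega>) holomorphic_on S"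
    and S: "open S" "cball z0 (2 * R) \<subseteq> S" and R: "0 < R"
    and meas: "(\<lambda>(z, \<omega>). f z \<omega>) \<in> borel_measurable (borel \<Otimes>\<^sub>M M)"
    and bound: "\<And>z. z \<in> cball z0 (2 * R) \<Longrightarrow> (\<integral>\<^sup>+\<omega>. norm (f z \<omega>) \<partial>M) \<le> ennreal \<eta>"
    and e: "0 < e" and \<eta>: "0 \<le> \<eta>"
  shows "\<exists>B\<in>events. prob B \<le> 2 * \<eta> / e \<and> (\<forall>\<omega>\<in>space M - B. \<forall>z\<in>cball z0 R. norm (f z \<omega>) \<le> e)"
proof -
  let ?c = "circlepath z0 (2 * R)"
  define g where "g \<omega> = (\<integral>\<^sup>+t. ennreal (norm (f (?c t) \<omega>)) * indicator {0..1} t \<partial>lborel)" for \<omega>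
  have c_meas: "?c \<in> borel_measurable borel"
    unfolding circlepath by (intro borel_measurable_continuous_onI continuous_intros)
  have m: "(\<lambda>(\<omega>, t). ennreal (norm (f (?c t) \<omega>)) * indicator {0..1::real} t) \<in> borel_measurable (M \<Otimes>\<^sub>M lborel)"
  proof -
    have "(\<lambda>x. f (?c (snd x)) (fst x)) \<in> borel_measurable (M \<Otimes>\<^sub>M lborel)"
    proof -
      have "(\<lambda>x. (?c (snd x), fst x)) \<in> measurable (M \<Otimes>\<^sub>M lborel) (borel \<Otimes>\<^sub>M M)"
        using c_meas by measurable
      from measurable_compose[OF this meas] show ?thesis by simp
    qed
    then show ?thesis by (simp add: case_prod_unfold)
  qed
  have g_meas: "g \<in> borel_measurable M"
    unfolding g_def using m by (rule lborel.borel_measurable_nn_integral)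
  interpret P: pair_sigma_finite M lborel ..
  have "(\<integral>\<^sup>+\<omega>. g \<omega> \<partial>M) = (\<integral>\<^sup>+t. (\<integral>\<^sup>+\<omega>. ennreal (norm (f (?c t) \<omega>)) * indicator {0..1} t \<partial>M) \<partial>lborel)"
    unfolding g_def using P.Fubini'[OF m] by simp
  also have "\<dots> \<le> (\<integral>\<^sup>+t. ennreal \<eta> * indicator {0..1::real} t \<partial>lborel)"
  proof (rule nn_integral_mono)
    fix t :: real
    have "?c t \<in> cball z0 (2 * R)" using R by (simp add: circlepath dist_norm norm_mult)
    then have "(\<integral>\<^sup>+\<omega>. norm (f (?c t) \<omega>) \<partial>M) \<le> ennreal \<eta>" by (rule bound)
    then show "(\<integral>\<^sup>+\<omega>. ennreal (norm (f (?c t) \<omega>)) * indicator {0..1} t \<partial>M) \<le> ennreal \<eta> * indicator {0..1} t"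
      by (auto simp: indicator_def)
  qed
  also have "\<dots> = ennreal \<eta>" by (simp add: nn_integral_cmult_indicator)
  finally have Eg: "(\<integral>\<^sup>+\<omega>. g \<omega> \<partial>M) \<le> ennreal \<eta>" .
  \<comment> \<open>The event is defined through the circle average, measurable by Fubini's theorem,
    instead of a supremum over the disc.\<close>
  define B where "B = {\<omega> \<in> space M. 1 \<le> ennreal (2 / e) * g \<omega>}"
  have B: "B \<in> events" unfolding B_def using g_meas by measurable
  have "emeasure M B \<le> ennreal (2 / e) * (\<integral>\<^sup>+\<omega>. g \<omega> * indicator (space M) \<omega> \<partial>M)"
    unfolding B_def using g_meas by (intro nn_integral_Markov_inequality) auto
  also have "(\<integral>\<^sup>+\<omega>. g \<omega> * indicator (space M) \<omega> \<partial>M) = (\<integral>\<^sup>+\<omega>. g \<omega> \<partial>M)"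
    by (intro nn_integral_cong) simp
  also have "ennreal (2 / e) * \<dots> \<le> ennreal (2 / e) * ennreal \<eta>" by (intro mult_left_mono Eg) simp
  also have "\<dots> = ennreal (2 * \<eta> / e)" using e \<eta> by (simp add: ennreal_mult'[symmetric])
  finally have "prob B \<le> 2 * \<eta> / e" using e \<eta> by (simp add: emeasure_eq_measure)
  moreover have "norm (f z \<omega>) \<le> e" if \<omega>: "\<omega> \<in> space M - B" and z: "z \<in> cball z0 R" for z \<omega>
  proof -
    have "ennreal (norm (f z \<omega>)) \<le> 2 * g \<omega>"
      unfolding g_def using norm_le_circle_average[OF hol S R z, of \<omega>] \<omega> by auto
    then have "ennreal (1 / e) * ennreal (norm (f z \<omega>)) \<le> ennreal (1 / e) * (2 * g \<omega>)"
      by (intro mult_left_mono) auto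
    also have "\<dots> = ennreal (2 / e) * g \<omega>"
      using e by (simp add: mult.assoc[symmetric] ennreal_mult'[symmetric] flip: ennreal_numeral)
    also have "\<dots> \<le> 1" using \<omega> unfolding B_def by auto
    finally have "ennreal (norm (f z \<omega>) / e) \<le> ennreal 1" using e by (simp add: ennreal_mult'[symmetric])
    then show ?thesis using e by (simp add: field_simps)
  qed
  ultimately show ?thesis using B by blast
qed

section \<open>Continuation of the zeta function of a regular sequence\<close>

text \<open>For positive \<open>x\<close> this is \<open>x powr z\<close>; the exponential form is
  entire in \<open>z\<close> for every real \<open>x\<close>, so holomorphy comes without side
  conditions.\<close>

definition rpow :: "real \<Rightarrow> complex \<Rightarrow> complex" where
  "rpow x z = exp (z * of_real (ln x))"

lemma rpow_eq_powr: "0 < x \<Longrightarrow> complex_of_real x powr z = rpow x z"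
  unfolding rpow_def powr_def by (simp add: Ln_of_real)

lemma norm_rpow: "0 < x \<Longrightarrow> norm (rpow x z) = x powr Re z"
  unfolding rpow_def powr_def by simp

lemma rpow_1_left [simp]: "rpow 1 z = 1"
  unfolding rpow_def by simp

lemma holomorphic_rpow [holomorphic_intros]: "f holomorphic_on A \<Longrightarrow> (\<lambda>z. rpow x (f z)) holomorphic_on A"
  unfolding rpow_def by (intro holomorphic_intros)

lemma rpow_has_vector_derivative:
  assumes "0 < x"
  shows "((\<lambda>x. rpow x z) has_vector_derivative z * rpow x (z - 1)) (at x within S)"
proof -
  have "((\<lambda>x. exp (z * of_real (ln x))) has_vector_derivative (z * of_real (1 / x)) * exp (z * of_real (ln x))) (at x within S)"
  proof -
    have "((\<lambda>x. z * of_real (ln x)) has_vector_derivative z * of_real (1 / x)) (at x within S)"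
    proof -
      have "(ln has_real_derivative 1 / x) (at x within S)"
        using DERIV_ln_divide[OF assms] by (rule has_field_derivative_at_within)
      then have "((\<lambda>x. complex_of_real (ln x)) has_vector_derivative of_real (1 / x)) (at x within S)"
        by (rule has_vector_derivative_of_real)
      then show ?thesis by (rule has_vector_derivative_mult_right)
    qed
    from field_vector_diff_chain_within[OF this DERIV_exp[THEN has_field_derivative_at_within]]
    show ?thesis by (simp add: o_def)
  qed
  moreover have "rpow x (z - 1) = of_real (1 / x) * rpow x z"
  proof -
    have "exp (complex_of_real (ln x)) = of_real x" using assms by (simp add: exp_of_real)
    then show ?thesis unfolding rpow_def by (simp add: left_diff_distrib exp_diff)
  qed
  ultimately show ?thesis unfolding rpow_def[symmetric] by (simp add: mult_ac)
qed

lemma norm_diff_le_of_vector_derivative: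
  fixes F :: "real \<Rightarrow> complex"
  assumes "convex S" "\<And>x. x \<in> S \<Longrightarrow> (F has_vector_derivative F' x) (at x within S)"
    "\<And>x. x \<in> S \<Longrightarrow> norm (F' x) \<le> B" "x \<in> S" "y \<in> S"
  shows "norm (F x - F y) \<le> B * \<bar>x - y\<bar>"
  using differentiable_bound[of S F "\<lambda>x h. h *\<^sub>R F' x" B x y] assms
  by (simp add: has_vector_derivative_def onorm_scaleR_left[OF bounded_linear_ident] onorm_id)

text \<open>The derivative has norm |z| t^(-Re z - 1), decreasing in t because Re z \<ge> -1, so its
  value at the left end \<open>m\<close> bounds it everywhere.\<close>

lemma norm_rpow_diff_le:
  assumes m: "0 < m" "m \<le> x" "m \<le> y" and z: "-1 \<le> Re z"
  shows "norm (rpow x (-z) - rpow y (-z)) \<le> norm z * m powr (- Re z - 1) * \<bar>x - y\<bar>"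
proof (rule norm_diff_le_of_vector_derivative[of "{m..}" _ "\<lambda>x. - z * rpow x (- z - 1)"])
  fix t assume t: "t \<in> {m..}"
  then show "((\<lambda>x. rpow x (- z)) has_vector_derivative - z * rpow t (- z - 1)) (at t within {m..})"
    using m by (intro rpow_has_vector_derivative) auto
  have "t powr (- Re z - 1) \<le> m powr (- Re z - 1)" using t m z by (intro powr_mono2') auto
  then show "norm (- z * rpow t (- z - 1)) \<le> norm z * m powr (- Re z - 1)"
    using t m by (simp add: norm_mult norm_rpow mult_left_mono)
qed (use m in auto)

text \<open>What the continuation uses of Poisson points: fluctuations of order k^(1/2 + o(1)). This
  exponent is the reason for the half-plane Re z > 1/2. Indices start at 0, hence the comparison
  with k + 1.\<close>

locale regular_sequence =
  fixes p :: "nat \<Rightarrow> real"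
  assumes mono: "strict_mono p" and pos: "0 < p 0"
    and regular: "\<And>\<theta>. 1/2 < \<theta> \<Longrightarrow> \<exists>C. \<forall>k. \<bar>p k - (real k + 1)\<bar> \<le> C * (real k + 1) powr \<theta>"
begin

lemma p_pos: "0 < p k"
  using mono pos by (metis less_eq_nat.simps(1) less_le_trans strict_mono_less_eq)

lemma p_lower: "\<exists>c>0. c \<le> 1 \<and> (\<forall>k. c * (real k + 1) \<le> p k)"
proof -
  obtain C where C: "\<And>k. \<bar>p k - (real k + 1)\<bar> \<le> C * (real k + 1) powr (3/4)"
    using regular[of "3/4"] by auto
  have "((\<lambda>k. C * (real k + 1) powr (3/4) / (real k + 1)) \<longlonglongrightarrow> 0)" by real_asymp
  then have "\<forall>\<^sub>F k in sequentially. C * (real k + 1) powr (3/4) / (real k + 1) < 1/2"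
    by (rule order_tendstoD) simp
  then obtain K where K: "\<And>k. k \<ge> K \<Longrightarrow> C * (real k + 1) powr (3/4) / (real k + 1) < 1/2"
    unfolding eventually_sequentially by auto
  \<comment> \<open>1/2 serves the indices from \<open>K\<close> on, where the deviation is below
    half of k + 1; the other entry serves the finitely many before.\<close>
  define c where "c = min (1/2) (p 0 / (real K + 1))"
  have c: "0 < c" "c \<le> 1" using pos by (auto simp: c_def min_def)
  have "c * (real k + 1) \<le> p k" for k
  proof (cases "k \<ge> K")
    case True
    have "c \<le> 1/2" unfolding c_def by (rule min.cobounded1)
    then have "c * (real k + 1) \<le> 1/2 * (real k + 1)" by (intro mult_right_mono) auto
    also have "\<dots> \<le> p k" using C[of k] K[OF True] by (simp add: field_simps abs_le_iff)
    finally show ?thesis .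
  next
    case False
    have "c * (real k + 1) \<le> p 0 / (real K + 1) * (real K + 1)"
      using False pos unfolding c_def by (intro mult_mono) auto
    also have "\<dots> = p 0" by (simp add: field_simps)
    also have "\<dots> \<le> p k" using mono by (simp add: strict_mono_less_eq)
    finally show ?thesis .
  qed
  with c show ?thesis by blast
qed

text \<open>This is z - 1 times the difference of p_k^(-z) and the integral of t^(-z) over
  [k+1, k+2]. The factor z - 1 removes the pole, and the integrals telescope.\<close>

definition zeta_term :: "nat \<Rightarrow> complex \<Rightarrow> complex" where
  "zeta_term k z = (z - 1) * rpow (p k) (- z) + rpow (real k + 2) (1 - z) - rpow (real k + 1) (1 - z)"

text \<open>The summand 1 compensates the lower end 1^(1-z) of the telescoping sum.\<close>

definition zeta_num :: "complex \<Rightarrow> complex" where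
  "zeta_num z = 1 + (\<Sum>k. zeta_term k z)"

definition zeta_cont :: "complex \<Rightarrow> complex" where
  "zeta_cont z = zeta_num z / (z - 1)"

lemma sum_zeta_term:
  "(\<Sum>k<K. zeta_term k z) = (z - 1) * (\<Sum>k<K. rpow (p k) (- z)) + rpow (real K + 1) (1 - z) - 1"
proof (induction K)
  case (Suc K)
  have "real (Suc K) + 1 = real K + 2" by simp
  then show ?case using Suc by (simp add: zeta_term_def algebra_simps)
qed simp

text \<open>The term is the increment over [k+1, k+2] of a function with derivative (1 - z)(t^(-z) -
  p_k^(-z)). Since |t - p_k| is of order k^\<theta> and the derivative of the power of order
  k^(-a-1), the term is of order k^(\<theta>-a-1), summable for \<theta> < a.\<close>

lemma norm_zeta_term_le:
  assumes \<theta>: "0 \<le> \<theta>" and C: "\<And>k. \<bar>p k - (real k + 1)\<bar> \<le> C * (real k + 1) powr \<theta>"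
    and c: "0 < c" "c \<le> 1" "\<And>k. c * (real k + 1) \<le> p k"
    and z: "a \<le> Re z" "0 \<le> a" "norm z \<le> B"
  shows "norm (zeta_term k z) \<le> (1 + B) * B * (C + 1) * c powr (- B - 1) * (real k + 1) powr (\<theta> - a - 1)"
proof -
  let ?K = "real k + 1"
  have C0: "0 \<le> C" using C[of 0] by simp
  have B0: "0 \<le> B" using z(3) norm_ge_zero[of z] by linarith
  define H where "H t = rpow t (1 - z) - (1 - z) * rpow (p k) (- z) * of_real t" for t
  have H: "zeta_term k z = H (?K + 1) - H ?K" unfolding zeta_term_def H_def by (simp add: algebra_simps)
  have Re_le: "Re z \<le> B" using complex_Re_le_cmod[of z] z(3) by linarith
  have "norm (H (?K + 1) - H ?K) \<le> ((1 + B) * B * (C + 1) * c powr (- B - 1) * ?K powr (\<theta> - a - 1)) * \<bar>?K + 1 - ?K\<bar>"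
  proof (rule norm_diff_le_of_vector_derivative[of "{?K..?K+1}" _ "\<lambda>t. (1 - z) * (rpow t (- z) - rpow (p k) (- z))"])
    fix t assume t: "t \<in> {?K..?K+1}"
    have "(H has_vector_derivative (1 - z) * rpow t (1 - z - 1) - (1 - z) * rpow (p k) (- z) * of_real 1) (at t within {?K..?K+1})"
      unfolding H_def using t
      by (intro has_vector_derivative_diff rpow_has_vector_derivative has_vector_derivative_mult_right
          has_vector_derivative_of_real) (auto intro!: derivative_eq_intros)
    then show "(H has_vector_derivative (1 - z) * (rpow t (- z) - rpow (p k) (- z))) (at t within {?K..?K+1})"
      by (simp add: algebra_simps)
    have m: "0 < c * ?K" using c by simp
    have tm: "c * ?K \<le> t" proof -
      have "c * ?K \<le> 1 * ?K" by (rule mult_right_mono[OF c(2)]) simp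
      also have "1 * ?K \<le> t" using t by simp
      finally show ?thesis .
    qed
    have "norm (rpow t (- z) - rpow (p k) (- z)) \<le> norm z * (c * ?K) powr (- Re z - 1) * \<bar>t - p k\<bar>"
      using m tm c(3) z by (intro norm_rpow_diff_le) auto
    also have "\<dots> \<le> B * (c powr (- B - 1) * ?K powr (- a - 1)) * ((C + 1) * ?K powr \<theta>)"
    proof (intro mult_mono z)
      show "(c * ?K) powr (- Re z - 1) \<le> c powr (- B - 1) * ?K powr (- a - 1)"
      proof -
        have "c powr (- Re z - 1) \<le> c powr (- B - 1)" using c Re_le by (intro powr_mono') auto
        moreover have "?K powr (- Re z - 1) \<le> ?K powr (- a - 1)" using z by (intro powr_mono) auto
        ultimately show ?thesis unfolding powr_mult by (intro mult_mono) auto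
      qed
      have "\<bar>t - p k\<bar> \<le> C * ?K powr \<theta> + 1" using C[of k] t by (simp add: abs_le_iff)
      moreover have "1 \<le> ?K powr \<theta>" using \<theta> by (intro ge_one_powr_ge_zero) auto
      ultimately show "\<bar>t - p k\<bar> \<le> (C + 1) * ?K powr \<theta>" by (simp add: algebra_simps)
    qed (use B0 C0 in auto)
    also have "\<dots> = B * (C + 1) * c powr (- B - 1) * (?K powr \<theta> * ?K powr (- a - 1))"
      by (simp only: mult_ac)
    also have "?K powr \<theta> * ?K powr (- a - 1) = ?K powr (\<theta> - a - 1)"
    proof -
      have "\<theta> + (- a - 1) = \<theta> - a - 1" by simp
      then show ?thesis by (metis powr_add)
    qed
    finally have 1: "norm (rpow t (- z) - rpow (p k) (- z)) \<le> B * (C + 1) * c powr (- B - 1) * ?K powr (\<theta> - a - 1)" .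
    have "norm (1 - z) \<le> 1 + B" using norm_triangle_ineq4[of 1 z] z(3) by simp
    then have "norm (1 - z) * norm (rpow t (- z) - rpow (p k) (- z))
        \<le> (1 + B) * (B * (C + 1) * c powr (- B - 1) * ?K powr (\<theta> - a - 1))"
      using 1 B0 by (intro mult_mono) auto
    then show "norm ((1 - z) * (rpow t (- z) - rpow (p k) (- z)))
        \<le> (1 + B) * B * (C + 1) * c powr (- B - 1) * ?K powr (\<theta> - a - 1)"
      by (simp add: norm_mult mult.assoc)
  qed auto
  then show ?thesis unfolding H by simp
qed

lemma zeta_terms_uniform:
  assumes a: "1/2 < a"
  shows "uniform_limit {z. a \<le> Re z \<and> norm z \<le> B} (\<lambda>K z. \<Sum>k<K. zeta_term k z) (\<lambda>z. \<Sum>k. zeta_term k z) sequentially"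
proof -
  \<comment> \<open>Halfway between 1/2 and \<open>a\<close>: above 1/2 for the regularity of the
    sequence, below \<open>a\<close> for summability.\<close>
  define \<theta> where "\<theta> = (a + 1/2) / 2"
  have \<theta>: "1/2 < \<theta>" "\<theta> < a" using a unfolding \<theta>_def by auto
  obtain C where C: "\<And>k. \<bar>p k - (real k + 1)\<bar> \<le> C * (real k + 1) powr \<theta>" using regular[OF \<theta>(1)] by blast
  obtain c where c: "0 < c" "c \<le> 1" "\<And>k. c * (real k + 1) \<le> p k" using p_lower by blast
  show ?thesis
  proof (rule Weierstrass_m_test)
    show "norm (zeta_term k z) \<le> (1 + B) * B * (C + 1) * c powr (- B - 1) * (real k + 1) powr (\<theta> - a - 1)"
      if "z \<in> {z. a \<le> Re z \<and> norm z \<le> B}" for k z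
      using that \<theta> a C c by (intro norm_zeta_term_le) auto
    have "summable (\<lambda>k. real (Suc k) powr (\<theta> - a - 1))"
      using summable_Suc_iff[of "\<lambda>k. real k powr (\<theta> - a - 1)"] \<theta> by (simp add: summable_real_powr_iff del: of_nat_Suc)
    then show "summable (\<lambda>k. (1 + B) * B * (C + 1) * c powr (- B - 1) * (real k + 1) powr (\<theta> - a - 1))"
      by (intro summable_mult) (simp add: add.commute)
  qed
qed

lemma holomorphic_zeta_num: "zeta_num holomorphic_on {z. 1/2 < Re z}"
  unfolding zeta_num_def[abs_def]
proof (rule holomorphic_on_add[OF holomorphic_on_const], rule holomorphic_uniform_sequence)
  show "open {z. 1/2 < Re z}" by (rule open_halfspace_Re_gt)
  show "(\<lambda>z. \<Sum>k<K. zeta_term k z) holomorphic_on {z. 1/2 < Re z}" for K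
    unfolding zeta_term_def by (intro holomorphic_intros)
  fix z assume z: "z \<in> {z. 1/2 < Re z}"
  define d where "d = (Re z - 1/2) / 2"
  have sub: "cball z d \<subseteq> {w. 1/2 + d \<le> Re w \<and> norm w \<le> norm z + d}"
  proof
    fix w assume w: "w \<in> cball z d"
    have "Re z - Re w \<le> d" using w abs_Re_le_cmod[of "z - w"] by (simp add: dist_norm)
    moreover have "norm w \<le> norm z + d" using w norm_triangle_ineq2[of w z] by (simp add: dist_norm norm_minus_commute)
    moreover have "Re z = 1/2 + 2 * d" unfolding d_def by (simp add: field_simps)
    ultimately show "w \<in> {w. 1/2 + d \<le> Re w \<and> norm w \<le> norm z + d}" by auto
  qed
  have d: "0 < d" using z unfolding d_def by auto
  show "\<exists>d>0. cball z d \<subseteq> {z. 1/2 < Re z} \<and>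
      uniform_limit (cball z d) (\<lambda>K z. \<Sum>k<K. zeta_term k z) (\<lambda>z. \<Sum>k. zeta_term k z) sequentially"
    using d sub by (intro exI[of _ d] conjI uniform_limit_on_subset[OF zeta_terms_uniform[of "1/2 + d" "norm z + d"]]) auto
qed

lemma zeta_terms_tendsto:
  assumes "1/2 < Re z"
  shows "(\<lambda>K. 1 + (\<Sum>k<K. zeta_term k z)) \<longlonglongrightarrow> zeta_num z"
  unfolding zeta_num_def
  using tendsto_uniform_limitI[OF zeta_terms_uniform[OF assms, of "norm z"], of z]
  by (intro tendsto_intros) auto

lemma is_zeta_continuation_zeta_cont: "is_zeta_continuation p zeta_cont"
  unfolding is_zeta_continuation_def
proof (intro conjI allI impI)
  let ?S = "{z. 1/2 < Re z}"
  have an: "zeta_num analytic_on ?S"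
    using holomorphic_zeta_num by (subst analytic_on_open[OF open_halfspace_Re_gt])
  have "zeta_cont meromorphic_on ?S"
    unfolding zeta_cont_def[abs_def]
    by (intro meromorphic_on_divide analytic_on_imp_meromorphic_on[OF an] analytic_on_imp_meromorphic_on analytic_intros)
  moreover have "(is_pole zeta_cont z \<and> zeta_cont z = 0) \<or> zeta_cont \<midarrow>z\<rightarrow> zeta_cont z" if z: "z \<in> ?S" for z
  proof (cases "z = 1")
    \<comment> \<open>Every term vanishes at 1, so the numerator is 1 there and the pole is genuine.
      The value of \<open>zeta_cont\<close> at 1 is a division by zero, hence 0, as
      \<open>nicely_meromorphic_on\<close> demands at poles.\<close>
    case True
    have "zeta_term k 1 = 0" for k unfolding zeta_term_def by (simp add: rpow_def)
    then have "zeta_num 1 \<noteq> 0" unfolding zeta_num_def by simp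
    moreover have "isCont zeta_num 1" using an z True by (intro analytic_at_imp_isCont analytic_on_subset[OF an]) auto
    moreover have "filterlim (\<lambda>z::complex. z - 1) (at 0) (at 1)"
      by (auto simp: filterlim_at eventually_at_filter intro!: tendsto_eq_intros)
    ultimately have "is_pole zeta_cont 1"
      unfolding zeta_cont_def[abs_def] by (intro is_pole_divide) auto
    then show ?thesis using True by (simp add: zeta_cont_def)
  next
    case False
    have "isCont zeta_num z" using an z by (intro analytic_at_imp_isCont analytic_on_subset[OF an]) auto
    then have "isCont zeta_cont z" unfolding zeta_cont_def[abs_def] using False by (intro continuous_intros) auto
    then show ?thesis by (simp add: isCont_def)
  qed
  ultimately show "zeta_cont nicely_meromorphic_on ?S" unfolding nicely_meromorphic_on_def by blast
  fix z assume z: "1 < Re z"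
  \<comment> \<open>For Re z > 1 the boundary term of the telescoping sum disappears in the limit
    and the plain series remains.\<close>
  have "(\<lambda>K. rpow (real K + 1) (1 - z)) \<longlonglongrightarrow> 0"
  proof (rule tendsto_norm_zero_cancel)
    have "(\<lambda>K. (real K + 1) powr (1 - Re z)) \<longlonglongrightarrow> 0" using z by real_asymp
    then show "(\<lambda>K. norm (rpow (real K + 1) (1 - z))) \<longlonglongrightarrow> 0" by (subst norm_rpow) auto
  qed
  then have "(\<lambda>K. (1 + (\<Sum>k<K. zeta_term k z) - rpow (real K + 1) (1 - z)) / (z - 1)) \<longlonglongrightarrow> (zeta_num z - 0) / (z - 1)"
    using z by (intro tendsto_intros zeta_terms_tendsto) auto
  moreover have "(1 + (\<Sum>k<K. zeta_term k z) - rpow (real K + 1) (1 - z)) / (z - 1) = (\<Sum>k<K. complex_of_real (p k) powr (- z))" for K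
  proof -
    have "z \<noteq> 1" using z by auto
    then show ?thesis by (simp add: sum_zeta_term rpow_eq_powr[OF p_pos])
  qed
  ultimately show "(\<lambda>k. complex_of_real (p k) powr (- z)) sums zeta_cont z"
    unfolding sums_def zeta_cont_def by simp
qed

end

text \<open>The identity theorem for meromorphic functions gives equality near every point; at the
  point itself the values are then forced, 0 at a pole and the limit elsewhere. This makes the
  choice in \<open>poisson_zeta\<close> harmless.\<close>

lemma is_zeta_continuation_unique:
  assumes f: "is_zeta_continuation p f" and g: "is_zeta_continuation p g" and z: "1/2 < Re z"
  shows "f z = g z"
proof -
  let ?S = "{z. 1/2 < Re z}"
  have mer: "f nicely_meromorphic_on ?S" "g nicely_meromorphic_on ?S"
    using f g unfolding is_zeta_continuation_def by auto
  have eq1: "f w = g w" if "1 < Re w" for w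
    using f g that unfolding is_zeta_continuation_def by (auto intro: sums_unique2)
  have "(\<forall>\<^sub>\<approx>x\<in>?S. f x - g x = 0) \<or> (\<forall>\<^sub>\<approx>x\<in>?S. f x - g x \<noteq> 0)"
  proof (rule meromorphic_imp_constant_or_avoid)
    show "(\<lambda>x. f x - g x) meromorphic_on ?S"
      using mer unfolding nicely_meromorphic_on_def by (intro meromorphic_on_diff) auto
  qed (intro open_halfspace_Re_gt convex_connected convex_halfspace_Re_gt)+
  moreover have "\<not> (\<forall>\<^sub>\<approx>x\<in>?S. f x - g x \<noteq> 0)"
  proof
    assume "\<forall>\<^sub>\<approx>x\<in>?S. f x - g x \<noteq> 0"
    then have "eventually (\<lambda>x. f x - g x \<noteq> 0) (at 2)"
      by (rule eventually_cosparse_imp_eventually_at) auto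
    moreover have "eventually (\<lambda>x. f x - g x = 0) (at (2::complex))"
      unfolding eventually_at_topological
      by (intro exI[of _ "{w. 1 < Re w}"]) (auto simp: open_halfspace_Re_gt eq1)
    ultimately have "eventually (\<lambda>x. False) (at (2::complex))" by eventually_elim auto
    then show False by simp
  qed
  ultimately have "\<forall>\<^sub>\<approx>x\<in>?S. f x - g x = 0" by blast
  then have ev: "eventually (\<lambda>x. f x - g x = 0) (at z)"
    by (rule eventually_cosparse_imp_eventually_at) (use z in auto)
  then have ev': "eventually (\<lambda>x. f x = g x) (at z)" by eventually_elim auto
  have pole: "is_pole f z \<longleftrightarrow> is_pole g z" by (rule is_pole_cong[OF ev']) simp
  show ?thesis
  proof (cases "is_pole f z")
    case True
    then have "\<not> f \<midarrow>z\<rightarrow> f z" "\<not> g \<midarrow>z\<rightarrow> g z"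
      using pole not_tendsto_and_filterlim_at_infinity[of "at z"] unfolding is_pole_def by auto
    then have "f z = 0" "g z = 0" using mer z unfolding nicely_meromorphic_on_def by blast+
    then show ?thesis by simp
  next
    case False
    then have "f \<midarrow>z\<rightarrow> f z" "g \<midarrow>z\<rightarrow> g z"
      using mer z pole unfolding nicely_meromorphic_on_def by auto
    moreover from this(1) have "g \<midarrow>z\<rightarrow> f z" using ev' by (rule Lim_transform_eventually)
    ultimately show ?thesis by (metis LIM_unique)
  qed
qed

lemma (in regular_sequence) poisson_zeta_eq: "1/2 < Re z \<Longrightarrow> poisson_zeta p z = zeta_cont z"
proof -
  assume z: "1/2 < Re z"
  have ex: "\<exists>f. is_zeta_continuation p f" using is_zeta_continuation_zeta_cont by blast
  then have "is_zeta_continuation p (poisson_zeta p)"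
    unfolding poisson_zeta_def if_P[OF ex] by (rule someI_ex)
  then show ?thesis using is_zeta_continuation_zeta_cont z by (rule is_zeta_continuation_unique)
qed

text \<open>The interval \<open>(0, r]\<close> is cut into \<open>r\<^sup>3\<close> cells of length \<open>1/r\<^sup>2\<close>. Moving every point to the right
  end of its cell changes the truncated zeta function only by \<open>O(1/r)\<close>.\<close>

definition cell :: "nat \<Rightarrow> nat \<Rightarrow> real set" where
  "cell r i = {real i / (real r)\<^sup>2 <.. real (Suc i) / (real r)\<^sup>2}"

text \<open>The subtracted term is the integral of t^(-z) over (0, r], finite for Re z < 1: a
  truncated zeta function with its compensator, depending on the points through finitely many
  counts.\<close>

definition cell_zeta :: "nat \<Rightarrow> (nat \<Rightarrow> nat) \<Rightarrow> complex \<Rightarrow> complex" where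
  "cell_zeta r c z = (\<Sum>i<r^3. of_nat (c i) * rpow (real (Suc i) / (real r)\<^sup>2) (- z)) - rpow r (1 - z) / (1 - z)"

lemma cell_disjoint: "i \<noteq> j \<Longrightarrow> 0 < r \<Longrightarrow> cell r i \<inter> cell r j = {}"
proof -
  have *: "cell r i \<inter> cell r j = {}" if "i < j" "0 < r" for i j
  proof -
    have "real (Suc i) / (real r)\<^sup>2 \<le> real j / (real r)\<^sup>2" using that by (intro divide_right_mono) auto
    then show ?thesis unfolding cell_def by fastforce
  qed
  assume "i \<noteq> j" "0 < r"
  then show ?thesis using *[of i j] *[of j i] by (cases "i < j") auto
qed

lemma Union_cell: assumes "0 < r" shows "(\<Union>i<r^3. cell r i) = {0<..real r}"
proof (intro set_eqI iffI)
  fix t assume "t \<in> (\<Union>i<r^3. cell r i)"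
  then obtain i where i: "i < r^3" "real i / (real r)\<^sup>2 < t" "t \<le> real (Suc i) / (real r)\<^sup>2" by (auto simp: cell_def)
  have "real (Suc i) \<le> real (r^3)" using i(1) by (simp only: of_nat_le_iff)
  then have "real (Suc i) / (real r)\<^sup>2 \<le> real (r^3) / (real r)\<^sup>2" using assms by (intro divide_right_mono) auto
  also have "\<dots> = real r" using assms by (simp add: power2_eq_square power3_eq_cube)
  finally have "t \<le> real r" using i by linarith
  moreover have "0 \<le> real i / (real r)\<^sup>2" by simp
  with i(2) have "0 < t" by linarith
  ultimately show "t \<in> {0<..real r}" by simp
next
  fix t assume t: "t \<in> {0<..real r}"
  \<comment> \<open>Cells are open on the left and closed on the right, hence the ceiling minus
    one.\<close>
  define i where "i = nat \<lceil>t * (real r)\<^sup>2\<rceil> - 1"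
  have pos: "0 < t * (real r)\<^sup>2" using t assms by simp
  then have c1: "1 \<le> nat \<lceil>t * (real r)\<^sup>2\<rceil>" by linarith
  have i1: "real i = real_of_int \<lceil>t * (real r)\<^sup>2\<rceil> - 1" unfolding i_def using c1 pos by (simp add: of_nat_diff)
  have "real i < t * (real r)\<^sup>2" "t * (real r)\<^sup>2 \<le> real (Suc i)" using i1 by linarith+
  then have "t \<in> cell r i" using assms unfolding cell_def
    by (auto simp: pos_divide_less_eq pos_le_divide_eq simp del: of_nat_Suc)
  moreover have "i < r^3"
  proof -
    have "t * (real r)\<^sup>2 \<le> real r * (real r)\<^sup>2" using t by (intro mult_right_mono) auto
    then have "real i < real (r^3)"
      using \<open>real i < t * (real r)\<^sup>2\<close> by (simp add: power2_eq_square power3_eq_cube)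
    then show ?thesis by (simp only: of_nat_less_iff)
  qed
  ultimately show "t \<in> (\<Union>i<r^3. cell r i)" by blast
qed


text \<open>Used both for the points of a sequence and for the first-level points of the model,
  hence the arbitrary finite index set.\<close>

lemma sum_card_cells:
  fixes w :: "nat \<Rightarrow> complex"
  assumes "finite J" "0 < r" "\<And>j. j \<in> J \<Longrightarrow> 0 < t j \<and> t j \<le> real r"
    and q: "\<And>i j. j \<in> J \<Longrightarrow> t j \<in> cell r i \<Longrightarrow> v j = w i"
  shows "(\<Sum>i<r^3. of_nat (card {j\<in>J. t j \<in> cell r i}) * w i) = (\<Sum>j\<in>J. v j)"
proof -
  have "(\<Sum>i<r^3. of_nat (card {j\<in>J. t j \<in> cell r i}) * w i) = (\<Sum>i<r^3. \<Sum>j\<in>{j\<in>J. t j \<in> cell r i}. v j)"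
  proof (intro sum.cong refl)
    fix i
    have "(\<Sum>j\<in>{j\<in>J. t j \<in> cell r i}. v j) = (\<Sum>j\<in>{j\<in>J. t j \<in> cell r i}. w i)"
      using q by (intro sum.cong) auto
    then show "of_nat (card {j\<in>J. t j \<in> cell r i}) * w i = (\<Sum>j\<in>{j\<in>J. t j \<in> cell r i}. v j)" by simp
  qed
  also have "\<dots> = (\<Sum>j\<in>(\<Union>i<r^3. {j\<in>J. t j \<in> cell r i}). v j)"
  proof (rule sum.UNION_disjoint[symmetric])
    show "\<forall>i\<in>{..<r^3}. \<forall>j\<in>{..<r^3}. i \<noteq> j \<longrightarrow> {k\<in>J. t k \<in> cell r i} \<inter> {k\<in>J. t k \<in> cell r j} = {}"
      using cell_disjoint[OF _ assms(2)] by blast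
  qed (use assms(1) in auto)
  also have "(\<Union>i<r^3. {j\<in>J. t j \<in> cell r i}) = {j\<in>J. t j \<in> (\<Union>i<r^3. cell r i)}" by blast
  also have "\<dots> = J" unfolding Union_cell[OF assms(2)] using assms(3) by auto
  finally show ?thesis .
qed

section \<open>Convergence of the cell approximations to the zeta function\<close>

context regular_sequence
begin

text \<open>Inverting p_k = k + O(k^\<theta>) gives the counting function n(r) = r + O(r^\<theta>).
  The comparison is made with n(r) + 1 since the telescoped sum of n terms ends with (n +
  1)^(1-z).\<close>

lemma count_asymptotics:
  assumes \<theta>: "1/2 < \<theta>" "\<theta> < 1"
  shows "\<exists>C c n. 0 < C \<and> 0 < c \<and> (\<forall>r\<ge>1::nat. \<forall>k. p k \<le> real r \<longleftrightarrow> k < n r) \<and>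
     (\<forall>r\<ge>1. real (n r) + 1 \<le> C * real r \<and> c * real r \<le> real (n r) + 1
        \<and> \<bar>real r - (real (n r) + 1)\<bar> \<le> C * real r powr \<theta>)"
proof -
  obtain C where C: "\<And>k. \<bar>p k - (real k + 1)\<bar> \<le> C * (real k + 1) powr \<theta>" using regular[OF \<theta>(1)] by blast
  have C0: "0 \<le> C" using C[of 0] by simp
  obtain c where c: "0 < c" "c \<le> 1" "\<And>k. c * (real k + 1) \<le> p k" using p_lower by blast
  have ex: "\<exists>k. real r < p k" for r :: nat
  proof -
    obtain k :: nat where "real r / c < real k" using reals_Archimedean2 by blast
    then have "real r < c * (real k + 1)" using c by (simp add: field_simps)
    then show ?thesis using c(3)[of k] by (intro exI[of _ k]) linarith
  qed
  define n where "n r = (LEAST k. real r < p k)" for r :: nat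
  have n1: "real r < p (n r)" for r unfolding n_def by (rule LeastI_ex[OF ex])
  have n2: "p k \<le> real r" if "k < n r" for k r
    using not_less_Least[of k "\<lambda>k. real r < p k"] that unfolding n_def by force
  have iff: "p k \<le> real r \<longleftrightarrow> k < n r" for k r
  proof
    assume "p k \<le> real r"
    then have "p k < p (n r)" using n1[of r] by linarith
    then show "k < n r" using mono by (simp add: strict_mono_less)
  qed (rule n2)
  define C' where "C' = 1 / c + 1 + C * (1 / c + 1) powr \<theta>"
  have C': "0 < C'" using c C0 unfolding C'_def by (intro add_pos_nonneg) auto
  have main: "real (n r) + 1 \<le> C' * real r \<and> 1 / (1 + C) * real r \<le> real (n r) + 1
        \<and> \<bar>real r - (real (n r) + 1)\<bar> \<le> C' * real r powr \<theta>" if r: "1 \<le> r" for r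
  proof (intro conjI)
    let ?n = "real (n r)"
    have nr: "c * ?n \<le> real r"
    proof (cases "n r = 0")
      case False
      then have "c * (real (n r - 1) + 1) \<le> real r" using c(3)[of "n r - 1"] n2[of "n r - 1" r] by simp
      then show ?thesis using False by (simp add: of_nat_diff)
    qed simp
    have n_le: "?n + 1 \<le> (1 / c + 1) * real r"
    proof -
      have "?n \<le> real r / c" using nr c by (simp add: field_simps)
      then show ?thesis using r by (simp add: algebra_simps)
    qed
    have "(1 / c + 1) * real r \<le> C' * real r"
      unfolding C'_def using C0 by (intro mult_right_mono) auto
    then show "?n + 1 \<le> C' * real r" using n_le by linarith
    have "real r \<le> ?n + 1 + C * (?n + 1) powr \<theta>" using n1[of r] C[of "n r"] by (simp add: abs_le_iff)
    also have "\<dots> \<le> ?n + 1 + C * (?n + 1) powr 1"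
      using \<theta> C0 by (intro add_left_mono mult_left_mono powr_mono) auto
    also have "\<dots> = (1 + C) * (?n + 1)" by (simp add: algebra_simps)
    finally show "1 / (1 + C) * real r \<le> ?n + 1" using C0 by (simp add: field_simps)
    have pw: "C * (?n + 1) powr \<theta> \<le> C * (1 / c + 1) powr \<theta> * real r powr \<theta>"
    proof -
      have "(?n + 1) powr \<theta> \<le> ((1 / c + 1) * real r) powr \<theta>" using n_le \<theta> by (intro powr_mono2) auto
      then show ?thesis using C0 c by (simp add: powr_mult mult_left_mono mult.assoc)
    qed
    have r1: "1 \<le> real r powr \<theta>" using r \<theta> by (intro ge_one_powr_ge_zero) auto
    have up: "real r - (?n + 1) \<le> C * (?n + 1) powr \<theta>" using n1[of r] C[of "n r"] by (simp add: abs_le_iff)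
    have low: "?n + 1 - real r \<le> 1 + C * (?n + 1) powr \<theta>"
    proof (cases "n r = 0")
      case True
      then show ?thesis using C0 by (simp add: True)
    next
      case False
      then have "?n - C * ?n powr \<theta> \<le> p (n r - 1)" using C[of "n r - 1"] by (simp add: of_nat_diff abs_le_iff)
      also have "\<dots> \<le> real r" using n2[of "n r - 1" r] False by simp
      finally have "?n - C * ?n powr \<theta> \<le> real r" .
      moreover have "C * ?n powr \<theta> \<le> C * (?n + 1) powr \<theta>" using C0 \<theta> by (intro mult_left_mono powr_mono2) auto
      ultimately show ?thesis by linarith
    qed
    have "1 + C * (?n + 1) powr \<theta> \<le> real r powr \<theta> + C * (1 / c + 1) powr \<theta> * real r powr \<theta>"
      using pw r1 by linarith
    also have "\<dots> \<le> C' * real r powr \<theta>"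
      using c by (simp add: C'_def algebra_simps)
    finally show "\<bar>real r - (?n + 1)\<bar> \<le> C' * real r powr \<theta>" using up low by (simp add: abs_le_iff)
  qed
  show ?thesis
    using C' C0 iff main
    by (intro exI[of _ C'] exI[of _ "1 / (1 + C)"] exI[of _ n] conjI) auto
qed

text \<open>Each of the n points moves by at most r^(-2) to the end of its cell, and all lie to the
  right of \<open>m\<close>, where the derivative of t^(-z) is bounded.\<close>

lemma cell_zeta_sum:
  assumes r: "1 \<le> r" and n: "\<And>k. p k \<le> real r \<longleftrightarrow> k < n" and m: "0 < m" "m \<le> 1" "m \<le> p 0"
    and z: "0 \<le> Re z" "norm z \<le> B"
  shows "norm (cell_zeta r (\<lambda>i. card {k. p k \<in> cell r i}) z - ((\<Sum>k<n. rpow (p k) (- z)) - rpow r (1 - z) / (1 - z)))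
     \<le> real n * (B * m powr (- B - 1) * (1 / (real r)\<^sup>2))"
proof -
  have Re_le: "Re z \<le> B" using complex_Re_le_cmod[of z] z(2) by linarith
  have B0: "0 \<le> B" using z(2) norm_ge_zero[of z] by linarith
  define idx where "idx k = (THE i. p k \<in> cell r i)" for k
  have idx: "idx k = i" if "p k \<in> cell r i" for k i
    unfolding idx_def using that cell_disjoint[of _ _ r] r by (intro the_equality) (auto simp: disjoint_iff)
  define v where "v k = rpow (real (Suc (idx k)) / (real r)\<^sup>2) (- z)" for k
  have card_eq: "{k. p k \<in> cell r i} = {k\<in>{..<n}. p k \<in> cell r i}" if "i < r^3" for i
  proof -
    have "p k \<le> real r" if "p k \<in> cell r i" for k
      using Union_cell[of r] r that \<open>i < r^3\<close> by (auto simp: set_eq_iff)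
    then show ?thesis using n by auto
  qed
  have "(\<Sum>i<r^3. of_nat (card {k. p k \<in> cell r i}) * rpow (real (Suc i) / (real r)\<^sup>2) (- z)) = (\<Sum>k<n. v k)"
  proof -
    have "(\<Sum>i<r^3. of_nat (card {k. p k \<in> cell r i}) * rpow (real (Suc i) / (real r)\<^sup>2) (- z))
        = (\<Sum>i<r^3. of_nat (card {k\<in>{..<n}. p k \<in> cell r i}) * rpow (real (Suc i) / (real r)\<^sup>2) (- z))"
      by (intro sum.cong refl) (simp only: card_eq lessThan_iff)
    also have "\<dots> = (\<Sum>k<n. v k)"
      using r n p_pos by (intro sum_card_cells) (auto simp: v_def dest: idx)
    finally show ?thesis .
  qed
  then have "norm (cell_zeta r (\<lambda>i. card {k. p k \<in> cell r i}) z - ((\<Sum>k<n. rpow (p k) (- z)) - rpow r (1 - z) / (1 - z)))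
      = norm (\<Sum>k<n. v k - rpow (p k) (- z))"
    unfolding cell_zeta_def by (simp add: sum_subtractf)
  also have "\<dots> \<le> (\<Sum>k<n. norm (v k - rpow (p k) (- z)))" by (rule norm_sum)
  also have "\<dots> \<le> (\<Sum>k<n. B * m powr (- B - 1) * (1 / (real r)\<^sup>2))"
  proof (rule sum_mono)
    fix k assume "k \<in> {..<n}"
    then have "p k \<in> {0<..real r}" using n p_pos by auto
    then have "p k \<in> (\<Union>i<r^3. cell r i)" using Union_cell[of r] r by simp
    then obtain i where i: "p k \<in> cell r i" by blast
    let ?q = "real (Suc i) / (real r)\<^sup>2"
    have q: "p k \<le> ?q" "?q - p k \<le> 1 / (real r)\<^sup>2" using i by (auto simp: cell_def add_divide_distrib)
    have mp: "m \<le> p k" using m mono by (metis order_trans less_eq_nat.simps(1) strict_mono_less_eq)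
    have "norm (v k - rpow (p k) (- z)) \<le> norm z * m powr (- Re z - 1) * \<bar>?q - p k\<bar>"
      unfolding v_def idx[OF i] using m mp q z by (intro norm_rpow_diff_le) auto
    also have "\<dots> \<le> B * m powr (- B - 1) * (1 / (real r)\<^sup>2)"
      using z q m Re_le B0 by (intro mult_mono powr_mono') auto
    finally show "norm (v k - rpow (p k) (- z)) \<le> B * m powr (- B - 1) * (1 / (real r)\<^sup>2)" .
  qed
  finally show ?thesis by simp
qed

text \<open>Three errors: the displacement of the points (\<open>E1\<close>, of order 1/r), the
  comparison of r^(1-z) with (n+1)^(1-z) (\<open>E2\<close>, of order r^(\<theta>-a)), and the
  remainder of the series. A division by z - 1 is the reason for the distance \<open>b\<close> from
  the pole.\<close>

lemma cell_zeta_tendsto: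
  assumes a: "1/2 < a" "a < 1" and b: "0 < b" and e: "0 < e"
  shows "\<forall>\<^sub>F r in sequentially. \<forall>z. a \<le> Re z \<and> norm z \<le> B \<and> b \<le> norm (z - 1) \<longrightarrow>
     norm (cell_zeta r (\<lambda>i. card {k. p k \<in> cell r i}) z - zeta_cont z) \<le> e"
proof -
  define \<theta> where "\<theta> = (a + 1/2) / 2"
  have \<theta>: "1/2 < \<theta>" "\<theta> < a" "\<theta> < 1" using a unfolding \<theta>_def by auto
  obtain C c n where C: "0 < C" "0 < c" and *: "\<forall>r\<ge>1::nat. \<forall>k. p k \<le> real r \<longleftrightarrow> k < n r"
      "\<forall>r\<ge>1. real (n r) + 1 \<le> C * real r \<and> c * real r \<le> real (n r) + 1
        \<and> \<bar>real r - (real (n r) + 1)\<bar> \<le> C * real r powr \<theta>"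
    using count_asymptotics[OF \<theta>(1,3)] by (elim exE conjE) (rule that)
  have n: "\<And>r k. 1 \<le> r \<Longrightarrow> p k \<le> real r \<longleftrightarrow> k < n r" using *(1) by simp
  have nb: "\<And>r. 1 \<le> r \<Longrightarrow> real (n r) + 1 \<le> C * real r"
      "\<And>r. 1 \<le> r \<Longrightarrow> c * real r \<le> real (n r) + 1"
      "\<And>r. 1 \<le> r \<Longrightarrow> \<bar>real r - (real (n r) + 1)\<bar> \<le> C * real r powr \<theta>"
    using *(2) by simp_all
  define m where "m = min 1 (p 0)"
  have m: "0 < m" "m \<le> 1" "m \<le> p 0" unfolding m_def using pos by auto
  \<comment> \<open>Both \<open>r\<close> and n(r) + 1 lie above c' r, which serves as left end in
    the mean value estimate for \<open>E2\<close>.\<close>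
  define c' where "c' = min 1 c"
  have c': "0 < c'" "c' \<le> 1" "c' \<le> c" unfolding c'_def using C by auto
  define B' where "B' = max B 0"
  have B': "B \<le> B'" "0 \<le> B'" unfolding B'_def by auto
  define E1 where "E1 r = C * B' * m powr (- B' - 1) / real r" for r :: nat
  define E2 where "E2 r = (1 / b) * ((B' + 1) * c' powr (- B') * C * real r powr (\<theta> - a))" for r :: nat
  have "E1 \<longlonglongrightarrow> 0" unfolding E1_def by real_asymp
  moreover have "E2 \<longlonglongrightarrow> 0"
  proof -
    have "(\<lambda>r. real r powr (\<theta> - a)) \<longlonglongrightarrow> 0"
      using \<theta> by (intro tendsto_neg_powr filterlim_real_sequentially) auto
    then have "(\<lambda>r. (1 / b) * ((B' + 1) * c' powr (- B') * C * real r powr (\<theta> - a))) \<longlonglongrightarrow> (1 / b) * ((B' + 1) * c' powr (- B') * C * 0)"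
      by (intro tendsto_intros)
    then show ?thesis unfolding E2_def by simp
  qed
  ultimately have "\<forall>\<^sub>F r in sequentially. E1 r < e/3" "\<forall>\<^sub>F r in sequentially. E2 r < e/3"
    using e by (intro order_tendstoD(2)[of _ 0]; simp)+
  moreover have "filterlim n at_top sequentially"
  proof (rule filterlim_at_top_mono[OF _ _, of "\<lambda>r. nat \<lfloor>c * real r - 1\<rfloor>"])
    show "filterlim (\<lambda>r. nat \<lfloor>c * real r - 1\<rfloor>) at_top sequentially"
    proof (rule filterlim_compose[OF filterlim_nat_sequentially])
      show "filterlim (\<lambda>r. \<lfloor>c * real r - 1\<rfloor>) at_top sequentially"
      proof (rule filterlim_compose[OF filterlim_floor_sequentially])
        show "filterlim (\<lambda>r. c * real r - 1) at_top sequentially" using C(2) by real_asymp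
      qed
    qed
    show "\<forall>\<^sub>F r in sequentially. nat \<lfloor>c * real r - 1\<rfloor> \<le> n r"
      using eventually_ge_at_top[of 1] 
    proof eventually_elim
      case (elim r)
      then have "\<lfloor>c * real r - 1\<rfloor> \<le> int (n r)" using nb(2)[of r] by linarith
      then show ?case by simp
    qed
  qed
  then have "\<forall>\<^sub>F r in sequentially. \<forall>z\<in>{z. a \<le> Re z \<and> norm z \<le> B}. dist (\<Sum>k<n r. zeta_term k z) (\<Sum>k. zeta_term k z) < b * e/3"
    using uniform_limitD[OF zeta_terms_uniform[OF a(1), of B], of "b * e / 3"] b e
    by (auto simp: filterlim_iff)
  ultimately show ?thesis using eventually_ge_at_top[of 1]
  proof eventually_elim
    case (elim r)
    show ?case
    proof (intro allI impI)
      fix z assume z: "a \<le> Re z \<and> norm z \<le> B \<and> b \<le> norm (z - 1)"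
      then have z0: "0 \<le> Re z" "norm z \<le> B'" "z \<noteq> 1" using a B' b by auto
      have Re_le: "Re z \<le> B'" using complex_Re_le_cmod[of z] z0(2) by linarith
      define S where "S = (\<Sum>k<n r. rpow (p k) (- z)) - rpow r (1 - z) / (1 - z)"
      have "norm (cell_zeta r (\<lambda>i. card {k. p k \<in> cell r i}) z - S) \<le> real (n r) * (B' * m powr (- B' - 1) * (1 / (real r)\<^sup>2))"
        unfolding S_def using elim(4) n m z0 by (intro cell_zeta_sum) auto
      also have "\<dots> \<le> (C * real r) * (B' * m powr (- B' - 1) * (1 / (real r)\<^sup>2))"
        using nb(1)[OF elim(4)] B' by (intro mult_right_mono) auto
      also have "\<dots> = E1 r" unfolding E1_def by (simp add: power2_eq_square field_simps)
      finally have 1: "norm (cell_zeta r (\<lambda>i. card {k. p k \<in> cell r i}) z - S) < e/3" using elim(1) by linarith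
      \<comment> \<open>After multiplication by z - 1 the compensator takes the form of the boundary
        term of the telescoping sum, and only \<open>r\<close> and n(r) + 1 remain to be
        compared.\<close>
      have "(z - 1) * (S - zeta_cont z) = (\<Sum>k<n r. zeta_term k z) - (\<Sum>k. zeta_term k z)
          + (rpow r (- (z - 1)) - rpow (real (n r) + 1) (- (z - 1)))"
      proof -
        have *: "(z - 1) * (x / (1 - z)) = - x" for x using z0(3) by (simp add: field_simps)
        have "(z - 1) * S = (z - 1) * (\<Sum>k<n r. rpow (p k) (- z)) + rpow r (1 - z)"
          unfolding S_def right_diff_distrib[of "z - 1"] * by simp
        moreover have "(z - 1) * zeta_cont z = zeta_num z" unfolding zeta_cont_def using z0(3) by simp
        ultimately show ?thesis
          unfolding right_diff_distrib[of "z - 1" S] sum_zeta_term zeta_num_def by simp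
      qed
      then have "b * norm (S - zeta_cont z) \<le> norm ((\<Sum>k<n r. zeta_term k z) - (\<Sum>k. zeta_term k z)
          + (rpow r (- (z - 1)) - rpow (real (n r) + 1) (- (z - 1))))"
        using z mult_right_mono[of b "norm (z - 1)" "norm (S - zeta_cont z)"] by (simp add: norm_mult[symmetric])
      also have "\<dots> \<le> norm ((\<Sum>k<n r. zeta_term k z) - (\<Sum>k. zeta_term k z))
          + norm (rpow r (- (z - 1)) - rpow (real (n r) + 1) (- (z - 1)))" by (rule norm_triangle_ineq)
      also have "norm ((\<Sum>k<n r. zeta_term k z) - (\<Sum>k. zeta_term k z)) \<le> b * e / 3"
        using elim(3) z by (auto simp: dist_norm intro: less_imp_le)
      also have "norm (rpow r (- (z - 1)) - rpow (real (n r) + 1) (- (z - 1))) \<le> b * E2 r"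
      proof -
        have "c' * real r \<le> 1 * real r" using c' by (intro mult_right_mono) auto
        moreover have "c' * real r \<le> c * real r" using c' by (intro mult_right_mono) auto
        moreover note nb(2)[OF elim(4)]
        ultimately have "c' * real r \<le> real r" "c' * real r \<le> real (n r) + 1" by linarith+
        then have "norm (rpow r (- (z - 1)) - rpow (real (n r) + 1) (- (z - 1)))
            \<le> norm (z - 1) * (c' * real r) powr (- Re (z - 1) - 1) * \<bar>real r - (real (n r) + 1)\<bar>"
          using c'(1) elim(4) z0 by (intro norm_rpow_diff_le) auto
        also have "\<dots> \<le> (B' + 1) * (c' powr (- B') * real r powr (- a)) * (C * real r powr \<theta>)"
        proof (intro mult_mono nb(3) elim(4))
          show "norm (z - 1) \<le> B' + 1" using norm_triangle_ineq4[of z 1] z0 by simp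
          have "c' powr (- Re z) \<le> c' powr (- B')" using c' Re_le by (intro powr_mono') auto
          moreover have "real r powr (- Re z) \<le> real r powr (- a)" using z elim(4) by (intro powr_mono) auto
          ultimately show "(c' * real r) powr (- Re (z - 1) - 1) \<le> c' powr (- B') * real r powr (- a)"
            unfolding powr_mult by (intro mult_mono) auto
        qed (use B' C in auto)
        also have "\<dots> = (B' + 1) * c' powr (- B') * C * (real r powr \<theta> * real r powr (- a))" by (simp only: mult_ac)
        also have "real r powr \<theta> * real r powr (- a) = real r powr (\<theta> - a)"
          by (metis powr_add uminus_add_conv_diff add.commute)
        also have "(B' + 1) * c' powr (- B') * C * real r powr (\<theta> - a) = b * E2 r"
          unfolding E2_def using b by simp
        finally show ?thesis .
      qed
      also have "b * E2 r \<le> b * (e / 3)" using b elim(2) by (intro mult_left_mono) auto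
      finally have "b * norm (S - zeta_cont z) \<le> b * (2 * e / 3)" by simp
      then have 2: "norm (S - zeta_cont z) \<le> 2 * e / 3" using b by simp
      have "norm (cell_zeta r (\<lambda>i. card {k. p k \<in> cell r i}) z - zeta_cont z)
          \<le> norm (cell_zeta r (\<lambda>i. card {k. p k \<in> cell r i}) z - S) + norm (S - zeta_cont z)"
        using norm_triangle_ineq[of "cell_zeta r (\<lambda>i. card {k. p k \<in> cell r i}) z - S" "S - zeta_cont z"] by simp
      then show "norm (cell_zeta r (\<lambda>i. card {k. p k \<in> cell r i}) z - zeta_cont z) \<le> e" using 1 2 by linarith
    qed
  qed
qed

end

section \<open>Regularity of Poisson points\<close>

lemma exp_minus_le_square: "\<bar>s\<bar> \<le> 1 \<Longrightarrow> exp s - 1 - s \<le> s\<^sup>2" for s :: real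
proof (cases "0 \<le> s")
  case True
  assume "\<bar>s\<bar> \<le> 1"
  then show ?thesis using exp_bound[of s] True by simp
next
  case False
  define x where "x = - s"
  assume "\<bar>s\<bar> \<le> 1"
  have x: "0 < x" using False x_def by simp
  have "exp x \<ge> 1 + x" by (rule exp_ge_add_one_self)
  then have "exp (- x) \<le> 1 / (1 + x)" using x by (simp add: exp_minus field_simps)
  also have "\<dots> \<le> 1 - x + x\<^sup>2"
    using x by (simp add: field_simps power2_eq_square)
  finally show ?thesis by (simp add: x_def)
qed

lemma (in prob_space) poisson_deviation:
  fixes N :: "'a \<Rightarrow> nat" and s y \<mu> :: real
  assumes N: "N \<in> measurable M (count_space UNIV)"
    and pmf: "\<And>m. prob {\<omega> \<in> space M. N \<omega> = m} = \<mu> ^ m / fact m * exp (- \<mu>)"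
    and \<mu>: "0 \<le> \<mu>" and s: "\<bar>s\<bar> \<le> 1"
  shows "prob {\<omega> \<in> space M. s * (real (N \<omega>) - \<mu>) \<ge> y} \<le> exp (\<mu> * s\<^sup>2 - y)"
proof -
  have pw: "ennreal (exp (s * real (N \<omega>))) = (\<Sum>m. ennreal (exp (s * real m)) * indicator {\<omega>'\<in>space M. N \<omega>' = m} \<omega>)"
    if "\<omega> \<in> space M" for \<omega>
    using that by (subst suminf_finite[of "{N \<omega>}"]) auto
  have ms: "{\<omega>\<in>space M. N \<omega> = m} \<in> events" for m
    using measurable_sets[OF N, of "{m}"] by (simp add: vimage_def Int_def conj_commute)
  have "(\<integral>\<^sup>+\<omega>. ennreal (exp (s * real (N \<omega>))) \<partial>M)
      = (\<integral>\<^sup>+\<omega>. (\<Sum>m. ennreal (exp (s * real m)) * indicator {\<omega>'\<in>space M. N \<omega>' = m} \<omega>) \<partial>M)"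
    by (intro nn_integral_cong pw)
  also have "\<dots> = (\<Sum>m. \<integral>\<^sup>+\<omega>. ennreal (exp (s * real m)) * indicator {\<omega>'\<in>space M. N \<omega>' = m} \<omega> \<partial>M)"
    using ms by (intro nn_integral_suminf) auto
  also have "\<dots> = (\<Sum>m. ennreal (exp (s * real m)) * emeasure M {\<omega>'\<in>space M. N \<omega>' = m})"
    by (simp only: nn_integral_cmult_indicator[OF ms])
  also have "\<dots> = (\<Sum>m. ennreal ((\<mu> * exp s) ^ m / fact m * exp (- \<mu>)))"
  proof (intro suminf_cong)
    fix m
    have "exp (s * real m) = exp s ^ m" by (simp add: exp_of_nat2_mult mult.commute)
    then show "ennreal (exp (s * real m)) * emeasure M {\<omega>'\<in>space M. N \<omega>' = m} = ennreal ((\<mu> * exp s) ^ m / fact m * exp (- \<mu>))"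
      using \<mu> by (simp add: emeasure_eq_measure pmf ennreal_mult'[symmetric] power_mult_distrib mult_ac)
  qed
  also have "\<dots> = ennreal (exp (\<mu> * exp s) * exp (- \<mu>))"
  proof (rule suminf_ennreal_eq)
    have "(\<lambda>m. (\<mu> * exp s) ^ m / fact m) sums exp (\<mu> * exp s)"
      using exp_converges[of "\<mu> * exp s"] by (simp add: divide_inverse mult.commute)
    then show "(\<lambda>m. (\<mu> * exp s) ^ m / fact m * exp (- \<mu>)) sums (exp (\<mu> * exp s) * exp (- \<mu>))"
      by (rule sums_mult2)
  qed (use \<mu> in auto)
  finally have E: "(\<integral>\<^sup>+\<omega>. ennreal (exp (s * real (N \<omega>))) \<partial>M) = ennreal (exp (\<mu> * exp s) * exp (- \<mu>))" .
  have meas: "(\<lambda>\<omega>. ennreal (exp (s * real (N \<omega>)))) \<in> borel_measurable M"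
    using measurable_compose[OF N, of "\<lambda>m. ennreal (exp (s * real m))" borel] by simp
  have "emeasure M {\<omega>\<in>space M. 1 \<le> ennreal (exp (- s * \<mu> - y)) * ennreal (exp (s * real (N \<omega>)))}
      \<le> ennreal (exp (- s * \<mu> - y)) * (\<integral>\<^sup>+\<omega>. ennreal (exp (s * real (N \<omega>))) * indicator (space M) \<omega> \<partial>M)"
    using meas by (intro nn_integral_Markov_inequality) auto
  also have "(\<integral>\<^sup>+\<omega>. ennreal (exp (s * real (N \<omega>))) * indicator (space M) \<omega> \<partial>M) = (\<integral>\<^sup>+\<omega>. ennreal (exp (s * real (N \<omega>))) \<partial>M)"
    by (intro nn_integral_cong) simp
  also have "ennreal (exp (- s * \<mu> - y)) * \<dots> = ennreal (exp (\<mu> * (exp s - 1 - s) - y))"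
    unfolding E by (simp add: ennreal_mult'[symmetric] exp_add[symmetric] algebra_simps)
  also have "{\<omega>\<in>space M. 1 \<le> ennreal (exp (- s * \<mu> - y)) * ennreal (exp (s * real (N \<omega>)))}
      = {\<omega> \<in> space M. s * (real (N \<omega>) - \<mu>) \<ge> y}"
    by (auto simp: ennreal_mult'[symmetric] exp_add[symmetric] algebra_simps simp flip: ennreal_1)
  finally have "prob {\<omega> \<in> space M. s * (real (N \<omega>) - \<mu>) \<ge> y} \<le> exp (\<mu> * (exp s - 1 - s) - y)"
    by (simp add: emeasure_eq_measure)
  also have "\<dots> \<le> exp (\<mu> * s\<^sup>2 - y)" using \<mu> exp_minus_le_square[OF s] by (simp add: mult_left_mono)
  finally show ?thesis .
qed

lemma unit_poisson_pointsD:
  assumes "unit_poisson_points M P" "A \<in> sets borel" "A \<subseteq> {0<..}" "emeasure lborel A < \<infinity>"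
  shows "AE \<omega> in M. finite {k. P k \<omega> \<in> A}"
    and "measure M {\<omega> \<in> space M. card {k. P k \<omega> \<in> A} = m} = measure lborel A ^ m / fact m * exp (- measure lborel A)"
proof -
  have "\<forall>A. A \<in> sets borel \<and> A \<subseteq> {0<..} \<and> emeasure lborel A < \<infinity> \<longrightarrow>
        (AE \<omega> in M. finite {k. P k \<omega> \<in> A}) \<and>
        (\<forall>m. measure M {\<omega> \<in> space M. card {k. P k \<omega> \<in> A} = m} =
               measure lborel A ^ m / fact m * exp (- measure lborel A))"
    using assms(1) unfolding unit_poisson_points_def by (elim conjE)
  from spec[OF this, of A] assms(2-)
  show "AE \<omega> in M. finite {k. P k \<omega> \<in> A}"
    "measure M {\<omega> \<in> space M. card {k. P k \<omega> \<in> A} = m} = measure lborel A ^ m / fact m * exp (- measure lborel A)"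
    by simp_all
qed

lemma unit_poisson_points_indep:
  fixes A :: "nat \<Rightarrow> real set"
  assumes "unit_poisson_points M P" "\<And>i. A i \<in> sets borel" "\<And>i. A i \<subseteq> {0<..}"
    "\<And>i. emeasure lborel (A i) < \<infinity>" "disjoint_family A"
  shows "prob_space.indep_vars M (\<lambda>_. count_space UNIV) (\<lambda>i \<omega>. card {k. P k \<omega> \<in> A i}) UNIV"
proof -
  have "\<forall>A :: nat \<Rightarrow> real set.
        (\<forall>i. A i \<in> sets borel \<and> A i \<subseteq> {0<..} \<and> emeasure lborel (A i) < \<infinity>) \<and>
        disjoint_family A \<longrightarrow>
        prob_space.indep_vars M (\<lambda>_. count_space UNIV) (\<lambda>i \<omega>. card {k. P k \<omega> \<in> A i}) UNIV"
    using assms(1) unfolding unit_poisson_points_def by (elim conjE)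
  from spec[OF this, of A] assms(2-) show ?thesis by simp
qed

text \<open>A point displaced by more than K^\<theta> forces an atypical count in an initial
  interval. The probabilities of such counts are summable, and Borel--Cantelli is applied to
  countably many exponents decreasing to 1/2.\<close>

lemma (in prob_space) AE_regular_sequence:
  assumes P: "unit_poisson_points M P"
  shows "AE \<omega> in M. regular_sequence (\<lambda>k. P k \<omega>)"
proof -
  define N where "N t \<omega> = card {k. P k \<omega> \<in> {0<..t}}" for t \<omega>
  have fin_lb: "emeasure lborel {0<..t} < \<infinity>" for t :: real by (cases "0 \<le> t") auto
  have N_meas: "N t \<in> measurable M (count_space UNIV)" for t
  proof -
    \<comment> \<open>Measurability of a single count is part of the independence statement, here
      for a family with at most one nonempty set.\<close>
    define A where "A i = (if i = 0 then {0<..t} else {})" for i :: nat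
    have "indep_vars (\<lambda>_. count_space UNIV) (\<lambda>i \<omega>. card {k. P k \<omega> \<in> A i}) UNIV"
      using fin_lb by (intro unit_poisson_points_indep[OF P]) (auto simp: A_def disjoint_family_on_def)
    then have "(\<lambda>\<omega>. card {k. P k \<omega> \<in> A 0}) \<in> measurable M (count_space UNIV)" unfolding indep_vars_def by blast
    then show ?thesis unfolding N_def A_def by simp
  qed
  have sub: "{0<..t} \<subseteq> {0<..}" for t :: real by auto
  have pmf: "prob {\<omega> \<in> space M. N t \<omega> = m} = t ^ m / fact m * exp (- t)" if "0 \<le> t" for t m
  proof -
    have "measure lborel {0<..t} = t" using that by simp
    then show ?thesis using unit_poisson_pointsD(2)[OF P _ sub fin_lb, of t m] unfolding N_def by simp
  qed
  have fin: "AE \<omega> in M. finite {k. P k \<omega> \<in> {0<..t}}" for t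
    by (rule unit_poisson_pointsD(1)[OF P _ sub fin_lb]) simp
  have inc: "AE \<omega> in M. 0 < P 0 \<omega> \<and> strict_mono (\<lambda>k. P k \<omega>)"
    using P unfolding unit_poisson_points_def by (elim conjE)
  have main: "AE \<omega> in M. \<forall>\<^sub>F k in sequentially. \<bar>P k \<omega> - (real k + 1)\<bar> \<le> (real k + 1) powr \<theta>" if \<theta>: "1/2 < \<theta>" "\<theta> < 1" for \<theta>
  proof -
    define K where "K k = real k + 1" for k
    define x where "x k = K k powr \<theta>" for k
    \<comment> \<open>With this slope \<mu> s^2 \<le> 2, since \<mu> \<le> K + x \<le> 2K, while s x
      = K^(\<theta> - 1/2) grows; the resulting bound exp(2 - K^(\<theta> - 1/2)) is
      summable.\<close>
    define s where "s k = K k powr (- 1/2)" for k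
    have K1: "1 \<le> K k" for k unfolding K_def by simp
    have s: "0 < s k" "\<bar>s k\<bar> \<le> 1" "(s k)\<^sup>2 = 1 / K k" for k
    proof -
      have "0 < K k" using K1[of k] by linarith
      then show "0 < s k" unfolding s_def by simp
      moreover have "s k \<le> K k powr 0" unfolding s_def using K1[of k] by (intro powr_mono) auto
      ultimately show "\<bar>s k\<bar> \<le> 1" using \<open>0 < K k\<close> by simp
      have "s k * s k = K k powr (- 1)" unfolding s_def by (subst powr_add[symmetric]) simp
      then show "(s k)\<^sup>2 = 1 / K k" using powr_neg_one[OF \<open>0 < K k\<close>] by (simp add: power2_eq_square)
    qed
    have sx: "s k * x k = K k powr (\<theta> - 1/2)" for k
    proof -
      have "- 1/2 + \<theta> = \<theta> - 1/2" by simp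
      then show ?thesis unfolding s_def x_def by (metis powr_add)
    qed
    have x: "0 \<le> x k" "x k \<le> K k" for k
    proof -
      have "K k powr \<theta> \<le> K k powr 1" using K1 \<theta> by (intro powr_mono) auto
      then show "0 \<le> x k" "x k \<le> K k" unfolding x_def using K1[of k] by auto
    qed
    define U where "U k = {\<omega> \<in> space M. - s k * (real (N (K k + x k) \<omega>) - (K k + x k)) \<ge> s k * x k}" for k
    define L where "L k = {\<omega> \<in> space M. s k * (real (N (K k - x k) \<omega>) - (K k - x k)) \<ge> s k * x k}" for k
    have real_meas: "(\<lambda>\<omega>. real (N t \<omega>)) \<in> borel_measurable M" for t
      using measurable_compose[OF N_meas, of real borel t] by simp
    have ULm: "U k \<in> events" "L k \<in> events" for k
      unfolding U_def L_def using real_meas by measurable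
    have PU: "prob (U k) \<le> exp (2 - K k powr (\<theta> - 1/2))" for k
    proof -
      have "prob (U k) \<le> exp ((K k + x k) * (- s k)\<^sup>2 - s k * x k)"
        unfolding U_def using x[of k] K1[of k] s(2)[of k] pmf by (intro poisson_deviation N_meas) auto
      also have "\<dots> \<le> exp (2 - K k powr (\<theta> - 1/2))"
        using x[of k] K1[of k] by (simp add: s sx field_simps)
      finally show ?thesis .
    qed
    have PL: "prob (L k) \<le> exp (2 - K k powr (\<theta> - 1/2))" for k
    proof -
      have "prob (L k) \<le> exp ((K k - x k) * (s k)\<^sup>2 - s k * x k)"
        unfolding L_def using x[of k] K1[of k] s(2)[of k] pmf by (intro poisson_deviation N_meas) auto
      also have "\<dots> \<le> exp (2 - K k powr (\<theta> - 1/2))"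
        using x[of k] K1[of k] by (simp add: s sx field_simps)
      finally show ?thesis .
    qed
    have summ: "summable (\<lambda>k. exp (2 - K k powr (\<theta> - 1/2)))"
    proof (rule summable_comparison_test_ev)
      define \<delta> where "\<delta> = \<theta> - 1/2"
      have \<delta>: "0 < \<delta>" using \<theta> \<delta>_def by simp
      have "((\<lambda>k. exp (2 - (real k + 1) powr \<delta>) * real k ^ 2) \<longlonglongrightarrow> 0)" using \<delta> by real_asymp
      then have "\<forall>\<^sub>F k in sequentially. exp (2 - (real k + 1) powr \<delta>) * real k ^ 2 < 1"
        by (rule order_tendstoD) simp
      then show "\<forall>\<^sub>F k in sequentially. norm (exp (2 - K k powr (\<theta> - 1/2))) \<le> 1 / real k ^ 2"
        using eventually_gt_at_top[of 0] by eventually_elim (simp add: K_def \<delta>_def field_simps)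
      show "summable (\<lambda>k. 1 / real k ^ 2)" using inverse_power_summable[of 2] by (simp add: inverse_eq_divide)
    qed
    have "AE \<omega> in M. \<forall>\<^sub>F k in sequentially. \<omega> \<in> space M - U k"
      using PU by (intro borel_cantelli_AE1 ULm summable_comparison_test'[OF summ]) (auto simp: emeasure_eq_measure)
    moreover have "AE \<omega> in M. \<forall>\<^sub>F k in sequentially. \<omega> \<in> space M - L k"
      using PL by (intro borel_cantelli_AE1 ULm summable_comparison_test'[OF summ]) (auto simp: emeasure_eq_measure)
    moreover have "AE \<omega> in M. \<forall>k. finite {j. P j \<omega> \<in> {0<..K k + x k}}" "AE \<omega> in M. \<forall>k. finite {j. P j \<omega> \<in> {0<..K k - x k}}"
      using fin by (simp_all add: AE_all_countable)
    ultimately show ?thesis using inc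
    proof eventually_elim
      case (elim \<omega>)
      have sm: "strict_mono (\<lambda>k. P k \<omega>)" and P0: "0 < P 0 \<omega>" using elim by auto
      have less: "P i \<omega> < P j \<omega> \<longleftrightarrow> i < j" and le: "P i \<omega> \<le> P j \<omega> \<longleftrightarrow> i \<le> j" for i j
        using strict_mono_less[OF sm, of i j] strict_mono_less_eq[OF sm, of i j] by simp_all
      have Ppos: "0 < P j \<omega>" for j using le[of 0 j] P0 by simp
      show ?case using elim(1,2)
      proof eventually_elim
        case (elim k)
        note fin1 = \<open>\<forall>k. finite {j. P j \<omega> \<in> {0<..K k + x k}}\<close>
        note fin2 = \<open>\<forall>k. finite {j. P j \<omega> \<in> {0<..K k - x k}}\<close>
        show ?case unfolding K_def[symmetric] x_def[symmetric]
        proof (rule ccontr)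
          assume "\<not> \<bar>P k \<omega> - K k\<bar> \<le> x k"
          \<comment> \<open>Counting from 0, a late point \<open>k\<close> leaves at most k < K
            points in (0, K + x], and an early one puts at least k + 1 = K points into (0, K - x].
            The second case relies on finiteness, as \<open>card\<close> of an infinite set is
            0.\<close>
          then consider "K k + x k < P k \<omega>" | "P k \<omega> < K k - x k" by linarith
          then show False
          proof cases
            case 1
            have "{j. P j \<omega> \<in> {0<..K k + x k}} \<subseteq> {..<k}"
            proof
              fix j assume "j \<in> {j. P j \<omega> \<in> {0<..K k + x k}}"
              then have "P j \<omega> < P k \<omega>" using 1 by auto
              then show "j \<in> {..<k}" using less by simp
            qed
            from card_mono[OF _ this] have "N (K k + x k) \<omega> \<le> k" unfolding N_def by simp
            then have "x k \<le> - (real (N (K k + x k) \<omega>) - (K k + x k))" unfolding K_def by simp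
            then have "s k * x k \<le> s k * - (real (N (K k + x k) \<omega>) - (K k + x k))"
              using s(1) by (intro mult_left_mono) (auto intro: less_imp_le)
            moreover have "s k * - w = - s k * w" for w by simp
            ultimately have "- s k * (real (N (K k + x k) \<omega>) - (K k + x k)) \<ge> s k * x k" by metis
            then have "\<omega> \<in> U k" using elim(1) unfolding U_def by blast
            then show False using elim(1) by blast
          next
            case 2
            have "{..k} \<subseteq> {j. P j \<omega> \<in> {0<..K k - x k}}"
            proof
              fix j assume "j \<in> {..k}"
              then have "P j \<omega> \<le> P k \<omega>" using le by simp
              then show "j \<in> {j. P j \<omega> \<in> {0<..K k - x k}}" using 2 Ppos[of j] by auto
            qed
            from card_mono[OF fin2[rule_format] this] have "Suc k \<le> N (K k - x k) \<omega>" unfolding N_def by simp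
            then have "real (Suc k) \<le> real (N (K k - x k) \<omega>)" by (simp only: of_nat_le_iff)
            then have "x k \<le> real (N (K k - x k) \<omega>) - (K k - x k)" unfolding K_def by simp
            then have "s k * x k \<le> s k * (real (N (K k - x k) \<omega>) - (K k - x k))"
              using s(1) by (intro mult_left_mono) (auto intro: less_imp_le)
            then have "\<omega> \<in> L k" using elim(2) unfolding L_def by blast
            then show False using elim(2) by blast
          qed
        qed
      qed
    qed
  qed
  \<comment> \<open>The + 3 keeps the exponents below 1, the range of the estimate above.\<close>
  define \<Theta> where "\<Theta> i = 1/2 + 1 / (real i + 3)" for i :: nat
  have "AE \<omega> in M. \<forall>i. \<forall>\<^sub>F k in sequentially. \<bar>P k \<omega> - (real k + 1)\<bar> \<le> (real k + 1) powr \<Theta> i"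
    unfolding AE_all_countable
  proof
    fix i
    have "1 / (real i + 3) < 1/2" "0 < 1 / (real i + 3)" by (simp_all add: field_simps)
    then have "1/2 < \<Theta> i" "\<Theta> i < 1" unfolding \<Theta>_def by linarith+
    then show "AE \<omega> in M. \<forall>\<^sub>F k in sequentially. \<bar>P k \<omega> - (real k + 1)\<bar> \<le> (real k + 1) powr \<Theta> i"
      by (rule main)
  qed
  with inc show ?thesis
  proof eventually_elim
    case (elim \<omega>)
    show ?case
    proof
      fix \<theta> :: real assume \<theta>: "1/2 < \<theta>"
      obtain i :: nat where i: "1 / (\<theta> - 1/2) < real i" using reals_Archimedean2 by blast
      have "1 / (real i + 3) < \<theta> - 1/2" using i \<theta> by (simp add: field_simps)
      then have le: "\<Theta> i \<le> \<theta>" unfolding \<Theta>_def by linarith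
      obtain k0 where k0: "\<And>k. k \<ge> k0 \<Longrightarrow> \<bar>P k \<omega> - (real k + 1)\<bar> \<le> (real k + 1) powr \<Theta> i"
        using elim(2) unfolding eventually_sequentially by blast
      \<comment> \<open>The finitely many indices before \<open>k0\<close> are absorbed in the
        constant.\<close>
      define C where "C = 1 + (\<Sum>k<k0. \<bar>P k \<omega> - (real k + 1)\<bar>)"
      have "\<bar>P k \<omega> - (real k + 1)\<bar> \<le> C * (real k + 1) powr \<theta>" for k
      proof -
        have p1: "1 \<le> (real k + 1) powr \<theta>" using \<theta> by (intro ge_one_powr_ge_zero) auto
        have C1: "1 \<le> C" unfolding C_def by (simp add: sum_nonneg)
        show ?thesis
        proof (cases "k \<ge> k0")
          case True
          have "\<bar>P k \<omega> - (real k + 1)\<bar> \<le> (real k + 1) powr \<theta>"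
            using k0[OF True] powr_mono[OF le, of "real k + 1"] by linarith
          also have "\<dots> \<le> C * (real k + 1) powr \<theta>" using mult_right_mono[OF C1, of "(real k + 1) powr \<theta>"] by simp
          finally show ?thesis .
        next
          case False
          have "\<bar>P k \<omega> - (real k + 1)\<bar> \<le> (\<Sum>k<k0. \<bar>P k \<omega> - (real k + 1)\<bar>)"
            using False by (intro member_le_sum) auto
          also have "\<dots> \<le> C" unfolding C_def by simp
          also have "\<dots> \<le> C * (real k + 1) powr \<theta>" using mult_left_mono[OF p1, of C] C1 by simp
          finally show ?thesis .
        qed
      qed
      then show "\<exists>C. \<forall>k. \<bar>P k \<omega> - (real k + 1)\<bar> \<le> C * (real k + 1) powr \<theta>" by blast
    qed (use elim in auto)
  qed
qed

section \<open>Multinomial counts and their Poisson limit\<close>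

lemma (in prob_space) prob_indep_family:
  fixes X :: "'i \<Rightarrow> 'a \<Rightarrow> real"
  assumes "indep_vars (\<lambda>_. borel) X I" "finite I" "\<And>\<eta>. \<eta> \<in> I \<Longrightarrow> B \<eta> \<in> sets borel"
  shows "prob {\<omega>\<in>space M. \<forall>\<eta>\<in>I. X \<eta> \<omega> \<in> B \<eta>} = (\<Prod>\<eta>\<in>I. prob {\<omega>\<in>space M. X \<eta> \<omega> \<in> B \<eta>})"
proof (cases "I = {}")
  case True
  then show ?thesis by (simp add: prob_space)
next
  case False
  have "prob (\<Inter>\<eta>\<in>I. X \<eta> -` B \<eta> \<inter> space M) = (\<Prod>\<eta>\<in>I. prob (X \<eta> -` B \<eta> \<inter> space M))"
    using assms False by (intro indep_varsD) auto
  moreover have "(\<Inter>\<eta>\<in>I. X \<eta> -` B \<eta> \<inter> space M) = {\<omega>\<in>space M. \<forall>\<eta>\<in>I. X \<eta> \<omega> \<in> B \<eta>}"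
    using False by auto
  moreover have "X \<eta> -` B \<eta> \<inter> space M = {\<omega>\<in>space M. X \<eta> \<omega> \<in> B \<eta>}" for \<eta> by auto
  ultimately show ?thesis by simp
qed

text \<open>Once the index set is enumerated, the outcome is a word of class labels. The event is
  the disjoint union over all words with the prescribed letter counts; they are equally likely, and
  their number is that of the permutations of a multiset, a multinomial coefficient.\<close>

lemma (in prob_space) multinomial_counts:
  fixes X :: "'i \<Rightarrow> 'a \<Rightarrow> real" and A :: "nat \<Rightarrow> real set" and q :: "nat \<Rightarrow> real" and c :: "nat \<Rightarrow> nat"
  assumes ind: "indep_vars (\<lambda>_. borel) X I" and fin: "finite I"
    and A: "\<And>i. i < L \<Longrightarrow> A i \<in> sets borel" and disj: "disjoint_family_on A {..<L}"
    and q: "\<And>\<eta> i. \<eta> \<in> I \<Longrightarrow> i < L \<Longrightarrow> prob {\<omega>\<in>space M. X \<eta> \<omega> \<in> A i} = q i"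
    and c: "(\<Sum>i<L. c i) \<le> card I"
  shows "prob {\<omega>\<in>space M. \<forall>i<L. card {\<eta>\<in>I. X \<eta> \<omega> \<in> A i} = c i} =
     fact (card I) / (fact (card I - (\<Sum>i<L. c i)) * (\<Prod>i<L. fact (c i))) *
     ((\<Prod>i<L. q i ^ c i) * (1 - (\<Sum>i<L. q i)) ^ (card I - (\<Sum>i<L. c i)))"
proof -
  define N where "N = card I"
  define m where "m = (\<Sum>i<L. c i)"
  obtain e where e: "bij_betw e {..<N} I"
    using ex_bij_betw_nat_finite[OF fin] unfolding N_def atLeast0LessThan by blast
  \<comment> \<open>Label \<open>L\<close> is the class of everything outside the given sets, which
    completes them to a partition.\<close>
  define B where "B i = (if i < L then A i else - (\<Union>i<L. A i))" for i
  define q' where "q' i = (if i < L then q i else 1 - (\<Sum>i<L. q i))" for i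
  define c' where "c' i = (if i < L then c i else N - m)" for i
  define cls where "cls x = (THE i. i \<le> L \<and> x \<in> B i)" for x
  have B_unique: "i = j" if "i \<le> L" "j \<le> L" "x \<in> B i" "x \<in> B j" for i j x
    using that disj unfolding B_def disjoint_family_on_def by (auto split: if_splits)
  have B_ex: "\<exists>i\<le>L. x \<in> B i" for x
  proof (cases "\<exists>i<L. x \<in> A i")
    case True
    then obtain i where "i < L" "x \<in> A i" by blast
    then show ?thesis unfolding B_def by (intro exI[of _ i]) auto
  next
    case False
    then show ?thesis unfolding B_def by (intro exI[of _ L]) auto
  qed
  have cls_eq: "cls x = i \<longleftrightarrow> x \<in> B i" if "i \<le> L" for x i
  proof
    obtain j where j: "j \<le> L" "x \<in> B j" using B_ex by blast
    have "cls x = j" unfolding cls_def using j B_unique by (intro the_equality) auto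
    then show "cls x = i \<Longrightarrow> x \<in> B i" using j by simp
    show "x \<in> B i \<Longrightarrow> cls x = i" using \<open>cls x = j\<close> B_unique[OF that j(1) _ j(2)] by simp
  qed
  have cls_le: "cls x \<le> L" for x
  proof -
    obtain j where j: "j \<le> L" "x \<in> B j" using B_ex by blast
    then have "cls x = j" using cls_eq[OF j(1)] by simp
    with j show ?thesis by simp
  qed
  have "(\<Union>i<L. A i) \<in> sets borel" using A by auto
  from borel_comp[OF this] have B_sets: "B i \<in> sets borel" for i unfolding B_def using A by simp
  have X_meas: "\<eta> \<in> I \<Longrightarrow> X \<eta> \<in> borel_measurable M" for \<eta> using ind unfolding indep_vars_def by auto
  have ev: "\<eta> \<in> I \<Longrightarrow> S \<in> sets borel \<Longrightarrow> {\<omega>\<in>space M. X \<eta> \<omega> \<in> S} \<in> events" for \<eta> S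
    using measurable_sets[OF X_meas, of \<eta> S] by (simp add: vimage_def Int_def conj_commute)
  have pB: "prob {\<omega>\<in>space M. X \<eta> \<omega> \<in> B i} = q' i" if \<eta>: "\<eta> \<in> I" for \<eta> i
  proof (cases "i < L")
    case True
    then show ?thesis using q[OF \<eta>] unfolding B_def q'_def by simp
  next
    case False
    have "{\<omega>\<in>space M. X \<eta> \<omega> \<in> B i} = space M - (\<Union>i<L. {\<omega>\<in>space M. X \<eta> \<omega> \<in> A i})"
      using False unfolding B_def by auto
    moreover have "prob (\<Union>i<L. {\<omega>\<in>space M. X \<eta> \<omega> \<in> A i}) = (\<Sum>i<L. prob {\<omega>\<in>space M. X \<eta> \<omega> \<in> A i})"
      using disj ev[OF \<eta> A] by (intro finite_measure_finite_Union) (auto simp: disjoint_family_on_def)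
    moreover have "(\<Sum>i<L. prob {\<omega>\<in>space M. X \<eta> \<omega> \<in> A i}) = (\<Sum>i<L. q i)" using q[OF \<eta>] by simp
    moreover have "(\<Union>i<L. {\<omega>\<in>space M. X \<eta> \<omega> \<in> A i}) \<in> events" using ev[OF \<eta> A] by auto
    ultimately show ?thesis using False unfolding q'_def by (simp add: prob_compl)
  qed
  define Q where "Q = (\<Sum>i\<le>L. replicate_mset (c' i) i)"
  have count_Q: "count Q i = (if i \<le> L then c' i else 0)" for i
    unfolding Q_def count_sum by (simp add: sum.delta)
  have sum_c': "(\<Sum>i\<le>L. c' i) = N"
  proof -
    have "(\<Sum>i\<le>L. c' i) = (\<Sum>i<L. c' i) + c' L" by (simp add: lessThan_Suc_atMost[symmetric])
    also have "\<dots> = m + (N - m)" unfolding m_def c'_def by simp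
    finally show ?thesis using c unfolding m_def N_def by simp
  qed
  have size_Q: "size Q = N" unfolding Q_def using sum_c' by simp
  have set_Q: "set_mset Q \<subseteq> {..L}" using count_Q by (auto simp: set_mset_def split: if_splits)
  have prodQ: "(\<Prod>x\<in>set_mset Q. g x (count Q x)) = (\<Prod>i\<le>L. g i (c' i))"
    if "\<And>x. g x 0 = 1" for g :: "nat \<Rightarrow> nat \<Rightarrow> 'z::comm_monoid_mult"
  proof -
    have "(\<Prod>x\<in>set_mset Q. g x (count Q x)) = (\<Prod>x\<le>L. g x (count Q x))"
      using set_Q that by (intro prod.mono_neutral_left) (auto simp: not_in_iff)
    also have "\<dots> = (\<Prod>i\<le>L. g i (c' i))" by (intro prod.cong) (auto simp: count_Q)
    finally show ?thesis .
  qed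
  define F where "F xs = {\<omega>\<in>space M. \<forall>k<N. X (e k) \<omega> \<in> B (xs ! k)}" for xs
  have eI: "k < N \<Longrightarrow> e k \<in> I" for k using e by (auto simp: bij_betw_def)
  have PF: "prob (F xs) = (\<Prod>i\<le>L. q' i ^ c' i)" and F_ev: "F xs \<in> events" if xs: "xs \<in> permutations_of_multiset Q" for xs
  proof -
    define b where "b \<eta> = xs ! (the_inv_into {..<N} e \<eta>)" for \<eta>
    have be: "k < N \<Longrightarrow> b (e k) = xs ! k" for k
      unfolding b_def using e by (simp add: bij_betw_def the_inv_into_f_f)
    have FF: "F xs = {\<omega>\<in>space M. \<forall>\<eta>\<in>I. X \<eta> \<omega> \<in> B (b \<eta>)}"
    proof -
      have "(\<forall>\<eta>\<in>I. X \<eta> \<omega> \<in> B (b \<eta>)) \<longleftrightarrow> (\<forall>k<N. X (e k) \<omega> \<in> B (xs ! k))" for \<omega>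
      proof -
        have "(\<forall>\<eta>\<in>e ` {..<N}. X \<eta> \<omega> \<in> B (b \<eta>)) \<longleftrightarrow> (\<forall>k<N. X (e k) \<omega> \<in> B (xs ! k))"
          by (auto simp: be)
        then show ?thesis unfolding bij_betw_imp_surj_on[OF e] .
      qed
      then show ?thesis unfolding F_def by simp
    qed
    have "prob (F xs) = (\<Prod>\<eta>\<in>I. prob {\<omega>\<in>space M. X \<eta> \<omega> \<in> B (b \<eta>)})"
      unfolding FF by (rule prob_indep_family[OF ind fin B_sets])
    also have "\<dots> = (\<Prod>\<eta>\<in>I. q' (b \<eta>))" by (intro prod.cong pB) auto
    also have "\<dots> = (\<Prod>k<N. q' (b (e k)))" by (rule prod.reindex_bij_betw[OF e, symmetric])
    also have "\<dots> = (\<Prod>k<N. q' (xs ! k))" by (intro prod.cong) (auto simp: be)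
    also have "\<dots> = prod_list (map q' xs)"
    proof -
      have "length xs = N" using permutations_of_multisetD[OF xs] size_Q size_mset[of xs] by simp
      then show ?thesis by (simp add: prod.list_conv_set_nth atLeast0LessThan)
    qed
    also have "\<dots> = prod_mset (image_mset q' (mset xs))" by (simp add: prod_mset_prod_list[symmetric])
    also have "mset xs = Q" using xs by (rule permutations_of_multisetD)
    also have "prod_mset (image_mset q' Q) = (\<Prod>i\<le>L. q' i ^ c' i)"
      unfolding image_prod_mset_multiplicity by (rule prodQ) simp
    finally show "prob (F xs) = (\<Prod>i\<le>L. q' i ^ c' i)" .
    have "F xs = space M \<inter> (\<Inter>\<eta>\<in>I. {\<omega>\<in>space M. X \<eta> \<omega> \<in> B (b \<eta>)})" unfolding FF by auto
    also have "\<dots> \<in> events" using ev[OF _ B_sets] fin by (cases "I = {}") (auto intro!: sets.Int sets.finite_INT)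
    finally show "F xs \<in> events" .
  qed
  define G where "G \<omega> = map (\<lambda>k. cls (X (e k) \<omega>)) [0..<N]" for \<omega>
  have FG: "\<omega> \<in> F xs \<longleftrightarrow> \<omega> \<in> space M \<and> G \<omega> = xs" if xs: "xs \<in> permutations_of_multiset Q" for \<omega> xs
  proof -
    have len: "length xs = N" using permutations_of_multisetD[OF xs] size_Q size_mset[of xs] by simp
    have le: "xs ! k \<le> L" if "k < N" for k
    proof -
      note that
      then have "xs ! k \<in> set_mset (mset xs)" using len by simp
      also have "mset xs = Q" using xs by (rule permutations_of_multisetD)
      finally show ?thesis using set_Q by auto
    qed
    have "G \<omega> = xs \<longleftrightarrow> (\<forall>k<N. cls (X (e k) \<omega>) = xs ! k)"
      unfolding G_def using len by (auto simp: list_eq_iff_nth_eq)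
    also have "\<dots> \<longleftrightarrow> (\<forall>k<N. X (e k) \<omega> \<in> B (xs ! k))" using cls_eq le by auto
    finally show ?thesis unfolding F_def by auto
  qed
  have count_G: "count (mset (G \<omega>)) i = card {\<eta>\<in>I. cls (X \<eta> \<omega>) = i}" for \<omega> i
  proof -
    have "count (mset (G \<omega>)) i = card {k. k < N \<and> cls (X (e k) \<omega>) = i}"
      unfolding count_mset count_list_eq_length_filter length_filter_conv_card G_def
      by (intro arg_cong[of _ _ card]) auto
    also have "\<dots> = card (e ` {k. k < N \<and> cls (X (e k) \<omega>) = i})"
      using e by (intro card_image[symmetric]) (auto simp: bij_betw_def inj_on_def)
    also have "e ` {k. k < N \<and> cls (X (e k) \<omega>) = i} = {\<eta>\<in>I. cls (X \<eta> \<omega>) = i}"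
      using bij_betw_imp_surj_on[OF e] by auto
    finally show ?thesis .
  qed
  have event: "{\<omega>\<in>space M. \<forall>i<L. card {\<eta>\<in>I. X \<eta> \<omega> \<in> A i} = c i} = (\<Union>xs\<in>permutations_of_multiset Q. F xs)"
  proof -
    have "(\<forall>i<L. card {\<eta>\<in>I. X \<eta> \<omega> \<in> A i} = c i) \<longleftrightarrow> mset (G \<omega>) = Q" for \<omega>
    proof -
      have cardA: "card {\<eta>\<in>I. X \<eta> \<omega> \<in> A i} = count (mset (G \<omega>)) i" if "i < L" for i
        unfolding count_G using cls_eq[of i] that by (simp add: B_def)
      show ?thesis
      proof
        assume "mset (G \<omega>) = Q"
        then show "\<forall>i<L. card {\<eta>\<in>I. X \<eta> \<omega> \<in> A i} = c i" using cardA count_Q by (simp add: c'_def)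
      next
        assume *: "\<forall>i<L. card {\<eta>\<in>I. X \<eta> \<omega> \<in> A i} = c i"
        have lt: "count (mset (G \<omega>)) i = count Q i" if "i < L" for i
          using * cardA[OF that] that by (simp add: count_Q c'_def)
        have gt: "count (mset (G \<omega>)) i = count Q i" if "i > L" for i
        proof -
          have "{\<eta>\<in>I. cls (X \<eta> \<omega>) = i} = {}" using cls_le that leD by blast
          then show ?thesis unfolding count_G count_Q using that by (simp only: card.empty) simp
        qed
        have "(\<Sum>i\<le>L. count (mset (G \<omega>)) i) = (\<Sum>i\<le>L. card {\<eta>\<in>I. cls (X \<eta> \<omega>) = i})"
          unfolding count_G ..
        also have "\<dots> = card (\<Union>i\<le>L. {\<eta>\<in>I. cls (X \<eta> \<omega>) = i})"
          using fin by (subst card_UN_disjoint) auto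
        also have "(\<Union>i\<le>L. {\<eta>\<in>I. cls (X \<eta> \<omega>) = i}) = I" using cls_le by auto
        also have "card I = (\<Sum>i\<le>L. count Q i)" using sum_c' by (simp add: count_Q N_def)
        \<comment> \<open>The count of the last class is determined by the total.\<close>
        finally have "count (mset (G \<omega>)) L = count Q L"
          using lt by (simp add: lessThan_Suc_atMost[symmetric])
        with lt gt show "mset (G \<omega>) = Q" by (intro multiset_eqI) (metis linorder_neqE_nat)
      qed
    qed
    then show ?thesis using FG by (auto simp: permutations_of_multiset_def)
  qed
  have "prob {\<omega>\<in>space M. \<forall>i<L. card {\<eta>\<in>I. X \<eta> \<omega> \<in> A i} = c i} = (\<Sum>xs\<in>permutations_of_multiset Q. prob (F xs))"
    unfolding event using F_ev FG by (intro finite_measure_finite_Union) (auto simp: disjoint_family_on_def)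
  also have "\<dots> = real (card (permutations_of_multiset Q)) * (\<Prod>i\<le>L. q' i ^ c' i)" using PF by simp
  also have "real (card (permutations_of_multiset Q)) = fact N / (\<Prod>i\<le>L. fact (c' i))"
  proof -
    have "real (card (permutations_of_multiset Q)) = real (fact N) / real (\<Prod>x\<in>set_mset Q. fact (count Q x))"
      unfolding card_permutations_of_multiset(1) size_Q using card_permutations_of_multiset(2)[of Q] size_Q
      by (intro real_of_nat_div) simp
    also have "(\<Prod>x\<in>set_mset Q. fact (count Q x)) = (\<Prod>i\<le>L. fact (c' i) :: nat)" by (rule prodQ) simp
    finally show ?thesis by simp
  qed
  also have "(\<Prod>i\<le>L. fact (c' i) :: real) = fact (N - m) * (\<Prod>i<L. fact (c i))"
    unfolding lessThan_Suc_atMost[symmetric] by (simp add: c'_def)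
  also have "(\<Prod>i\<le>L. q' i ^ c' i) = (\<Prod>i<L. q i ^ c i) * (1 - (\<Sum>i<L. q i)) ^ (N - m)"
    unfolding lessThan_Suc_atMost[symmetric] by (simp add: c'_def q'_def)
  finally show ?thesis unfolding N_def m_def .
qed

text \<open>The law of rare events for finitely many classes. The falling factorial is asymptotic to
  N^m, and (1 - Q)^(N-m) is squeezed between exponentials by -Q - 2Q^2 \<le> ln (1 - Q) \<le>
  -Q.\<close>

lemma multinomial_poisson_limit:
  fixes N :: "nat \<Rightarrow> nat" and q :: "nat \<Rightarrow> nat \<Rightarrow> real" and \<mu> :: "nat \<Rightarrow> real"
  assumes N: "filterlim N at_top sequentially"
    and q: "\<And>i. i < L \<Longrightarrow> (\<lambda>n. real (N n) * q n i) \<longlonglongrightarrow> \<mu> i"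
    and q0: "\<And>n i. i < L \<Longrightarrow> 0 \<le> q n i"
  shows "(\<lambda>n. fact (N n) / (fact (N n - (\<Sum>i<L. c i)) * (\<Prod>i<L. fact (c i))) *
     ((\<Prod>i<L. q n i ^ c i) * (1 - (\<Sum>i<L. q n i)) ^ (N n - (\<Sum>i<L. c i))))
     \<longlonglongrightarrow> (\<Prod>i<L. \<mu> i ^ c i / fact (c i) * exp (- \<mu> i))"
proof -
  define m where "m = (\<Sum>i<L. c i)"
  define Q where "Q n = (\<Sum>i<L. q n i)" for n
  define \<mu>' where "\<mu>' = (\<Sum>i<L. \<mu> i)"
  have N_real: "filterlim (\<lambda>n. real (N n)) at_top sequentially"
    by (rule filterlim_compose[OF filterlim_real_sequentially N])
  have inv: "(\<lambda>n. inverse (real (N n))) \<longlonglongrightarrow> 0"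
    by (rule filterlim_compose[OF tendsto_inverse_0_at_top N_real]) (rule filterlim_ident)
  have NQ: "(\<lambda>n. real (N n) * Q n) \<longlonglongrightarrow> \<mu>'"
    unfolding Q_def \<mu>'_def sum_distrib_left by (intro tendsto_sum q) auto
  have N_pos: "\<forall>\<^sub>F n in sequentially. N n \<ge> max m 1"
    using N unfolding filterlim_at_top by blast
  have Q0: "Q \<longlonglongrightarrow> 0"
  proof (rule Lim_transform_eventually)
    show "(\<lambda>n. inverse (real (N n)) * (real (N n) * Q n)) \<longlonglongrightarrow> 0"
      using tendsto_mult[OF inv NQ] by simp
    show "\<forall>\<^sub>F n in sequentially. inverse (real (N n)) * (real (N n) * Q n) = Q n"
      using N_pos by eventually_elim simp
  qed
  have Qn: "0 \<le> Q n" for n unfolding Q_def using q0 by (intro sum_nonneg) auto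
  have fact_lim: "(\<lambda>n. fact (N n) / fact (N n - k) / real (N n) ^ k) \<longlonglongrightarrow> 1" for k
  proof (induction k)
    case 0
    then show ?case by simp
  next
    case (Suc k)
    have lim: "(\<lambda>n. fact (N n) / fact (N n - k) / real (N n) ^ k * (1 - real k * inverse (real (N n)))) \<longlonglongrightarrow> 1 * (1 - real k * 0)"
      by (intro tendsto_intros Suc inv)
    have "\<forall>\<^sub>F n in sequentially. N n \<ge> Suc k" using N unfolding filterlim_at_top by blast
    then have ev: "\<forall>\<^sub>F n in sequentially. fact (N n) / fact (N n - k) / real (N n) ^ k * (1 - real k * inverse (real (N n)))
        = fact (N n) / fact (N n - Suc k) / real (N n) ^ Suc k"
    proof eventually_elim
      case (elim n)
      have "fact (N n - k) = (real (N n) - real k) * fact (N n - Suc k)"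
        using elim fact_reduce[of "N n - k", where 'a = real] by (simp add: of_nat_diff)
      moreover have "1 - real k * inverse (real (N n)) = (real (N n) - real k) / real (N n)"
        using elim by (simp add: field_simps)
      moreover have "A / (d * b) / w * (d / x) = A / b / (x * w)" if "d \<noteq> 0" for A b d w x :: real
        using that by (simp add: field_simps)
      moreover have "real (N n) - real k \<noteq> 0" using elim by auto
      ultimately show ?case by simp
    qed
    show ?case using Lim_transform_eventually[OF lim ev] by simp
  qed
  have pow_lim: "(\<lambda>n. (1 - Q n) ^ (N n - m)) \<longlonglongrightarrow> exp (- \<mu>')"
  proof (rule tendsto_sandwich)
    have ev: "\<forall>\<^sub>F n in sequentially. Q n < 1/2 \<and> N n \<ge> max m 1"
      using order_tendstoD(2)[OF Q0, of "1/2"] N_pos by (auto elim: eventually_elim2)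
    have pow: "(1 - Q n) ^ (N n - m) = exp ((real (N n) - real m) * ln (1 - Q n))" if "Q n < 1/2 \<and> N n \<ge> max m 1" for n
      using that by (simp add: exp_of_nat_mult[symmetric] of_nat_diff[symmetric] powr_realpow[symmetric] powr_def del: of_nat_diff)
    show "\<forall>\<^sub>F n in sequentially. exp ((real (N n) - real m) * (- Q n - 2 * (Q n)\<^sup>2)) \<le> (1 - Q n) ^ (N n - m)"
      using ev
    proof eventually_elim
      case (elim n)
      then show ?case unfolding pow[OF elim] exp_le_cancel_iff
        using ln_one_minus_pos_lower_bound[OF Qn[of n]] by (intro mult_left_mono) auto
    qed
    show "\<forall>\<^sub>F n in sequentially. (1 - Q n) ^ (N n - m) \<le> exp ((real (N n) - real m) * (- Q n))"
      using ev
    proof eventually_elim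
      case (elim n)
      have "ln (1 - Q n) \<le> - Q n" using ln_le_minus_one[of "1 - Q n"] elim by simp
      then show ?case unfolding pow[OF elim] exp_le_cancel_iff using elim by (intro mult_left_mono) auto
    qed
    have "(\<lambda>n. exp (- (real (N n) * Q n) + real m * Q n)) \<longlonglongrightarrow> exp (- \<mu>' + real m * 0)"
      by (intro tendsto_intros NQ Q0)
    then show "(\<lambda>n. exp ((real (N n) - real m) * (- Q n))) \<longlonglongrightarrow> exp (- \<mu>')"
      by (simp add: algebra_simps)
    have "(\<lambda>n. exp ((- (real (N n) * Q n) + real m * Q n) * (1 + 2 * Q n))) \<longlonglongrightarrow> exp ((- \<mu>' + real m * 0) * (1 + 2 * 0))"
      by (intro tendsto_intros NQ Q0)
    moreover have "(- (real (N n) * Q n) + real m * Q n) * (1 + 2 * Q n) = (real (N n) - real m) * (- Q n - 2 * (Q n)\<^sup>2)" for n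
      by (simp add: algebra_simps power2_eq_square)
    ultimately show "(\<lambda>n. exp ((real (N n) - real m) * (- Q n - 2 * (Q n)\<^sup>2))) \<longlonglongrightarrow> exp (- \<mu>')"
      by simp
  qed
  have lim: "(\<lambda>n. (fact (N n) / fact (N n - m) / real (N n) ^ m) * inverse (\<Prod>i<L. fact (c i)) * ((\<Prod>i<L. (real (N n) * q n i) ^ c i) * (1 - Q n) ^ (N n - m)))
      \<longlonglongrightarrow> 1 * inverse (\<Prod>i<L. fact (c i)) * ((\<Prod>i<L. \<mu> i ^ c i) * exp (- \<mu>'))"
    by (intro tendsto_mult tendsto_prod tendsto_power fact_lim pow_lim q tendsto_const) auto
  have eq: "1 * inverse (\<Prod>i<L. fact (c i)) * ((\<Prod>i<L. \<mu> i ^ c i) * exp (- \<mu>')) = (\<Prod>i<L. \<mu> i ^ c i / fact (c i) * exp (- \<mu> i))"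
    unfolding \<mu>'_def by (simp add: prod.distrib prod_dividef exp_sum sum_negf[symmetric] field_simps)
  have ev: "\<forall>\<^sub>F n in sequentially. (fact (N n) / fact (N n - m) / real (N n) ^ m) * inverse (\<Prod>i<L. fact (c i)) * ((\<Prod>i<L. (real (N n) * q n i) ^ c i) * (1 - Q n) ^ (N n - m))
      = fact (N n) / (fact (N n - m) * (\<Prod>i<L. fact (c i))) * ((\<Prod>i<L. q n i ^ c i) * (1 - Q n) ^ (N n - m))"
    using N_pos
  proof eventually_elim
    case (elim n)
    have "(\<Prod>i<L. (real (N n) * q n i) ^ c i) = real (N n) ^ m * (\<Prod>i<L. q n i ^ c i)"
      unfolding m_def by (simp add: power_mult_distrib prod.distrib power_sum)
    then show ?case using elim by (simp add: field_simps)
  qed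
  show ?thesis using Lim_transform_eventually[OF lim ev] unfolding eq m_def[symmetric] Q_def[symmetric] .
qed

text \<open>For a countable target, convergence of the point masses to a probability is already
  convergence in total variation.\<close>

lemma (in prob_space) expectation_finite_part:
  fixes X :: "'a \<Rightarrow> 'c::countable" and \<psi> :: "'c \<Rightarrow> real"
  assumes X: "X \<in> measurable M (count_space UNIV)" and B: "\<And>x. \<bar>\<psi> x\<bar> \<le> B" and F: "finite F"
  shows "\<bar>expectation (\<lambda>\<omega>. \<psi> (X \<omega>)) - (\<Sum>x\<in>F. \<psi> x * prob {\<omega>\<in>space M. X \<omega> = x})\<bar>
    \<le> B * (1 - (\<Sum>x\<in>F. prob {\<omega>\<in>space M. X \<omega> = x}))"
proof -
  have ev: "{\<omega>\<in>space M. X \<omega> = x} \<in> events" for x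
    using measurable_sets[OF X, of "{x}"] by (simp add: vimage_def Int_def conj_commute)
  have int: "integrable M (\<lambda>\<omega>. \<psi> (X \<omega>))"
    using B by (intro integrable_const_bound[of _ B] measurable_compose[OF X]) auto
  let ?i = "\<lambda>x. indicator {\<omega>\<in>space M. X \<omega> = x} :: 'a \<Rightarrow> real"
  have inti: "integrable M (?i x)" for x using ev by (simp add: emeasure_eq_measure)
  have "expectation (\<lambda>\<omega>. \<psi> (X \<omega>)) - (\<Sum>x\<in>F. \<psi> x * prob {\<omega>\<in>space M. X \<omega> = x})
      = expectation (\<lambda>\<omega>. \<psi> (X \<omega>) - (\<Sum>x\<in>F. \<psi> x * ?i x \<omega>))"
    using int inti ev by (subst Bochner_Integration.integral_diff) auto
  also have "\<bar>\<dots>\<bar> \<le> expectation (\<lambda>\<omega>. B * (1 - (\<Sum>x\<in>F. ?i x \<omega>)))"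
  proof (rule order_trans[OF integral_abs_bound integral_mono])
    fix \<omega> assume \<omega>: "\<omega> \<in> space M"
    have "(\<Sum>x\<in>F. \<psi> x * ?i x \<omega>) = (if X \<omega> \<in> F then \<psi> (X \<omega>) else 0)"
      using F \<omega> by (simp add: indicator_def if_distrib sum.delta' cong: if_cong)
    moreover have "(\<Sum>x\<in>F. ?i x \<omega>) = (if X \<omega> \<in> F then 1 else 0)"
      using F \<omega> by (simp add: indicator_def sum.delta' cong: if_cong)
    ultimately show "\<bar>\<psi> (X \<omega>) - (\<Sum>x\<in>F. \<psi> x * ?i x \<omega>)\<bar> \<le> B * (1 - (\<Sum>x\<in>F. ?i x \<omega>))"
      using B by auto
  qed (use int inti in auto)
  also have "\<dots> = B * (1 - (\<Sum>x\<in>F. prob {\<omega>\<in>space M. X \<omega> = x}))"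
    using inti ev by (simp add: prob_space)
  finally show ?thesis .
qed

lemma expectation_tendsto_of_point_masses:
  fixes X :: "nat \<Rightarrow> 'a \<Rightarrow> 'c::countable" and X' :: "'b \<Rightarrow> 'c" and \<psi> :: "'c \<Rightarrow> real"
  assumes M: "\<And>n. prob_space (M n)" and M': "prob_space M'"
    and X: "\<And>n. X n \<in> measurable (M n) (count_space UNIV)" and X': "X' \<in> measurable M' (count_space UNIV)"
    and lim: "\<And>x. (\<lambda>n. measure (M n) {\<omega>\<in>space (M n). X n \<omega> = x}) \<longlonglongrightarrow> measure M' {\<omega>\<in>space M'. X' \<omega> = x}"
    and B: "\<And>x. \<bar>\<psi> x\<bar> \<le> B"
  shows "(\<lambda>n. \<integral>\<omega>. \<psi> (X n \<omega>) \<partial>M n) \<longlonglongrightarrow> (\<integral>\<omega>. \<psi> (X' \<omega>) \<partial>M')"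
proof (rule LIMSEQ_I)
  fix e :: real assume e: "0 < e"
  interpret M': prob_space M' by (rule M')
  have B0: "0 \<le> B" using B[of undefined] by linarith
  define F where "F j = {x::'c. to_nat x \<le> j}" for j
  have finF: "finite (F j)" for j
  proof -
    have "F j \<subseteq> from_nat ` {..j}" unfolding F_def by (auto simp: image_iff) (metis atMost_iff from_nat_to_nat)
    then show ?thesis by (rule finite_subset) simp
  qed
  have ev': "{\<omega>\<in>space M'. X' \<omega> \<in> S} \<in> sets M'" for S
    using measurable_sets[OF X', of S] by (simp add: vimage_def Int_def conj_commute)
  have sumF: "(\<Sum>x\<in>F j. measure M' {\<omega>\<in>space M'. X' \<omega> = x}) = measure M' {\<omega>\<in>space M'. X' \<omega> \<in> F j}" for j
  proof -
    have "measure M' (\<Union>x\<in>F j. {\<omega>\<in>space M'. X' \<omega> \<in> {x}}) = (\<Sum>x\<in>F j. measure M' {\<omega>\<in>space M'. X' \<omega> \<in> {x}})"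
      using finF ev'[of "{_}"] by (intro M'.finite_measure_finite_Union) (auto simp: disjoint_family_on_def)
    moreover have "(\<Union>x\<in>F j. {\<omega>\<in>space M'. X' \<omega> \<in> {x}}) = {\<omega>\<in>space M'. X' \<omega> \<in> F j}" by auto
    ultimately show ?thesis by simp
  qed
  have "(\<lambda>j. measure M' {\<omega>\<in>space M'. X' \<omega> \<in> F j}) \<longlonglongrightarrow> measure M' (\<Union>j. {\<omega>\<in>space M'. X' \<omega> \<in> F j})"
  proof (rule M'.finite_Lim_measure_incseq)
    show "range (\<lambda>j. {\<omega>\<in>space M'. X' \<omega> \<in> F j}) \<subseteq> sets M'" using ev' by blast
  qed (auto simp: incseq_def F_def)
  also have "(\<Union>j. {\<omega>\<in>space M'. X' \<omega> \<in> F j}) = space M'" unfolding F_def by auto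
  finally have "(\<lambda>j. measure M' {\<omega>\<in>space M'. X' \<omega> \<in> F j}) \<longlonglongrightarrow> 1" by (simp add: M'.prob_space)
  \<comment> \<open>A finite set that carries all but \<epsilon> of the limit law also carries all
    but \<epsilon> of the laws for large n, because the strict inequality passes through the finite
    sum of point masses.\<close>
  define \<epsilon> where "\<epsilon> = e / (4 * (B + 1))"
  have \<epsilon>: "0 < \<epsilon>" unfolding \<epsilon>_def using e B0 by simp
  have B\<epsilon>: "B * \<epsilon> < e / 4" unfolding \<epsilon>_def using e B0 by (simp add: field_simps)
  have "\<forall>\<^sub>F j in sequentially. 1 - \<epsilon> < measure M' {\<omega>\<in>space M'. X' \<omega> \<in> F j}"
    using \<open>(\<lambda>j. measure M' {\<omega>\<in>space M'. X' \<omega> \<in> F j}) \<longlonglongrightarrow> 1\<close> \<epsilon> by (intro order_tendstoD) auto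
  then obtain j where j: "1 - \<epsilon> < (\<Sum>x\<in>F j. measure M' {\<omega>\<in>space M'. X' \<omega> = x})"
    unfolding sumF by (auto dest: eventually_happens)
  let ?p = "\<lambda>n x. measure (M n) {\<omega>\<in>space (M n). X n \<omega> = x}" and ?p' = "\<lambda>x. measure M' {\<omega>\<in>space M'. X' \<omega> = x}"
  have "(\<lambda>n. \<Sum>x\<in>F j. ?p n x) \<longlonglongrightarrow> (\<Sum>x\<in>F j. ?p' x)" by (intro tendsto_sum lim)
  from order_tendstoD(1)[OF this j] have 1: "\<forall>\<^sub>F n in sequentially. 1 - \<epsilon> < (\<Sum>x\<in>F j. ?p n x)" .
  have "(\<lambda>n. \<Sum>x\<in>F j. \<psi> x * ?p n x) \<longlonglongrightarrow> (\<Sum>x\<in>F j. \<psi> x * ?p' x)" by (intro tendsto_sum tendsto_mult lim tendsto_const)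
  from tendstoD[OF this, of "e/4"] e have 2: "\<forall>\<^sub>F n in sequentially. \<bar>(\<Sum>x\<in>F j. \<psi> x * ?p n x) - (\<Sum>x\<in>F j. \<psi> x * ?p' x)\<bar> < e/4"
    by (simp add: dist_real_def)
  have "\<forall>\<^sub>F n in sequentially. norm ((\<integral>\<omega>. \<psi> (X n \<omega>) \<partial>M n) - (\<integral>\<omega>. \<psi> (X' \<omega>) \<partial>M')) < e"
    using 1 2
  proof eventually_elim
    case (elim n)
    interpret Mn: prob_space "M n" by (rule M)
    have "\<bar>(\<integral>\<omega>. \<psi> (X n \<omega>) \<partial>M n) - (\<Sum>x\<in>F j. \<psi> x * ?p n x)\<bar> \<le> B * (1 - (\<Sum>x\<in>F j. ?p n x))"
      by (rule Mn.expectation_finite_part[OF X B finF])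
    also have "\<dots> \<le> B * \<epsilon>" using elim B0 by (intro mult_left_mono) auto
    finally have a: "\<bar>(\<integral>\<omega>. \<psi> (X n \<omega>) \<partial>M n) - (\<Sum>x\<in>F j. \<psi> x * ?p n x)\<bar> \<le> B * \<epsilon>" .
    have "\<bar>(\<integral>\<omega>. \<psi> (X' \<omega>) \<partial>M') - (\<Sum>x\<in>F j. \<psi> x * ?p' x)\<bar> \<le> B * (1 - (\<Sum>x\<in>F j. ?p' x))"
      by (rule M'.expectation_finite_part[OF X' B finF])
    also have "\<dots> \<le> B * \<epsilon>" using j B0 by (intro mult_left_mono) auto
    finally show ?case using a elim(2) B\<epsilon> unfolding real_norm_def by linarith
  qed
  then show "\<exists>n0. \<forall>n\<ge>n0. norm ((\<integral>\<omega>. \<psi> (X n \<omega>) \<partial>M n) - (\<integral>\<omega>. \<psi> (X' \<omega>) \<partial>M')) < e"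
    unfolding eventually_sequentially .
qed

section \<open>The first level as a point process\<close>

lemma nn_integral_exp_atLeast:
  fixes \<kappa> x :: real assumes "0 < \<kappa>"
  shows "(\<integral>\<^sup>+v. ennreal (exp (- \<kappa> * v)) * indicator {x..} v \<partial>lborel) = ennreal (exp (- \<kappa> * x) / \<kappa>)"
proof -
  have "(\<integral>\<^sup>+v. ennreal (exp (- \<kappa> * v)) * indicator {x..} v \<partial>lborel) = ennreal (0 - (- exp (- \<kappa> * x) / \<kappa>))"
  proof (rule nn_integral_FTC_atLeast)
    show "((\<lambda>v. - exp (- \<kappa> * v) / \<kappa>) has_real_derivative exp (- \<kappa> * v)) (at v)" for v
      using assms by (auto intro!: derivative_eq_intros)
    have "((\<lambda>v. exp (- \<kappa> * v)) \<longlongrightarrow> 0) at_top" using assms by real_asymp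
    then have "((\<lambda>v. - exp (- \<kappa> * v) / \<kappa>) \<longlongrightarrow> - 0 / \<kappa>) at_top" by (intro tendsto_intros) (use assms in auto)
    then show "((\<lambda>v. - exp (- \<kappa> * v) / \<kappa>) \<longlongrightarrow> 0) at_top" by simp
  qed auto
  then show ?thesis by simp
qed

lemma nn_integral_exp_atMost:
  fixes \<kappa> x :: real assumes "0 < \<kappa>"
  shows "(\<integral>\<^sup>+v. ennreal (exp (\<kappa> * v)) * indicator {..x} v \<partial>lborel) = ennreal (exp (\<kappa> * x) / \<kappa>)"
proof -
  have "(\<integral>\<^sup>+v. ennreal (exp (\<kappa> * v)) * indicator {..x} v \<partial>lborel)
      = (\<integral>\<^sup>+v. ennreal (exp (\<kappa> * (0 + (-1) * v))) * indicator {..x} (0 + (-1) * v) \<partial>lborel)"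
    by (subst nn_integral_real_affine[where c = "-1" and t = 0]) (auto simp: one_ennreal_def[symmetric])
  also have "\<dots> = (\<integral>\<^sup>+v. ennreal (exp (- \<kappa> * v)) * indicator {-x..} v \<partial>lborel)"
    by (intro nn_integral_cong) (auto simp: indicator_def)
  also have "\<dots> = ennreal (exp (- \<kappa> * (- x)) / \<kappa>)" by (rule nn_integral_exp_atLeast[OF assms])
  finally show ?thesis by simp
qed

lemma set_integrable_exp_atMost:
  fixes \<kappa> x :: real assumes "0 < \<kappa>" shows "integrable lborel (\<lambda>v. indicator {..x} v * exp (\<kappa> * v))"
proof (rule integrableI_nonneg)
  have "(\<integral>\<^sup>+v. ennreal (indicator {..x} v * exp (\<kappa> * v)) \<partial>lborel) = ennreal (exp (\<kappa> * x) / \<kappa>)"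
    unfolding nn_integral_exp_atMost[OF assms, of x, symmetric]
    by (intro nn_integral_cong) (auto simp: indicator_def)
  then show "(\<integral>\<^sup>+v. ennreal (indicator {..x} v * exp (\<kappa> * v)) \<partial>lborel) < \<infinity>" by simp
qed (auto simp: indicator_def)

text \<open>With w = 1 - z and x = ln r this is the integral of t^(-z) over (0, r], written in the
  variable v = ln t.\<close>

lemma integral_complex_exp_atMost:
  fixes x :: real and w :: complex assumes w: "0 < Re w"
  shows "integrable lborel (\<lambda>v. indicator {..x} v *\<^sub>R exp (w * of_real v))"
    and "(\<integral>v. indicator {..x} v *\<^sub>R exp (w * of_real v) \<partial>lborel) = exp (w * of_real x) / w"
proof -
  let ?f = "\<lambda>v::real. exp (w * of_real v)"
  have fm: "?f \<in> borel_measurable borel"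
    by (intro borel_measurable_continuous_onI continuous_intros)
  show int: "integrable lborel (\<lambda>v. indicator {..x} v *\<^sub>R ?f v)"
  proof (rule Bochner_Integration.integrable_bound[OF set_integrable_exp_atMost[OF w, of x]])
    show "(\<lambda>v. indicator {..x} v *\<^sub>R ?f v) \<in> borel_measurable lborel" using fm by simp
  qed (auto simp: indicator_def)
  have w0: "w \<noteq> 0" using w by auto
  have "(LBINT v=-\<infinity>..ereal x. ?f v) = exp (w * of_real x) / w - 0"
  proof (rule interval_integral_FTC_integrable)
    show "((\<lambda>v. exp (w * of_real v) / w) has_vector_derivative ?f v) (at v)" for v :: real
    proof -
      have "((\<lambda>u. exp (w * u) / w) has_field_derivative exp (w * of_real v)) (at (of_real v))"
        using w0 by (auto intro!: derivative_eq_intros)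
      then show ?thesis by (rule has_vector_derivative_real_field)
    qed
    show "isCont ?f v" for v by (intro continuous_intros)
    show "set_integrable lborel (einterval (-\<infinity>) (ereal x)) ?f"
    proof -
      have "set_integrable lborel {..x} ?f" using int unfolding set_integrable_def .
      then show ?thesis by (rule set_integrable_subset) (auto simp: einterval_def)
    qed
    show "(((\<lambda>v. exp (w * of_real v) / w) \<circ> real_of_ereal) \<longlongrightarrow> 0) (at_right (-\<infinity>))"
    proof -
      have "((\<lambda>v::real. exp (w * of_real v) / w) \<longlongrightarrow> 0) at_bot"
      proof (rule tendsto_norm_zero_cancel)
        have "((\<lambda>v::real. exp (Re w * v)) \<longlongrightarrow> 0) at_bot" using w by real_asymp
        then have "((\<lambda>v::real. exp (Re w * v) / norm w) \<longlongrightarrow> 0 / norm w) at_bot" by (intro tendsto_intros) (use w0 in auto)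
        then show "((\<lambda>v::real. norm (exp (w * of_real v) / w)) \<longlongrightarrow> 0) at_bot" by (simp add: norm_divide)
      qed
      then show ?thesis by (simp only: ereal_tendsto_simps1)
    qed
    show "(((\<lambda>v. exp (w * of_real v) / w) \<circ> real_of_ereal) \<longlongrightarrow> exp (w * of_real x) / w) (at_left (ereal x))"
    proof -
      have "((\<lambda>v::real. exp (w * of_real v) / w) \<longlongrightarrow> exp (w * of_real x) / w) (at_left x)"
        using w0 by (intro tendsto_intros) auto
      then show ?thesis by (simp only: ereal_tendsto_simps1)
    qed
  qed simp
  moreover have "(LBINT v=-\<infinity>..ereal x. ?f v) = (\<integral>v. indicator {..x} v *\<^sub>R ?f v \<partial>lborel)"
  proof -
    have "(LBINT v=-\<infinity>..ereal x. ?f v) = (\<integral>v. indicator {..<x} v *\<^sub>R ?f v \<partial>lborel)"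
    proof -
      have "einterval (-\<infinity>) (ereal x) = {..<x}" by (auto simp: einterval_def)
      then show ?thesis by (simp add: interval_lebesgue_integral_def set_lebesgue_integral_def)
    qed
    also have "\<dots> = (\<integral>v. indicator {..x} v *\<^sub>R ?f v \<partial>lborel)"
    proof (rule integral_cong_AE)
      have "AE v in lborel. v \<noteq> x" by (rule AE_lborel_singleton)
      then show "AE v in lborel. indicator {..<x} v *\<^sub>R ?f v = indicator {..x} v *\<^sub>R ?f v"
        by eventually_elim (auto simp: indicator_def)
    qed (use fm in simp_all)
    finally show ?thesis .
  qed
  ultimately show "(\<integral>v. indicator {..x} v *\<^sub>R ?f v \<partial>lborel) = exp (w * of_real x) / w" by simp
qed

text \<open>For a standard normal \<open>\<xi>\<close>, the variable \<open>v = - u (\<xi> - u)\<close> has the following density; \<open>e\<^sup>v\<close> is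
  the position of the corresponding point of the approximate Poisson process.\<close>

definition site_const :: "real \<Rightarrow> real" where
  "site_const u = 1 / (sqrt (2 * pi) * u * exp (u\<^sup>2 / 2))"

definition site_density :: "real \<Rightarrow> real \<Rightarrow> real" where
  "site_density u v = site_const u * exp (v - v\<^sup>2 / (2 * u\<^sup>2))"

lemma site_const_pos: "0 < u \<Longrightarrow> 0 < site_const u"
  unfolding site_const_def by simp

text \<open>Since e^v dv = dt, the right side is a multiple of the image of Lebesgue measure under
  ln. As N times \<open>site_const\<close> tends to 1, upper bounds for the model reduce to
  computations with unit intensity.\<close>

lemma site_density_le: "0 < u \<Longrightarrow> site_density u v \<le> site_const u * exp v"
  unfolding site_density_def using site_const_pos[of u] by (intro mult_left_mono) auto

lemma site_density_nonneg: "0 < u \<Longrightarrow> 0 \<le> site_density u v"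
  unfolding site_density_def using site_const_pos[of u] by simp

lemma site_density_measurable [measurable]: "site_density u \<in> borel_measurable borel"
  unfolding site_density_def by measurable

lemma distributed_site:
  assumes d: "distributed M lborel \<xi> std_normal_density" and u: "0 < u"
  shows "distributed M lborel (\<lambda>\<omega>. - u * (\<xi> \<omega> - u)) (site_density u)"
  unfolding distributed_def
proof (intro conjI)
  have \<xi>: "\<xi> \<in> borel_measurable M" using distributed_measurable[OF d] by simp
  show meas: "(\<lambda>\<omega>. - u * (\<xi> \<omega> - u)) \<in> measurable M lborel" using \<xi> by simp
  show "(\<lambda>x. ennreal (site_density u x)) \<in> borel_measurable lborel" by measurable
  show "distr M lborel (\<lambda>\<omega>. - u * (\<xi> \<omega> - u)) = density lborel (\<lambda>x. ennreal (site_density u x))"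
  proof (rule measure_eqI)
    fix A assume "A \<in> sets (distr M lborel (\<lambda>\<omega>. - u * (\<xi> \<omega> - u)))"
    then have A: "A \<in> sets borel" by simp
    have "emeasure (distr M lborel (\<lambda>\<omega>. - u * (\<xi> \<omega> - u))) A = (\<integral>\<^sup>+x. indicator A x \<partial>distr M lborel (\<lambda>\<omega>. - u * (\<xi> \<omega> - u)))"
      using A by simp
    also have "\<dots> = (\<integral>\<^sup>+\<omega>. indicator A (- u * (\<xi> \<omega> - u)) \<partial>M)"
      using A meas by (subst nn_integral_distr) auto
    also have "\<dots> = (\<integral>\<^sup>+x. ennreal (std_normal_density x) * indicator A (- u * (x - u)) \<partial>lborel)"
    proof (rule distributed_nn_integral[OF d, symmetric])
      have "(\<lambda>x. - u * (x - u)) \<in> borel_measurable borel" by measurable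
      from measurable_compose[OF this, of "indicator A" borel] A
      show "(\<lambda>x. indicator A (- u * (x - u)) :: ennreal) \<in> borel_measurable lborel" by simp
    qed
    also have "\<dots> = ennreal \<bar>-1/u\<bar> * (\<integral>\<^sup>+v. ennreal (std_normal_density (u + (-1/u) * v)) * indicator A (- u * (u + (-1/u) * v - u)) \<partial>lborel)"
    proof (rule nn_integral_real_affine)
      have "(\<lambda>x. - u * (x - u)) \<in> borel_measurable borel" by measurable
      from measurable_compose[OF this, of "indicator A" borel] A
      have "(\<lambda>x. indicator A (- u * (x - u)) :: ennreal) \<in> borel_measurable borel" by simp
      then show "(\<lambda>x. ennreal (std_normal_density x) * indicator A (- u * (x - u))) \<in> borel_measurable borel" by measurable
    qed (use u in auto)
    also have "\<dots> = (\<integral>\<^sup>+v. ennreal \<bar>-1/u\<bar> * (ennreal (std_normal_density (u + (-1/u) * v)) * indicator A v) \<partial>lborel)"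
      using u A by (subst nn_integral_cmult[symmetric]) auto
    also have "\<dots> = (\<integral>\<^sup>+v. ennreal (site_density u v) * indicator A v \<partial>lborel)"
    proof (intro nn_integral_cong)
      fix v :: real
      \<comment> \<open>Completing the square: exp(-u^2/2) goes into \<open>site_const\<close>, and
        v is left with slope 1.\<close>
      have "- (u + (-1/u) * v)\<^sup>2 / 2 = (v - v\<^sup>2 / (2 * u\<^sup>2)) - u\<^sup>2 / 2"
        using u by (simp add: power2_eq_square field_simps)
      then have "\<bar>-1/u\<bar> * std_normal_density (u + (-1/u) * v) = site_density u v"
        using u unfolding std_normal_density_def site_density_def site_const_def
        by (simp add: exp_diff real_sqrt_mult)
      moreover have "0 \<le> std_normal_density (u + (-1/u) * v)" by (rule normal_density_nonneg)
      ultimately have "ennreal \<bar>-1/u\<bar> * ennreal (std_normal_density (u + (-1/u) * v)) = ennreal (site_density u v)"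
        by (simp only: ennreal_mult[symmetric] abs_ge_zero)
      then show "ennreal \<bar>-1/u\<bar> * (ennreal (std_normal_density (u + (-1/u) * v)) * indicator A v) = ennreal (site_density u v) * indicator A v"
        by (simp only: mult.assoc[symmetric])
    qed
    also have "\<dots> = emeasure (density lborel (\<lambda>x. ennreal (site_density u x))) A"
      using A by (subst emeasure_density) auto
    finally show "emeasure (distr M lborel (\<lambda>\<omega>. - u * (\<xi> \<omega> - u))) A = emeasure (density lborel (\<lambda>x. ennreal (site_density u x))) A" .
  qed simp
qed

lemma distributed_site_nn_integral_le:
  assumes V: "distributed M lborel V (site_density u)" and u: "0 < u" and g: "g \<in> borel_measurable borel"
  shows "(\<integral>\<^sup>+\<omega>. g (V \<omega>) \<partial>M) \<le> ennreal (site_const u) * (\<integral>\<^sup>+v. ennreal (exp v) * g v \<partial>lborel)"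
proof -
  have "(\<integral>\<^sup>+\<omega>. g (V \<omega>) \<partial>M) = (\<integral>\<^sup>+v. ennreal (site_density u v) * g v \<partial>lborel)"
    using g by (intro distributed_nn_integral[OF V, symmetric]) simp
  also have "\<dots> \<le> (\<integral>\<^sup>+v. ennreal (site_const u * exp v) * g v \<partial>lborel)"
    using site_density_le[OF u] by (intro nn_integral_mono mult_right_mono ennreal_leI) auto
  also have "\<dots> = (\<integral>\<^sup>+v. ennreal (site_const u) * (ennreal (exp v) * g v) \<partial>lborel)"
    using site_const_pos[OF u] by (intro nn_integral_cong) (simp add: ennreal_mult' mult.assoc)
  also have "\<dots> = ennreal (site_const u) * (\<integral>\<^sup>+v. ennreal (exp v) * g v \<partial>lborel)"
    using g by (intro nn_integral_cmult) measurable
  finally show ?thesis .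
qed

text \<open>\<kappa> will be p Re \<beta> s. \<kappa> > 1 beats the density e^v at +\<infinity>, and
  the cutoff at \<open>x\<close> keeps out the other end, where the integrand explodes.\<close>

lemma site_upper_moment:
  assumes V: "distributed M lborel V (site_density u)" and u: "0 < u" and \<kappa>: "1 < \<kappa>"
  shows "(\<integral>\<^sup>+\<omega>. ennreal (indicator {x..} (V \<omega>) * exp (- \<kappa> * V \<omega>)) \<partial>M) \<le> ennreal (site_const u * (exp (- (\<kappa> - 1) * x) / (\<kappa> - 1)))"
proof -
  have "(\<integral>\<^sup>+\<omega>. ennreal (indicator {x..} (V \<omega>) * exp (- \<kappa> * V \<omega>)) \<partial>M)
      \<le> ennreal (site_const u) * (\<integral>\<^sup>+v. ennreal (exp v) * ennreal (indicator {x..} v * exp (- \<kappa> * v)) \<partial>lborel)"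
    by (rule distributed_site_nn_integral_le[OF V u]) measurable
  also have "(\<integral>\<^sup>+v. ennreal (exp v) * ennreal (indicator {x..} v * exp (- \<kappa> * v)) \<partial>lborel)
      = (\<integral>\<^sup>+v. ennreal (exp (- (\<kappa> - 1) * v)) * indicator {x..} v \<partial>lborel)"
    by (intro nn_integral_cong) (auto simp: indicator_def ennreal_mult'[symmetric] exp_add[symmetric] algebra_simps)
  also have "\<dots> = ennreal (exp (- (\<kappa> - 1) * x) / (\<kappa> - 1))" using \<kappa> by (intro nn_integral_exp_atLeast) simp
  finally show ?thesis using site_const_pos[OF u] \<kappa> by (simp add: ennreal_mult'[symmetric])
qed

lemma site_lower_prob:
  assumes V: "distributed M lborel V (site_density u)" and u: "0 < u"
  shows "(\<integral>\<^sup>+\<omega>. indicator {..x} (V \<omega>) \<partial>M) \<le> ennreal (site_const u * exp x)"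
proof -
  have "(\<integral>\<^sup>+\<omega>. indicator {..x} (V \<omega>) \<partial>M) \<le> ennreal (site_const u) * (\<integral>\<^sup>+v. ennreal (exp v) * indicator {..x} v \<partial>lborel)"
    by (rule distributed_site_nn_integral_le[OF V u]) measurable
  also have "(\<integral>\<^sup>+v. ennreal (exp v) * indicator {..x} v \<partial>lborel) = ennreal (exp x)"
    using nn_integral_exp_atMost[of 1 x] by simp
  finally show ?thesis using site_const_pos[OF u] by (simp add: ennreal_mult'[symmetric])
qed

lemma site_cell_limit:
  fixes c u :: "nat \<Rightarrow> real" and a b :: real
  assumes c: "c \<longlonglongrightarrow> 1" and u: "filterlim u at_top sequentially" and ab: "0 \<le> a" "a < b"
  shows "(\<lambda>n. c n * (\<integral>v. indicator {a<..b} (exp v) * exp (v - v\<^sup>2 / (2 * (u n)\<^sup>2)) \<partial>lborel)) \<longlonglongrightarrow> b - a"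
proof -
  have int: "integrable lborel (\<lambda>v. indicator {..ln b} v * exp (1 * v))" by (rule set_integrable_exp_atMost) simp
  have lim1: "(\<lambda>n. \<integral>v. indicator {a<..b} (exp v) * exp (v - v\<^sup>2 / (2 * (u n)\<^sup>2)) \<partial>lborel) \<longlonglongrightarrow> (\<integral>v. indicator {a<..b} (exp v) * exp v \<partial>lborel)"
  proof (rule integral_dominated_convergence[where w = "\<lambda>v. indicator {..ln b} v * exp (1 * v)"])
    show "AE v in lborel. (\<lambda>n. indicator {a<..b} (exp v) * exp (v - v\<^sup>2 / (2 * (u n)\<^sup>2))) \<longlonglongrightarrow> indicator {a<..b} (exp v) * exp v"
    proof (rule AE_I2)
      fix v :: real
      have "((\<lambda>x. v - v\<^sup>2 / (2 * x\<^sup>2)) \<longlongrightarrow> v) at_top" by real_asymp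
      from filterlim_compose[OF this u] have "(\<lambda>n. v - v\<^sup>2 / (2 * (u n)\<^sup>2)) \<longlonglongrightarrow> v" .
      then show "(\<lambda>n. indicator {a<..b} (exp v) * exp (v - v\<^sup>2 / (2 * (u n)\<^sup>2))) \<longlonglongrightarrow> indicator {a<..b} (exp v) * exp v"
        by (intro tendsto_intros)
    qed
    show "AE v in lborel. norm (indicator {a<..b} (exp v) * exp (v - v\<^sup>2 / (2 * (u n)\<^sup>2))) \<le> indicator {..ln b} v * exp (1 * v)" for n
    proof (rule AE_I2)
      fix v :: real
      have "exp v \<le> b \<Longrightarrow> v \<le> ln b" using ab by (simp add: ln_ge_iff)
      then show "norm (indicator {a<..b} (exp v) * exp (v - v\<^sup>2 / (2 * (u n)\<^sup>2))) \<le> indicator {..ln b} v * exp (1 * v)"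
        by (auto simp: indicator_def)
    qed
  qed (use int in measurable)
  have val: "(\<integral>v. indicator {..x} v * exp v \<partial>lborel) = exp x" for x :: real
  proof -
    have "(\<integral>\<^sup>+v. ennreal (indicator {..x} v * exp v) \<partial>lborel) = ennreal (exp x)"
    proof -
      have "(\<integral>\<^sup>+v. ennreal (indicator {..x} v * exp v) \<partial>lborel) = (\<integral>\<^sup>+v. ennreal (exp (1 * v)) * indicator {..x} v \<partial>lborel)"
        by (intro nn_integral_cong) (auto simp: indicator_def)
      then show ?thesis using nn_integral_exp_atMost[of 1 x] by simp
    qed
    then show ?thesis by (intro integral_eq_nn_integral[THEN trans]) (auto simp: enn2real_ennreal)
  qed
  have "(\<integral>v. indicator {a<..b} (exp v) * exp v \<partial>lborel) = b - a"
  \<comment> \<open>The first cell reaches down to 0, whose logarithm cannot serve as an end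
    point.\<close>
  proof (cases "a = 0")
    case True
    have "(\<integral>v. indicator {a<..b} (exp v) * exp v \<partial>lborel) = (\<integral>v. indicator {..ln b} v * exp v \<partial>lborel)"
      using True ab by (intro Bochner_Integration.integral_cong refl) (auto simp: indicator_def ln_ge_iff)
    then show ?thesis using True ab by (simp add: val)
  next
    case False
    then have a: "0 < a" using ab by simp
    have i: "integrable lborel (\<lambda>v. indicator {..x} v * exp v)" for x :: real
      using set_integrable_exp_atMost[of 1 x] by simp
    have "(\<integral>v. indicator {a<..b} (exp v) * exp v \<partial>lborel) = (\<integral>v. indicator {..ln b} v * exp v - indicator {..ln a} v * exp v \<partial>lborel)"
    proof (intro Bochner_Integration.integral_cong refl)
      fix v :: real
      have "exp v \<le> b \<longleftrightarrow> v \<le> ln b" "exp v \<le> a \<longleftrightarrow> v \<le> ln a" "ln a \<le> ln b" using a ab by (auto simp: ln_ge_iff)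
      then show "indicator {a<..b} (exp v) * exp v = indicator {..ln b} v * exp v - indicator {..ln a} v * exp v"
        by (auto simp: indicator_def)
    qed
    also have "\<dots> = b - a" using i a ab by (simp add: val)
    finally show ?thesis .
  qed
  then show ?thesis using tendsto_mult[OF c lim1] by simp
qed

text \<open>The compensator of the points below e^x converges uniformly over the admissible \<beta>.
  Dominated convergence alone would be pointwise, so the integrand is compared with its limit
  through two bounds free of \<beta>: \<open>I1\<close> for the Gaussian factor and, by the
  Lipschitz estimate for exp, a multiple of \<open>I2\<close> for the replacement of
  \<open>s n\<close> by \<open>s0\<close>.\<close>

lemma site_mean_limit:
  fixes c u s :: "nat \<Rightarrow> real"
  assumes c: "c \<longlonglongrightarrow> 1" and u: "filterlim u at_top sequentially" and s: "s \<longlonglongrightarrow> s0"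
    and \<kappa>: "0 < \<kappa>" and e: "0 < e"
  shows "\<forall>\<^sub>F n in sequentially. \<forall>\<beta>. 0 \<le> Re \<beta> * s n \<and> Re \<beta> * s n \<le> 1 - \<kappa> \<and> 0 \<le> Re \<beta> * s0 \<and> Re \<beta> * s0 \<le> 1 - \<kappa> \<and> norm \<beta> \<le> B \<longrightarrow>
     norm (of_real (c n) * (\<integral>v. indicator {..x} v *\<^sub>R (of_real (exp (v - v\<^sup>2 / (2 * (u n)\<^sup>2))) * exp (- \<beta> * of_real (s n * v))) \<partial>lborel)
         - exp ((1 - \<beta> * of_real s0) * of_real x) / (1 - \<beta> * of_real s0)) \<le> e"
proof -
  \<comment> \<open>Dominates e^v |e^(-\<beta> s v)|: for v \<ge> 0 by e^v since Re \<beta> s \<ge>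
    0, for v < 0 by e^(\<kappa> v) since Re \<beta> s \<le> 1 - \<kappa>.\<close>
  define D where "D v = exp (\<kappa> * v) + exp (1 * v)" for v :: real
  define h where "h n v = exp (- v\<^sup>2 / (2 * (u n)\<^sup>2))" for n v
  have h01: "0 \<le> h n v" "h n v \<le> 1" for n v unfolding h_def by auto
  have hm: "h n \<in> borel_measurable borel" for n unfolding h_def by measurable
  have Dm: "D \<in> borel_measurable borel" unfolding D_def by measurable
  have D0: "0 \<le> D v" for v unfolding D_def by simp
  have Dint: "integrable lborel (\<lambda>v. indicator {..x} v * D v)"
    unfolding D_def distrib_left by (intro Bochner_Integration.integrable_add set_integrable_exp_atMost) (use \<kappa> in auto)
  have vDint: "integrable lborel (\<lambda>v. indicator {..x} v * (\<bar>v\<bar> * D v))"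
  proof (rule Bochner_Integration.integrable_bound)
    \<comment> \<open>The factor |v| is at most exp(k|v|)/k; k is below both rates \<kappa> and 1,
      so all exponents stay positive.\<close>
    define k where "k = min \<kappa> 1 / 2"
    have k: "0 < k" "k < \<kappa>" "k < 1" unfolding k_def using \<kappa> by auto
    let ?W = "\<lambda>v. (1 / k) * (indicator {..x} v * exp ((\<kappa> + k) * v) + indicator {..x} v * exp ((\<kappa> - k) * v)
        + indicator {..x} v * exp ((1 + k) * v) + indicator {..x} v * exp ((1 - k) * v))"
    show "integrable lborel ?W"
      by (intro integrable_mult_right Bochner_Integration.integrable_add set_integrable_exp_atMost) (use k in auto)
    show "AE v in lborel. norm (indicator {..x} v * (\<bar>v\<bar> * D v)) \<le> norm (?W v)"
    proof (rule AE_I2)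
      fix v :: real
      have "k * \<bar>v\<bar> \<le> exp (k * \<bar>v\<bar>)" using exp_ge_add_one_self[of "k * \<bar>v\<bar>"] by linarith
      also have "\<dots> \<le> exp (k * v) + exp (- k * v)" by (cases "0 \<le> v") auto
      finally have "\<bar>v\<bar> \<le> (1 / k) * (exp (k * v) + exp (- k * v))" using k by (simp add: field_simps)
      then have "\<bar>v\<bar> * D v \<le> (1 / k) * (exp (k * v) + exp (- k * v)) * D v" by (rule mult_right_mono[OF _ D0])
      also have "\<dots> = (1 / k) * (exp ((\<kappa> + k) * v) + exp ((\<kappa> - k) * v) + exp ((1 + k) * v) + exp ((1 - k) * v))"
        unfolding D_def by (simp add: algebra_simps exp_add[symmetric] add_divide_distrib)
      finally have "\<bar>v\<bar> * D v \<le> (1 / k) * (exp ((\<kappa> + k) * v) + exp ((\<kappa> - k) * v) + exp ((1 + k) * v) + exp ((1 - k) * v))" .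
      then show "norm (indicator {..x} v * (\<bar>v\<bar> * D v)) \<le> norm (?W v)"
        using k D0[of v] by (simp add: indicator_def abs_mult)
    qed
  qed (use Dm in measurable)
  define I2 where "I2 = (\<integral>v. indicator {..x} v * (\<bar>v\<bar> * D v) \<partial>lborel)"
  define I1 where "I1 n = (\<integral>v. indicator {..x} v * (\<bar>c n * h n v - 1\<bar> * D v) \<partial>lborel)" for n
  have cev: "\<forall>\<^sub>F n in sequentially. c n < 2" "\<forall>\<^sub>F n in sequentially. 0 < c n"
    using c by (auto intro: order_tendstoD)
  have I1_bound: "norm (indicator {..x} v * (\<bar>c n * h n v - 1\<bar> * D v)) \<le> 3 * (indicator {..x} v * D v)" if "c n < 2" "0 < c n" for n v
  proof -
    have "c n * h n v \<le> 2 * 1" using that h01[of n v] by (intro mult_mono) auto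
    moreover have "0 \<le> c n * h n v" using that h01[of n v] by simp
    ultimately have "\<bar>c n * h n v - 1\<bar> \<le> 3" by linarith
    then show ?thesis using D0[of v] by (auto simp: indicator_def abs_mult intro: mult_right_mono)
  qed
  have I1: "I1 \<longlonglongrightarrow> (\<integral>v. 0 \<partial>(lborel :: real measure))"
  proof -
    \<comment> \<open>The dominating function is valid only once \<open>c n\<close> lies in (0, 2),
      so the sequence is shifted.\<close>
    obtain n0 where n0: "\<And>n. n \<ge> n0 \<Longrightarrow> c n < 2 \<and> 0 < c n"
      using eventually_conj[OF cev] unfolding eventually_sequentially by blast
    have "(\<lambda>n. I1 (n + n0)) \<longlonglongrightarrow> (\<integral>v. 0 \<partial>(lborel :: real measure))"
      unfolding I1_def
    proof (rule integral_dominated_convergence[where w = "\<lambda>v. 3 * (indicator {..x} v * D v)"])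
      show "AE v in lborel. (\<lambda>n. indicator {..x} v * (\<bar>c (n + n0) * h (n + n0) v - 1\<bar> * D v)) \<longlonglongrightarrow> 0"
      proof (rule AE_I2)
        fix v :: real
        have "((\<lambda>y. exp (- v\<^sup>2 / (2 * y\<^sup>2))) \<longlongrightarrow> 1) at_top" by real_asymp
        from filterlim_compose[OF this u] have "(\<lambda>n. h n v) \<longlonglongrightarrow> 1" unfolding h_def .
        then have "(\<lambda>n. indicator {..x} v * (\<bar>c n * h n v - 1\<bar> * D v)) \<longlonglongrightarrow> indicator {..x} v * (\<bar>1 * 1 - 1\<bar> * D v)"
          by (intro tendsto_intros c)
        then show "(\<lambda>n. indicator {..x} v * (\<bar>c (n + n0) * h (n + n0) v - 1\<bar> * D v)) \<longlonglongrightarrow> 0"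
          by (intro LIMSEQ_ignore_initial_segment) simp
      qed
      show "AE v in lborel. norm (indicator {..x} v * (\<bar>c (n + n0) * h (n + n0) v - 1\<bar> * D v)) \<le> 3 * (indicator {..x} v * D v)" for n
        using I1_bound n0 by (intro AE_I2) auto
      show "integrable lborel (\<lambda>v. 3 * (indicator {..x} v * D v))" using Dint by simp
    qed (use hm Dm in measurable)
    then show ?thesis by (rule LIMSEQ_offset)
  qed
  have "(\<lambda>n. I1 n + \<bar>B\<bar> * \<bar>s n - s0\<bar> * I2) \<longlonglongrightarrow> 0 + \<bar>B\<bar> * \<bar>s0 - s0\<bar> * I2"
    using I1 by (intro tendsto_intros s) simp
  then have "\<forall>\<^sub>F n in sequentially. I1 n + \<bar>B\<bar> * \<bar>s n - s0\<bar> * I2 < e" using e by (intro order_tendstoD(2)) auto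
  then show ?thesis using cev
  proof eventually_elim
    case (elim n)
    show ?case
    proof (intro allI impI)
      fix \<beta> assume \<beta>: "0 \<le> Re \<beta> * s n \<and> Re \<beta> * s n \<le> 1 - \<kappa> \<and> 0 \<le> Re \<beta> * s0 \<and> Re \<beta> * s0 \<le> 1 - \<kappa> \<and> norm \<beta> \<le> B"
      define w where "w = 1 - \<beta> * of_real s0"
      have w: "0 < Re w" unfolding w_def using \<beta> \<kappa> by simp
      let ?G = "\<lambda>v::real. indicator {..x} v *\<^sub>R (of_real (exp (v - v\<^sup>2 / (2 * (u n)\<^sup>2))) * exp (- \<beta> * of_real (s n * v)))"
      have expD: "exp v * exp (- y * v) \<le> D v" if "0 \<le> y" "y \<le> 1 - \<kappa>" for y v :: real
      proof (cases "0 \<le> v")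
        case True
        then have "exp (- y * v) \<le> 1" using that by simp
        then have "exp v * exp (- y * v) \<le> exp v * 1" by (intro mult_left_mono) auto
        then show ?thesis unfolding D_def by (simp add: add_increasing)
      next
        case False
        then have "(1 - \<kappa>) * v \<le> y * v" using that by (intro mult_right_mono_neg) auto
        then have "v - y * v \<le> \<kappa> * v" by (simp add: algebra_simps)
        then have "exp (v - y * v) \<le> exp (\<kappa> * v)" by simp
        then show ?thesis unfolding D_def by (simp add: exp_add[symmetric] add_increasing2)
      qed
      have Gm: "?G \<in> borel_measurable lborel"
      proof -
        have "(\<lambda>v::real. exp (- \<beta> * of_real (s n * v))) \<in> borel_measurable borel"
          by (intro borel_measurable_continuous_onI continuous_intros)
        then show ?thesis by measurable
      qed
      have Gint: "integrable lborel ?G"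
      proof (rule Bochner_Integration.integrable_bound[OF Dint _ AE_I2])
        fix v :: real
        have "exp (v - v\<^sup>2 / (2 * (u n)\<^sup>2)) * exp (- (Re \<beta> * s n) * v) \<le> exp v * exp (- (Re \<beta> * s n) * v)"
          by (intro mult_right_mono) auto
        also have "\<dots> \<le> D v" using \<beta> by (intro expD) auto
        finally show "norm (?G v) \<le> norm (indicator {..x} v * D v)"
          using D0[of v] by (simp add: indicator_def norm_mult mult.assoc)
      qed (rule Gm)
      have int1: "integrable lborel (\<lambda>v. indicator {..x} v * (\<bar>c n * h n v - 1\<bar> * D v))"
      proof (rule Bochner_Integration.integrable_bound)
        show "integrable lborel (\<lambda>v. 3 * (indicator {..x} v * D v))" using Dint by simp
        show "AE v in lborel. norm (indicator {..x} v * (\<bar>c n * h n v - 1\<bar> * D v)) \<le> norm (3 * (indicator {..x} v * D v))"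
          using I1_bound[OF elim(2,3)] by (intro AE_I2) (metis norm_ge_zero order_trans abs_ge_self real_norm_def)
      qed (use hm Dm in measurable)
      have eq1: "of_real (c n) * (\<integral>v. ?G v \<partial>lborel) - exp (w * of_real x) / w
          = (\<integral>v. of_real (c n) * ?G v - indicator {..x} v *\<^sub>R exp (w * of_real v) \<partial>lborel)"
        by (simp only: Bochner_Integration.integral_diff[OF integrable_mult_right[OF Gint] integral_complex_exp_atMost(1)[OF w]]
            integral_mult_right_zero integral_complex_exp_atMost(2)[OF w])
      have le: "norm (\<integral>v. of_real (c n) * ?G v - indicator {..x} v *\<^sub>R exp (w * of_real v) \<partial>lborel)
          \<le> (\<integral>v. indicator {..x} v * (\<bar>c n * h n v - 1\<bar> * D v) + \<bar>B\<bar> * \<bar>s n - s0\<bar> * (indicator {..x} v * (\<bar>v\<bar> * D v)) \<partial>lborel)"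
      proof (rule Bochner_Integration.integral_norm_bound_integral)
        show "integrable lborel (\<lambda>v. of_real (c n) * ?G v - indicator {..x} v *\<^sub>R exp (w * of_real v))"
          using Gint integral_complex_exp_atMost(1)[OF w, of x] by (intro Bochner_Integration.integrable_diff integrable_mult_right)
        show "integrable lborel (\<lambda>v. indicator {..x} v * (\<bar>c n * h n v - 1\<bar> * D v) + \<bar>B\<bar> * \<bar>s n - s0\<bar> * (indicator {..x} v * (\<bar>v\<bar> * D v)))"
          by (intro Bochner_Integration.integrable_add integrable_mult_right vDint int1)
        fix v :: real
        define E1 where "E1 = exp (- \<beta> * of_real (s n * v))"
        define E0 where "E0 = exp (- \<beta> * of_real (s0 * v))"
        have nE1: "exp v * norm E1 \<le> D v" unfolding E1_def using expD[of "Re \<beta> * s n" v] \<beta> by (simp add: mult.assoc)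
        have nE0: "exp v * norm E0 \<le> D v" unfolding E0_def using expD[of "Re \<beta> * s0" v] \<beta> by (simp add: mult.assoc)
        have "norm (E1 - E0) \<le> norm (- \<beta> * of_real (s n * v) - - \<beta> * of_real (s0 * v)) * max (norm E1) (norm E0)"
        proof -
          have "max (norm (exp a)) (norm (exp b)) = exp (max (Re a) (Re b))" for a b :: complex by (simp add: max_def)
          then show ?thesis unfolding E1_def E0_def by (simp only: norm_exp_diff_le)
        qed
        also have "norm (- \<beta> * of_real (s n * v) - - \<beta> * of_real (s0 * v)) = norm \<beta> * \<bar>s n - s0\<bar> * \<bar>v\<bar>"
        proof -
          have "- \<beta> * of_real (s n * v) - - \<beta> * of_real (s0 * v) = - \<beta> * of_real ((s n - s0) * v)" by (simp add: algebra_simps)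
          then show ?thesis by (simp only: norm_mult norm_minus_cancel norm_of_real abs_mult mult.assoc)
        qed
        finally have "exp v * norm (E1 - E0) \<le> exp v * (norm \<beta> * \<bar>s n - s0\<bar> * \<bar>v\<bar> * max (norm E1) (norm E0))"
          by (intro mult_left_mono) auto
        also have "\<dots> = (norm \<beta> * \<bar>s n - s0\<bar> * \<bar>v\<bar>) * (exp v * max (norm E1) (norm E0))" by (simp only: mult_ac)
        also have "\<dots> \<le> (\<bar>B\<bar> * \<bar>s n - s0\<bar> * \<bar>v\<bar>) * D v"
          using nE1 nE0 \<beta> by (intro mult_mono) (auto simp: max_def)
        finally have d2: "exp v * norm (E1 - E0) \<le> \<bar>B\<bar> * \<bar>s n - s0\<bar> * (\<bar>v\<bar> * D v)" by (simp add: mult.assoc)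
        have "exp (v - v\<^sup>2 / (2 * (u n)\<^sup>2)) = exp v * h n v" unfolding h_def by (simp add: exp_add[symmetric])
        moreover have "exp (w * of_real v) = of_real (exp v) * E0"
          unfolding w_def E0_def by (simp add: exp_of_real[symmetric] exp_add[symmetric] algebra_simps)
        ultimately have "of_real (c n) * (of_real (exp (v - v\<^sup>2 / (2 * (u n)\<^sup>2))) * E1) - exp (w * of_real v)
            = of_real (exp v) * (of_real (c n * h n v - 1) * E1 + (E1 - E0))" by (simp add: algebra_simps)
        also have "norm \<dots> \<le> exp v * (\<bar>c n * h n v - 1\<bar> * norm E1 + norm (E1 - E0))"
        proof -
          have "norm (of_real (c n * h n v - 1) * E1 + (E1 - E0)) \<le> \<bar>c n * h n v - 1\<bar> * norm E1 + norm (E1 - E0)"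
            using norm_triangle_ineq[of "of_real (c n * h n v - 1) * E1" "E1 - E0"] by (simp only: norm_mult norm_of_real)
          then show ?thesis by (simp only: norm_mult norm_of_real abs_exp_cancel mult_left_mono exp_ge_zero)
        qed
        also have "\<dots> = \<bar>c n * h n v - 1\<bar> * (exp v * norm E1) + exp v * norm (E1 - E0)" by (simp add: algebra_simps)
        also have "\<dots> \<le> \<bar>c n * h n v - 1\<bar> * D v + \<bar>B\<bar> * \<bar>s n - s0\<bar> * (\<bar>v\<bar> * D v)"
          by (intro add_mono mult_left_mono nE1 d2) auto
        finally show "norm (of_real (c n) * ?G v - indicator {..x} v *\<^sub>R exp (w * of_real v))
            \<le> indicator {..x} v * (\<bar>c n * h n v - 1\<bar> * D v) + \<bar>B\<bar> * \<bar>s n - s0\<bar> * (indicator {..x} v * (\<bar>v\<bar> * D v))"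
          unfolding E1_def by (simp add: indicator_def)
      qed
      have eq2: "(\<integral>v. indicator {..x} v * (\<bar>c n * h n v - 1\<bar> * D v) + \<bar>B\<bar> * \<bar>s n - s0\<bar> * (indicator {..x} v * (\<bar>v\<bar> * D v)) \<partial>lborel)
          = I1 n + \<bar>B\<bar> * \<bar>s n - s0\<bar> * I2"
        unfolding I1_def I2_def
        by (simp only: Bochner_Integration.integral_add[OF int1 integrable_mult_right[OF vDint]] integral_mult_right_zero)
      show "norm (of_real (c n) * (\<integral>v. ?G v \<partial>lborel) - exp ((1 - \<beta> * of_real s0) * of_real x) / (1 - \<beta> * of_real s0)) \<le> e"
        unfolding w_def[symmetric] eq1 by (rule order_trans[OF le]) (use elim(1) in \<open>simp only: eq2 less_imp_le\<close>)
    qed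
  qed
qed

text \<open>Two replacements at once, \<open>s\<close> by \<open>s0\<close> and e^v by the nearby
  \<open>q\<close>. As v and ln q are at least ln \<delta>, both exponentials are at most 1/\<delta>
  in norm, and ln q differs from v by at most \<rho>/\<delta>.\<close>

lemma site_discretization_error:
  fixes \<beta> :: complex
  assumes \<delta>: "0 < \<delta>" "\<delta> \<le> 1" and r: "1 \<le> r" and v: "ln \<delta> \<le> v" "v \<le> ln r"
    and q: "exp v \<le> q" "q \<le> exp v + \<rho>"
    and \<beta>: "0 \<le> Re \<beta> * s" "Re \<beta> * s \<le> 1" "0 \<le> Re \<beta> * s0" "Re \<beta> * s0 \<le> 1" and s0: "0 \<le> s0"
  shows "norm (exp (- \<beta> * of_real (s * v)) - rpow q (- (\<beta> * of_real s0)))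
     \<le> norm \<beta> / \<delta> * (\<bar>s - s0\<bar> * (1 / \<delta> + r) + s0 * (\<rho> / \<delta>))"
proof -
  have q0: "0 < q" using q(1) exp_gt_zero[of v] by linarith
  have lq: "v \<le> ln q" using q q0 by (simp add: ln_ge_iff)
  have ev: "\<delta> \<le> exp v" using v(1) \<delta>(1) by (metis exp_le_cancel_iff exp_ln)
  have "ln q - v = ln (q / exp v)" using q0 by (simp add: ln_div)
  also have "\<dots> \<le> q / exp v - 1" using q0 by (intro ln_le_minus_one) auto
  also have "\<dots> = (q - exp v) / exp v" by (simp add: diff_divide_distrib)
  also have "\<dots> \<le> \<rho> / \<delta>" using q ev \<delta> by (intro frac_le) auto
  finally have lqv: "\<bar>ln q - v\<bar> \<le> \<rho> / \<delta>" using lq by simp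
  have ln\<delta>: "ln \<delta> \<le> 0" using \<delta> by simp
  have mln: "- ln \<delta> \<le> 1 / \<delta>" using ln_le_minus_one[of "1 / \<delta>"] \<delta> by (simp add: ln_div)
  have lnr: "ln r \<le> r" "0 \<le> ln r" using ln_le_minus_one[of r] r by auto
  have absv: "\<bar>v\<bar> \<le> 1 / \<delta> + r" using v mln lnr ln\<delta> \<delta>(1) r by (auto simp: abs_le_iff add_increasing add_increasing2)
  have Re_le: "- (y * t) \<le> - ln \<delta>" if "0 \<le> y" "y \<le> 1" "ln \<delta> \<le> t" for y t
  proof -
    have "y * ln \<delta> \<le> y * t" using that by (intro mult_left_mono)
    moreover have "1 * ln \<delta> \<le> y * ln \<delta>" using that ln\<delta> by (intro mult_right_mono_neg)
    ultimately show ?thesis by linarith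
  qed
  let ?a = "- \<beta> * of_real (s * v)" and ?b = "- (\<beta> * of_real s0) * of_real (ln q)"
  have Ra: "Re ?a \<le> - ln \<delta>" using Re_le[of "Re \<beta> * s" v] \<beta> v by (simp add: mult.assoc)
  have Rb: "Re ?b \<le> - ln \<delta>" using Re_le[of "Re \<beta> * s0" "ln q"] \<beta> v lq by (simp add: mult.assoc)
  have "norm (exp ?a - exp ?b) \<le> norm (?a - ?b) * exp (max (Re ?a) (Re ?b))" by (rule norm_exp_diff_le)
  also have "\<dots> \<le> (norm \<beta> * (\<bar>s - s0\<bar> * (1 / \<delta> + r) + s0 * (\<rho> / \<delta>))) * (1 / \<delta>)"
  proof (intro mult_mono)
    have "?a - ?b = - \<beta> * of_real ((s - s0) * v - s0 * (ln q - v))" by (simp add: algebra_simps)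
    then have "norm (?a - ?b) = norm \<beta> * \<bar>(s - s0) * v - s0 * (ln q - v)\<bar>"
      by (simp only: norm_mult norm_minus_cancel norm_of_real)
    also have "\<bar>(s - s0) * v - s0 * (ln q - v)\<bar> \<le> \<bar>s - s0\<bar> * \<bar>v\<bar> + s0 * \<bar>ln q - v\<bar>"
      using s0 abs_triangle_ineq4[of "(s - s0) * v" "s0 * (ln q - v)"] by (simp add: abs_mult)
    also have "\<dots> \<le> \<bar>s - s0\<bar> * (1 / \<delta> + r) + s0 * (\<rho> / \<delta>)"
      using absv lqv s0 by (intro add_mono mult_left_mono) auto
    finally show "norm (?a - ?b) \<le> norm \<beta> * (\<bar>s - s0\<bar> * (1 / \<delta> + r) + s0 * (\<rho> / \<delta>))"
      by (simp add: mult_left_mono)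
    have "exp (max (Re ?a) (Re ?b)) \<le> exp (- ln \<delta>)" using Ra Rb by simp
    also have "\<dots> = 1 / \<delta>" using \<delta> by (simp add: exp_minus inverse_eq_divide)
    finally show "exp (max (Re ?a) (Re ?b)) \<le> 1 / \<delta>" .
    have "0 \<le> \<rho> / \<delta>" using lqv by linarith
    then show "0 \<le> norm \<beta> * (\<bar>s - s0\<bar> * (1 / \<delta> + r) + s0 * (\<rho> / \<delta>))"
      using s0 \<delta> r by (intro mult_nonneg_nonneg add_nonneg_nonneg) auto
  qed auto
  finally show ?thesis unfolding rpow_def by (simp add: mult.commute)
qed

section \<open>Exponential moments of normal variables\<close>

text \<open>Completing the square in the real part shifts the density by Re z; the imaginary part
  leaves the characteristic function of the normal law.\<close>

lemma complex_mgf_std_normal: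
  fixes z :: complex
  assumes X: "distributed M lborel X std_normal_density"
  shows "integrable M (\<lambda>\<omega>. exp (z * of_real (X \<omega>)))"
    and "(\<integral>\<omega>. exp (z * of_real (X \<omega>)) \<partial>M) = exp (z\<^sup>2 / 2)"
proof -
  define \<sigma> where "\<sigma> = Re z"
  define \<tau> where "\<tau> = Im z"
  have em: "(\<lambda>x::real. exp (w * of_real x)) \<in> borel_measurable borel" for w :: complex
    by (intro borel_measurable_continuous_onI continuous_intros)
  have dens: "std_normal_density x * exp (\<sigma> * x) = exp (\<sigma>\<^sup>2 / 2) * std_normal_density (- \<sigma> + x)" for x
  proof -
    have "- x\<^sup>2 / 2 + \<sigma> * x = \<sigma>\<^sup>2 / 2 + - (- \<sigma> + x)\<^sup>2 / 2" by (simp add: power2_eq_square field_simps)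
    then have "exp (- x\<^sup>2 / 2) * exp (\<sigma> * x) = exp (\<sigma>\<^sup>2 / 2) * exp (- (- \<sigma> + x)\<^sup>2 / 2)"
      by (simp only: exp_add[symmetric])
    then show ?thesis unfolding std_normal_density_def by simp
  qed
  have decomp: "std_normal_density x *\<^sub>R exp (z * of_real x)
      = (exp (\<sigma>\<^sup>2 / 2) * std_normal_density (- \<sigma> + x)) *\<^sub>R exp (\<i> * of_real (\<tau> * x))" for x
  proof -
    have "exp (z * of_real x) = exp (\<sigma> * x) *\<^sub>R exp (\<i> * of_real (\<tau> * x))"
    proof -
      have "z * of_real x = of_real (\<sigma> * x) + \<i> * of_real (\<tau> * x)"
        unfolding \<sigma>_def \<tau>_def by (simp add: complex_eq_iff)
      then show ?thesis by (simp only: exp_add exp_of_real scaleR_conv_of_real)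
    qed
    then show ?thesis using dens[of x] by simp
  qed
  have int0: "integrable lborel (\<lambda>x. exp (\<sigma>\<^sup>2 / 2) * std_normal_density (- \<sigma> + x))"
    using lborel_integrable_real_affine[of std_normal_density 1 "- \<sigma>"] by simp
  have intz: "integrable lborel (\<lambda>x. std_normal_density x *\<^sub>R exp (z * of_real x))"
  proof (rule Bochner_Integration.integrable_bound[OF int0])
    show "(\<lambda>x. std_normal_density x *\<^sub>R exp (z * of_real x)) \<in> borel_measurable lborel" using em[of z] by measurable
    show "AE x in lborel. norm (std_normal_density x *\<^sub>R exp (z * of_real x)) \<le> norm (exp (\<sigma>\<^sup>2 / 2) * std_normal_density (- \<sigma> + x))"
      unfolding decomp by (intro AE_I2) simp
  qed
  have Xm: "X \<in> measurable M lborel" using distributed_measurable[OF X] .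
  have emz: "(\<lambda>x::real. exp (z * of_real x)) \<in> borel_measurable lborel" using em[of z] by simp
  have dX: "distr M lborel X = density lborel (\<lambda>x. ennreal (std_normal_density x))"
    by (rule distributed_distr_eq_density[OF X])
  have "integrable (distr M lborel X) (\<lambda>x. exp (z * of_real x))"
    unfolding dX using emz intz by (subst integrable_density) (auto simp: normal_density_nonneg)
  then show "integrable M (\<lambda>\<omega>. exp (z * of_real (X \<omega>)))"
    using integrable_distr_eq[OF Xm emz] by simp
  have "(\<integral>\<omega>. exp (z * of_real (X \<omega>)) \<partial>M) = (\<integral>x. exp (z * of_real x) \<partial>distr M lborel X)"
    by (rule integral_distr[OF Xm emz, symmetric])
  also have "\<dots> = (\<integral>x. std_normal_density x *\<^sub>R exp (z * of_real x) \<partial>lborel)"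
    unfolding dX using emz by (subst integral_density) (auto simp: normal_density_nonneg)
  also have "\<dots> = (\<integral>x. (exp (\<sigma>\<^sup>2 / 2) * std_normal_density (- \<sigma> + x)) *\<^sub>R exp (\<i> * of_real (\<tau> * x)) \<partial>lborel)"
    unfolding decomp ..
  also have "\<dots> = (\<integral>x. (exp (\<sigma>\<^sup>2 / 2) * std_normal_density (- \<sigma> + (\<sigma> + 1 * x))) *\<^sub>R exp (\<i> * of_real (\<tau> * (\<sigma> + 1 * x))) \<partial>lborel)"
    by (subst lborel_integral_real_affine[where c = 1 and t = \<sigma>]) auto
  also have "\<dots> = (\<integral>x. (of_real (exp (\<sigma>\<^sup>2 / 2)) * exp (\<i> * of_real (\<tau> * \<sigma>))) * (std_normal_density x *\<^sub>R exp (\<i> * of_real (\<tau> * x))) \<partial>lborel)"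
    by (intro Bochner_Integration.integral_cong refl) (simp add: scaleR_conv_of_real distrib_left exp_add mult_ac)
  also have "\<dots> = (of_real (exp (\<sigma>\<^sup>2 / 2)) * exp (\<i> * of_real (\<tau> * \<sigma>))) * (\<integral>x. std_normal_density x *\<^sub>R exp (\<i> * of_real (\<tau> * x)) \<partial>lborel)"
    by (rule integral_mult_right_zero)
  also have "(\<integral>x. std_normal_density x *\<^sub>R exp (\<i> * of_real (\<tau> * x)) \<partial>lborel) = char std_normal_distribution \<tau>"
  proof -
    have "(\<lambda>x::real. exp (\<i> * of_real (\<tau> * x))) \<in> borel_measurable borel"
      by (intro borel_measurable_continuous_onI continuous_intros)
    then show ?thesis unfolding char_def by (subst integral_density) (auto simp: normal_density_nonneg)
  qed
  also have "\<dots> = of_real (exp (- \<tau>\<^sup>2 / 2))" by (simp add: char_std_normal_distribution)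
  also have "of_real (exp (\<sigma>\<^sup>2 / 2)) * exp (\<i> * of_real (\<tau> * \<sigma>)) * of_real (exp (- \<tau>\<^sup>2 / 2)) = exp (z\<^sup>2 / 2)"
  proof -
    have "z = of_real \<sigma> + \<i> * of_real \<tau>" unfolding \<sigma>_def \<tau>_def by (simp add: complex_eq)
    then have "z\<^sup>2 / 2 = of_real (\<sigma>\<^sup>2 / 2) + \<i> * of_real (\<tau> * \<sigma>) + of_real (- \<tau>\<^sup>2 / 2)"
      by (simp add: power2_eq_square field_simps)
    then show ?thesis by (simp only: exp_add exp_of_real)
  qed
  finally show "(\<integral>\<omega>. exp (z * of_real (X \<omega>)) \<partial>M) = exp (z\<^sup>2 / 2)" .
qed

lemma real_mgf_std_normal:
  fixes c :: real
  assumes X: "distributed M lborel X std_normal_density"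
  shows "integrable M (\<lambda>\<omega>. exp (c * X \<omega>))" and "(\<integral>\<omega>. exp (c * X \<omega>) \<partial>M) = exp (c\<^sup>2 / 2)"
proof -
  have eq: "exp (of_real c * of_real x) = complex_of_real (exp (c * x))" for x
    by (simp add: exp_of_real[symmetric])
  have int: "integrable M (\<lambda>\<omega>. complex_of_real (exp (c * X \<omega>)))"
    using complex_mgf_std_normal(1)[OF X, of "of_real c"] unfolding eq .
  then show "integrable M (\<lambda>\<omega>. exp (c * X \<omega>))" using integrable_Re[OF int] by simp
  have "complex_of_real (\<integral>\<omega>. exp (c * X \<omega>) \<partial>M) = complex_of_real (exp (c\<^sup>2 / 2))"
    using complex_mgf_std_normal(2)[OF X, of "of_real c"] unfolding eq integral_complex_of_real
    by (simp add: exp_of_real[symmetric])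
  then show "(\<integral>\<omega>. exp (c * X \<omega>) \<partial>M) = exp (c\<^sup>2 / 2)" by (simp only: of_real_eq_iff)
qed

section \<open>Levels of the tree\<close>

lemma grem_level_0: "grem_level 0 N = {[]}"
  by (auto simp: grem_level_def)

lemma grem_level_Suc: "grem_level (Suc j) N = (\<lambda>(\<epsilon>, k). \<epsilon> @ [k]) ` (grem_level j N \<times> {1..N (Suc j)})"
proof (intro set_eqI iffI)
  fix \<epsilon> assume e: "\<epsilon> \<in> grem_level (Suc j) N"
  then have len: "length \<epsilon> = Suc j" by (simp add: grem_level_def)
  then have split: "\<epsilon> = take j \<epsilon> @ [\<epsilon> ! j]" by (metis lessI take_Suc_conv_app_nth take_all_iff order_refl)
  have "\<forall>i\<in>{1..Suc j}. 1 \<le> \<epsilon> ! (i - 1) \<and> \<epsilon> ! (i - 1) \<le> N i" using e by (simp add: grem_level_def)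
  then have "take j \<epsilon> \<in> grem_level j N" "\<epsilon> ! j \<in> {1..N (Suc j)}"
    using len by (auto simp: grem_level_def dest: bspec[of _ _ "Suc j"])
  then show "\<epsilon> \<in> (\<lambda>(\<epsilon>, k). \<epsilon> @ [k]) ` (grem_level j N \<times> {1..N (Suc j)})"
    by (subst split) (auto intro!: image_eqI[of _ _ "(take j \<epsilon>, \<epsilon> ! j)"])
next
  fix \<epsilon> assume "\<epsilon> \<in> (\<lambda>(\<epsilon>, k). \<epsilon> @ [k]) ` (grem_level j N \<times> {1..N (Suc j)})"
  then show "\<epsilon> \<in> grem_level (Suc j) N"
    by (auto simp: grem_level_def nth_append le_Suc_eq)
qed

lemma inj_append_pair: "inj_on (\<lambda>(\<epsilon>, k). \<epsilon> @ [k]) A"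
  by (auto simp: inj_on_def)

lemma finite_grem_level [simp]: "finite (grem_level j N)"
  by (induction j) (auto simp: grem_level_0 grem_level_Suc)

lemma card_grem_level: "card (grem_level j N) = (\<Prod>i=1..j. N i)"
  by (induction j) (auto simp: grem_level_0 grem_level_Suc card_image[OF inj_append_pair] card_cartesian_product prod.nat_ivl_Suc')

lemma sum_grem_level_Suc:
  "(\<Sum>\<epsilon>\<in>grem_level (Suc j) N. F \<epsilon>) = (\<Sum>\<epsilon>\<in>grem_level j N. \<Sum>k=1..N (Suc j). F (\<epsilon> @ [k]))"
  unfolding grem_level_Suc
  by (subst sum.reindex[OF inj_append_pair]) (simp add: sum.cartesian_product case_prod_unfold)

lemma length_grem_level: "\<epsilon> \<in> grem_level j N \<Longrightarrow> length \<epsilon> = j"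
  by (simp add: grem_level_def)

lemma take_grem_level: "\<epsilon> \<in> grem_level j N \<Longrightarrow> i \<le> j \<Longrightarrow> take i \<epsilon> \<in> grem_level i N"
  by (auto simp: grem_level_def)

text \<open>The hypothesis on \<open>u\<close> and on the sizes of the levels holds for all
  large \<open>n\<close>.\<close>

locale grem = prob_space M for M :: "'a measure" +
  fixes d n :: nat and a :: "nat \<Rightarrow> real" and N :: "nat \<Rightarrow> nat" and \<xi> :: "nat list \<Rightarrow> 'a \<Rightarrow> real" and u :: real
  assumes d: "1 \<le> d" and a_pos: "\<And>j. j \<in> {1..d} \<Longrightarrow> 0 < a j"
    and N_pos: "\<And>j. j \<in> {1..d} \<Longrightarrow> 0 < N j" and u_pos: "0 < u" and n_pos: "0 < n"
    and normal: "\<And>\<eta>. \<eta> \<in> (\<Union>j\<in>{1..d}. grem_level j N) \<Longrightarrow> distributed M lborel (\<xi> \<eta>) std_normal_density"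
    and indep: "indep_vars (\<lambda>_. borel) \<xi> (\<Union>j\<in>{1..d}. grem_level j N)"
begin

definition V :: "nat list \<Rightarrow> 'a \<Rightarrow> real" where
  "V \<eta> \<omega> = - u * (\<xi> \<eta> \<omega> - u)"

definition s :: real where
  "s = sqrt (real n * a 1) / u"

text \<open>The weight of a node at level \<open>i\<close>, divided by its mean.\<close>

definition G :: "nat \<Rightarrow> complex \<Rightarrow> real \<Rightarrow> complex" where
  "G i \<beta> x = exp (\<beta> * of_real (sqrt (real n * a i) * x) - \<beta>\<^sup>2 * of_real (a i * real n / 2))"

text \<open>The conditional expectation of the normalized partition function given the first
  \<open>j\<close> levels, because every \<open>G\<close> has mean 1; thus a martingale in
  \<open>j\<close>.\<close>

definition level_sum :: "nat \<Rightarrow> complex \<Rightarrow> 'a \<Rightarrow> complex" where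
  "level_sum j \<beta> \<omega> = (\<Sum>\<epsilon>\<in>grem_level j N. exp (- \<beta> * of_real (s * V (take 1 \<epsilon>) \<omega>))
      * (\<Prod>i=2..j. G i \<beta> (\<xi> (take i \<epsilon>) \<omega>) / of_nat (N i)))"

text \<open>The martingale difference from level \<open>j\<close> to \<open>j + 1\<close> over the
  paths whose first-level point is at least e^x. Without the cutoff the p-th moments of the first
  factor, summed over the sites, are unbounded in n.\<close>

definition trunc_diff :: "real \<Rightarrow> nat \<Rightarrow> complex \<Rightarrow> 'a \<Rightarrow> complex" where
  "trunc_diff x j \<beta> \<omega> = (\<Sum>\<epsilon>\<in>grem_level (Suc j) N.
      indicator {x..} (V (take 1 \<epsilon>) \<omega>) * exp (- \<beta> * of_real (s * V (take 1 \<epsilon>) \<omega>))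
      * (\<Prod>i=2..j. G i \<beta> (\<xi> (take i \<epsilon>) \<omega>) / of_nat (N i)) / of_nat (N (Suc j)) * (G (Suc j) \<beta> (\<xi> \<epsilon> \<omega>) - 1))"

lemma \<xi>_measurable: "j \<in> {1..d} \<Longrightarrow> \<eta> \<in> grem_level j N \<Longrightarrow> \<xi> \<eta> \<in> borel_measurable M"
  using indep unfolding indep_vars_def by auto

lemma V_measurable: "j \<in> {1..d} \<Longrightarrow> \<eta> \<in> grem_level j N \<Longrightarrow> V \<eta> \<in> borel_measurable M"
  unfolding V_def[abs_def] using \<xi>_measurable by (intro borel_measurable_times borel_measurable_diff) auto

lemma distributed_V: "\<eta> \<in> grem_level 1 N \<Longrightarrow> distributed M lborel (V \<eta>) (site_density u)"
  unfolding V_def[abs_def] using d by (intro distributed_site u_pos normal UN_I[of 1]) auto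

lemma G_measurable: "G i \<beta> \<in> borel_measurable borel"
  unfolding G_def[abs_def] by (intro borel_measurable_continuous_onI continuous_intros)

lemma norm_G_powr: "norm (G i \<beta> x) powr p = exp (p * Re \<beta> * sqrt (real n * a i) * x) * exp (- (p * ((Re \<beta>)\<^sup>2 - (Im \<beta>)\<^sup>2) * a i * real n / 2))"
  unfolding G_def by (simp add: powr_def exp_add[symmetric] power2_eq_square algebra_simps)

lemma moment_G:
  assumes j: "j \<in> {1..d}" and \<eta>: "\<eta> \<in> grem_level j N"
  shows "integrable M (\<lambda>\<omega>. norm (G j \<beta> (\<xi> \<eta> \<omega>)) powr p)"
    and "expectation (\<lambda>\<omega>. norm (G j \<beta> (\<xi> \<eta> \<omega>)) powr p)
      = exp (real n * a j / 2 * (p\<^sup>2 * (Re \<beta>)\<^sup>2 - p * (Re \<beta>)\<^sup>2 + p * (Im \<beta>)\<^sup>2))"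
proof -
  have X: "distributed M lborel (\<xi> \<eta>) std_normal_density" using normal j \<eta> by blast
  note * = real_mgf_std_normal[OF X, of "p * Re \<beta> * sqrt (real n * a j)"]
  show "integrable M (\<lambda>\<omega>. norm (G j \<beta> (\<xi> \<eta> \<omega>)) powr p)"
    unfolding norm_G_powr using *(1) by (rule integrable_mult_left)
  have "0 \<le> real n * a j" using a_pos[OF j] by simp
  then have "(p * Re \<beta> * sqrt (real n * a j))\<^sup>2 / 2 + - (p * ((Re \<beta>)\<^sup>2 - (Im \<beta>)\<^sup>2) * a j * real n / 2)
      = real n * a j / 2 * (p\<^sup>2 * (Re \<beta>)\<^sup>2 - p * (Re \<beta>)\<^sup>2 + p * (Im \<beta>)\<^sup>2)"
    by (simp add: power_mult_distrib real_sqrt_pow2 field_simps)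
  moreover have "expectation (\<lambda>\<omega>. norm (G j \<beta> (\<xi> \<eta> \<omega>)) powr p)
      = exp ((p * Re \<beta> * sqrt (real n * a j))\<^sup>2 / 2) * exp (- (p * ((Re \<beta>)\<^sup>2 - (Im \<beta>)\<^sup>2) * a j * real n / 2))"
    by (simp only: norm_G_powr integral_mult_left_zero *(2))
  ultimately show "expectation (\<lambda>\<omega>. norm (G j \<beta> (\<xi> \<eta> \<omega>)) powr p)
      = exp (real n * a j / 2 * (p\<^sup>2 * (Re \<beta>)\<^sup>2 - p * (Re \<beta>)\<^sup>2 + p * (Im \<beta>)\<^sup>2))"
    by (simp only: exp_add[symmetric])
qed

lemma mean_G:
  assumes j: "j \<in> {1..d}" and \<eta>: "\<eta> \<in> grem_level j N"
  shows "integrable M (\<lambda>\<omega>. G j \<beta> (\<xi> \<eta> \<omega>))" and "expectation (\<lambda>\<omega>. G j \<beta> (\<xi> \<eta> \<omega>)) = 1"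
proof -
  have X: "distributed M lborel (\<xi> \<eta>) std_normal_density" using normal j \<eta> by blast
  note * = complex_mgf_std_normal[OF X, of "\<beta> * of_real (sqrt (real n * a j))"]
  have G: "G j \<beta> x = exp (\<beta> * of_real (sqrt (real n * a j)) * of_real x) * exp (- (\<beta>\<^sup>2 * of_real (a j * real n / 2)))" for x
    unfolding G_def by (simp add: exp_add[symmetric] mult.assoc)
  show "integrable M (\<lambda>\<omega>. G j \<beta> (\<xi> \<eta> \<omega>))" unfolding G using *(1) by (rule integrable_mult_left)
  have "0 \<le> real n * a j" using a_pos[OF j] by simp
  then have "(\<beta> * of_real (sqrt (real n * a j)))\<^sup>2 / 2 = \<beta>\<^sup>2 * of_real (a j * real n / 2)"
    by (simp add: power_mult_distrib of_real_power[symmetric] del: of_real_power)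
  then show "expectation (\<lambda>\<omega>. G j \<beta> (\<xi> \<eta> \<omega>)) = 1"
    unfolding G integral_mult_left_zero *(2) by (simp add: exp_add[symmetric])
qed

lemma path_product:
  fixes f :: "nat \<Rightarrow> real \<Rightarrow> 'z::{real_normed_field,banach,second_countable_topology}"
  assumes \<epsilon>: "\<epsilon> \<in> grem_level j N" and j: "j \<le> d" and S: "S \<subseteq> {1..j}"
    and f: "\<And>i. i \<in> S \<Longrightarrow> f i \<in> borel_measurable borel"
    and int: "\<And>i. i \<in> S \<Longrightarrow> integrable M (\<lambda>\<omega>. f i (\<xi> (take i \<epsilon>) \<omega>))"
  shows "integrable M (\<lambda>\<omega>. \<Prod>i\<in>S. f i (\<xi> (take i \<epsilon>) \<omega>))"
    and "expectation (\<lambda>\<omega>. \<Prod>i\<in>S. f i (\<xi> (take i \<epsilon>) \<omega>)) = (\<Prod>i\<in>S. expectation (\<lambda>\<omega>. f i (\<xi> (take i \<epsilon>) \<omega>)))"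
proof -
  let ?t = "\<lambda>i. take i \<epsilon>"
  have len: "length (?t i) = i" if "i \<in> S" for i using that S length_grem_level[OF \<epsilon>] by auto
  have inj: "inj_on ?t S"
  proof (rule inj_onI)
    fix i k assume "i \<in> S" "k \<in> S" "?t i = ?t k"
    then show "i = k" using len[of i] len[of k] by simp
  qed
  have sub: "?t ` S \<subseteq> (\<Union>j\<in>{1..d}. grem_level j N)"
  proof
    fix \<eta> assume "\<eta> \<in> ?t ` S"
    then obtain i where i: "i \<in> S" "\<eta> = ?t i" by blast
    then have "i \<in> {1..d}" "i \<le> j" using S j by auto
    then show "\<eta> \<in> (\<Union>j\<in>{1..d}. grem_level j N)" using take_grem_level[OF \<epsilon>, of i] i(2) by blast
  qed
  \<comment> \<open>Independence is indexed by nodes, the factors by levels; on a path the level is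
    recovered as the length of the node.\<close>
  define Y where "Y \<eta> \<omega> = f (length \<eta>) (\<xi> \<eta> \<omega>)" for \<eta> \<omega>
  have Y: "Y (?t i) = (\<lambda>\<omega>. f i (\<xi> (?t i) \<omega>))" if "i \<in> S" for i
    unfolding Y_def len[OF that] ..
  have fin: "finite (?t ` S)" using S finite_subset by blast
  have ind: "indep_vars (\<lambda>_. borel) Y (?t ` S)"
    unfolding Y_def[abs_def]
    by (rule indep_vars_compose2[OF indep_vars_subset[OF indep sub]]) (use f len in auto)
  have intY: "integrable M (Y \<eta>)" if "\<eta> \<in> ?t ` S" for \<eta> using that int Y by auto
  have prodY: "(\<Prod>\<eta>\<in>?t ` S. Y \<eta> \<omega>) = (\<Prod>i\<in>S. f i (\<xi> (?t i) \<omega>))" for \<omega>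
    unfolding prod.reindex[OF inj] o_def by (intro prod.cong refl) (simp only: Y)
  have prodE: "(\<Prod>\<eta>\<in>?t ` S. expectation (Y \<eta>)) = (\<Prod>i\<in>S. expectation (\<lambda>\<omega>. f i (\<xi> (?t i) \<omega>)))"
    unfolding prod.reindex[OF inj] o_def by (intro prod.cong refl) (simp only: Y)
  show "integrable M (\<lambda>\<omega>. \<Prod>i\<in>S. f i (\<xi> (?t i) \<omega>))"
    using indep_vars_integrable[OF fin ind intY] unfolding prodY .
  show "expectation (\<lambda>\<omega>. \<Prod>i\<in>S. f i (\<xi> (?t i) \<omega>)) = (\<Prod>i\<in>S. expectation (\<lambda>\<omega>. f i (\<xi> (?t i) \<omega>)))"
    using indep_vars_lebesgue_integral[OF fin ind intY] unfolding prodY prodE .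
qed

lemma sV: "s * V \<eta> \<omega> = - (sqrt (real n * a 1) * (\<xi> \<eta> \<omega> - u))"
  unfolding s_def V_def using u_pos by (simp add: field_simps)

lemma prod_split_first: "1 \<le> j \<Longrightarrow> (\<Prod>i=1..j. h i) = h 1 * (\<Prod>i=2..j. h i)" for h :: "nat \<Rightarrow> 'z::comm_monoid_mult"
  by (simp add: prod.atLeast_Suc_atMost numeral_2_eq_2)

lemma norm_const:
  "exp (\<beta> * of_real (sqrt (real n * a 1) * u) + grem_c_tilde d a N n \<beta>)
    = exp (\<beta> * of_real (sqrt (real n * a 1) * u)) * (\<Prod>i=2..d. of_nat (N i) * exp (\<beta>\<^sup>2 * of_real (a i * real n / 2)))"
proof -
  have "exp (grem_c_tilde d a N n \<beta>) = (\<Prod>i=2..d. exp (of_real (ln (real (N i))) + of_real (a i) * \<beta>\<^sup>2 * of_nat n / 2))"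
    unfolding grem_c_tilde_def by (simp add: exp_sum)
  also have "\<dots> = (\<Prod>i=2..d. of_nat (N i) * exp (\<beta>\<^sup>2 * of_real (a i * real n / 2)))"
  proof (intro prod.cong refl)
    fix i assume "i \<in> {2..d}"
    then have "exp (complex_of_real (ln (real (N i)))) = of_nat (N i)" using N_pos[of i] by (simp add: exp_of_real)
    then show "exp (of_real (ln (real (N i))) + of_real (a i) * \<beta>\<^sup>2 * of_nat n / 2) = of_nat (N i) * exp (\<beta>\<^sup>2 * of_real (a i * real n / 2))"
      by (simp add: exp_add mult_ac)
  qed
  finally show ?thesis by (simp add: exp_add)
qed

lemma exp_field:
  assumes \<epsilon>: "\<epsilon> \<in> grem_level d N"
  shows "exp (\<beta> * of_real (sqrt (real n) * grem_field d a \<xi> \<epsilon> \<omega>)) = (\<Prod>j=1..d. exp (\<beta> * of_real (sqrt (real n * a j) * \<xi> (take j \<epsilon>) \<omega>)))"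
  unfolding grem_field_def sum_distrib_left of_real_sum exp_sum[OF finite_atLeastAtMost, symmetric]
  by (simp add: real_sqrt_mult mult_ac)

text \<open>The factor exp(\<beta> sqrt(n a_1) u) recentres the first-level variables at
  \<open>u\<close>, which turns their weight into exp(-\<beta> s V); \<open>grem_c_tilde\<close>
  supplies the sizes and means of the deeper levels.\<close>

lemma partition_eq_level_sum:
  "grem_partition d a N \<xi> n \<beta> \<omega> / exp (\<beta> * of_real (sqrt (real n * a 1) * u) + grem_c_tilde d a N n \<beta>) = level_sum d \<beta> \<omega>"
  unfolding grem_partition_def level_sum_def sum_divide_distrib
proof (intro sum.cong refl)
  fix \<epsilon> assume \<epsilon>: "\<epsilon> \<in> grem_level d N"
  let ?h = "\<lambda>j. exp (\<beta> * of_real (sqrt (real n * a j) * \<xi> (take j \<epsilon>) \<omega>))"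
  have "exp (\<beta> * of_real (sqrt (real n) * grem_field d a \<xi> \<epsilon> \<omega>)) = ?h 1 * (\<Prod>j=2..d. ?h j)"
    unfolding exp_field[OF \<epsilon>] by (rule prod_split_first[OF d])
  moreover have "?h 1 = exp (\<beta> * of_real (sqrt (real n * a 1) * u)) * exp (- \<beta> * of_real (s * V (take 1 \<epsilon>) \<omega>))"
    unfolding sV exp_add[symmetric] by (simp add: algebra_simps)
  moreover have "(\<Prod>j=2..d. ?h j) = (\<Prod>i=2..d. of_nat (N i) * exp (\<beta>\<^sup>2 * of_real (a i * real n / 2))) * (\<Prod>i=2..d. G i \<beta> (\<xi> (take i \<epsilon>) \<omega>) / of_nat (N i))"
    unfolding prod.distrib[symmetric]
  proof (intro prod.cong refl)
    fix i assume "i \<in> {2..d}"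
    then have "N i \<noteq> 0" using N_pos[of i] by simp
    then show "?h i = of_nat (N i) * exp (\<beta>\<^sup>2 * of_real (a i * real n / 2)) * (G i \<beta> (\<xi> (take i \<epsilon>) \<omega>) / of_nat (N i))"
      unfolding G_def by (simp add: exp_diff)
  qed
  moreover have "(\<Prod>i=2..d. of_nat (N i) * exp (\<beta>\<^sup>2 * of_real (a i * real n / 2))) \<noteq> (0::complex)"
    using N_pos by auto
  moreover have "e * x * (P * Q) / (e * P) = x * Q" if "e \<noteq> 0" "P \<noteq> 0" for e x P Q :: complex
    using that by simp
  ultimately show "exp (\<beta> * of_real (sqrt (real n) * grem_field d a \<xi> \<epsilon> \<omega>)) / exp (\<beta> * of_real (sqrt (real n * a 1) * u) + grem_c_tilde d a N n \<beta>)
      = exp (- \<beta> * of_real (s * V (take 1 \<epsilon>) \<omega>)) * (\<Prod>i=2..d. G i \<beta> (\<xi> (take i \<epsilon>) \<omega>) / of_nat (N i))"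
    unfolding norm_const by (simp only: exp_not_eq_zero not_False_eq_True)
qed

lemma mean_first_level:
  fixes \<beta> :: complex
  assumes \<eta>: "\<eta> \<in> grem_level 1 N"
  shows "integrable M (\<lambda>\<omega>. exp (- \<beta> * of_real (s * V \<eta> \<omega>)))"
    and "expectation (\<lambda>\<omega>. exp (- \<beta> * of_real (s * V \<eta> \<omega>))) = exp (\<beta>\<^sup>2 * of_real (a 1 * real n / 2)) / exp (\<beta> * of_real (sqrt (real n * a 1) * u))"
proof -
  have X: "distributed M lborel (\<xi> \<eta>) std_normal_density" using normal[of \<eta>] d \<eta> by force
  note * = complex_mgf_std_normal[OF X, of "\<beta> * of_real (sqrt (real n * a 1))"]
  have eq: "exp (- \<beta> * of_real (s * V \<eta> \<omega>)) = exp (\<beta> * of_real (sqrt (real n * a 1)) * of_real (\<xi> \<eta> \<omega>)) * exp (- (\<beta> * of_real (sqrt (real n * a 1) * u)))" for \<omega>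
    unfolding sV exp_add[symmetric] by (simp add: algebra_simps)
  show "integrable M (\<lambda>\<omega>. exp (- \<beta> * of_real (s * V \<eta> \<omega>)))" unfolding eq using *(1) by (rule integrable_mult_left)
  have "0 \<le> real n * a 1" using a_pos[of 1] d by simp
  then have "(\<beta> * of_real (sqrt (real n * a 1)))\<^sup>2 / 2 = \<beta>\<^sup>2 * of_real (a 1 * real n / 2)"
    by (simp add: power_mult_distrib of_real_power[symmetric] del: of_real_power)
  note sq = this
  have "expectation (\<lambda>\<omega>. exp (- \<beta> * of_real (s * V \<eta> \<omega>)))
      = exp ((\<beta> * of_real (sqrt (real n * a 1)))\<^sup>2 / 2) * exp (- (\<beta> * of_real (sqrt (real n * a 1) * u)))"
    unfolding eq by (simp only: integral_mult_left_zero *(2))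
  then show "expectation (\<lambda>\<omega>. exp (- \<beta> * of_real (s * V \<eta> \<omega>))) = exp (\<beta>\<^sup>2 * of_real (a 1 * real n / 2)) / exp (\<beta> * of_real (sqrt (real n * a 1) * u))"
    unfolding sq exp_minus divide_inverse[of _ "exp (\<beta> * of_real (sqrt (real n * a 1) * u))"] .
qed

lemma level_sum_diff:
  assumes j: "1 \<le> j" "Suc j \<le> d" and x: "\<And>\<eta>. \<eta> \<in> grem_level 1 N \<Longrightarrow> x \<le> V \<eta> \<omega>"
  shows "level_sum (Suc j) \<beta> \<omega> - level_sum j \<beta> \<omega> = trunc_diff x j \<beta> \<omega>"
proof -
  define F where "F \<epsilon> = exp (- \<beta> * of_real (s * V (take 1 \<epsilon>) \<omega>)) * (\<Prod>i=2..j. G i \<beta> (\<xi> (take i \<epsilon>) \<omega>) / of_nat (N i))" for \<epsilon>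
  have N0: "N (Suc j) \<noteq> 0" using N_pos[of "Suc j"] j by simp
  have F_take: "F (\<epsilon> @ [k]) = F \<epsilon>" if "\<epsilon> \<in> grem_level j N" for \<epsilon> k
  proof -
    have len: "length \<epsilon> = j" using that by (rule length_grem_level)
    have "take i (\<epsilon> @ [k]) = take i \<epsilon>" if "i \<le> j" for i using that len by simp
    then show ?thesis unfolding F_def using j by (auto intro!: prod.cong)
  qed
  \<comment> \<open>Each path of level \<open>j\<close> is spread evenly over its children, which
    brings both sums to level \<open>j + 1\<close>.\<close>
  have "level_sum j \<beta> \<omega> = (\<Sum>\<epsilon>\<in>grem_level j N. \<Sum>k=1..N (Suc j). F (\<epsilon> @ [k]) / of_nat (N (Suc j)))"
    unfolding level_sum_def F_def[symmetric] using N0 by (intro sum.cong refl) (simp add: F_take)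
  also have "\<dots> = (\<Sum>\<epsilon>\<in>grem_level (Suc j) N. F \<epsilon> / of_nat (N (Suc j)))" by (rule sum_grem_level_Suc[symmetric])
  finally have 1: "level_sum j \<beta> \<omega> = (\<Sum>\<epsilon>\<in>grem_level (Suc j) N. F \<epsilon> / of_nat (N (Suc j)))" .
  have 2: "level_sum (Suc j) \<beta> \<omega> = (\<Sum>\<epsilon>\<in>grem_level (Suc j) N. F \<epsilon> / of_nat (N (Suc j)) * G (Suc j) \<beta> (\<xi> \<epsilon> \<omega>))"
    unfolding level_sum_def
  proof (intro sum.cong refl)
    fix \<epsilon> assume "\<epsilon> \<in> grem_level (Suc j) N"
    from length_grem_level[OF this] have "take (Suc j) \<epsilon> = \<epsilon>" by simp
    then show "exp (- \<beta> * of_real (s * V (take 1 \<epsilon>) \<omega>)) * (\<Prod>i=2..Suc j. G i \<beta> (\<xi> (take i \<epsilon>) \<omega>) / of_nat (N i))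
        = F \<epsilon> / of_nat (N (Suc j)) * G (Suc j) \<beta> (\<xi> \<epsilon> \<omega>)"
      using j unfolding F_def by (simp add: prod.nat_ivl_Suc')
  qed
  have 3: "trunc_diff x j \<beta> \<omega> = (\<Sum>\<epsilon>\<in>grem_level (Suc j) N. F \<epsilon> / of_nat (N (Suc j)) * (G (Suc j) \<beta> (\<xi> \<epsilon> \<omega>) - 1))"
    unfolding trunc_diff_def
  proof (intro sum.cong refl)
    fix \<epsilon> assume "\<epsilon> \<in> grem_level (Suc j) N"
    from take_grem_level[OF this, of 1] have "take 1 \<epsilon> \<in> grem_level 1 N" by simp
    from x[OF this] show "indicator {x..} (V (take 1 \<epsilon>) \<omega>) * exp (- \<beta> * of_real (s * V (take 1 \<epsilon>) \<omega>))
      * (\<Prod>i=2..j. G i \<beta> (\<xi> (take i \<epsilon>) \<omega>) / of_nat (N i)) / of_nat (N (Suc j)) * (G (Suc j) \<beta> (\<xi> \<epsilon> \<omega>) - 1)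
      = F \<epsilon> / of_nat (N (Suc j)) * (G (Suc j) \<beta> (\<xi> \<epsilon> \<omega>) - 1)"
      unfolding F_def by simp
  qed
  show ?thesis unfolding 1 2 3 sum_subtractf[symmetric] by (simp add: right_diff_distrib)
qed

end

section \<open>Auxiliary moment bounds\<close>

lemma integrable_nonneg_le:
  fixes f :: "'a \<Rightarrow> real"
  assumes "f \<in> borel_measurable M" "\<And>x. 0 \<le> f x" "(\<integral>\<^sup>+x. ennreal (f x) \<partial>M) \<le> ennreal b" "0 \<le> b"
  shows "integrable M f" "(\<integral>x. f x \<partial>M) \<le> b"
proof -
  show int: "integrable M f"
    using assms by (intro integrableI_nonneg) (auto intro: le_less_trans[OF _ ennreal_less_top])
  have "ennreal (\<integral>x. f x \<partial>M) \<le> ennreal b"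
    using nn_integral_eq_integral[OF int] assms by simp
  then show "(\<integral>x. f x \<partial>M) \<le> b" using assms(4) by (simp add: ennreal_le_iff)
qed

text \<open>Pointwise x \<le> e + e^(1-p) x^p, according to whether x \<le> e. In this additive form
  a sufficiently small p-th moment bounds the first moment by 2e.\<close>

lemma (in prob_space) nn_integral_norm_le_powr:
  fixes X :: "'a \<Rightarrow> complex"
  assumes int: "integrable M (\<lambda>\<omega>. norm (X \<omega>) powr p)" and E: "expectation (\<lambda>\<omega>. norm (X \<omega>) powr p) \<le> B"
    and p: "1 \<le> p" and e: "0 < e"
  shows "(\<integral>\<^sup>+\<omega>. norm (X \<omega>) \<partial>M) \<le> ennreal (e + e powr (1 - p) * B)"
proof -
  have pw: "x \<le> e + e powr (1 - p) * x powr p" if x: "0 \<le> x" for x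
  proof (cases "x \<le> e")
    case True
    then show ?thesis by (simp add: add_increasing2)
  next
    case False
    then have "x powr (1 - p) \<le> e powr (1 - p)" using e p by (intro powr_mono2') auto
    then have "x powr (1 - p) * x powr p \<le> e powr (1 - p) * x powr p" by (intro mult_right_mono) auto
    moreover have "x powr (1 - p) * x powr p = x" using False e by (simp add: powr_add[symmetric])
    ultimately show ?thesis using e by linarith
  qed
  have "(\<integral>\<^sup>+\<omega>. norm (X \<omega>) \<partial>M) \<le> (\<integral>\<^sup>+\<omega>. ennreal (e + e powr (1 - p) * norm (X \<omega>) powr p) \<partial>M)"
    using pw by (intro nn_integral_mono ennreal_leI) auto
  also have "\<dots> = ennreal (expectation (\<lambda>\<omega>. e + e powr (1 - p) * norm (X \<omega>) powr p))"
    using int e by (intro nn_integral_eq_integral) auto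
  also have "expectation (\<lambda>\<omega>. e + e powr (1 - p) * norm (X \<omega>) powr p) = e + e powr (1 - p) * expectation (\<lambda>\<omega>. norm (X \<omega>) powr p)"
    using int by (simp add: prob_space)
  also have "ennreal \<dots> \<le> ennreal (e + e powr (1 - p) * B)"
    using E by (intro ennreal_leI add_left_mono mult_left_mono) auto
  finally show ?thesis .
qed

text \<open>By Jensen's inequality |E Y|^p is at most the p-th moment, so centring costs 2^p for the
  sum and 2 for the two summands.\<close>

lemma (in prob_space) centered_moment:
  fixes Y :: "'a \<Rightarrow> complex"
  assumes Ym: "Y \<in> borel_measurable M" and int: "integrable M (\<lambda>\<omega>. norm (Y \<omega>) powr p)" and p: "1 \<le> p"
  shows "integrable M Y" "integrable M (\<lambda>\<omega>. norm (Y \<omega> - expectation Y) powr p)"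
    "expectation (\<lambda>\<omega>. norm (Y \<omega> - expectation Y) powr p) \<le> 2 powr (p + 1) * expectation (\<lambda>\<omega>. norm (Y \<omega>) powr p)"
proof -
  show intY: "integrable M Y"
  proof (rule Bochner_Integration.integrable_bound[of M "\<lambda>\<omega>. 1 + norm (Y \<omega>) powr p"])
    show "integrable M (\<lambda>\<omega>. 1 + norm (Y \<omega>) powr p)" using int by simp
    show "AE \<omega> in M. norm (Y \<omega>) \<le> norm (1 + norm (Y \<omega>) powr p)"
    proof (rule AE_I2)
      fix \<omega>
      have "norm (Y \<omega>) \<le> 1 + norm (Y \<omega>) powr p" using p by (intro le_one_plus_powr) auto
      then show "norm (Y \<omega>) \<le> norm (1 + norm (Y \<omega>) powr p)" by simp
    qed
  qed (rule Ym)
  let ?m = "expectation Y"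
  have m: "norm ?m powr p \<le> expectation (\<lambda>\<omega>. norm (Y \<omega>) powr p)"
  proof -
    have "norm ?m powr p \<le> (expectation (\<lambda>\<omega>. norm (Y \<omega>))) powr p"
      using p by (intro powr_mono2 integral_norm_bound) auto
    also have "\<dots> \<le> expectation (\<lambda>\<omega>. norm (Y \<omega>) powr p)"
      using intY int p by (intro powr_expectation_le) auto
    finally show ?thesis .
  qed
  have pw: "norm (Y \<omega> - ?m) powr p \<le> 2 powr p * (norm (Y \<omega>) powr p + norm ?m powr p)" for \<omega>
  proof -
    have "norm (Y \<omega> - ?m) powr p \<le> (norm (Y \<omega>) + norm ?m) powr p"
      using p by (intro powr_mono2 norm_triangle_ineq4) auto
    also have "\<dots> \<le> 2 powr p * (norm (Y \<omega>) powr p + norm ?m powr p)" using p by (intro powr_add_le_two_powr) auto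
    finally show ?thesis .
  qed
  have intb: "integrable M (\<lambda>\<omega>. 2 powr p * (norm (Y \<omega>) powr p + norm ?m powr p))" using int by simp
  show intc: "integrable M (\<lambda>\<omega>. norm (Y \<omega> - ?m) powr p)"
  proof (rule Bochner_Integration.integrable_bound[OF intb])
    show "(\<lambda>\<omega>. norm (Y \<omega> - ?m) powr p) \<in> borel_measurable M" using Ym by measurable
    show "AE \<omega> in M. norm (norm (Y \<omega> - ?m) powr p) \<le> norm (2 powr p * (norm (Y \<omega>) powr p + norm ?m powr p))"
      using pw by (intro AE_I2) simp
  qed
  have "expectation (\<lambda>\<omega>. norm (Y \<omega> - ?m) powr p) \<le> expectation (\<lambda>\<omega>. 2 powr p * (norm (Y \<omega>) powr p + norm ?m powr p))"
    by (rule integral_mono[OF intc intb pw])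
  also have "\<dots> = 2 powr p * (expectation (\<lambda>\<omega>. norm (Y \<omega>) powr p) + norm ?m powr p)"
    using int by (simp add: prob_space)
  also have "\<dots> \<le> 2 powr p * (expectation (\<lambda>\<omega>. norm (Y \<omega>) powr p) + expectation (\<lambda>\<omega>. norm (Y \<omega>) powr p))"
    using m by (intro mult_left_mono add_left_mono) auto
  also have "\<dots> = 2 powr (p + 1) * expectation (\<lambda>\<omega>. norm (Y \<omega>) powr p)" by (simp add: powr_add)
  finally show "expectation (\<lambda>\<omega>. norm (Y \<omega> - ?m) powr p) \<le> 2 powr (p + 1) * expectation (\<lambda>\<omega>. norm (Y \<omega>) powr p)" .
qed

section \<open>p-th moments of the first-level tail and of the martingale differences\<close>

context grem
begin

definition first_term :: "complex \<Rightarrow> real \<Rightarrow> complex" where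
  "first_term \<beta> v = exp (- \<beta> * of_real (s * v))"

lemma first_term_measurable: "first_term \<beta> \<in> borel_measurable borel"
  unfolding first_term_def[abs_def] by (intro borel_measurable_continuous_onI continuous_intros)

lemma norm_first_term_powr: "norm (first_term \<beta> v) powr p = exp (- (p * Re \<beta> * s) * v)"
  unfolding first_term_def by (simp add: powr_def mult_ac)

text \<open>The p-th absolute moment of \<open>G j\<close> at a node, by
  \<open>moment_G\<close>.\<close>

definition mom :: "real \<Rightarrow> complex \<Rightarrow> nat \<Rightarrow> real" where
  "mom p \<beta> j = exp (real n * a j / 2 * (p\<^sup>2 * (Re \<beta>)\<^sup>2 - p * (Re \<beta>)\<^sup>2 + p * (Im \<beta>)\<^sup>2))"

definition upper_moment :: "real \<Rightarrow> complex \<Rightarrow> real \<Rightarrow> real" where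
  "upper_moment p \<beta> x = site_const u * (exp (- (p * Re \<beta> * s - 1) * x) / (p * Re \<beta> * s - 1))"

lemma first_level_moment:
  assumes \<eta>: "\<eta> \<in> grem_level 1 N" and \<kappa>: "1 < p * Re \<beta> * s"
  shows "integrable M (\<lambda>\<omega>. norm (indicator {x..} (V \<eta> \<omega>) * first_term \<beta> (V \<eta> \<omega>)) powr p)"
    and "expectation (\<lambda>\<omega>. norm (indicator {x..} (V \<eta> \<omega>) * first_term \<beta> (V \<eta> \<omega>)) powr p) \<le> upper_moment p \<beta> x"
proof -
  have eq: "norm (indicator {x..} v * first_term \<beta> v) powr p = indicator {x..} v * exp (- (p * Re \<beta> * s) * v)" for v
    using norm_first_term_powr[of \<beta> v p] by (auto simp: indicator_def norm_mult)
  have Vm: "V \<eta> \<in> borel_measurable M" using V_measurable[of 1] d \<eta> by simp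
  note * = site_upper_moment[OF distributed_V[OF \<eta>] u_pos \<kappa>, of x]
  have m: "(\<lambda>\<omega>. indicator {x..} (V \<eta> \<omega>) * exp (- (p * Re \<beta> * s) * V \<eta> \<omega>)) \<in> borel_measurable M"
    using Vm by measurable
  have b0: "0 \<le> upper_moment p \<beta> x" unfolding upper_moment_def using site_const_pos[OF u_pos] \<kappa> by simp
  show "integrable M (\<lambda>\<omega>. norm (indicator {x..} (V \<eta> \<omega>) * first_term \<beta> (V \<eta> \<omega>)) powr p)"
    "expectation (\<lambda>\<omega>. norm (indicator {x..} (V \<eta> \<omega>) * first_term \<beta> (V \<eta> \<omega>)) powr p) \<le> upper_moment p \<beta> x"
    unfolding eq using integrable_nonneg_le[OF m _ *[folded upper_moment_def] b0] by (auto simp: indicator_def)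
qed

definition tail :: "real \<Rightarrow> complex \<Rightarrow> 'a \<Rightarrow> complex" where
  "tail y \<beta> \<omega> = (\<Sum>\<eta>\<in>grem_level 1 N. indicator {y<..} (V \<eta> \<omega>) * first_term \<beta> (V \<eta> \<omega>)
      - expectation (\<lambda>\<omega>. indicator {y<..} (V \<eta> \<omega>) * first_term \<beta> (V \<eta> \<omega>)))"

lemma tail_moment:
  assumes p: "1 < p" "p \<le> 2" and \<kappa>: "1 < p * Re \<beta> * s"
  shows "integrable M (\<lambda>\<omega>. norm (tail y \<beta> \<omega>) powr p)"
    and "expectation (\<lambda>\<omega>. norm (tail y \<beta> \<omega>) powr p) \<le> 6 * 2 powr (p + 1) * (real (N 1) * upper_moment p \<beta> y)"
proof -
  let ?I = "grem_level 1 N"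
  define Y where "Y \<eta> \<omega> = indicator {y<..} (V \<eta> \<omega>) * first_term \<beta> (V \<eta> \<omega>)" for \<eta> \<omega>
  define f where "f \<eta> x = indicator {y<..} (- u * (x - u)) * first_term \<beta> (- u * (x - u)) - expectation (Y \<eta>)" for \<eta> x
  have fY: "f \<eta> (\<xi> \<eta> \<omega>) = Y \<eta> \<omega> - expectation (Y \<eta>)" for \<eta> \<omega> unfolding f_def Y_def V_def ..
  have fm: "f \<eta> \<in> borel_measurable borel" for \<eta>
    unfolding f_def[abs_def] by (intro borel_measurable_diff borel_measurable_times measurable_compose[OF _ first_term_measurable]
        borel_measurable_const) measurable
  have Ym: "Y \<eta> \<in> borel_measurable M" if "\<eta> \<in> ?I" for \<eta>
  proof -
    have "V \<eta> \<in> borel_measurable M" using V_measurable[of 1] d that by simp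
    then show ?thesis unfolding Y_def[abs_def]
      using measurable_compose[OF _ first_term_measurable] by measurable
  qed
  have Yp: "integrable M (\<lambda>\<omega>. norm (Y \<eta> \<omega>) powr p)" "expectation (\<lambda>\<omega>. norm (Y \<eta> \<omega>) powr p) \<le> upper_moment p \<beta> y"
    if \<eta>: "\<eta> \<in> ?I" for \<eta>
  proof -
    note * = first_level_moment[OF \<eta> \<kappa>, of y]
    have le: "norm (Y \<eta> \<omega>) powr p \<le> norm (indicator {y..} (V \<eta> \<omega>) * first_term \<beta> (V \<eta> \<omega>)) powr p" for \<omega>
      unfolding Y_def using p by (auto simp: indicator_def)
    show i: "integrable M (\<lambda>\<omega>. norm (Y \<eta> \<omega>) powr p)"
    proof (rule Bochner_Integration.integrable_bound[OF *(1)])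
      show "(\<lambda>\<omega>. norm (Y \<eta> \<omega>) powr p) \<in> borel_measurable M" using Ym[OF \<eta>] by measurable
      show "AE \<omega> in M. norm (norm (Y \<eta> \<omega>) powr p) \<le> norm (norm (indicator {y..} (V \<eta> \<omega>) * first_term \<beta> (V \<eta> \<omega>)) powr p)"
        using le by (intro AE_I2) simp
    qed
    show "expectation (\<lambda>\<omega>. norm (Y \<eta> \<omega>) powr p) \<le> upper_moment p \<beta> y"
      using integral_mono[OF i *(1) le] *(2) by linarith
  qed
  have p1: "1 \<le> p" using p by simp
  note cm = centered_moment[OF Ym Yp(1) p1]
  have tail_eq: "tail y \<beta> \<omega> = (\<Sum>\<eta>\<in>?I. 1 * f \<eta> (\<xi> \<eta> \<omega>))" for \<omega>
    unfolding tail_def fY Y_def by simp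
  have sub: "{} \<union> ?I \<subseteq> (\<Union>j\<in>{1..d}. grem_level j N)"
    using d by (intro Un_least UN_upper) auto
  \<comment> \<open>First-level terms are independent and centred: the weights are 1 and depend on
    no variables, so \<open>J\<close> is empty.\<close>
  note vBE = von_Bahr_Esseen[OF p indep_vars_subset[OF indep sub] finite_grem_level, of "\<lambda>_ _. 1" f]
  show "integrable M (\<lambda>\<omega>. norm (tail y \<beta> \<omega>) powr p)"
    unfolding tail_eq
    by (rule vBE(1)) (use fm cm p in \<open>auto simp: fY prob_space\<close>)
  have "expectation (\<lambda>\<omega>. norm (tail y \<beta> \<omega>) powr p)
      \<le> 6 * (\<Sum>\<eta>\<in>?I. expectation (\<lambda>\<omega>. norm (1::complex) powr p) * expectation (\<lambda>\<omega>. norm (f \<eta> (\<xi> \<eta> \<omega>)) powr p))"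
    unfolding tail_eq
    by (rule vBE(2)) (use fm cm p in \<open>auto simp: fY prob_space\<close>)
  also have "(\<Sum>\<eta>\<in>?I. expectation (\<lambda>\<omega>. norm (1::complex) powr p) * expectation (\<lambda>\<omega>. norm (f \<eta> (\<xi> \<eta> \<omega>)) powr p))
      \<le> (\<Sum>\<eta>\<in>?I. 2 powr (p + 1) * upper_moment p \<beta> y)"
  proof (intro sum_mono)
    fix \<eta> assume \<eta>: "\<eta> \<in> ?I"
    have "expectation (\<lambda>\<omega>. norm (f \<eta> (\<xi> \<eta> \<omega>)) powr p) \<le> 2 powr (p + 1) * expectation (\<lambda>\<omega>. norm (Y \<eta> \<omega>) powr p)"
      unfolding fY by (rule cm(3)[OF \<eta> \<eta>])
    also have "\<dots> \<le> 2 powr (p + 1) * upper_moment p \<beta> y" using Yp(2)[OF \<eta>] by (intro mult_left_mono) auto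
    finally show "expectation (\<lambda>\<omega>. norm (1::complex) powr p) * expectation (\<lambda>\<omega>. norm (f \<eta> (\<xi> \<eta> \<omega>)) powr p) \<le> 2 powr (p + 1) * upper_moment p \<beta> y"
      by (simp add: prob_space)
  qed
  also have "\<dots> = 2 powr (p + 1) * (real (N 1) * upper_moment p \<beta> y)" by (simp add: card_grem_level)
  finally show "expectation (\<lambda>\<omega>. norm (tail y \<beta> \<omega>) powr p) \<le> 6 * 2 powr (p + 1) * (real (N 1) * upper_moment p \<beta> y)"
    by simp
qed

text \<open>Given the first \<open>j\<close> levels the summands are independent and centred, so the
  von Bahr--Esseen inequality applies with the path weights as coefficients. Level \<open>i\<close>
  contributes N_i through the number of paths and N_i^(-p) through the averaging, that is N_i^(1-p)
  times a moment.\<close>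

lemma trunc_diff_moment:
  assumes p: "1 < p" "p \<le> 2" and \<kappa>: "1 < p * Re \<beta> * s" and j: "1 \<le> j" "Suc j \<le> d"
  shows "integrable M (\<lambda>\<omega>. norm (trunc_diff x j \<beta> \<omega>) powr p)"
    and "expectation (\<lambda>\<omega>. norm (trunc_diff x j \<beta> \<omega>) powr p) \<le> 6 * ((real (N 1) * upper_moment p \<beta> x)
      * (\<Prod>i=2..j. real (N i) powr (1 - p) * mom p \<beta> i) * (2 powr p * (real (N (Suc j)) powr (1 - p) * (mom p \<beta> (Suc j) + 1))))"
proof -
  let ?I = "grem_level (Suc j) N"
  define J where "J = (\<Union>i\<in>{1..j}. grem_level i N)"
  have N1: "0 < real (N i)" if "i \<in> {1..d}" for i using N_pos[OF that] by simp
  \<comment> \<open>One family of factors for all levels, so that \<open>path_product\<close> covers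
    the first level as well.\<close>
  define g where "g i y = (if i = (1::nat) then indicator {x..} (- u * (y - u)) * first_term \<beta> (- u * (y - u)) else G i \<beta> y / of_nat (N i))" for i and y :: real
  have gm: "g i \<in> borel_measurable borel" for i
  proof (cases "i = 1")
    case True
    have "(\<lambda>y. indicator {x..} (- u * (y - u)) * first_term \<beta> (- u * (y - u))) \<in> borel_measurable borel"
      by (intro borel_measurable_times measurable_compose[OF _ first_term_measurable]) measurable
    then show ?thesis unfolding g_def[abs_def] using True by simp
  next
    case False
    then show ?thesis unfolding g_def[abs_def] using G_measurable[of i \<beta>] by simp
  qed
  define A where "A \<epsilon> w = (\<Prod>i=1..j. g i (w (take i \<epsilon>))) / of_nat (N (Suc j))" for \<epsilon> and w :: "nat list \<Rightarrow> real"
  define f where "f (\<epsilon>::nat list) y = G (Suc j) \<beta> y - 1" for \<epsilon> y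
  have tJ: "take i \<epsilon> \<in> J" if "\<epsilon> \<in> ?I" "i \<in> {1..j}" for \<epsilon> i
    using take_grem_level[OF that(1), of i] that(2) unfolding J_def by auto
  have A_eq: "A \<epsilon> (restrict (\<lambda>\<eta>. \<xi> \<eta> \<omega>) J) = (\<Prod>i=1..j. g i (\<xi> (take i \<epsilon>) \<omega>)) / of_nat (N (Suc j))" if "\<epsilon> \<in> ?I" for \<epsilon> \<omega>
    unfolding A_def using tJ[OF that] by (auto intro!: arg_cong2[where f="(/)"] prod.cong)
  have trunc_eq: "trunc_diff x j \<beta> \<omega> = (\<Sum>\<epsilon>\<in>?I. A \<epsilon> (restrict (\<lambda>\<eta>. \<xi> \<eta> \<omega>) J) * f \<epsilon> (\<xi> \<epsilon> \<omega>))" for \<omega>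
    unfolding trunc_diff_def
  proof (intro sum.cong refl)
    fix \<epsilon> assume \<epsilon>: "\<epsilon> \<in> ?I"
    have "(\<Prod>i=1..j. g i (\<xi> (take i \<epsilon>) \<omega>)) = g 1 (\<xi> (take 1 \<epsilon>) \<omega>) * (\<Prod>i=2..j. g i (\<xi> (take i \<epsilon>) \<omega>))"
      by (rule prod_split_first[OF j(1)])
    also have "(\<Prod>i=2..j. g i (\<xi> (take i \<epsilon>) \<omega>)) = (\<Prod>i=2..j. G i \<beta> (\<xi> (take i \<epsilon>) \<omega>) / of_nat (N i))"
      by (intro prod.cong refl) (simp add: g_def)
    finally have P: "(\<Prod>i=1..j. g i (\<xi> (take i \<epsilon>) \<omega>)) = g 1 (\<xi> (take 1 \<epsilon>) \<omega>) * (\<Prod>i=2..j. G i \<beta> (\<xi> (take i \<epsilon>) \<omega>) / of_nat (N i))" .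
    have g1: "g 1 (\<xi> (take 1 \<epsilon>) \<omega>) = indicator {x..} (V (take 1 \<epsilon>) \<omega>) * exp (- \<beta> * of_real (s * V (take 1 \<epsilon>) \<omega>))"
      by (simp add: g_def first_term_def V_def)
    show "indicator {x..} (V (take 1 \<epsilon>) \<omega>) * exp (- \<beta> * of_real (s * V (take 1 \<epsilon>) \<omega>)) * (\<Prod>i=2..j. G i \<beta> (\<xi> (take i \<epsilon>) \<omega>) / of_nat (N i)) / of_nat (N (Suc j)) * (G (Suc j) \<beta> (\<xi> \<epsilon> \<omega>) - 1)
      = A \<epsilon> (restrict (\<lambda>\<eta>. \<xi> \<eta> \<omega>) J) * f \<epsilon> (\<xi> \<epsilon> \<omega>)"
      unfolding A_eq[OF \<epsilon>] f_def P g1 ..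
  qed
  have disj: "J \<inter> ?I = {}" unfolding J_def by (auto dest!: length_grem_level)
  have sub: "J \<union> ?I \<subseteq> (\<Union>j\<in>{1..d}. grem_level j N)"
    unfolding J_def using j by (intro Un_least UN_least UN_upper) auto
  have Am: "A \<epsilon> \<in> borel_measurable (PiM J (\<lambda>_. borel))" if \<epsilon>: "\<epsilon> \<in> ?I" for \<epsilon>
    unfolding A_def[abs_def]
  proof (intro borel_measurable_divide borel_measurable_prod borel_measurable_const)
    fix i assume i: "i \<in> {1..j}"
    have "(\<lambda>w. w (take i \<epsilon>)) \<in> measurable (PiM J (\<lambda>_. borel)) borel"
      using tJ[OF \<epsilon> i] by (rule measurable_component_singleton)
    then show "(\<lambda>w. g i (w (take i \<epsilon>))) \<in> borel_measurable (PiM J (\<lambda>_. borel))" by (rule measurable_compose[OF _ gm])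
  qed
  have fm: "f \<epsilon> \<in> borel_measurable borel" for \<epsilon>
    unfolding f_def[abs_def] using G_measurable by (intro borel_measurable_diff) auto
  define h where "h i y = norm (g i y) powr p" for i y
  have hm: "h i \<in> borel_measurable borel" for i unfolding h_def[abs_def] using gm[of i] by measurable
  have h_moment: "integrable M (\<lambda>\<omega>. h i (\<xi> (take i \<epsilon>) \<omega>))"
    "expectation (\<lambda>\<omega>. h i (\<xi> (take i \<epsilon>) \<omega>)) \<le> (if i = 1 then upper_moment p \<beta> x else mom p \<beta> i / real (N i) powr p)"
    if \<epsilon>: "\<epsilon> \<in> ?I" and i: "i \<in> {1..j}" for \<epsilon> i
  proof -
    have ti: "take i \<epsilon> \<in> grem_level i N" using take_grem_level[OF \<epsilon>, of i] i by simp
    have id: "i \<in> {1..d}" using i j by auto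
    have "integrable M (\<lambda>\<omega>. h i (\<xi> (take i \<epsilon>) \<omega>)) \<and> expectation (\<lambda>\<omega>. h i (\<xi> (take i \<epsilon>) \<omega>)) \<le> (if i = 1 then upper_moment p \<beta> x else mom p \<beta> i / real (N i) powr p)"
    proof (cases "i = 1")
      case True
      have "h i (\<xi> (take i \<epsilon>) \<omega>) = norm (indicator {x..} (V (take i \<epsilon>) \<omega>) * first_term \<beta> (V (take i \<epsilon>) \<omega>)) powr p" for \<omega>
        unfolding h_def g_def V_def using True by simp
      then show ?thesis using first_level_moment[OF _ \<kappa>, of "take i \<epsilon>" x] ti True by simp
    next
      case False
      have h: "h i y = norm (G i \<beta> y) powr p / real (N i) powr p" for y
        unfolding h_def g_def using False by (simp add: norm_divide powr_divide)
      show ?thesis unfolding h using moment_G[OF id ti, of \<beta> p] False by (simp add: mom_def)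
    qed
    then show "integrable M (\<lambda>\<omega>. h i (\<xi> (take i \<epsilon>) \<omega>))"
      "expectation (\<lambda>\<omega>. h i (\<xi> (take i \<epsilon>) \<omega>)) \<le> (if i = 1 then upper_moment p \<beta> x else mom p \<beta> i / real (N i) powr p)" by auto
  qed
  have normA: "norm (A \<epsilon> (restrict (\<lambda>\<eta>. \<xi> \<eta> \<omega>) J)) powr p = (\<Prod>i\<in>{1..j}. h i (\<xi> (take i \<epsilon>) \<omega>)) / real (N (Suc j)) powr p" if "\<epsilon> \<in> ?I" for \<epsilon> \<omega>
    unfolding A_eq[OF that] h_def by (simp add: norm_divide powr_divide prod_norm[symmetric] prod_powr_distrib)
  have pp: "integrable M (\<lambda>\<omega>. \<Prod>i\<in>{1..j}. h i (\<xi> (take i \<epsilon>) \<omega>))"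
    "expectation (\<lambda>\<omega>. \<Prod>i\<in>{1..j}. h i (\<xi> (take i \<epsilon>) \<omega>)) = (\<Prod>i\<in>{1..j}. expectation (\<lambda>\<omega>. h i (\<xi> (take i \<epsilon>) \<omega>)))" if "\<epsilon> \<in> ?I" for \<epsilon>
    using path_product[OF that j(2), of "{1..j}" h] hm h_moment(1)[OF that] j by auto
  have intA: "integrable M (\<lambda>\<omega>. norm (A \<epsilon> (restrict (\<lambda>\<eta>. \<xi> \<eta> \<omega>) J)) powr p)" if "\<epsilon> \<in> ?I" for \<epsilon>
    unfolding normA[OF that] using pp(1)[OF that] by (rule integrable_divide_zero)
  define bA where "bA = upper_moment p \<beta> x * (\<Prod>i=2..j. mom p \<beta> i / real (N i) powr p) / real (N (Suc j)) powr p"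
  have EA: "expectation (\<lambda>\<omega>. norm (A \<epsilon> (restrict (\<lambda>\<eta>. \<xi> \<eta> \<omega>) J)) powr p) \<le> bA" if \<epsilon>: "\<epsilon> \<in> ?I" for \<epsilon>
  proof -
    have "(\<Prod>i\<in>{1..j}. expectation (\<lambda>\<omega>. h i (\<xi> (take i \<epsilon>) \<omega>))) \<le> (\<Prod>i\<in>{1..j}. if i = 1 then upper_moment p \<beta> x else mom p \<beta> i / real (N i) powr p)"
      using h_moment(2)[OF \<epsilon>] by (intro prod_mono) (auto simp: h_def)
    also have "\<dots> = upper_moment p \<beta> x * (\<Prod>i=2..j. if i = 1 then upper_moment p \<beta> x else mom p \<beta> i / real (N i) powr p)"
      using prod_split_first[OF j(1), of "\<lambda>i. if i = 1 then upper_moment p \<beta> x else mom p \<beta> i / real (N i) powr p"] by simp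
    also have "(\<Prod>i=2..j. if i = 1 then upper_moment p \<beta> x else mom p \<beta> i / real (N i) powr p) = (\<Prod>i=2..j. mom p \<beta> i / real (N i) powr p)"
      by (intro prod.cong) auto
    finally show ?thesis unfolding normA[OF \<epsilon>] bA_def using pp(2)[OF \<epsilon>] by (simp add: divide_right_mono)
  qed
  have jd: "Suc j \<in> {1..d}" using j by simp
  define bf where "bf = 2 powr p * (mom p \<beta> (Suc j) + 1)"
  have f_moment: "integrable M (\<lambda>\<omega>. norm (f \<epsilon> (\<xi> \<epsilon> \<omega>)) powr p)" "expectation (\<lambda>\<omega>. norm (f \<epsilon> (\<xi> \<epsilon> \<omega>)) powr p) \<le> bf"
    "expectation (\<lambda>\<omega>. f \<epsilon> (\<xi> \<epsilon> \<omega>)) = 0" if \<epsilon>: "\<epsilon> \<in> ?I" for \<epsilon>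
  proof -
    note m = moment_G[OF jd \<epsilon>, of \<beta> p]
    have pw: "norm (f \<epsilon> y) powr p \<le> 2 powr p * (norm (G (Suc j) \<beta> y) powr p + 1)" for y
    proof -
      have "norm (f \<epsilon> y) powr p \<le> (norm (G (Suc j) \<beta> y) + 1) powr p"
        unfolding f_def using p norm_triangle_ineq4[of "G (Suc j) \<beta> y" 1] by (intro powr_mono2) auto
      also have "\<dots> \<le> 2 powr p * (norm (G (Suc j) \<beta> y) powr p + 1 powr p)" using p by (intro powr_add_le_two_powr) auto
      finally show ?thesis by simp
    qed
    have ib: "integrable M (\<lambda>\<omega>. 2 powr p * (norm (G (Suc j) \<beta> (\<xi> \<epsilon> \<omega>)) powr p + 1))" using m(1) by simp
    show i: "integrable M (\<lambda>\<omega>. norm (f \<epsilon> (\<xi> \<epsilon> \<omega>)) powr p)"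
    proof (rule Bochner_Integration.integrable_bound[OF ib])
      show "(\<lambda>\<omega>. norm (f \<epsilon> (\<xi> \<epsilon> \<omega>)) powr p) \<in> borel_measurable M"
        using measurable_compose[OF \<xi>_measurable[OF jd \<epsilon>] fm[of \<epsilon>]] by measurable
      show "AE \<omega> in M. norm (norm (f \<epsilon> (\<xi> \<epsilon> \<omega>)) powr p) \<le> norm (2 powr p * (norm (G (Suc j) \<beta> (\<xi> \<epsilon> \<omega>)) powr p + 1))"
        using pw by (intro AE_I2) simp
    qed
    have "expectation (\<lambda>\<omega>. norm (f \<epsilon> (\<xi> \<epsilon> \<omega>)) powr p) \<le> expectation (\<lambda>\<omega>. 2 powr p * (norm (G (Suc j) \<beta> (\<xi> \<epsilon> \<omega>)) powr p + 1))"
      by (rule integral_mono[OF i ib pw])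
    also have "\<dots> = bf" unfolding bf_def using m by (simp add: prob_space mom_def)
    finally show "expectation (\<lambda>\<omega>. norm (f \<epsilon> (\<xi> \<epsilon> \<omega>)) powr p) \<le> bf" .
    show "expectation (\<lambda>\<omega>. f \<epsilon> (\<xi> \<epsilon> \<omega>)) = 0"
      unfolding f_def using mean_G[OF jd \<epsilon>, of \<beta>] by (simp add: prob_space)
  qed
  note vBE = von_Bahr_Esseen[OF p indep_vars_subset[OF indep sub] finite_grem_level disj, of A f, OF Am fm intA f_moment(1) f_moment(3)]
  show "integrable M (\<lambda>\<omega>. norm (trunc_diff x j \<beta> \<omega>) powr p)" unfolding trunc_eq by (rule vBE(1))
  have b0: "0 \<le> upper_moment p \<beta> x" unfolding upper_moment_def using site_const_pos[OF u_pos] \<kappa> by simp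
  have bA0: "0 \<le> bA" unfolding bA_def
    by (intro divide_nonneg_nonneg mult_nonneg_nonneg prod_nonneg b0) (auto simp: mom_def)
  have "expectation (\<lambda>\<omega>. norm (trunc_diff x j \<beta> \<omega>) powr p)
      \<le> 6 * (\<Sum>\<epsilon>\<in>?I. expectation (\<lambda>\<omega>. norm (A \<epsilon> (restrict (\<lambda>\<eta>. \<xi> \<eta> \<omega>) J)) powr p) * expectation (\<lambda>\<omega>. norm (f \<epsilon> (\<xi> \<epsilon> \<omega>)) powr p))"
    unfolding trunc_eq by (rule vBE(2))
  also have "\<dots> \<le> 6 * (\<Sum>\<epsilon>\<in>?I. bA * bf)"
    using EA f_moment(2) bA0 by (intro mult_left_mono sum_mono mult_mono) auto
  also have "\<dots> = 6 * (real (card ?I) * (bA * bf))" by simp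
  also have "real (card ?I) = real (N 1) * (\<Prod>i=2..j. real (N i)) * real (N (Suc j))"
    unfolding card_grem_level using prod_split_first[OF j(1), of N] by (simp add: prod.nat_ivl_Suc')
  also have "real (N 1) * (\<Prod>i=2..j. real (N i)) * real (N (Suc j)) * (bA * bf)
      = (real (N 1) * upper_moment p \<beta> x) * ((\<Prod>i=2..j. real (N i)) * (\<Prod>i=2..j. mom p \<beta> i / real (N i) powr p)) * ((real (N (Suc j)) / real (N (Suc j)) powr p) * bf)"
    unfolding bA_def by (simp add: field_simps)
  also have "(\<Prod>i=2..j. real (N i)) * (\<Prod>i=2..j. mom p \<beta> i / real (N i) powr p) = (\<Prod>i=2..j. real (N i) powr (1 - p) * mom p \<beta> i)"
    unfolding prod.distrib[symmetric]
  proof (intro prod.cong refl)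
    fix i assume "i \<in> {2..j}"
    then have "0 < real (N i)" using N1[of i] j by simp
    then show "real (N i) * (mom p \<beta> i / real (N i) powr p) = real (N i) powr (1 - p) * mom p \<beta> i" by (simp add: powr_diff)
  qed
  also have "real (N (Suc j)) / real (N (Suc j)) powr p = real (N (Suc j)) powr (1 - p)"
    using N1[OF jd] by (simp add: powr_diff)
  finally show "expectation (\<lambda>\<omega>. norm (trunc_diff x j \<beta> \<omega>) powr p) \<le> 6 * ((real (N 1) * upper_moment p \<beta> x)
      * (\<Prod>i=2..j. real (N i) powr (1 - p) * mom p \<beta> i) * (2 powr p * (real (N (Suc j)) powr (1 - p) * (mom p \<beta> (Suc j) + 1))))"
    unfolding bf_def by (simp add: mult_ac)
qed

end

section \<open>Asymptotics of the normalization\<close>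

text \<open>Logarithms of N ~ sqrt(2 pi) u e^(u^2/2) give u^2 ~ 2 n ln \<alpha>, hence the limit of
  sqrt(n b)/u; for b = a_1 it is 1/\<sigma>_1. Positivity and divergence of \<open>u\<close> are
  deduced first from the growth of N.\<close>

lemma grem_asymptotics:
  fixes N :: "nat \<Rightarrow> nat" and u :: "nat \<Rightarrow> real" and \<alpha> b :: real
  assumes N: "(\<lambda>n. real (N n) / \<alpha> ^ n) \<longlonglongrightarrow> 1" and \<alpha>: "1 < \<alpha>" and b: "0 < b"
    and u: "(\<lambda>n. real (N n)) \<sim>[sequentially] (\<lambda>n. sqrt (2 * pi) * u n * exp ((u n)\<^sup>2 / 2))"
  shows "\<forall>\<^sub>F n in sequentially. 0 < u n" and "filterlim u at_top sequentially"
    and "(\<lambda>n. real (N n) * site_const (u n)) \<longlonglongrightarrow> 1"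
    and "(\<lambda>n. sqrt (real n * b) / u n) \<longlonglongrightarrow> 1 / sqrt (2 * ln \<alpha> / b)"
    and "filterlim N at_top sequentially"
proof -
  define R where "R n = sqrt (2 * pi) * u n * exp ((u n)\<^sup>2 / 2)" for n
  have pow: "filterlim (\<lambda>n. \<alpha> ^ n) at_top sequentially" using \<alpha> by real_asymp
  have "\<forall>\<^sub>F n in sequentially. 1/2 < real (N n) / \<alpha> ^ n" by (rule order_tendstoD(1)[OF N]) simp
  then have Nge: "\<forall>\<^sub>F n in sequentially. 1/2 * \<alpha> ^ n \<le> real (N n)"
    by eventually_elim (use \<alpha> in \<open>simp add: field_simps\<close>)
  have "filterlim (\<lambda>n. 1/2 * \<alpha> ^ n) at_top sequentially"
    by (rule filterlim_tendsto_pos_mult_at_top[OF tendsto_const _ pow]) simp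
  then have Ntop: "filterlim (\<lambda>n. real (N n)) at_top sequentially"
    using Nge by (rule filterlim_at_top_mono)
  then show "filterlim N at_top sequentially" by (simp add: filterlim_sequentially_iff_filterlim_real)
  have Npos: "\<forall>\<^sub>F n in sequentially. 0 < real (N n)" using Ntop unfolding filterlim_at_top_dense by blast
  have lim0: "(\<lambda>n. real (N n) / R n) \<longlonglongrightarrow> 1"
  proof (rule Lim_transform_eventually)
    show "(\<lambda>n. if real (N n) = 0 \<and> R n = 0 then 1 else real (N n) / R n) \<longlonglongrightarrow> 1"
      using u unfolding asymp_equiv_def R_def .
    show "\<forall>\<^sub>F n in sequentially. (if real (N n) = 0 \<and> R n = 0 then 1 else real (N n) / R n) = real (N n) / R n"
      using Npos by eventually_elim simp
  qed
  have cR: "real (N n) * site_const (u n) = real (N n) / R n" for n unfolding site_const_def R_def by simp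
  show "(\<lambda>n. real (N n) * site_const (u n)) \<longlonglongrightarrow> 1" unfolding cR by (rule lim0)
  have c0: "\<forall>\<^sub>F n in sequentially. 0 < real (N n) / R n" "\<forall>\<^sub>F n in sequentially. real (N n) / R n < 2"
    using lim0 by (auto intro: order_tendstoD)
  have Rpos: "\<forall>\<^sub>F n in sequentially. 0 < R n"
    using c0(1) Npos by eventually_elim (simp add: zero_less_divide_iff)
  then show upos: "\<forall>\<^sub>F n in sequentially. 0 < u n"
    by eventually_elim (simp add: R_def zero_less_mult_iff)
  show utop: "filterlim u at_top sequentially"
    unfolding filterlim_at_top_ge[of _ _ 0]
  proof (intro allI impI)
    fix Z :: real assume Z: "0 \<le> Z"
    have "\<forall>\<^sub>F n in sequentially. 2 * (sqrt (2 * pi) * Z * exp (Z\<^sup>2 / 2)) < real (N n)"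
      using Ntop unfolding filterlim_at_top_dense by blast
    then show "\<forall>\<^sub>F n in sequentially. Z \<le> u n" using c0(2) Rpos upos
    proof eventually_elim
      case (elim n)
      show ?case
      proof (rule ccontr)
        assume "\<not> Z \<le> u n"
        \<comment> \<open>A bounded \<open>u n\<close> would keep \<open>R n\<close> bounded,
          against N < 2R and the growth of N.\<close>
        then have "R n \<le> sqrt (2 * pi) * Z * exp (Z\<^sup>2 / 2)"
          unfolding R_def using elim(4) Z by (intro mult_mono) (auto intro: power_mono)
        moreover have "real (N n) < 2 * R n" using elim(2,3) by (simp add: field_simps)
        ultimately show False using elim(1) by linarith
      qed
    qed
  qed
  \<comment> \<open>The relative size of the logarithmic corrections: ln (R n) = (1 + e n) u^2 /
    2.\<close>
  define e where "e n = 2 * (ln (sqrt (2 * pi)) + ln (u n)) / (u n)\<^sup>2" for n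
  have e0: "e \<longlonglongrightarrow> 0"
  proof -
    have "((\<lambda>x::real. 2 * (ln (sqrt (2 * pi)) + ln x) / x\<^sup>2) \<longlongrightarrow> 0) at_top" by real_asymp
    from filterlim_compose[OF this utop] show ?thesis unfolding e_def .
  qed
  have lnN: "(\<lambda>n. ln (real (N n) / \<alpha> ^ n) * inverse (real n) + ln \<alpha>) \<longlonglongrightarrow> ln 1 * 0 + ln \<alpha>"
    by (intro tendsto_intros N lim_inverse_n) simp
  have lnc: "(\<lambda>n. ln (real (N n) / R n) * inverse (real n)) \<longlonglongrightarrow> ln 1 * 0"
    by (intro tendsto_intros lim0 lim_inverse_n) simp
  have "(\<lambda>n. 2 * ((ln (real (N n) / \<alpha> ^ n) * inverse (real n) + ln \<alpha>) - ln (real (N n) / R n) * inverse (real n)) / (1 + e n))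
      \<longlonglongrightarrow> 2 * ((ln 1 * 0 + ln \<alpha>) - ln 1 * 0) / (1 + 0)"
    by (intro tendsto_divide tendsto_mult[OF tendsto_const] tendsto_diff lnN lnc tendsto_add[OF tendsto_const] e0) simp
  then have lim1: "(\<lambda>n. 2 * ((ln (real (N n) / \<alpha> ^ n) * inverse (real n) + ln \<alpha>) - ln (real (N n) / R n) * inverse (real n)) / (1 + e n)) \<longlonglongrightarrow> 2 * ln \<alpha>"
    by simp
  have eme: "\<forall>\<^sub>F n in sequentially. -1/2 < e n" by (rule order_tendstoD(1)[OF e0]) simp
  have usq: "(\<lambda>n. (u n)\<^sup>2 / real n) \<longlonglongrightarrow> 2 * ln \<alpha>"
  proof (rule Lim_transform_eventually[OF lim1])
    show "\<forall>\<^sub>F n in sequentially. 2 * ((ln (real (N n) / \<alpha> ^ n) * inverse (real n) + ln \<alpha>) - ln (real (N n) / R n) * inverse (real n)) / (1 + e n) = (u n)\<^sup>2 / real n"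
      using upos Rpos Npos eventually_gt_at_top[of 0] eme
    proof eventually_elim
      case (elim n)
      have "ln (real (N n) / \<alpha> ^ n) = ln (real (N n)) - real n * ln \<alpha>" using elim \<alpha> by (simp add: ln_div ln_realpow)
      moreover have "ln (real (N n) / R n) = ln (real (N n)) - ln (R n)" using elim by (simp add: ln_div)
      moreover have "ln (R n) = ln (sqrt (2 * pi)) + ln (u n) + (u n)\<^sup>2 / 2"
      proof -
        have "sqrt (2 * pi) \<noteq> 0" by simp
        then show ?thesis unfolding R_def using elim by (simp add: ln_mult_pos)
      qed
      moreover have "ln (sqrt (2 * pi)) + ln (u n) = e n * (u n)\<^sup>2 / 2" unfolding e_def using elim by simp
      ultimately have "2 * ((ln (real (N n) / \<alpha> ^ n) * inverse (real n) + ln \<alpha>) - ln (real (N n) / R n) * inverse (real n)) = (u n)\<^sup>2 / real n * (1 + e n)"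
        using elim by (simp add: field_simps)
      then show ?case using elim by simp
    qed
  qed
  have ln0: "0 < ln \<alpha>" using \<alpha> by simp
  have lim: "(\<lambda>n. sqrt (b / ((u n)\<^sup>2 / real n))) \<longlonglongrightarrow> sqrt (b / (2 * ln \<alpha>))"
    using ln0 by (intro tendsto_intros usq) auto
  have ev: "\<forall>\<^sub>F n in sequentially. sqrt (b / ((u n)\<^sup>2 / real n)) = sqrt (real n * b) / u n"
    using upos eventually_gt_at_top[of 0]
  proof eventually_elim
    case (elim n)
    then show ?case by (simp add: real_sqrt_divide mult.commute)
  qed
  have "sqrt (b / (2 * ln \<alpha>)) = 1 / sqrt (2 * ln \<alpha> / b)" by (simp add: real_sqrt_divide)
  then show "(\<lambda>n. sqrt (real n * b) / u n) \<longlonglongrightarrow> 1 / sqrt (2 * ln \<alpha> / b)"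
    using Lim_transform_eventually[OF lim ev] by simp
qed

lemma distributed_integral_vector:
  fixes g :: "real \<Rightarrow> 'z::{banach,second_countable_topology}"
  assumes X: "distributed M lborel X (\<lambda>x. ennreal (f x))" and f: "f \<in> borel_measurable borel" "\<And>x. 0 \<le> f x"
    and g: "g \<in> borel_measurable borel"
  shows "(\<integral>\<omega>. g (X \<omega>) \<partial>M) = (\<integral>x. f x *\<^sub>R g x \<partial>lborel)"
proof -
  have Xm: "X \<in> measurable M lborel" using distributed_measurable[OF X] .
  have g': "g \<in> borel_measurable lborel" using g by simp
  have "(\<integral>\<omega>. g (X \<omega>) \<partial>M) = (\<integral>x. g x \<partial>distr M lborel X)" by (rule integral_distr[OF Xm g', symmetric])
  also have "\<dots> = (\<integral>x. f x *\<^sub>R g x \<partial>lborel)"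
    unfolding distributed_distr_eq_density[OF X] using f g' by (subst integral_density) auto
  finally show ?thesis .
qed

text \<open>The right end of the cell containing \<open>e\<^sup>v\<close>.\<close>

definition cell_end :: "nat \<Rightarrow> real \<Rightarrow> real" where
  "cell_end r v = real_of_int \<lceil>(real r)\<^sup>2 * exp v\<rceil> / (real r)\<^sup>2"

lemma cell_end_bounds:
  assumes "1 \<le> r" shows "exp v \<le> cell_end r v" "cell_end r v \<le> exp v + 1 / (real r)\<^sup>2"
proof -
  have r: "0 < (real r)\<^sup>2" using assms by simp
  have c: "(real r)\<^sup>2 * exp v \<le> real_of_int \<lceil>(real r)\<^sup>2 * exp v\<rceil>" "real_of_int \<lceil>(real r)\<^sup>2 * exp v\<rceil> \<le> (real r)\<^sup>2 * exp v + 1"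
    by linarith+
  show "exp v \<le> cell_end r v" unfolding cell_end_def using c(1) r by (simp add: pos_le_divide_eq mult.commute)
  have "cell_end r v \<le> ((real r)\<^sup>2 * exp v + 1) / (real r)\<^sup>2" unfolding cell_end_def using c(2) r by (intro divide_right_mono) auto
  also have "\<dots> = exp v + 1 / (real r)\<^sup>2" using r by (simp add: add_divide_distrib)
  finally show "cell_end r v \<le> exp v + 1 / (real r)\<^sup>2" .
qed

lemma cell_end_eq:
  assumes r: "1 \<le> r" and c: "exp v \<in> cell r i" shows "cell_end r v = real (Suc i) / (real r)\<^sup>2"
proof -
  have r0: "0 < (real r)\<^sup>2" using r by simp
  have "real i < (real r)\<^sup>2 * exp v" "(real r)\<^sup>2 * exp v \<le> real i + 1"
    using c r0 unfolding cell_def by (auto simp: pos_divide_less_eq pos_le_divide_eq mult.commute)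
  then have "\<lceil>(real r)\<^sup>2 * exp v\<rceil> = int i + 1" by linarith
  then show ?thesis unfolding cell_end_def by simp
qed

lemma cell_end_measurable [measurable]: "cell_end r \<in> borel_measurable borel"
  unfolding cell_end_def[abs_def] by measurable

section \<open>Splitting the normalized fluctuation into a cell approximation and an error\<close>

context grem
begin

text \<open>The error made on the points in [\<delta>, r] by moving them to the ends of their cells
  and replacing \<open>s\<close> by its limit.\<close>

definition mid :: "nat \<Rightarrow> real \<Rightarrow> real \<Rightarrow> complex \<Rightarrow> 'a \<Rightarrow> complex" where
  "mid r \<delta> s0 \<beta> \<omega> = (\<Sum>\<eta>\<in>grem_level 1 N. indicator {ln \<delta>..ln (real r)} (V \<eta> \<omega>)
     * (first_term \<beta> (V \<eta> \<omega>) - rpow (cell_end r (V \<eta> \<omega>)) (- (\<beta> * of_real s0))))"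

text \<open>The expected number of points below \<open>r\<close> is at most N times
  \<open>site_const\<close> times r, and each contributes at most the discretization error.\<close>

lemma mid_bound:
  assumes \<delta>: "0 < \<delta>" "\<delta> \<le> 1" and r: "1 \<le> r"
    and \<beta>: "0 \<le> Re \<beta> * s" "Re \<beta> * s \<le> 1" "0 \<le> Re \<beta> * s0" "Re \<beta> * s0 \<le> 1" and s0: "0 \<le> s0"
  shows "(\<integral>\<^sup>+\<omega>. norm (mid r \<delta> s0 \<beta> \<omega>) \<partial>M)
    \<le> ennreal (real (N 1) * site_const u * real r * (norm \<beta> / \<delta> * (\<bar>s - s0\<bar> * (1 / \<delta> + real r) + s0 * (1 / (real r)\<^sup>2 / \<delta>))))"
proof -
  let ?I = "grem_level 1 N"
  define K where "K = norm \<beta> / \<delta> * (\<bar>s - s0\<bar> * (1 / \<delta> + real r) + s0 * (1 / (real r)\<^sup>2 / \<delta>))"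
  have K: "0 \<le> K" unfolding K_def using \<delta> s0 by (intro mult_nonneg_nonneg add_nonneg_nonneg) auto
  have Vm: "V \<eta> \<in> borel_measurable M" if "\<eta> \<in> ?I" for \<eta> using V_measurable[of 1] d that by simp
  have pw: "norm (mid r \<delta> s0 \<beta> \<omega>) \<le> (\<Sum>\<eta>\<in>?I. K * indicator {..ln (real r)} (V \<eta> \<omega>))" for \<omega>
    unfolding mid_def
  proof (rule order_trans[OF norm_sum sum_mono])
    fix \<eta> assume "\<eta> \<in> ?I"
    show "norm (indicator {ln \<delta>..ln (real r)} (V \<eta> \<omega>) * (first_term \<beta> (V \<eta> \<omega>) - rpow (cell_end r (V \<eta> \<omega>)) (- (\<beta> * of_real s0))))
        \<le> K * indicator {..ln (real r)} (V \<eta> \<omega>)"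
    proof (cases "V \<eta> \<omega> \<in> {ln \<delta>..ln (real r)}")
      case True
      have "norm (first_term \<beta> (V \<eta> \<omega>) - rpow (cell_end r (V \<eta> \<omega>)) (- (\<beta> * of_real s0))) \<le> K"
        unfolding K_def first_term_def
        by (rule site_discretization_error[OF \<delta> _ _ _ cell_end_bounds[OF r] \<beta> s0]) (use True r in auto)
      then show ?thesis using True by simp
    next
      case False
      then show ?thesis using K by (auto simp: indicator_def)
    qed
  qed
  have "(\<integral>\<^sup>+\<omega>. norm (mid r \<delta> s0 \<beta> \<omega>) \<partial>M) \<le> (\<integral>\<^sup>+\<omega>. (\<Sum>\<eta>\<in>?I. ennreal K * indicator {..ln (real r)} (V \<eta> \<omega>)) \<partial>M)"
  proof (rule nn_integral_mono)
    fix \<omega>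
    have "ennreal (norm (mid r \<delta> s0 \<beta> \<omega>)) \<le> ennreal (\<Sum>\<eta>\<in>?I. K * indicator {..ln (real r)} (V \<eta> \<omega>))" by (rule ennreal_leI[OF pw])
    also have "\<dots> = (\<Sum>\<eta>\<in>?I. ennreal (K * indicator {..ln (real r)} (V \<eta> \<omega>)))" using K by (intro sum_ennreal[symmetric]) auto
    also have "\<dots> = (\<Sum>\<eta>\<in>?I. ennreal K * indicator {..ln (real r)} (V \<eta> \<omega>))"
      by (intro sum.cong refl) (auto simp: indicator_def)
    finally show "ennreal (norm (mid r \<delta> s0 \<beta> \<omega>)) \<le> (\<Sum>\<eta>\<in>?I. ennreal K * indicator {..ln (real r)} (V \<eta> \<omega>))" .
  qed
  also have "\<dots> = (\<Sum>\<eta>\<in>?I. \<integral>\<^sup>+\<omega>. ennreal K * indicator {..ln (real r)} (V \<eta> \<omega>) \<partial>M)"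
    using Vm by (intro nn_integral_sum) measurable
  also have "\<dots> = (\<Sum>\<eta>\<in>?I. ennreal K * (\<integral>\<^sup>+\<omega>. indicator {..ln (real r)} (V \<eta> \<omega>) \<partial>M))"
    using Vm by (intro sum.cong refl nn_integral_cmult) measurable
  also have "\<dots> \<le> (\<Sum>\<eta>\<in>?I. ennreal K * ennreal (site_const u * exp (ln (real r))))"
    by (intro sum_mono mult_left_mono site_lower_prob distributed_V u_pos) auto
  also have "\<dots> = ennreal (real (N 1) * site_const u * real r * K)"
    using K r site_const_pos[OF u_pos] by (simp add: card_grem_level ennreal_mult'[symmetric] ennreal_of_nat_eq_real_of_nat mult_ac)
  finally show ?thesis unfolding K_def .
qed

lemma low_points_prob:
  assumes \<delta>: "0 < \<delta>"
  shows "{\<omega>\<in>space M. \<exists>\<eta>\<in>grem_level 1 N. V \<eta> \<omega> < ln \<delta>} \<in> events"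
    and "prob {\<omega>\<in>space M. \<exists>\<eta>\<in>grem_level 1 N. V \<eta> \<omega> < ln \<delta>} \<le> real (N 1) * site_const u * \<delta>"
proof -
  let ?I = "grem_level 1 N"
  define B where "B \<eta> = {\<omega>\<in>space M. V \<eta> \<omega> \<le> ln \<delta>}" for \<eta>
  have Vm: "V \<eta> \<in> borel_measurable M" if "\<eta> \<in> ?I" for \<eta> using V_measurable[of 1] d that by simp
  have Bm: "B \<eta> \<in> events" if "\<eta> \<in> ?I" for \<eta> unfolding B_def using Vm[OF that] by measurable
  have lt: "{\<omega>\<in>space M. V \<eta> \<omega> < ln \<delta>} \<in> events" if "\<eta> \<in> ?I" for \<eta> using Vm[OF that] by measurable
  have "{\<omega>\<in>space M. \<exists>\<eta>\<in>?I. V \<eta> \<omega> < ln \<delta>} = (\<Union>\<eta>\<in>?I. {\<omega>\<in>space M. V \<eta> \<omega> < ln \<delta>})" by auto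
  also have "\<dots> \<in> events" using lt by (intro sets.finite_UN) auto
  finally show ev: "{\<omega>\<in>space M. \<exists>\<eta>\<in>?I. V \<eta> \<omega> < ln \<delta>} \<in> events" .
  have "prob {\<omega>\<in>space M. \<exists>\<eta>\<in>?I. V \<eta> \<omega> < ln \<delta>} \<le> prob (\<Union>\<eta>\<in>?I. B \<eta>)"
    using Bm by (intro finite_measure_mono sets.finite_UN) (auto simp: B_def intro: less_imp_le)
  also have "\<dots> \<le> (\<Sum>\<eta>\<in>?I. prob (B \<eta>))" using Bm by (intro finite_measure_subadditive_finite) auto
  also have "\<dots> \<le> (\<Sum>\<eta>\<in>?I. site_const u * \<delta>)"
  proof (rule sum_mono)
    fix \<eta> assume \<eta>: "\<eta> \<in> ?I"
    have "emeasure M (B \<eta>) = (\<integral>\<^sup>+\<omega>. indicator (B \<eta>) \<omega> \<partial>M)" using Bm[OF \<eta>] by simp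
    also have "\<dots> = (\<integral>\<^sup>+\<omega>. indicator {..ln \<delta>} (V \<eta> \<omega>) \<partial>M)"
      by (intro nn_integral_cong) (auto simp: B_def indicator_def)
    also have "\<dots> \<le> ennreal (site_const u * exp (ln \<delta>))" by (rule site_lower_prob[OF distributed_V[OF \<eta>] u_pos])
    finally show "prob (B \<eta>) \<le> site_const u * \<delta>"
      using \<delta> site_const_pos[OF u_pos] by (simp add: emeasure_eq_measure ennreal_le_iff)
  qed
  also have "\<dots> = real (N 1) * site_const u * \<delta>" by (simp add: card_grem_level)
  finally show "prob {\<omega>\<in>space M. \<exists>\<eta>\<in>?I. V \<eta> \<omega> < ln \<delta>} \<le> real (N 1) * site_const u * \<delta>" .
qed

definition cell_count :: "nat \<Rightarrow> 'a \<Rightarrow> nat \<Rightarrow> nat" where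
  "cell_count r \<omega> i = card {\<eta>\<in>grem_level 1 N. exp (V \<eta> \<omega>) \<in> cell r i}"

lemma cell_zeta_eq:
  assumes r: "1 \<le> r" and low: "\<And>\<eta>. \<eta> \<in> grem_level 1 N \<Longrightarrow> ln \<delta> \<le> V \<eta> \<omega>"
  shows "cell_zeta r (cell_count r \<omega>) z
    = (\<Sum>\<eta>\<in>grem_level 1 N. indicator {ln \<delta>..ln (real r)} (V \<eta> \<omega>) * rpow (cell_end r (V \<eta> \<omega>)) (- z)) - rpow r (1 - z) / (1 - z)"
proof -
  let ?I = "grem_level 1 N"
  define J where "J = {\<eta>\<in>?I. V \<eta> \<omega> \<le> ln (real r)}"
  have in_le: "V \<eta> \<omega> \<le> ln (real r)" if "exp (V \<eta> \<omega>) \<in> cell r i" "i < r^3" for \<eta> i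
  proof -
    have "exp (V \<eta> \<omega>) \<in> (\<Union>i<r^3. cell r i)" using that by blast
    also have "\<dots> = {0<..real r}" using r by (intro Union_cell) simp
    finally have "exp (V \<eta> \<omega>) \<in> {0<..real r}" .
    then show ?thesis using r by (simp add: ln_ge_iff)
  qed
  have "(\<Sum>i<r^3. of_nat (cell_count r \<omega> i) * rpow (real (Suc i) / (real r)\<^sup>2) (- z))
      = (\<Sum>i<r^3. of_nat (card {\<eta>\<in>J. exp (V \<eta> \<omega>) \<in> cell r i}) * rpow (real (Suc i) / (real r)\<^sup>2) (- z))"
  proof (intro sum.cong refl)
    fix i assume "i \<in> {..<r^3}"
    then have "{\<eta>\<in>?I. exp (V \<eta> \<omega>) \<in> cell r i} = {\<eta>\<in>J. exp (V \<eta> \<omega>) \<in> cell r i}" using in_le unfolding J_def by auto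
    then show "of_nat (cell_count r \<omega> i) * rpow (real (Suc i) / (real r)\<^sup>2) (- z)
      = of_nat (card {\<eta>\<in>J. exp (V \<eta> \<omega>) \<in> cell r i}) * rpow (real (Suc i) / (real r)\<^sup>2) (- z)"
      unfolding cell_count_def by (simp only:)
  qed
  also have "\<dots> = (\<Sum>\<eta>\<in>J. rpow (cell_end r (V \<eta> \<omega>)) (- z))"
  proof (rule sum_card_cells)
    show "finite J" unfolding J_def by simp
    show "0 < r" using r by simp
    show "0 < exp (V \<eta> \<omega>) \<and> exp (V \<eta> \<omega>) \<le> real r" if "\<eta> \<in> J" for \<eta>
      using that r unfolding J_def by (simp add: ln_ge_iff)
    show "rpow (cell_end r (V \<eta> \<omega>)) (- z) = rpow (real (Suc i) / (real r)\<^sup>2) (- z)" if "exp (V \<eta> \<omega>) \<in> cell r i" for \<eta> i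
      by (simp only: cell_end_eq[OF r that])
  qed
  also have "\<dots> = (\<Sum>\<eta>\<in>?I. indicator {ln \<delta>..ln (real r)} (V \<eta> \<omega>) * rpow (cell_end r (V \<eta> \<omega>)) (- z))"
    unfolding J_def using low by (intro sum.mono_neutral_cong_left) (auto simp: indicator_def)
  finally show ?thesis unfolding cell_zeta_def by simp
qed

text \<open>The mean of the first-level weight at one site, by
  \<open>mean_first_level\<close>.\<close>

definition first_mean :: "complex \<Rightarrow> complex" where
  "first_mean \<beta> = exp (\<beta>\<^sup>2 * of_real (a 1 * real n / 2)) / exp (\<beta> * of_real (sqrt (real n * a 1) * u))"

lemma expectation_partition:
  "expectation (\<lambda>\<omega>. grem_partition d a N \<xi> n \<beta> \<omega>) = (\<Prod>j=1..d. of_nat (N j) * exp (\<beta>\<^sup>2 * of_real (a j * real n / 2)))"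
proof -
  let ?h = "\<lambda>j x. exp (\<beta> * of_real (sqrt (real n * a j) * x))"
  have hm: "?h j \<in> borel_measurable borel" for j
    by (intro borel_measurable_continuous_onI continuous_intros)
  have h: "integrable M (\<lambda>\<omega>. ?h j (\<xi> (take j \<epsilon>) \<omega>))" "expectation (\<lambda>\<omega>. ?h j (\<xi> (take j \<epsilon>) \<omega>)) = exp (\<beta>\<^sup>2 * of_real (a j * real n / 2))"
    if \<epsilon>: "\<epsilon> \<in> grem_level d N" and j: "j \<in> {1..d}" for \<epsilon> j
  proof -
    have "take j \<epsilon> \<in> grem_level j N" using take_grem_level[OF \<epsilon>, of j] j by simp
    then have X: "distributed M lborel (\<xi> (take j \<epsilon>)) std_normal_density" using normal j by blast
    note * = complex_mgf_std_normal[OF X, of "\<beta> * of_real (sqrt (real n * a j))"]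
    have eq: "?h j x = exp (\<beta> * of_real (sqrt (real n * a j)) * of_real x)" for x by (simp add: mult.assoc)
    show "integrable M (\<lambda>\<omega>. ?h j (\<xi> (take j \<epsilon>) \<omega>))" unfolding eq by (rule *(1))
    have "0 \<le> real n * a j" using a_pos[OF j] by simp
    then have sq: "(\<beta> * of_real (sqrt (real n * a j)))\<^sup>2 / 2 = \<beta>\<^sup>2 * of_real (a j * real n / 2)"
      by (simp add: power_mult_distrib of_real_power[symmetric] del: of_real_power)
    show "expectation (\<lambda>\<omega>. ?h j (\<xi> (take j \<epsilon>) \<omega>)) = exp (\<beta>\<^sup>2 * of_real (a j * real n / 2))"
      unfolding eq *(2) sq ..
  qed
  have pp: "integrable M (\<lambda>\<omega>. \<Prod>j=1..d. ?h j (\<xi> (take j \<epsilon>) \<omega>))"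
    "expectation (\<lambda>\<omega>. \<Prod>j=1..d. ?h j (\<xi> (take j \<epsilon>) \<omega>)) = (\<Prod>j=1..d. exp (\<beta>\<^sup>2 * of_real (a j * real n / 2)))"
    if \<epsilon>: "\<epsilon> \<in> grem_level d N" for \<epsilon>
  proof -
    show "integrable M (\<lambda>\<omega>. \<Prod>j=1..d. ?h j (\<xi> (take j \<epsilon>) \<omega>))"
      by (rule path_product(1)[OF \<epsilon> order_refl subset_refl]) (use hm h(1)[OF \<epsilon>] in auto)
    have "expectation (\<lambda>\<omega>. \<Prod>j=1..d. ?h j (\<xi> (take j \<epsilon>) \<omega>)) = (\<Prod>j=1..d. expectation (\<lambda>\<omega>. ?h j (\<xi> (take j \<epsilon>) \<omega>)))"
      by (rule path_product(2)[OF \<epsilon> order_refl subset_refl]) (use hm h(1)[OF \<epsilon>] in auto)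
    also have "\<dots> = (\<Prod>j=1..d. exp (\<beta>\<^sup>2 * of_real (a j * real n / 2)))" by (intro prod.cong refl h(2)[OF \<epsilon>])
    finally show "expectation (\<lambda>\<omega>. \<Prod>j=1..d. ?h j (\<xi> (take j \<epsilon>) \<omega>)) = (\<Prod>j=1..d. exp (\<beta>\<^sup>2 * of_real (a j * real n / 2)))" .
  qed
  have "expectation (\<lambda>\<omega>. grem_partition d a N \<xi> n \<beta> \<omega>) = expectation (\<lambda>\<omega>. \<Sum>\<epsilon>\<in>grem_level d N. \<Prod>j=1..d. ?h j (\<xi> (take j \<epsilon>) \<omega>))"
    unfolding grem_partition_def by (intro Bochner_Integration.integral_cong refl sum.cong exp_field)
  also have "\<dots> = (\<Sum>\<epsilon>\<in>grem_level d N. \<Prod>j=1..d. exp (\<beta>\<^sup>2 * of_real (a j * real n / 2)))"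
    using pp by (subst Bochner_Integration.integral_sum) auto
  also have "\<dots> = of_nat (card (grem_level d N)) * (\<Prod>j=1..d. exp (\<beta>\<^sup>2 * of_real (a j * real n / 2)))" by simp
  also have "\<dots> = (\<Prod>j=1..d. of_nat (N j) * exp (\<beta>\<^sup>2 * of_real (a j * real n / 2)))"
    unfolding card_grem_level by (simp only: of_nat_prod prod.distrib)
  finally show ?thesis .
qed

lemma normalized_expectation:
  "expectation (\<lambda>\<omega>. grem_partition d a N \<xi> n \<beta> \<omega>) / exp (\<beta> * of_real (sqrt (real n * a 1) * u) + grem_c_tilde d a N n \<beta>)
    = of_nat (N 1) * first_mean \<beta>"
proof -
  let ?P = "\<Prod>i=2..d. of_nat (N i) * exp (\<beta>\<^sup>2 * of_real (a i * real n / 2))"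
  have P0: "?P \<noteq> 0" using N_pos by auto
  have "(\<Prod>j=1..d. of_nat (N j) * exp (\<beta>\<^sup>2 * of_real (a j * real n / 2))) = of_nat (N 1) * exp (\<beta>\<^sup>2 * of_real (a 1 * real n / 2)) * ?P"
    by (rule prod_split_first[OF d])
  moreover have "x * P / (e * P) = x / e" if "P \<noteq> 0" for x P e :: complex using that by simp
  ultimately show ?thesis unfolding expectation_partition norm_const first_mean_def using P0
    by (simp only: times_divide_eq_right not_False_eq_True)
qed

text \<open>The centring enters through the closed form \<open>first_mean\<close>, which makes
  holomorphy in \<beta> and joint measurability evident, as Cauchy's formula and Fubini's theorem
  require. The form suited to estimates is \<open>err_split\<close>.\<close>

definition err :: "nat \<Rightarrow> real \<Rightarrow> real \<Rightarrow> complex \<Rightarrow> 'a \<Rightarrow> complex" where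
  "err r \<delta> s0 \<beta> \<omega> = (\<Sum>\<eta>\<in>grem_level 1 N. indicator {ln (real r)<..} (V \<eta> \<omega>) * first_term \<beta> (V \<eta> \<omega>)) + mid r \<delta> s0 \<beta> \<omega>
     + rpow r (1 - \<beta> * of_real s0) / (1 - \<beta> * of_real s0) - of_nat (N 1) * first_mean \<beta>
     + (\<Sum>j=1..<d. trunc_diff (ln \<delta>) j \<beta> \<omega>)"

text \<open>The mean contribution of the points below \<open>r\<close> minus its limit, the integral
  of t^(-z) over (0, r] with z = \<beta> s0.\<close>

definition compensator_gap :: "nat \<Rightarrow> real \<Rightarrow> complex \<Rightarrow> complex" where
  "compensator_gap r s0 \<beta> = of_real (real (N 1) * site_const u)
     * (\<integral>v. indicator {..ln (real r)} v *\<^sub>R (of_real (exp (v - v\<^sup>2 / (2 * u\<^sup>2))) * exp (- \<beta> * of_real (s * v))) \<partial>lborel)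
     - exp ((1 - \<beta> * of_real s0) * of_real (ln (real r))) / (1 - \<beta> * of_real s0)"

text \<open>The difference telescopes over the levels. That no point lies below \<delta> is
  essential: \<open>err\<close> omits such points, whereas the partition function and the cell
  counts include them.\<close>

lemma normalized_eq_err:
  assumes r: "1 \<le> r" and \<delta>: "ln \<delta> \<le> ln (real r)" and low: "\<And>\<eta>. \<eta> \<in> grem_level 1 N \<Longrightarrow> ln \<delta> \<le> V \<eta> \<omega>"
  shows "(grem_partition d a N \<xi> n \<beta> \<omega> - expectation (\<lambda>\<omega>. grem_partition d a N \<xi> n \<beta> \<omega>)) / exp (\<beta> * of_real (sqrt (real n * a 1) * u) + grem_c_tilde d a N n \<beta>)
     - cell_zeta r (cell_count r \<omega>) (\<beta> * of_real s0) = err r \<delta> s0 \<beta> \<omega>"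
proof -
  let ?I = "grem_level 1 N"
  have "level_sum d \<beta> \<omega> - level_sum 1 \<beta> \<omega> = (\<Sum>j=1..<d. level_sum (Suc j) \<beta> \<omega> - level_sum j \<beta> \<omega>)"
    using sum_Suc_diff'[OF d, of "\<lambda>j. level_sum j \<beta> \<omega>"] by simp
  also have "\<dots> = (\<Sum>j=1..<d. trunc_diff (ln \<delta>) j \<beta> \<omega>)"
    by (intro sum.cong refl level_sum_diff low) auto
  finally have tele: "level_sum d \<beta> \<omega> = level_sum 1 \<beta> \<omega> + (\<Sum>j=1..<d. trunc_diff (ln \<delta>) j \<beta> \<omega>)" by (simp add: algebra_simps)
  have "level_sum 1 \<beta> \<omega> = (\<Sum>\<eta>\<in>?I. first_term \<beta> (V \<eta> \<omega>))"
    unfolding level_sum_def first_term_def by (intro sum.cong refl) (simp add: length_grem_level)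
  also have "\<dots> = (\<Sum>\<eta>\<in>?I. indicator {ln (real r)<..} (V \<eta> \<omega>) * first_term \<beta> (V \<eta> \<omega>) + indicator {ln \<delta>..ln (real r)} (V \<eta> \<omega>) * first_term \<beta> (V \<eta> \<omega>))"
  proof (intro sum.cong refl)
    fix \<eta> assume "\<eta> \<in> ?I"
    from low[OF this] show "first_term \<beta> (V \<eta> \<omega>) = indicator {ln (real r)<..} (V \<eta> \<omega>) * first_term \<beta> (V \<eta> \<omega>) + indicator {ln \<delta>..ln (real r)} (V \<eta> \<omega>) * first_term \<beta> (V \<eta> \<omega>)"
      by (simp add: indicator_def)
  qed
  finally have l1: "level_sum 1 \<beta> \<omega> = (\<Sum>\<eta>\<in>?I. indicator {ln (real r)<..} (V \<eta> \<omega>) * first_term \<beta> (V \<eta> \<omega>)) + (\<Sum>\<eta>\<in>?I. indicator {ln \<delta>..ln (real r)} (V \<eta> \<omega>) * first_term \<beta> (V \<eta> \<omega>))"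
    by (simp only: sum.distrib)
  have cz: "cell_zeta r (cell_count r \<omega>) (\<beta> * of_real s0)
    = (\<Sum>\<eta>\<in>?I. indicator {ln \<delta>..ln (real r)} (V \<eta> \<omega>) * rpow (cell_end r (V \<eta> \<omega>)) (- (\<beta> * of_real s0))) - rpow r (1 - \<beta> * of_real s0) / (1 - \<beta> * of_real s0)"
    by (rule cell_zeta_eq[OF r low])
  show ?thesis
    unfolding diff_divide_distrib partition_eq_level_sum normalized_expectation tele l1 cz err_def mid_def
    by (simp only: right_diff_distrib sum_subtractf) (simp only: algebra_simps)
qed

lemma err_split:
  assumes r: "1 \<le> r"
  shows "err r \<delta> s0 \<beta> \<omega> = tail (ln (real r)) \<beta> \<omega> + mid r \<delta> s0 \<beta> \<omega> - compensator_gap r s0 \<beta> + (\<Sum>j=1..<d. trunc_diff (ln \<delta>) j \<beta> \<omega>)"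
proof -
  let ?I = "grem_level 1 N" and ?y = "ln (real r)"
  \<comment> \<open>The full mean at a site is the mean above \<open>r\<close>, which centres the
    tail, plus the mean below, which is compared with the limiting compensator.\<close>
  have split: "expectation (\<lambda>\<omega>. indicator {?y<..} (V \<eta> \<omega>) * first_term \<beta> (V \<eta> \<omega>)) + of_real (site_const u) * (\<integral>v. indicator {..?y} v *\<^sub>R (of_real (exp (v - v\<^sup>2 / (2 * u\<^sup>2))) * exp (- \<beta> * of_real (s * v))) \<partial>lborel) = first_mean \<beta>"
    if \<eta>: "\<eta> \<in> ?I" for \<eta>
  proof -
    have Vm: "V \<eta> \<in> borel_measurable M" using V_measurable[of 1] d \<eta> by simp
    note mf = mean_first_level[OF \<eta>, of \<beta>, folded first_term_def first_mean_def]
    have fV: "(\<lambda>\<omega>. first_term \<beta> (V \<eta> \<omega>)) \<in> borel_measurable M" by (rule measurable_compose[OF Vm first_term_measurable])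
    have i1: "integrable M (\<lambda>\<omega>. indicator {?y<..} (V \<eta> \<omega>) * first_term \<beta> (V \<eta> \<omega>))"
      by (rule Bochner_Integration.integrable_bound[OF mf(1)]) (use Vm fV in \<open>auto simp: indicator_def\<close>)
    have i2: "integrable M (\<lambda>\<omega>. indicator {..?y} (V \<eta> \<omega>) * first_term \<beta> (V \<eta> \<omega>))"
      by (rule Bochner_Integration.integrable_bound[OF mf(1)]) (use Vm fV in \<open>auto simp: indicator_def\<close>)
    have "first_mean \<beta> = expectation (\<lambda>\<omega>. indicator {?y<..} (V \<eta> \<omega>) * first_term \<beta> (V \<eta> \<omega>) + indicator {..?y} (V \<eta> \<omega>) * first_term \<beta> (V \<eta> \<omega>))"
      unfolding mf(2)[symmetric] by (intro Bochner_Integration.integral_cong refl) (auto simp: indicator_def)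
    also have "\<dots> = expectation (\<lambda>\<omega>. indicator {?y<..} (V \<eta> \<omega>) * first_term \<beta> (V \<eta> \<omega>)) + expectation (\<lambda>\<omega>. indicator {..?y} (V \<eta> \<omega>) * first_term \<beta> (V \<eta> \<omega>))"
      by (rule Bochner_Integration.integral_add[OF i1 i2])
    also have "expectation (\<lambda>\<omega>. indicator {..?y} (V \<eta> \<omega>) * first_term \<beta> (V \<eta> \<omega>)) = (\<integral>v. site_density u v *\<^sub>R (indicator {..?y} v * first_term \<beta> v) \<partial>lborel)"
    proof (rule distributed_integral_vector[OF distributed_V[OF \<eta>] site_density_measurable site_density_nonneg[OF u_pos]])
      show "(\<lambda>v. indicator {..?y} v * first_term \<beta> v) \<in> borel_measurable borel" using first_term_measurable by measurable
    qed
    also have "\<dots> = (\<integral>v. of_real (site_const u) * (indicator {..?y} v *\<^sub>R (of_real (exp (v - v\<^sup>2 / (2 * u\<^sup>2))) * exp (- \<beta> * of_real (s * v)))) \<partial>lborel)"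
      by (intro Bochner_Integration.integral_cong refl) (simp add: site_density_def first_term_def scaleR_conv_of_real indicator_def mult_ac)
    also have "\<dots> = of_real (site_const u) * (\<integral>v. indicator {..?y} v *\<^sub>R (of_real (exp (v - v\<^sup>2 / (2 * u\<^sup>2))) * exp (- \<beta> * of_real (s * v))) \<partial>lborel)"
      by (rule integral_mult_right_zero)
    finally show ?thesis by simp
  qed
  define T where "T = (\<integral>v. indicator {..?y} v *\<^sub>R (of_real (exp (v - v\<^sup>2 / (2 * u\<^sup>2))) * exp (- \<beta> * of_real (s * v))) \<partial>lborel)"
  have "(\<Sum>\<eta>\<in>?I. expectation (\<lambda>\<omega>. indicator {?y<..} (V \<eta> \<omega>) * first_term \<beta> (V \<eta> \<omega>))) = (\<Sum>\<eta>\<in>?I. first_mean \<beta> - of_real (site_const u) * T)"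
    unfolding T_def by (intro sum.cong refl) (simp only: eq_diff_eq split)
  also have "\<dots> = of_nat (N 1) * first_mean \<beta> - of_real (real (N 1) * site_const u) * T"
    by (simp add: card_grem_level right_diff_distrib mult.assoc)
  finally have S: "(\<Sum>\<eta>\<in>?I. expectation (\<lambda>\<omega>. indicator {?y<..} (V \<eta> \<omega>) * first_term \<beta> (V \<eta> \<omega>))) = of_nat (N 1) * first_mean \<beta> - of_real (real (N 1) * site_const u) * T" .
  show ?thesis
    unfolding err_def tail_def sum_subtractf S compensator_gap_def T_def[symmetric] rpow_def by (simp only: algebra_simps)
qed

lemma holomorphic_err:
  assumes "\<And>\<beta>. \<beta> \<in> S \<Longrightarrow> \<beta> * of_real s0 \<noteq> 1"
  shows "(\<lambda>\<beta>. err r \<delta> s0 \<beta> \<omega>) holomorphic_on S"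
proof -
  have "1 - \<beta> * of_real s0 \<noteq> 0" if "\<beta> \<in> S" for \<beta> using assms[OF that] by auto
  note nz = this
  have ft: "(\<lambda>\<beta>. first_term \<beta> v) holomorphic_on S" for v
    unfolding first_term_def by (intro holomorphic_intros)
  have G: "(\<lambda>\<beta>. G i \<beta> x) holomorphic_on S" for i x
    unfolding G_def by (intro holomorphic_intros)
  have rp: "(\<lambda>\<beta>. rpow q (- (\<beta> * of_real s0))) holomorphic_on S" "(\<lambda>\<beta>. rpow q (1 - \<beta> * of_real s0)) holomorphic_on S" for q
    by (intro holomorphic_intros)+
  have fm: "first_mean holomorphic_on S"
    unfolding first_mean_def[abs_def] by (intro holomorphic_intros) auto
  have td: "(\<lambda>\<beta>. trunc_diff y j \<beta> \<omega>) holomorphic_on S" if j: "j \<in> {1..<d}" for y j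
    unfolding trunc_diff_def first_term_def[symmetric]
  proof (intro holomorphic_on_sum holomorphic_on_mult)
    have "of_nat (N i) \<noteq> (0::complex)" if "i \<in> {1..Suc j}" for i using N_pos[of i] that j by simp
    note N0 = this
    fix \<epsilon>
    have "(\<lambda>\<beta>. \<Prod>i=2..j. G i \<beta> (\<xi> (take i \<epsilon>) \<omega>) / of_nat (N i)) holomorphic_on S"
      by (rule holomorphic_on_prod, rule holomorphic_on_divide[OF G holomorphic_on_const]) (use N0 in auto)
    then show "(\<lambda>\<beta>. indicator {y..} (V (take 1 \<epsilon>) \<omega>) * first_term \<beta> (V (take 1 \<epsilon>) \<omega>) * (\<Prod>i=2..j. G i \<beta> (\<xi> (take i \<epsilon>) \<omega>) / of_nat (N i)) / of_nat (N (Suc j))) holomorphic_on S"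
      by (rule holomorphic_on_divide[OF holomorphic_on_mult[OF holomorphic_on_mult[OF holomorphic_on_const ft]] holomorphic_on_const])
        (use N0 in auto)
    show "(\<lambda>\<beta>. G (Suc j) \<beta> (\<xi> \<epsilon> \<omega>) - 1) holomorphic_on S"
      by (rule holomorphic_on_diff[OF G holomorphic_on_const])
  qed
  have md: "(\<lambda>\<beta>. mid r \<delta> s0 \<beta> \<omega>) holomorphic_on S"
    unfolding mid_def
    by (rule holomorphic_on_sum, rule holomorphic_on_mult[OF holomorphic_on_const], rule holomorphic_on_diff[OF ft rp(1)])
  have sm: "(\<lambda>\<beta>. \<Sum>\<eta>\<in>grem_level 1 N. indicator {ln (real r)<..} (V \<eta> \<omega>) * first_term \<beta> (V \<eta> \<omega>)) holomorphic_on S"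
    by (rule holomorphic_on_sum, rule holomorphic_on_mult[OF holomorphic_on_const ft])
  have ds: "(\<lambda>\<beta>. rpow r (1 - \<beta> * of_real s0) / (1 - \<beta> * of_real s0)) holomorphic_on S"
    by (rule holomorphic_on_divide[OF rp(2)]) (use nz in \<open>auto intro!: holomorphic_intros\<close>)
  show ?thesis
    unfolding err_def
    by (rule holomorphic_on_add[OF holomorphic_on_diff[OF holomorphic_on_add[OF holomorphic_on_add[OF sm md] ds]
            holomorphic_on_mult[OF holomorphic_on_const fm]] holomorphic_on_sum[OF td]])
qed

lemma err_measurable:
  "(\<lambda>(\<beta>, \<omega>). err r \<delta> s0 \<beta> \<omega>) \<in> borel_measurable (borel \<Otimes>\<^sub>M M)"
proof -
  have exp_m: "exp \<in> borel_measurable (borel :: complex measure)"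
    by (intro borel_measurable_continuous_onI continuous_intros)
  have Vm: "(\<lambda>x. V \<eta> (snd x)) \<in> borel_measurable (borel \<Otimes>\<^sub>M M)" if "\<eta> \<in> grem_level 1 N" for \<eta> and borel' :: "complex measure"
    using V_measurable[of 1 \<eta>] d that by (intro measurable_compose[OF measurable_snd]) auto
  have e: "(\<lambda>x. exp (f x)) \<in> borel_measurable (borel \<Otimes>\<^sub>M M)" if "f \<in> borel_measurable (borel \<Otimes>\<^sub>M M)" for f :: "complex \<times> 'a \<Rightarrow> complex"
    using measurable_compose[OF that exp_m] .
  have b: "fst \<in> borel_measurable ((borel :: complex measure) \<Otimes>\<^sub>M M)" by simp
  have re: "(\<lambda>x. complex_of_real (f x)) \<in> borel_measurable (borel \<Otimes>\<^sub>M M)" if "f \<in> borel_measurable (borel \<Otimes>\<^sub>M M)" for f :: "complex \<times> 'a \<Rightarrow> real"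
    using that by simp
  have xm: "(\<lambda>x. \<xi> \<eta> (snd x)) \<in> borel_measurable ((borel :: complex measure) \<Otimes>\<^sub>M M)" if "j \<in> {1..d}" "\<eta> \<in> grem_level j N" for j \<eta>
    using \<xi>_measurable[OF that] by (intro measurable_compose[OF measurable_snd])
  have ft: "(\<lambda>x. first_term (fst x) (V \<eta> (snd x))) \<in> borel_measurable (borel \<Otimes>\<^sub>M M)" if "\<eta> \<in> grem_level 1 N" for \<eta>
    unfolding first_term_def using Vm[OF that] b by (intro e borel_measurable_times borel_measurable_uminus re borel_measurable_const)
  have ind: "(\<lambda>x. indicator A (V \<eta> (snd x)) :: complex) \<in> borel_measurable ((borel :: complex measure) \<Otimes>\<^sub>M M)" if "\<eta> \<in> grem_level 1 N" "A \<in> sets borel" for \<eta> A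
    using measurable_compose[OF Vm[OF that(1)], of "indicator A" borel] that(2) by simp
  have Gm: "(\<lambda>x. G i (fst x) (\<xi> \<eta> (snd x))) \<in> borel_measurable (borel \<Otimes>\<^sub>M M)" if "j \<in> {1..d}" "\<eta> \<in> grem_level j N" for i j \<eta>
    unfolding G_def using xm[OF that] b
    by (intro e borel_measurable_diff borel_measurable_times borel_measurable_power re borel_measurable_const)
  have ce: "(\<lambda>x. rpow (cell_end r (V \<eta> (snd x))) (- (fst x * of_real s0))) \<in> borel_measurable (borel \<Otimes>\<^sub>M M)" if "\<eta> \<in> grem_level 1 N" for \<eta>
  proof -
    have "(\<lambda>x. ln (cell_end r (V \<eta> (snd x)))) \<in> borel_measurable (borel \<Otimes>\<^sub>M M)" using Vm[OF that] by measurable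
    then show ?thesis unfolding rpow_def using b
      by (intro e borel_measurable_times borel_measurable_uminus re borel_measurable_const)
  qed
  have td: "(\<lambda>x. trunc_diff y j (fst x) (snd x)) \<in> borel_measurable (borel \<Otimes>\<^sub>M M)" if j: "j \<in> {1..<d}" for y j
    unfolding trunc_diff_def
  proof (intro borel_measurable_sum borel_measurable_times borel_measurable_divide borel_measurable_diff borel_measurable_prod borel_measurable_const)
    fix \<epsilon> assume \<epsilon>: "\<epsilon> \<in> grem_level (Suc j) N"
    have t: "take 1 \<epsilon> \<in> grem_level 1 N" using take_grem_level[OF \<epsilon>, of 1] by simp
    show "(\<lambda>x. indicator {y..} (V (take 1 \<epsilon>) (snd x)) :: complex) \<in> borel_measurable ((borel :: complex measure) \<Otimes>\<^sub>M M)"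
      by (rule ind[OF t]) simp
    show "(\<lambda>x. exp (- fst x * complex_of_real (s * V (take 1 \<epsilon>) (snd x)))) \<in> borel_measurable (borel \<Otimes>\<^sub>M M)"
      using ft[OF t] unfolding first_term_def .
    show "(\<lambda>x. G (Suc j) (fst x) (\<xi> \<epsilon> (snd x))) \<in> borel_measurable (borel \<Otimes>\<^sub>M M)" using j \<epsilon> by (intro Gm[of "Suc j"]) auto
    fix i assume i: "i \<in> {2..j}"
    show "(\<lambda>x. G i (fst x) (\<xi> (take i \<epsilon>) (snd x))) \<in> borel_measurable (borel \<Otimes>\<^sub>M M)"
      using i j take_grem_level[OF \<epsilon>, of i] by (intro Gm[of i]) auto
  qed
  show ?thesis
    unfolding case_prod_unfold err_def mid_def first_mean_def rpow_def[of "real r"]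
    by (intro borel_measurable_add borel_measurable_diff borel_measurable_sum borel_measurable_times borel_measurable_divide
        borel_measurable_power borel_measurable_const b e ft ind ce td) auto
qed

section \<open>Law of the first-level counts\<close>

definition cell_prob :: "nat \<Rightarrow> nat \<Rightarrow> real" where
  "cell_prob r i = site_const u * (\<integral>v. indicator (cell r i) (exp v) * exp (v - v\<^sup>2 / (2 * u\<^sup>2)) \<partial>lborel)"

lemma indep_V: "indep_vars (\<lambda>_. borel) V (grem_level 1 N)"
proof -
  have "grem_level 1 N \<subseteq> (\<Union>j\<in>{1..d}. grem_level j N)" using d by (intro UN_upper) auto
  from indep_vars_compose2[OF indep_vars_subset[OF indep this], of "\<lambda>_ x. - u * (x - u)" "\<lambda>_. borel"]
  show ?thesis unfolding V_def[abs_def] by simp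
qed

lemma cell_count_pmf:
  assumes r: "1 \<le> r" and c: "(\<Sum>i<r^3. c i) \<le> N 1"
  shows "prob {\<omega>\<in>space M. \<forall>i<r^3. cell_count r \<omega> i = c i} =
     fact (N 1) / (fact (N 1 - (\<Sum>i<r^3. c i)) * (\<Prod>i<r^3. fact (c i))) *
     ((\<Prod>i<r^3. cell_prob r i ^ c i) * (1 - (\<Sum>i<r^3. cell_prob r i)) ^ (N 1 - (\<Sum>i<r^3. c i)))"
proof -
  define A where "A i = {v::real. exp v \<in> cell r i}" for i
  have Am: "A i \<in> sets borel" for i
  proof -
    have "exp -` cell r i \<inter> space borel \<in> sets (borel :: real measure)"
      by (rule measurable_sets[of exp borel borel]) (auto simp: cell_def)
    then show ?thesis unfolding A_def vimage_def by simp
  qed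
  have q: "prob {\<omega>\<in>space M. V \<eta> \<omega> \<in> A i} = cell_prob r i" if \<eta>: "\<eta> \<in> grem_level 1 N" for \<eta> i
  proof -
    have Vm: "V \<eta> \<in> borel_measurable M" using V_measurable[of 1] d \<eta> by simp
    have ev: "{\<omega>\<in>space M. V \<eta> \<omega> \<in> A i} \<in> events"
      using measurable_sets[OF Vm Am[of i]] by (simp add: vimage_def Int_def conj_commute)
    have "prob {\<omega>\<in>space M. V \<eta> \<omega> \<in> A i} = expectation (\<lambda>\<omega>. indicator {\<omega>\<in>space M. V \<eta> \<omega> \<in> A i} \<omega>)" using ev by simp
    also have "\<dots> = expectation (\<lambda>\<omega>. indicator (A i) (V \<eta> \<omega>))"
      by (intro Bochner_Integration.integral_cong refl) (auto simp: indicator_def)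
    also have "\<dots> = (\<integral>v. site_density u v *\<^sub>R indicator (A i) v \<partial>lborel)"
      by (rule distributed_integral_vector[OF distributed_V[OF \<eta>] site_density_measurable site_density_nonneg[OF u_pos]]) (use Am in simp)
    also have "\<dots> = (\<integral>v. site_const u * (indicator (cell r i) (exp v) * exp (v - v\<^sup>2 / (2 * u\<^sup>2))) \<partial>lborel)"
      by (intro Bochner_Integration.integral_cong refl) (auto simp: site_density_def A_def indicator_def)
    also have "\<dots> = cell_prob r i" unfolding cell_prob_def by (rule integral_mult_right_zero)
    finally show ?thesis .
  qed
  have disj: "disjoint_family_on A {..<r^3}"
    unfolding disjoint_family_on_def A_def using cell_disjoint[of _ _ r] r by fastforce
  have card1: "card (grem_level 1 N) = N 1" by (simp add: card_grem_level)
  have cc: "cell_count r \<omega> i = card {\<eta>\<in>grem_level 1 N. V \<eta> \<omega> \<in> A i}" for \<omega> i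
    unfolding cell_count_def A_def by simp
  show ?thesis unfolding cc
    using multinomial_counts[OF indep_V finite_grem_level Am disj q, of c] c unfolding card1 by simp
qed

lemma cell_count_measurable: "(\<lambda>\<omega>. cell_count r \<omega> i) \<in> measurable M (count_space UNIV)"
proof -
  have "{\<omega>\<in>space M. exp (V \<eta> \<omega>) \<in> cell r i} \<in> events" if "\<eta> \<in> grem_level 1 N" for \<eta>
  proof -
    have Vm: "V \<eta> \<in> borel_measurable M" using V_measurable[of 1] d that by simp
    then have "(\<lambda>\<omega>. exp (V \<eta> \<omega>)) \<in> borel_measurable M" by measurable
    from measurable_sets[OF this, of "cell r i"] show ?thesis by (simp add: cell_def vimage_def Int_def conj_commute)
  qed
  then have "(\<lambda>\<omega>. \<Sum>\<eta>\<in>grem_level 1 N. indicator {\<omega>\<in>space M. exp (V \<eta> \<omega>) \<in> cell r i} \<omega> :: nat) \<in> borel_measurable M"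
    by (intro borel_measurable_sum borel_measurable_indicator)
  also have "?this \<longleftrightarrow> (\<lambda>\<omega>. cell_count r \<omega> i) \<in> borel_measurable M"
  proof (rule measurable_cong)
    fix \<omega> assume "\<omega> \<in> space M"
    then have "(\<Sum>\<eta>\<in>grem_level 1 N. indicator {\<omega>\<in>space M. exp (V \<eta> \<omega>) \<in> cell r i} \<omega> :: nat)
        = (\<Sum>\<eta>\<in>grem_level 1 N. if exp (V \<eta> \<omega>) \<in> cell r i then 1 else 0)"
      by (intro sum.cong) (auto simp: indicator_def)
    also have "\<dots> = cell_count r \<omega> i"
      unfolding cell_count_def card_eq_sum by (rule sum.inter_filter[symmetric]) simp
    finally show "(\<Sum>\<eta>\<in>grem_level 1 N. indicator {\<omega>\<in>space M. exp (V \<eta> \<omega>) \<in> cell r i} \<omega> :: nat) = cell_count r \<omega> i" .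
  qed
  finally show ?thesis by (simp add: measurable_def sets_borel_eq_count_space)
qed

end

section \<open>Random exponential sums as random elements\<close>

lemma (in bounded_open_set) restrict_analytic:
  "f holomorphic_on D \<Longrightarrow> restrict f D \<in> analytic_functions D"
  unfolding analytic_functions_def by (auto intro: holomorphic_transform)

text \<open>The random function is a continuous image of finitely many real variables. These are
  embedded, padded by zeros, into the functions on a countable index type, where measurability is
  checked coordinatewise.\<close>

lemma (in bounded_open_set) exp_sum_measurable:
  fixes x :: "'i::countable \<Rightarrow> 'a \<Rightarrow> real"
  assumes I: "finite I" and x: "\<And>i. i \<in> I \<Longrightarrow> x i \<in> borel_measurable M"
    and h: "h holomorphic_on D" and f0: "f0 holomorphic_on D"
  shows "(\<lambda>\<omega>. restrict (\<lambda>\<beta>. h \<beta> * (\<Sum>i\<in>I. exp (\<beta> * of_real (x i \<omega>))) + f0 \<beta>) D) \<in> measurable M (borel_of (locally_uniform_topology D))"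
proof -
  define G where "G w = restrict (\<lambda>\<beta>. h \<beta> * (\<Sum>i\<in>I. exp (\<beta> * of_real (w i))) + f0 \<beta>) D" for w :: "'i \<Rightarrow> real"
  have GH: "G w \<in> analytic_functions D" for w
    unfolding G_def
  proof (rule restrict_analytic)
    have e: "(\<lambda>\<beta>. exp (\<beta> * of_real (w i))) holomorphic_on D" for i by (intro holomorphic_intros)
    show "(\<lambda>\<beta>. h \<beta> * (\<Sum>i\<in>I. exp (\<beta> * of_real (w i))) + f0 \<beta>) holomorphic_on D"
      by (rule holomorphic_on_add[OF holomorphic_on_mult[OF h holomorphic_on_sum[OF e]] f0])
  qed
  define w where "w \<omega> i = (if i \<in> I then x i \<omega> else 0)" for \<omega> i
  have w_meas: "w \<in> borel_measurable M"
  proof (rule measurable_coordinatewise_then_product)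
    show "(\<lambda>\<omega>. w \<omega> i) \<in> borel_measurable M" for i
      using x[of i] unfolding w_def by (cases "i \<in> I") auto
  qed
  have Gw: "restrict (\<lambda>\<beta>. h \<beta> * (\<Sum>i\<in>I. exp (\<beta> * of_real (x i \<omega>))) + f0 \<beta>) D = G (w \<omega>)" for \<omega>
    unfolding G_def w_def by simp
  have dist0: "((\<lambda>v. hol_dist D (G v) (G v0)) \<longlongrightarrow> 0) (at v0)" for v0
  proof (rule tendsto_hol_distI)
    fix K and e :: real assume K: "compact K" "K \<subseteq> D" and e: "0 < e"
    have "continuous_on K h" using h K(2) by (meson continuous_on_subset holomorphic_on_imp_continuous_on)
    then have "bounded (h ` K)" by (intro compact_imp_bounded compact_continuous_image K(1))
    then obtain H where H: "\<And>z. z \<in> K \<Longrightarrow> norm (h z) \<le> H" unfolding bounded_iff by auto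
    obtain B where B: "\<And>z. z \<in> K \<Longrightarrow> norm z \<le> B" using compact_imp_bounded[OF K(1)] unfolding bounded_iff by auto
    define H' where "H' = max H 0"
    define B' where "B' = max B 0"
    have H': "\<And>z. z \<in> K \<Longrightarrow> norm (h z) \<le> H'" "0 \<le> H'" and B': "\<And>z. z \<in> K \<Longrightarrow> norm z \<le> B'" "0 \<le> B'"
      unfolding H'_def B'_def using H B by (auto simp: le_max_iff_disj)
    \<comment> \<open>Bounds both exponentials as soon as \<open>v i\<close> is within 1 of
      \<open>v0 i\<close>.\<close>
    define E where "E i = exp (B' * (\<bar>v0 i\<bar> + 1))" for i
    have co: "((\<lambda>v. v i) \<longlongrightarrow> v0 i) (at v0)" for i :: 'i
    proof -
      have "continuous_on UNIV (\<lambda>v::'i \<Rightarrow> real. v i)" by (rule continuous_on_product_coordinates)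
      then show ?thesis by (simp add: continuous_on_def)
    qed
    have "((\<lambda>v. H' * (\<Sum>i\<in>I. B' * \<bar>v i - v0 i\<bar> * E i)) \<longlongrightarrow> H' * (\<Sum>i\<in>I. B' * \<bar>v0 i - v0 i\<bar> * E i)) (at v0)"
      by (intro tendsto_intros co)
    then have "((\<lambda>v. H' * (\<Sum>i\<in>I. B' * \<bar>v i - v0 i\<bar> * E i)) \<longlongrightarrow> 0) (at v0)" by simp
    then have ev1: "\<forall>\<^sub>F v in at v0. H' * (\<Sum>i\<in>I. B' * \<bar>v i - v0 i\<bar> * E i) < e" using e by (rule order_tendstoD)
    have "\<forall>\<^sub>F v in at v0. \<bar>v i - v0 i\<bar> < 1" for i
      using tendstoD[OF co[of i], of 1] by (simp add: dist_real_def)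
    then have ev2: "\<forall>\<^sub>F v in at v0. \<forall>i\<in>I. \<bar>v i - v0 i\<bar> < 1" using I by (simp add: eventually_ball_finite)
    show "\<forall>\<^sub>F v in at v0. \<forall>z\<in>K. norm (G v z - G v0 z) \<le> e"
      using ev1 ev2
    proof eventually_elim
      case (elim v)
      show ?case
      proof
        fix z assume z: "z \<in> K"
        have zD: "z \<in> D" using z K by auto
        have t: "norm (exp (z * of_real (v i)) - exp (z * of_real (v0 i))) \<le> B' * \<bar>v i - v0 i\<bar> * E i" if "i \<in> I" for i
        proof -
          have "norm (exp (z * of_real (v i)) - exp (z * of_real (v0 i)))
              \<le> norm (z * of_real (v i) - z * of_real (v0 i)) * exp (max (Re (z * of_real (v i))) (Re (z * of_real (v0 i))))"
            by (rule norm_exp_diff_le)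
          also have "\<dots> \<le> (B' * \<bar>v i - v0 i\<bar>) * E i"
          proof (intro mult_mono)
            have "norm (z * of_real (v i) - z * of_real (v0 i)) = norm (z * of_real (v i - v0 i))" by (simp add: algebra_simps)
            also have "\<dots> = norm z * \<bar>v i - v0 i\<bar>" by (simp only: norm_mult norm_of_real)
            also have "\<dots> \<le> B' * \<bar>v i - v0 i\<bar>" using B'(1)[OF z] by (intro mult_right_mono) auto
            finally show "norm (z * of_real (v i) - z * of_real (v0 i)) \<le> B' * \<bar>v i - v0 i\<bar>" .
            have R: "Re (z * of_real y) \<le> B' * (\<bar>v0 i\<bar> + 1)" if "\<bar>y\<bar> \<le> \<bar>v0 i\<bar> + 1" for y
            proof -
              have "Re (z * of_real y) \<le> norm z * \<bar>y\<bar>" using complex_Re_le_cmod[of "z * of_real y"] by (simp add: norm_mult)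
              also have "\<dots> \<le> B' * (\<bar>v0 i\<bar> + 1)" using B'(1)[OF z] B'(2) that by (intro mult_mono) auto
              finally show ?thesis .
            qed
            have "\<bar>v i\<bar> \<le> \<bar>v0 i\<bar> + 1" using elim(2) that by fastforce
            then show "exp (max (Re (z * of_real (v i))) (Re (z * of_real (v0 i)))) \<le> E i"
              unfolding E_def using R[of "v i"] R[of "v0 i"] by (simp only: exp_le_cancel_iff max.bounded_iff)
          qed (use B' in auto)
          finally show ?thesis .
        qed
        have "G v z - G v0 z = h z * (\<Sum>i\<in>I. exp (z * of_real (v i)) - exp (z * of_real (v0 i)))"
          unfolding G_def using zD by (simp add: sum_subtractf right_diff_distrib)
        also have "norm \<dots> \<le> H' * (\<Sum>i\<in>I. B' * \<bar>v i - v0 i\<bar> * E i)"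
          unfolding norm_mult
        proof (intro mult_mono H'(1)[OF z] H'(2))
          show "norm (\<Sum>i\<in>I. exp (z * of_real (v i)) - exp (z * of_real (v0 i))) \<le> (\<Sum>i\<in>I. B' * \<bar>v i - v0 i\<bar> * E i)"
            by (rule order_trans[OF norm_sum sum_mono[OF t]])
        qed auto
        finally show "norm (G v z - G v0 z) \<le> e" using elim(1) by linarith
      qed
    qed
  qed
  show ?thesis
    unfolding locally_uniform_topology_eq
  proof (rule hol.measurable_borel_ofI)
    fix \<phi> :: "(complex \<Rightarrow> complex) \<Rightarrow> real" assume \<phi>: "continuous_map hol.mtopology euclideanreal \<phi>"
    have "continuous_on UNIV (\<lambda>v. \<phi> (G v))"
      unfolding continuous_on_def
      by (auto intro!: continuous_map_tendsto GH dist0 \<phi>[folded locally_uniform_topology_eq])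
    then have "(\<lambda>v. \<phi> (G v)) \<in> borel_measurable borel" by (rule borel_measurable_continuous_onI)
    from measurable_compose[OF w_meas this]
    show "(\<lambda>\<omega>. \<phi> (restrict (\<lambda>\<beta>. h \<beta> * (\<Sum>i\<in>I. exp (\<beta> * of_real (x i \<omega>))) + f0 \<beta>) D)) \<in> borel_measurable M"
      unfolding Gw .
  qed (use Gw GH in auto)
qed

lemma measurable_map_count_space:
  fixes f :: "nat \<Rightarrow> 'a \<Rightarrow> nat"
  assumes "\<And>i. i < L \<Longrightarrow> f i \<in> measurable M (count_space UNIV)"
  shows "(\<lambda>\<omega>. map (\<lambda>i. f i \<omega>) [0..<L]) \<in> measurable M (count_space UNIV)"
proof (rule measurable_count_space_eq2_countable[THEN iffD2], intro conjI ballI)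
  fix xs :: "nat list"
  show "(\<lambda>\<omega>. map (\<lambda>i. f i \<omega>) [0..<L]) -` {xs} \<inter> space M \<in> sets M"
  proof (cases "length xs = L")
    case True
    have ev: "f i -` {xs ! i} \<inter> space M \<in> sets M" if "i < L" for i using assms[OF that] by (rule measurable_sets) simp
    have "(\<lambda>\<omega>. map (\<lambda>i. f i \<omega>) [0..<L]) -` {xs} \<inter> space M = space M \<inter> (\<Inter>i\<in>{..<L}. f i -` {xs ! i} \<inter> space M)"
    proof (intro set_eqI iffI)
      fix \<omega> assume "\<omega> \<in> (\<lambda>\<omega>. map (\<lambda>i. f i \<omega>) [0..<L]) -` {xs} \<inter> space M"
      then have \<omega>: "\<omega> \<in> space M" and eq: "map (\<lambda>i. f i \<omega>) [0..<L] = xs" by auto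
      have "f i \<omega> = xs ! i" if "i < L" for i using that by (simp flip: eq)
      then show "\<omega> \<in> space M \<inter> (\<Inter>i\<in>{..<L}. f i -` {xs ! i} \<inter> space M)" using \<omega> by simp
    next
      fix \<omega> assume \<omega>: "\<omega> \<in> space M \<inter> (\<Inter>i\<in>{..<L}. f i -` {xs ! i} \<inter> space M)"
      then have "f i \<omega> = xs ! i" if "i < L" for i using that by blast
      then have "map (\<lambda>i. f i \<omega>) [0..<L] = xs" using True by (intro nth_equalityI) auto
      then show "\<omega> \<in> (\<lambda>\<omega>. map (\<lambda>i. f i \<omega>) [0..<L]) -` {xs} \<inter> space M" using \<omega> by simp
    qed
    also have "\<dots> \<in> sets M" 
    proof (cases "L = 0")
      case False
      have "(\<Inter>i\<in>{..<L}. f i -` {xs ! i} \<inter> space M) \<in> sets M"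
      proof (rule sets.finite_INT)
        show "{..<L} \<noteq> {}" using False by auto
        show "f i -` {xs ! i} \<inter> space M \<in> sets M" if "i \<in> {..<L}" for i using ev that by blast
      qed simp
      then show ?thesis by (rule sets.Int[OF sets.top])
    qed simp
    finally show ?thesis .
  next
    case False
    then have "(\<lambda>\<omega>. map (\<lambda>i. f i \<omega>) [0..<L]) -` {xs} \<inter> space M = {}" by auto
    then show ?thesis by simp
  qed
qed auto

section \<open>The triangle on which the expectation dominates\<close>

lemma expectation_triangle:
  fixes s :: real assumes s: "0 < s"
  shows "expectation_phase s \<inter> {\<beta>. Re \<beta> > s / 2} = {\<beta>. s / 2 < Re \<beta> \<and> Re \<beta> + \<bar>Im \<beta>\<bar> < s}"
proof (intro set_eqI iffI)
  fix \<beta> assume b: "\<beta> \<in> expectation_phase s \<inter> {\<beta>. Re \<beta> > s / 2}"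
  have "Re \<beta> + \<bar>Im \<beta>\<bar> < s"
  proof (rule ccontr)
    assume n: "\<not> Re \<beta> + \<bar>Im \<beta>\<bar> < s"
    have "\<beta> \<in> closure (glassy_phase s \<union> fluctuation_phase s)"
      unfolding closure_approachable
    proof (intro allI impI)
      fix e :: real assume e: "0 < e"
      \<comment> \<open>A point with Re \<beta> + |Im \<beta>| \<ge> s is approached from the right
        by glassy points, so the closure absorbs the boundary line.\<close>
      have "\<beta> + of_real (e/2) \<in> glassy_phase s" using n b s e unfolding glassy_phase_def by auto
      moreover have "dist (\<beta> + of_real (e/2)) \<beta> < e" using e by (simp add: dist_norm)
      ultimately show "\<exists>y\<in>glassy_phase s \<union> fluctuation_phase s. dist y \<beta> < e" by blast
    qed
    then show False using b unfolding expectation_phase_def by auto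
  qed
  then show "\<beta> \<in> {\<beta>. s / 2 < Re \<beta> \<and> Re \<beta> + \<bar>Im \<beta>\<bar> < s}" using b by auto
next
  fix \<beta> assume b: "\<beta> \<in> {\<beta>. s / 2 < Re \<beta> \<and> Re \<beta> + \<bar>Im \<beta>\<bar> < s}"
  \<comment> \<open>A closed set that contains both phases and misses the triangle.\<close>
  let ?C = "{\<beta>. s \<le> \<bar>Re \<beta>\<bar> + \<bar>Im \<beta>\<bar>} \<union> {\<beta>. 2 * \<bar>Re \<beta>\<bar> \<le> s}"
  have "closed ?C" by (intro closed_Un closed_Collect_le continuous_intros)
  moreover have "glassy_phase s \<union> fluctuation_phase s \<subseteq> ?C"
    unfolding glassy_phase_def fluctuation_phase_def by auto
  ultimately have "closure (glassy_phase s \<union> fluctuation_phase s) \<subseteq> ?C" by (rule closure_minimal[rotated])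
  moreover have "\<beta> \<notin> ?C" using b s by auto
  ultimately show "\<beta> \<in> expectation_phase s \<inter> {\<beta>. Re \<beta> > s / 2}" using b unfolding expectation_phase_def by auto
qed

lemma bounded_open_triangle:
  fixes s :: real assumes s: "0 < s"
  shows "bounded_open_set {\<beta>. s / 2 < Re \<beta> \<and> Re \<beta> + \<bar>Im \<beta>\<bar> < s}" (is "bounded_open_set ?T")
proof
  have "?T = {\<beta>. s / 2 < Re \<beta>} \<inter> {\<beta>. Re \<beta> + \<bar>Im \<beta>\<bar> < s}" by auto
  also have "open \<dots>" by (intro open_Int open_Collect_less continuous_intros)
  finally show "open ?T" .
  show "bounded ?T" unfolding bounded_iff
  proof (intro exI[of _ "2 * s"] ballI)
    fix x assume "x \<in> ?T"
    then show "norm x \<le> 2 * s" using cmod_le[of x] s by auto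
  qed
  have "of_real (3 * s / 4) \<in> ?T" using s by simp
  then show "?T \<noteq> {}" by blast
qed

text \<open>The exponent \<open>p\<close> is chosen slightly above \<open>s / Re \<beta>\<close>, the smallest value for which the first
  level has tails with finite \<open>p\<close>-th moment; inside the triangle the \<open>p\<close>-th moments of the
  deeper levels still decay.\<close>

lemma moment_exponent_exists:
  fixes s :: real and \<beta>0 :: complex
  assumes s: "0 < s" and \<beta>0: "s / 2 < Re \<beta>0" "Re \<beta>0 + \<bar>Im \<beta>0\<bar> < s"
  obtains p \<kappa> R where "1 < p" "p \<le> 2" "0 < \<kappa>" "\<kappa> \<le> 1" "0 < R"
    "\<And>\<beta>. \<beta> \<in> cball \<beta>0 (2 * R) \<Longrightarrow> s / 2 < Re \<beta> \<and> Re \<beta> + \<bar>Im \<beta>\<bar> < s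
       \<and> 1 + \<kappa> < p * Re \<beta> * (1 / s) \<and> Re \<beta> * (1 / s) < 1 - \<kappa>
       \<and> p\<^sup>2 * (Re \<beta>)\<^sup>2 - p * (Re \<beta>)\<^sup>2 + p * (Im \<beta>)\<^sup>2 + (1 - p) * s\<^sup>2 < - \<kappa>"
proof -
  define \<sigma> where "\<sigma> = Re \<beta>0"
  define \<tau> where "\<tau> = Im \<beta>0"
  have \<sigma>: "0 < \<sigma>" "s < 2 * \<sigma>" "\<sigma> + \<bar>\<tau>\<bar> < s" using s \<beta>0 unfolding \<sigma>_def \<tau>_def by auto
  \<comment> \<open>With ln \<alpha> = a s^2 / 2, the least growth occurring at the deeper levels, n
    a f(p) / 2 is the exponent of N^(1-p) times the p-th moment of a factor
    \<open>G\<close>.\<close>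
  define f where "f p = p\<^sup>2 * \<sigma>\<^sup>2 - p * \<sigma>\<^sup>2 + p * \<tau>\<^sup>2 + (1 - p) * s\<^sup>2" for p :: real
  define p0 where "p0 = s / \<sigma>"
  have p0: "1 < p0" "p0 < 2" unfolding p0_def using \<sigma> by (auto simp: field_simps)
  \<comment> \<open>The decisive identity: at p0 = s/\<sigma>, the critical exponent of the first
    level, f has the sign of |\<tau>| - (s - \<sigma>), negative in the triangle. By continuity f
    remains negative slightly to the right of p0.\<close>
  have "f p0 = p0 * (\<tau>\<^sup>2 - (s - \<sigma>)\<^sup>2)"
  proof -
    have ps: "p0 * \<sigma> = s" unfolding p0_def using \<sigma> by simp
    have "f p0 = p0 * (p0 * \<sigma>) * \<sigma> - p0 * \<sigma>\<^sup>2 + p0 * \<tau>\<^sup>2 + (p0 * \<sigma>) * s - p0 * s\<^sup>2"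
      unfolding f_def using ps by (simp add: power2_eq_square algebra_simps)
    also have "\<dots> = p0 * (\<tau>\<^sup>2 - (s - \<sigma>)\<^sup>2)" unfolding ps
      by (simp add: power2_eq_square algebra_simps) (use ps in \<open>simp add: algebra_simps\<close>)
    finally show ?thesis .
  qed
  moreover have "\<tau>\<^sup>2 < (s - \<sigma>)\<^sup>2" using \<sigma> power_strict_mono[of "\<bar>\<tau>\<bar>" "s - \<sigma>" 2] by simp
  ultimately have "f p0 < 0" using p0 by (simp add: mult_pos_neg)
  moreover have "(f \<longlongrightarrow> f p0) (at_right p0)" unfolding f_def by (intro tendsto_intros)
  ultimately have "\<forall>\<^sub>F p in at_right p0. f p < 0" by (intro order_tendstoD)
  moreover have "\<forall>\<^sub>F p in at_right p0. p < 2" "\<forall>\<^sub>F p in at_right p0. p0 < p"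
    using p0 by (auto intro: eventually_at_right_less order_tendstoD tendsto_ident_at)
  ultimately have "\<forall>\<^sub>F p in at_right p0. f p < 0 \<and> p < 2 \<and> p0 < p" by eventually_elim auto
  then obtain p where p: "f p < 0" "p < 2" "p0 < p" using eventually_happens'[of "at_right p0"] by auto
  have pg: "1 < p * \<sigma> * (1 / s)" using p(3) \<sigma> s unfolding p0_def by (simp add: field_simps)
  have sg: "\<sigma> * (1 / s) < 1" using \<sigma> s by (simp add: field_simps)
  define m where "m = min (min (p * \<sigma> * (1 / s) - 1) (1 - \<sigma> * (1 / s))) (min (- f p) 1)"
  have m: "0 < m" unfolding m_def using pg sg p(1) by simp
  have mle: "m \<le> p * \<sigma> * (1 / s) - 1" "m \<le> 1 - \<sigma> * (1 / s)" "m \<le> - f p" "m \<le> 1"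
    unfolding m_def by (simp_all only: min.coboundedI1 min.coboundedI2 order_refl)
  \<comment> \<open>Half of the smallest margin keeps all inequalities strict at \<beta>0, so that
    they persist on a ball.\<close>
  define \<kappa> where "\<kappa> = m / 2"
  have \<kappa>: "0 < \<kappa>" "\<kappa> < p * \<sigma> * (1 / s) - 1" "\<kappa> < 1 - \<sigma> * (1 / s)" "\<kappa> < - f p" "\<kappa> \<le> 1"
    using m mle unfolding \<kappa>_def by linarith+
  define U where "U = {\<beta>. s / 2 < Re \<beta>} \<inter> {\<beta>. Re \<beta> + \<bar>Im \<beta>\<bar> < s} \<inter> {\<beta>. 1 + \<kappa> < p * Re \<beta> * (1 / s)} \<inter> {\<beta>. Re \<beta> * (1 / s) < 1 - \<kappa>}
       \<inter> {\<beta>. p\<^sup>2 * (Re \<beta>)\<^sup>2 - p * (Re \<beta>)\<^sup>2 + p * (Im \<beta>)\<^sup>2 + (1 - p) * s\<^sup>2 < - \<kappa>}"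
  have "open U" unfolding U_def by (intro open_Int open_Collect_less continuous_intros)
  moreover have "\<beta>0 \<in> U" unfolding U_def using \<beta>0 \<kappa> unfolding \<sigma>_def \<tau>_def f_def by auto
  ultimately obtain e where e: "0 < e" "cball \<beta>0 e \<subseteq> U" by (meson open_contains_cball)
  show ?thesis
    by (rule that[of p \<kappa> "e / 2"]) (use p p0 \<kappa> e in \<open>auto simp: U_def subset_iff\<close>)
qed

section \<open>First-moment bounds for the error\<close>

context grem
begin

lemma tail_measurable: "tail y \<beta> \<in> borel_measurable M"
proof -
  have "(\<lambda>\<omega>. indicator {y<..} (V \<eta> \<omega>) * first_term \<beta> (V \<eta> \<omega>)) \<in> borel_measurable M" if "\<eta> \<in> grem_level 1 N" for \<eta>
  proof -
    have Vm: "V \<eta> \<in> borel_measurable M" using V_measurable[of 1 \<eta>] d that by simp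
    from measurable_compose[OF this first_term_measurable] Vm show ?thesis by measurable
  qed
  then show ?thesis unfolding tail_def[abs_def] by (intro borel_measurable_sum borel_measurable_diff borel_measurable_const)
qed

lemma mid_measurable: "mid r \<delta> s0 \<beta> \<in> borel_measurable M"
proof -
  have exp_m: "(\<lambda>x. exp (- (\<beta> * of_real s0) * complex_of_real x)) \<in> borel_measurable borel"
    by (intro borel_measurable_continuous_onI continuous_intros)
  have "(\<lambda>\<omega>. indicator {ln \<delta>..ln (real r)} (V \<eta> \<omega>) * (first_term \<beta> (V \<eta> \<omega>) - rpow (cell_end r (V \<eta> \<omega>)) (- (\<beta> * of_real s0)))) \<in> borel_measurable M"
    if "\<eta> \<in> grem_level 1 N" for \<eta>
  proof -
    have Vm: "V \<eta> \<in> borel_measurable M" using V_measurable[of 1 \<eta>] d that by simp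
    then have "(\<lambda>\<omega>. ln (cell_end r (V \<eta> \<omega>))) \<in> borel_measurable M" by measurable
    from measurable_compose[OF this exp_m] have "(\<lambda>\<omega>. rpow (cell_end r (V \<eta> \<omega>)) (- (\<beta> * of_real s0))) \<in> borel_measurable M"
      unfolding rpow_def .
    then show ?thesis using Vm measurable_compose[OF Vm first_term_measurable] by measurable
  qed
  then show ?thesis unfolding mid_def[abs_def] by (intro borel_measurable_sum)
qed

lemma trunc_diff_measurable:
  assumes j: "j \<in> {1..<d}" shows "trunc_diff x j \<beta> \<in> borel_measurable M"
  unfolding trunc_diff_def[abs_def]
proof (intro borel_measurable_sum borel_measurable_times borel_measurable_divide borel_measurable_diff borel_measurable_prod borel_measurable_const)
  fix \<epsilon> assume \<epsilon>: "\<epsilon> \<in> grem_level (Suc j) N"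
  have t: "take 1 \<epsilon> \<in> grem_level 1 N" using take_grem_level[OF \<epsilon>, of 1] by simp
  have Vm: "V (take 1 \<epsilon>) \<in> borel_measurable M" using V_measurable[of 1, OF _ t] d by simp
  show "(\<lambda>\<omega>. indicator {x..} (V (take 1 \<epsilon>) \<omega>) :: complex) \<in> borel_measurable M" using Vm by measurable
  show "(\<lambda>\<omega>. exp (- \<beta> * of_real (s * V (take 1 \<epsilon>) \<omega>))) \<in> borel_measurable M"
    using measurable_compose[OF Vm first_term_measurable[of \<beta>]] unfolding first_term_def .
  show "(\<lambda>\<omega>. G (Suc j) \<beta> (\<xi> \<epsilon> \<omega>)) \<in> borel_measurable M"
    using \<xi>_measurable[OF _ \<epsilon>] j by (intro measurable_compose[OF _ G_measurable]) auto
  fix i assume i: "i \<in> {2..j}"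
  show "(\<lambda>\<omega>. G i \<beta> (\<xi> (take i \<epsilon>) \<omega>)) \<in> borel_measurable M"
    using \<xi>_measurable[of i, OF _ take_grem_level[OF \<epsilon>, of i]] i j by (intro measurable_compose[OF _ G_measurable]) auto
qed

lemma err_nn_integral_le:
  assumes r: "1 \<le> r"
  shows "(\<integral>\<^sup>+\<omega>. norm (err r \<delta> s0 \<beta> \<omega>) \<partial>M) \<le> (\<integral>\<^sup>+\<omega>. norm (tail (ln (real r)) \<beta> \<omega>) \<partial>M)
     + (\<integral>\<^sup>+\<omega>. norm (mid r \<delta> s0 \<beta> \<omega>) \<partial>M) + ennreal (norm (compensator_gap r s0 \<beta>))
     + (\<Sum>j=1..<d. \<integral>\<^sup>+\<omega>. norm (trunc_diff (ln \<delta>) j \<beta> \<omega>) \<partial>M)"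
proof -
  let ?T = "tail (ln (real r)) \<beta>" and ?m = "mid r \<delta> s0 \<beta>" and ?c = "compensator_gap r s0 \<beta>" and ?t = "\<lambda>j. trunc_diff (ln \<delta>) j \<beta>"
  have "(\<integral>\<^sup>+\<omega>. norm (err r \<delta> s0 \<beta> \<omega>) \<partial>M)
      \<le> (\<integral>\<^sup>+\<omega>. ennreal (norm (?T \<omega>)) + ennreal (norm (?m \<omega>)) + ennreal (norm ?c) + (\<Sum>j=1..<d. ennreal (norm (?t j \<omega>))) \<partial>M)"
  proof (rule nn_integral_mono)
    fix \<omega>
    have "norm (err r \<delta> s0 \<beta> \<omega>) \<le> norm (?T \<omega> + ?m \<omega> - ?c) + norm (\<Sum>j=1..<d. ?t j \<omega>)"
      unfolding err_split[OF r] by (rule norm_triangle_ineq)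
    also have "\<dots> \<le> norm (?T \<omega>) + norm (?m \<omega>) + norm ?c + (\<Sum>j=1..<d. norm (?t j \<omega>))"
      using norm_triangle_ineq4[of "?T \<omega> + ?m \<omega>" ?c] norm_triangle_ineq[of "?T \<omega>" "?m \<omega>"] norm_sum[of "\<lambda>j. ?t j \<omega>" "{1..<d}"] by linarith
    finally have "ennreal (norm (err r \<delta> s0 \<beta> \<omega>)) \<le> ennreal (norm (?T \<omega>) + norm (?m \<omega>) + norm ?c + (\<Sum>j=1..<d. norm (?t j \<omega>)))"
      by (rule ennreal_leI)
    also have "\<dots> = ennreal (norm (?T \<omega>)) + ennreal (norm (?m \<omega>)) + ennreal (norm ?c) + (\<Sum>j=1..<d. ennreal (norm (?t j \<omega>)))"
      by (simp add: ennreal_plus[symmetric] sum_nonneg del: ennreal_plus)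
    finally show "ennreal (norm (err r \<delta> s0 \<beta> \<omega>)) \<le> ennreal (norm (?T \<omega>)) + ennreal (norm (?m \<omega>)) + ennreal (norm ?c) + (\<Sum>j=1..<d. ennreal (norm (?t j \<omega>)))" .
  qed
  also have "\<dots> = (\<integral>\<^sup>+\<omega>. norm (?T \<omega>) \<partial>M) + (\<integral>\<^sup>+\<omega>. norm (?m \<omega>) \<partial>M) + ennreal (norm ?c) + (\<Sum>j=1..<d. \<integral>\<^sup>+\<omega>. norm (?t j \<omega>) \<partial>M)"
  proof -
    have T: "(\<lambda>\<omega>. ennreal (norm (?T \<omega>))) \<in> borel_measurable M" using tail_measurable by measurable
    have m: "(\<lambda>\<omega>. ennreal (norm (?m \<omega>))) \<in> borel_measurable M" using mid_measurable by measurable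
    have t: "(\<lambda>\<omega>. ennreal (norm (?t j \<omega>))) \<in> borel_measurable M" if "j \<in> {1..<d}" for j
      using trunc_diff_measurable[OF that] by measurable
    have c: "(\<lambda>\<omega>. ennreal (norm ?c)) \<in> borel_measurable M" by simp
    have st: "(\<lambda>\<omega>. \<Sum>j=1..<d. ennreal (norm (?t j \<omega>))) \<in> borel_measurable M" using t by (intro borel_measurable_sum)
    have "(\<integral>\<^sup>+\<omega>. (\<Sum>j=1..<d. ennreal (norm (?t j \<omega>))) \<partial>M) = (\<Sum>j=1..<d. \<integral>\<^sup>+\<omega>. norm (?t j \<omega>) \<partial>M)" using t by (rule nn_integral_sum)
    moreover have "(\<integral>\<^sup>+\<omega>. ennreal (norm ?c) \<partial>M) = ennreal (norm ?c)" by (simp add: emeasure_space_1)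
    ultimately show ?thesis
      by (simp only: nn_integral_add[OF borel_measurable_add[OF borel_measurable_add[OF T m] c] st]
          nn_integral_add[OF borel_measurable_add[OF T m] c] nn_integral_add[OF T m])
  qed
  finally show ?thesis .
qed

lemma first_level_tail_bound:
  assumes p: "1 < p" "p \<le> 2" and \<kappa>: "0 < \<kappa>" "1 + \<kappa> \<le> p * Re \<beta> * s" and c: "real (N 1) * site_const u \<le> 2"
    and r: "1 \<le> r" and e: "0 < e"
  shows "(\<integral>\<^sup>+\<omega>. norm (tail (ln (real r)) \<beta> \<omega>) \<partial>M) \<le> ennreal (e + e powr (1 - p) * (96 / \<kappa> * real r powr (- \<kappa>)))"
proof -
  let ?q = "p * Re \<beta> * s"
  have q: "1 < ?q" using \<kappa> by linarith
  note tm = tail_moment[OF p q, of "ln (real r)"]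
  have lnr: "0 \<le> ln (real r)" using r by simp
  have "real (N 1) * upper_moment p \<beta> (ln (real r)) = (real (N 1) * site_const u) * (exp (- (?q - 1) * ln (real r)) / (?q - 1))"
    unfolding upper_moment_def by simp
  also have "\<dots> \<le> 2 * (exp (- \<kappa> * ln (real r)) / \<kappa>)"
  proof (intro mult_mono c frac_le)
    show "exp (- (?q - 1) * ln (real r)) \<le> exp (- \<kappa> * ln (real r))"
      unfolding exp_le_cancel_iff using \<kappa> lnr by (intro mult_right_mono) auto
  qed (use \<kappa> q in auto)
  also have "exp (- \<kappa> * ln (real r)) = real r powr (- \<kappa>)" using r by (simp add: powr_def)
  finally have um: "real (N 1) * upper_moment p \<beta> (ln (real r)) \<le> 2 * (real r powr (- \<kappa>) / \<kappa>)" .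
  have "2 powr (p + 1) \<le> 2 powr 3" using p by (intro powr_mono) auto
  then have p8: "2 powr (p + 1) \<le> (8::real)" by simp
  \<comment> \<open>96 = 6 * 8 * 2: the von Bahr--Esseen constant, 2^(p+1) \<le> 8 from the
    centring, and the bound 2 for N times \<open>site_const\<close>.\<close>
  have "6 * 2 powr (p + 1) * (real (N 1) * upper_moment p \<beta> (ln (real r))) \<le> 6 * 8 * (2 * (real r powr (- \<kappa>) / \<kappa>))"
  proof (rule mult_mono[OF _ um])
    show "0 \<le> real (N 1) * upper_moment p \<beta> (ln (real r))" unfolding upper_moment_def using site_const_pos[OF u_pos] q by simp
  qed (use p8 in auto)
  then have "expectation (\<lambda>\<omega>. norm (tail (ln (real r)) \<beta> \<omega>) powr p) \<le> 96 / \<kappa> * real r powr (- \<kappa>)"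
    using tm(2) by (simp add: mult.commute)
  from nn_integral_norm_le_powr[OF tm(1) this _ e] p show ?thesis by simp
qed

lemma deep_level_bound:
  assumes p: "1 < p" "p \<le> 2" and \<kappa>: "0 < \<kappa>" "1 + \<kappa> \<le> p * Re \<beta> * s" "p * Re \<beta> * s \<le> 2" and c: "real (N 1) * site_const u \<le> 2"
    and \<delta>: "0 < \<delta>" "\<delta> \<le> 1" and e: "0 < e" and j: "1 \<le> j" "Suc j \<le> d"
    and \<rho>: "\<And>i. i \<in> {2..d} \<Longrightarrow> real (N i) powr (1 - p) * mom p \<beta> i \<le> \<rho>" "\<rho> \<le> 1"
  shows "(\<integral>\<^sup>+\<omega>. norm (trunc_diff (ln \<delta>) j \<beta> \<omega>) \<partial>M) \<le> ennreal (e + e powr (1 - p) * (96 / (\<kappa> * \<delta>) * \<rho>))"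
proof -
  let ?q = "p * Re \<beta> * s"
  have q: "1 < ?q" using \<kappa> by linarith
  note tm = trunc_diff_moment[OF p q j, of "ln \<delta>"]
  have ln\<delta>: "ln \<delta> \<le> 0" using \<delta> by simp
  have "real (N 1) * upper_moment p \<beta> (ln \<delta>) = (real (N 1) * site_const u) * (exp (- (?q - 1) * ln \<delta>) / (?q - 1))"
    unfolding upper_moment_def by simp
  \<comment> \<open>The exponent p Re \<beta> s - 1 is at most 1 and ln \<delta> \<le> 0, so the
    cutoff costs at most 1/\<delta>.\<close>
  also have "\<dots> \<le> 2 * (exp (- 1 * ln \<delta>) / \<kappa>)"
  proof (intro mult_mono c frac_le)
    show "exp (- (?q - 1) * ln \<delta>) \<le> exp (- 1 * ln \<delta>)"
      unfolding exp_le_cancel_iff using \<kappa> ln\<delta> by (intro mult_right_mono_neg) auto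
  qed (use \<kappa> q in auto)
  also have "exp (- 1 * ln \<delta>) = 1 / \<delta>" using \<delta> by (simp add: exp_minus inverse_eq_divide)
  finally have um: "real (N 1) * upper_moment p \<beta> (ln \<delta>) \<le> 2 * (1 / \<delta> / \<kappa>)" .
  have um0: "0 \<le> real (N 1) * upper_moment p \<beta> (ln \<delta>)" unfolding upper_moment_def using site_const_pos[OF u_pos] q by simp
  have mom0: "0 \<le> mom p \<beta> i" for i unfolding mom_def by simp
  have P: "(\<Prod>i=2..j. real (N i) powr (1 - p) * mom p \<beta> i) \<le> 1"
  proof (rule prod_le_1)
    fix i assume "i \<in> {2..j}"
    then show "0 \<le> real (N i) powr (1 - p) * mom p \<beta> i \<and> real (N i) powr (1 - p) * mom p \<beta> i \<le> 1"
      using \<rho>(1)[of i] \<rho>(2) j mom0 by auto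
  qed
  have P0: "0 \<le> (\<Prod>i=2..j. real (N i) powr (1 - p) * mom p \<beta> i)" using mom0 by (intro prod_nonneg) auto
  have jd: "Suc j \<in> {2..d}" using j by auto
  \<comment> \<open>This absorbs the centring of \<open>G\<close>: the moment plus 1 is at most
    twice the moment.\<close>
  have mom1: "1 \<le> mom p \<beta> (Suc j)"
  proof -
    have "0 \<le> p * ((p - 1) * (Re \<beta>)\<^sup>2 + (Im \<beta>)\<^sup>2)" using p by (intro mult_nonneg_nonneg add_nonneg_nonneg) auto
    also have "\<dots> = p\<^sup>2 * (Re \<beta>)\<^sup>2 - p * (Re \<beta>)\<^sup>2 + p * (Im \<beta>)\<^sup>2" by (simp add: power2_eq_square algebra_simps)
    finally have "0 \<le> real n * a (Suc j) / 2 * (p\<^sup>2 * (Re \<beta>)\<^sup>2 - p * (Re \<beta>)\<^sup>2 + p * (Im \<beta>)\<^sup>2)"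
      using a_pos[of "Suc j"] jd by (intro mult_nonneg_nonneg) auto
    then show ?thesis unfolding mom_def by simp
  qed
  have "real (N (Suc j)) powr (1 - p) * (mom p \<beta> (Suc j) + 1) \<le> real (N (Suc j)) powr (1 - p) * (2 * mom p \<beta> (Suc j))"
    using mom1 by (intro mult_left_mono) auto
  also have "\<dots> \<le> 2 * \<rho>" using \<rho>(1)[OF jd] by simp
  finally have last: "real (N (Suc j)) powr (1 - p) * (mom p \<beta> (Suc j) + 1) \<le> 2 * \<rho>" .
  have "2 powr p \<le> 2 powr 2" using p by (intro powr_mono) auto
  then have p4: "2 powr p \<le> (4::real)" by simp
  have L0: "0 \<le> real (N (Suc j)) powr (1 - p) * (mom p \<beta> (Suc j) + 1)" using mom0[of "Suc j"] by simp
  have "expectation (\<lambda>\<omega>. norm (trunc_diff (ln \<delta>) j \<beta> \<omega>) powr p) \<le> 6 * ((real (N 1) * upper_moment p \<beta> (ln \<delta>))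
      * (\<Prod>i=2..j. real (N i) powr (1 - p) * mom p \<beta> i) * (2 powr p * (real (N (Suc j)) powr (1 - p) * (mom p \<beta> (Suc j) + 1))))"
    by (rule tm(2))
  \<comment> \<open>96 = 6 * 2 * 4 * 2: the von Bahr--Esseen constant, the bound for N times
    \<open>site_const\<close>, 2^p \<le> 4, and the doubling just made. The intermediate levels
    contribute at most 1; the last one supplies the small factor \<rho>.\<close>
  also have "\<dots> \<le> 6 * ((2 * (1 / \<delta> / \<kappa>)) * 1 * (4 * (2 * \<rho>)))"
  proof (rule mult_left_mono, rule mult_mono[OF mult_mono[OF um P] mult_mono[OF p4 last]])
    show "0 \<le> 2 * (1 / \<delta> / \<kappa>) * 1" "0 \<le> 2 * (1 / \<delta> / \<kappa>)" using \<delta> \<kappa>(1) by auto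
    show "0 \<le> 2 powr p * (real (N (Suc j)) powr (1 - p) * (mom p \<beta> (Suc j) + 1))"
      using mult_nonneg_nonneg[OF powr_ge_zero[of 2 p] L0] .
  qed (use P0 L0 in auto)
  also have "\<dots> = 96 / (\<kappa> * \<delta>) * \<rho>" by (simp add: mult.commute)
  finally have E: "expectation (\<lambda>\<omega>. norm (trunc_diff (ln \<delta>) j \<beta> \<omega>) powr p) \<le> 96 / (\<kappa> * \<delta>) * \<rho>" .
  from nn_integral_norm_le_powr[OF tm(1) E _ e] p show ?thesis by simp
qed

end

context grem
begin

text \<open>The summands of \<open>err_split\<close> contribute 2e for the tail, e for
  \<open>mid\<close>, e for the compensator, and 2e for each deeper level.\<close>

lemma err_small:
  assumes p: "1 < p" "p \<le> 2" and \<kappa>: "0 < \<kappa>" "1 + \<kappa> \<le> p * Re \<beta> * s" "p * Re \<beta> * s \<le> 2"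
    and \<beta>: "0 \<le> Re \<beta> * s" "Re \<beta> * s \<le> 1" "0 \<le> Re \<beta> * s0" "Re \<beta> * s0 \<le> 1" "norm \<beta> \<le> B" and s0: "0 \<le> s0"
    and c: "real (N 1) * site_const u \<le> 2" and r: "1 \<le> r" and \<delta>: "0 < \<delta>" "\<delta> \<le> 1" and e: "0 < e"
    and tail_le: "e powr (1 - p) * (96 / \<kappa> * real r powr (- \<kappa>)) \<le> e"
    and mid_le: "2 * real r * (B / \<delta> * (\<bar>s - s0\<bar> * (1 / \<delta> + real r) + s0 * (1 / (real r)\<^sup>2 / \<delta>))) \<le> e"
    and gap_le: "norm (compensator_gap r s0 \<beta>) \<le> e"
    and \<rho>: "\<And>i. i \<in> {2..d} \<Longrightarrow> real (N i) powr (1 - p) * mom p \<beta> i \<le> \<rho>" "\<rho> \<le> 1"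
    and deep_le: "e powr (1 - p) * (96 / (\<kappa> * \<delta>) * \<rho>) \<le> e"
  shows "(\<integral>\<^sup>+\<omega>. norm (err r \<delta> s0 \<beta> \<omega>) \<partial>M) \<le> ennreal ((2 * real d + 4) * e)"
proof -
  have t: "(\<integral>\<^sup>+\<omega>. norm (tail (ln (real r)) \<beta> \<omega>) \<partial>M) \<le> ennreal (2 * e)"
    using first_level_tail_bound[OF p \<kappa>(1,2) c r e] by (rule order_trans) (use tail_le in \<open>intro ennreal_leI, linarith\<close>)
  define K where "K = (\<bar>s - s0\<bar> * (1 / \<delta> + real r) + s0 * (1 / (real r)\<^sup>2 / \<delta>))"
  have K: "0 \<le> K" unfolding K_def using \<delta> s0 by (intro add_nonneg_nonneg mult_nonneg_nonneg) auto
  have c0: "0 \<le> real (N 1) * site_const u" using site_const_pos[OF u_pos] by simp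
  have B0: "0 \<le> B" using \<beta>(5) norm_ge_zero order_trans by blast
  have "real (N 1) * site_const u * real r * (norm \<beta> / \<delta> * K) \<le> 2 * real r * (B / \<delta> * K)"
  proof (rule mult_mono)
    show "real (N 1) * site_const u * real r \<le> 2 * real r" using c by (rule mult_right_mono) simp
    show "norm \<beta> / \<delta> * K \<le> B / \<delta> * K" using \<beta>(5) \<delta>(1) K by (intro mult_right_mono divide_right_mono) auto
    show "0 \<le> norm \<beta> / \<delta> * K" using \<delta>(1) K by simp
  qed simp
  also have "\<dots> \<le> e" using mid_le unfolding K_def .
  finally have mm: "real (N 1) * site_const u * real r * (norm \<beta> / \<delta> * K) \<le> e" .
  have m: "(\<integral>\<^sup>+\<omega>. norm (mid r \<delta> s0 \<beta> \<omega>) \<partial>M) \<le> ennreal e"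
    using mid_bound[OF \<delta> r \<beta>(1-4) s0, folded K_def] ennreal_leI[OF mm] by (rule order_trans)
  have deep: "(\<integral>\<^sup>+\<omega>. norm (trunc_diff (ln \<delta>) j \<beta> \<omega>) \<partial>M) \<le> ennreal (2 * e)" if j: "j \<in> {1..<d}" for j
  proof -
    have j': "1 \<le> j" "Suc j \<le> d" using j by auto
    have "(\<integral>\<^sup>+\<omega>. norm (trunc_diff (ln \<delta>) j \<beta> \<omega>) \<partial>M) \<le> ennreal (e + e powr (1 - p) * (96 / (\<kappa> * \<delta>) * \<rho>))"
      by (rule deep_level_bound[OF p \<kappa> c \<delta> e j' \<rho>])
    then show ?thesis
      by (rule order_trans) (use deep_le in \<open>intro ennreal_leI, linarith\<close>)
  qed
  have "(\<Sum>j=1..<d. \<integral>\<^sup>+\<omega>. norm (trunc_diff (ln \<delta>) j \<beta> \<omega>) \<partial>M) \<le> (\<Sum>j=1..<d. ennreal (2 * e))"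
    by (rule sum_mono[OF deep])
  also have "\<dots> = ennreal (\<Sum>j=1..<d. 2 * e)" using e by (intro sum_ennreal) simp
  also have "\<dots> \<le> ennreal (2 * real d * e)" using e by (intro ennreal_leI) (simp add: algebra_simps)
  finally have D: "(\<Sum>j=1..<d. \<integral>\<^sup>+\<omega>. norm (trunc_diff (ln \<delta>) j \<beta> \<omega>) \<partial>M) \<le> ennreal (2 * real d * e)" .
  have "(\<integral>\<^sup>+\<omega>. norm (err r \<delta> s0 \<beta> \<omega>) \<partial>M) \<le> ennreal (2 * e) + ennreal e + ennreal e + ennreal (2 * real d * e)"
    using err_nn_integral_le[OF r] by (rule order_trans) (intro add_mono t m D ennreal_leI gap_le)
  also have "\<dots> = ennreal (2 * e + e + e + 2 * real d * e)" using e by (simp add: ennreal_plus[symmetric] del: ennreal_plus)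
  also have "2 * e + e + e + 2 * real d * e = (2 * real d + 4) * e" by (simp add: algebra_simps)
  finally show ?thesis .
qed

text \<open>The exceptional event is the union of two: the one from \<open>uniform_Markov\<close>,
  outside which the error is small on the whole disc, and the one where some point lies below
  \<delta>.\<close>

lemma approximation_event:
  assumes r: "1 \<le> r" and \<delta>: "0 < \<delta>" "\<delta> \<le> 1" and S: "open S" "cball \<beta>0 (2 * R) \<subseteq> S" and R: "0 < R"
    and nz: "\<And>\<beta>. \<beta> \<in> S \<Longrightarrow> \<beta> * of_real s0 \<noteq> 1"
    and bound: "\<And>\<beta>. \<beta> \<in> cball \<beta>0 (2 * R) \<Longrightarrow> (\<integral>\<^sup>+\<omega>. norm (err r \<delta> s0 \<beta> \<omega>) \<partial>M) \<le> ennreal \<eta>"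
    and \<eta>: "0 \<le> \<eta>" and e: "0 < e" and c: "real (N 1) * site_const u \<le> 2"
  shows "\<exists>B\<in>events. prob B \<le> 2 * \<eta> / e + 2 * \<delta> \<and> (\<forall>\<omega>\<in>space M - B. \<forall>z\<in>cball \<beta>0 R.
    norm ((grem_partition d a N \<xi> n z \<omega> - expectation (\<lambda>\<omega>. grem_partition d a N \<xi> n z \<omega>)) / exp (z * of_real (sqrt (real n * a 1) * u) + grem_c_tilde d a N n z)
      - cell_zeta r (cell_count r \<omega>) (z * of_real s0)) \<le> e)"
proof -
  obtain B where B: "B \<in> events" "prob B \<le> 2 * \<eta> / e" "\<forall>\<omega>\<in>space M - B. \<forall>z\<in>cball \<beta>0 R. norm (err r \<delta> s0 z \<omega>) \<le> e"
    using uniform_Markov[OF holomorphic_err[OF nz] S R err_measurable bound e \<eta>] by blast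
  define L where "L = {\<omega>\<in>space M. \<exists>\<eta>\<in>grem_level 1 N. V \<eta> \<omega> < ln \<delta>}"
  have L: "L \<in> events" "prob L \<le> real (N 1) * site_const u * \<delta>" unfolding L_def using low_points_prob[OF \<delta>(1)] by auto
  have "real (N 1) * site_const u * \<delta> \<le> 2 * \<delta>" using c \<delta> by (intro mult_right_mono) auto
  then have "prob (B \<union> L) \<le> 2 * \<eta> / e + 2 * \<delta>"
    using measure_Un_le[OF B(1) L(1)] B(2) L(2) by linarith
  moreover have "norm ((grem_partition d a N \<xi> n z \<omega> - expectation (\<lambda>\<omega>. grem_partition d a N \<xi> n z \<omega>)) / exp (z * of_real (sqrt (real n * a 1) * u) + grem_c_tilde d a N n z)
      - cell_zeta r (cell_count r \<omega>) (z * of_real s0)) \<le> e" if \<omega>: "\<omega> \<in> space M - (B \<union> L)" and z: "z \<in> cball \<beta>0 R" for \<omega> z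
  proof -
    have "ln \<delta> \<le> ln (real r)" using \<delta> r by (intro ln_mono) auto
    moreover have "ln \<delta> \<le> V \<eta> \<omega>" if "\<eta> \<in> grem_level 1 N" for \<eta>
      by (rule leI) (use \<omega> that in \<open>auto simp: L_def\<close>)
    ultimately show ?thesis using B(3) \<omega> z by (subst normalized_eq_err[OF r]) auto
  qed
  ultimately show ?thesis using B(1) L(1) by (intro bexI[of _ "B \<union> L"]) blast+
qed

end

section \<open>The sequence of models\<close>

locale grem_sequence =
  fixes d :: nat and a \<alpha> :: "nat \<Rightarrow> real" and N :: "nat \<Rightarrow> nat \<Rightarrow> nat" and M :: "nat \<Rightarrow> 'a measure"
    and \<xi> :: "nat \<Rightarrow> nat list \<Rightarrow> 'a \<Rightarrow> real" and u :: "nat \<Rightarrow> real"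
  assumes d: "1 \<le> d"
    and a: "\<And>j. j \<in> {1..d} \<Longrightarrow> 0 < a j"
    and alpha: "\<And>j. j \<in> {1..d} \<Longrightarrow> 1 < \<alpha> j"
    and N: "\<And>j. j \<in> {1..d} \<Longrightarrow> (\<lambda>n. real (N n j) / \<alpha> j ^ n) \<longlonglongrightarrow> 1"
    and sigma: "strict_mono_on {1..d} (grem_sigma a \<alpha>)"
    and M: "\<And>n. prob_space (M n)"
    and normal: "\<And>n \<eta>. \<eta> \<in> (\<Union>j\<in>{1..d}. grem_level j (N n)) \<Longrightarrow>
          distributed (M n) lborel (\<xi> n \<eta>) std_normal_density"
    and indep: "\<And>n. prob_space.indep_vars (M n) (\<lambda>_. borel) (\<xi> n)
          (\<Union>j\<in>{1..d}. grem_level j (N n))"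
    and u: "(\<lambda>n. real (N n 1)) \<sim>[sequentially] (\<lambda>n. sqrt (2 * pi) * u n * exp ((u n)\<^sup>2 / 2))"
begin

definition \<sigma>1 :: real where "\<sigma>1 = grem_sigma a \<alpha> 1"

definition T :: "complex set" where "T = {\<beta>. \<sigma>1 / 2 < Re \<beta> \<and> Re \<beta> + \<bar>Im \<beta>\<bar> < \<sigma>1}"

definition fluct :: "nat \<Rightarrow> complex \<Rightarrow> 'a \<Rightarrow> complex" where
  "fluct n \<beta> \<omega> = (grem_partition d a (N n) (\<xi> n) n \<beta> \<omega> - (\<integral>\<omega>'. grem_partition d a (N n) (\<xi> n) n \<beta> \<omega>' \<partial>M n))
     / exp (\<beta> * of_real (sqrt (real n * a 1) * u n) + grem_c_tilde d a (N n) n \<beta>)"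

definition count :: "nat \<Rightarrow> nat \<Rightarrow> 'a \<Rightarrow> nat \<Rightarrow> nat" where
  "count n r \<omega> i = card {\<eta>\<in>grem_level 1 (N n). exp (- u n * (\<xi> n \<eta> \<omega> - u n)) \<in> cell r i}"

lemma one_d: "1 \<in> {1..d}" using d by simp

lemma \<sigma>1_pos: "0 < \<sigma>1"
  unfolding \<sigma>1_def grem_sigma_def using a[OF one_d] alpha[OF one_d] by simp

lemmas asymptotics = grem_asymptotics[OF N[OF one_d] alpha[OF one_d] a[OF one_d] u]

lemma s_tendsto: "(\<lambda>n. sqrt (real n * a 1) / u n) \<longlonglongrightarrow> 1 / \<sigma>1"
  using asymptotics(4) unfolding \<sigma>1_def grem_sigma_def .

lemma N_lower: "\<forall>\<^sub>F n in sequentially. \<forall>j\<in>{1..d}. \<alpha> j ^ n / 2 \<le> real (N n j)"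
proof (rule eventually_ball_finite[OF finite_atLeastAtMost], rule ballI)
  fix j assume j: "j \<in> {1..d}"
  have "\<forall>\<^sub>F n in sequentially. 1/2 < real (N n j) / \<alpha> j ^ n" by (rule order_tendstoD(1)[OF N[OF j]]) simp
  then show "\<forall>\<^sub>F n in sequentially. \<alpha> j ^ n / 2 \<le> real (N n j)"
    by eventually_elim (use alpha[OF j] in \<open>simp add: field_simps\<close>)
qed

lemma gremI:
  assumes "\<And>j. j \<in> {1..d} \<Longrightarrow> 0 < N n j" "0 < v" "0 < n"
  shows "grem (M n) d n a (N n) (\<xi> n) v"
  unfolding grem_def grem_axioms_def using assms d a M normal indep by blast

lemma eventually_grem: "\<forall>\<^sub>F n in sequentially. grem (M n) d n a (N n) (\<xi> n) (u n)"
  using N_lower asymptotics(1) eventually_gt_at_top[of 0]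
proof eventually_elim
  case (elim n)
  show ?case
  proof (rule gremI)
    fix j assume j: "j \<in> {1..d}"
    have "0 < \<alpha> j ^ n / 2" using alpha[OF j] by simp
    then show "0 < N n j" using elim(1) j by fastforce
  qed (use elim in auto)
qed

text \<open>The ordering of the \<sigma>_i enters here: \<sigma>_i \<ge> \<sigma>_1 means ln
  \<alpha>_i \<ge> a_i \<sigma>_1^2 / 2, so the exponent found for the critical growth serves all
  deeper levels. \<beta> enters only through \<open>Q\<close>, which makes the bound
  uniform.\<close>

lemma deep_decay:
  assumes p: "1 < p" "p \<le> 2" and \<kappa>: "0 < \<kappa>"
  shows "\<exists>\<rho>. \<rho> \<longlonglongrightarrow> 0 \<and> (\<forall>\<^sub>F n in sequentially. \<forall>i\<in>{2..d}. \<forall>Q. Q + (1 - p) * \<sigma>1\<^sup>2 < - \<kappa> \<longrightarrow>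
    real (N n i) powr (1 - p) * exp (real n * a i / 2 * Q) \<le> \<rho> n)"
proof -
  define m where "m = Min (a ` {1..d})"
  have fin: "finite (a ` {1..d})" "a ` {1..d} \<noteq> {}" using d by auto
  have m: "0 < m" unfolding m_def using fin a by (subst Min_gr_iff) auto
  have m_le: "m \<le> a i" if "i \<in> {1..d}" for i unfolding m_def using that by (intro Min_le fin) auto
  \<comment> \<open>The factor 2 pays for the lower bound N \<ge> \<alpha>^n / 2, as p - 1 \<le>
    1.\<close>
  define \<rho> where "\<rho> n = 2 * exp (- (\<kappa> * m / 2) * real n)" for n
  have "0 < \<kappa> * m / 2" using \<kappa> m by simp
  moreover have "(\<lambda>n. 2 * exp (- c * real n)) \<longlonglongrightarrow> 0" if "0 < c" for c :: real using that by real_asymp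
  ultimately have "\<rho> \<longlonglongrightarrow> 0" unfolding \<rho>_def by blast
  moreover have "\<forall>\<^sub>F n in sequentially. \<forall>i\<in>{2..d}. \<forall>Q. Q + (1 - p) * \<sigma>1\<^sup>2 < - \<kappa> \<longrightarrow>
    real (N n i) powr (1 - p) * exp (real n * a i / 2 * Q) \<le> \<rho> n"
    using N_lower
  proof (eventually_elim, intro ballI allI impI)
    fix n i Q assume Nl: "\<forall>j\<in>{1..d}. \<alpha> j ^ n / 2 \<le> real (N n j)" and i: "i \<in> {2..d}" and Q: "Q + (1 - p) * \<sigma>1\<^sup>2 < - \<kappa>"
    have i1: "i \<in> {1..d}" using i by auto
    have ai: "0 < a i" and al: "1 < \<alpha> i" using a[OF i1] alpha[OF i1] by auto
    have "\<sigma>1 \<le> grem_sigma a \<alpha> i" unfolding \<sigma>1_def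
      using strict_mono_onD[OF sigma one_d i1] i by simp
    then have "\<sigma>1\<^sup>2 \<le> (grem_sigma a \<alpha> i)\<^sup>2" using \<sigma>1_pos by (intro power_mono) auto
    also have "\<dots> = 2 * ln (\<alpha> i) / a i" unfolding grem_sigma_def using ai al by (intro real_sqrt_pow2) auto
    finally have ln_ge: "a i * \<sigma>1\<^sup>2 / 2 \<le> ln (\<alpha> i)" using ai by (simp add: field_simps)
    have "real (N n i) powr (1 - p) \<le> (\<alpha> i ^ n / 2) powr (1 - p)"
      using Nl i1 al p by (intro powr_mono2') auto
    also have "\<dots> = exp ((1 - p) * (real n * ln (\<alpha> i) - ln 2))"
      using al by (simp add: powr_def ln_div ln_realpow)
    also have "\<dots> \<le> exp (ln 2 + (1 - p) * (real n * (a i * \<sigma>1\<^sup>2 / 2)))"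
    proof -
      have "(1 - p) * (real n * ln (\<alpha> i)) \<le> (1 - p) * (real n * (a i * \<sigma>1\<^sup>2 / 2))"
        using ln_ge p by (intro mult_left_mono_neg mult_left_mono) auto
      moreover have "(p - 1) * ln 2 \<le> 1 * ln 2" using p by (intro mult_right_mono) auto
      moreover have "(1 - p) * (real n * ln (\<alpha> i) - ln 2) = (1 - p) * (real n * ln (\<alpha> i)) + (p - 1) * ln 2"
        by (simp add: algebra_simps)
      ultimately show ?thesis unfolding exp_le_cancel_iff by linarith
    qed
    finally have "real (N n i) powr (1 - p) * exp (real n * a i / 2 * Q)
       \<le> exp (ln 2 + (1 - p) * (real n * (a i * \<sigma>1\<^sup>2 / 2))) * exp (real n * a i / 2 * Q)"
      by (rule mult_right_mono) simp
    also have "\<dots> = 2 * exp (real n * a i / 2 * (Q + (1 - p) * \<sigma>1\<^sup>2))"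
    proof -
      have "real n * a i / 2 * (Q + (1 - p) * \<sigma>1\<^sup>2) = (1 - p) * (real n * (a i * \<sigma>1\<^sup>2 / 2)) + real n * a i / 2 * Q"
        by (simp add: field_simps)
      then show ?thesis by (simp only: exp_add) simp
    qed
    also have "real n * a i / 2 * (Q + (1 - p) * \<sigma>1\<^sup>2) \<le> real n * a i / 2 * (- \<kappa>)"
      using Q ai by (intro mult_left_mono) auto
    also have "\<dots> \<le> - (\<kappa> * m / 2) * real n"
      using mult_left_mono[OF m_le[OF i1], of "\<kappa> / 2 * real n"] \<kappa> by (simp add: algebra_simps)
    finally show "real (N n i) powr (1 - p) * exp (real n * a i / 2 * Q) \<le> \<rho> n" unfolding \<rho>_def by simp
  qed
  ultimately show ?thesis by blast
qed

text \<open>The order of choices matters: p, \<kappa> and R depend on \<beta>0 only, \<delta> on the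
  tolerance; then r is taken large for the tail and the cell width, and finally n for everything
  that depends on the model.\<close>

lemma local_approximation:
  assumes \<beta>0: "\<beta>0 \<in> T"
  shows "\<exists>R>0. \<forall>e>0. \<exists>r0. \<forall>r\<ge>r0. \<forall>\<^sub>F n in sequentially. \<exists>B\<in>sets (M n). measure (M n) B \<le> e \<and>
    (\<forall>\<omega>\<in>space (M n) - B. \<forall>z\<in>cball \<beta>0 R. norm (fluct n z \<omega> - cell_zeta r (count n r \<omega>) (z * of_real (1 / \<sigma>1))) \<le> e)"
proof -
  define s0 where "s0 = 1 / \<sigma>1"
  have s0: "0 < s0" unfolding s0_def using \<sigma>1_pos by simp
  define sn where "sn n = sqrt (real n * a 1) / u n" for n
  have b0: "\<sigma>1 / 2 < Re \<beta>0" "Re \<beta>0 + \<bar>Im \<beta>0\<bar> < \<sigma>1" using \<beta>0 unfolding T_def by auto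
  obtain p \<kappa> R where p: "1 < p" "p \<le> 2" and \<kappa>: "0 < \<kappa>" "\<kappa> \<le> 1" and R: "0 < R" and
    box: "\<And>\<beta>. \<beta> \<in> cball \<beta>0 (2 * R) \<Longrightarrow> \<sigma>1 / 2 < Re \<beta> \<and> Re \<beta> + \<bar>Im \<beta>\<bar> < \<sigma>1
       \<and> 1 + \<kappa> < p * Re \<beta> * s0 \<and> Re \<beta> * s0 < 1 - \<kappa>
       \<and> p\<^sup>2 * (Re \<beta>)\<^sup>2 - p * (Re \<beta>)\<^sup>2 + p * (Im \<beta>)\<^sup>2 + (1 - p) * \<sigma>1\<^sup>2 < - \<kappa>"
    unfolding s0_def
  proof (rule moment_exponent_exists[OF \<sigma>1_pos b0])
    fix p \<kappa> R assume *: "1 < p" "p \<le> 2" "0 < \<kappa>" "\<kappa> \<le> 1" "0 < R"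
      "\<And>\<beta>. \<beta> \<in> cball \<beta>0 (2 * R) \<Longrightarrow> \<sigma>1 / 2 < Re \<beta> \<and> Re \<beta> + \<bar>Im \<beta>\<bar> < \<sigma>1
       \<and> 1 + \<kappa> < p * Re \<beta> * (1 / \<sigma>1) \<and> Re \<beta> * (1 / \<sigma>1) < 1 - \<kappa>
       \<and> p\<^sup>2 * (Re \<beta>)\<^sup>2 - p * (Re \<beta>)\<^sup>2 + p * (Im \<beta>)\<^sup>2 + (1 - p) * \<sigma>1\<^sup>2 < - \<kappa>"
    show thesis by (rule that[OF *(1-5)]) (unfold s0_def, rule *(6))
  qed
  define B where "B = norm \<beta>0 + 2 * R"
  have B: "norm \<beta> \<le> B" if "\<beta> \<in> cball \<beta>0 (2 * R)" for \<beta>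
    using that norm_triangle_ineq2[of \<beta> \<beta>0] unfolding B_def by (simp add: dist_norm norm_minus_commute)
  have B0: "0 < B" unfolding B_def using R by (simp add: add_nonneg_pos)
  obtain \<rho> where \<rho>: "\<rho> \<longlonglongrightarrow> 0" "\<forall>\<^sub>F n in sequentially. \<forall>i\<in>{2..d}. \<forall>Q. Q + (1 - p) * \<sigma>1\<^sup>2 < - \<kappa> \<longrightarrow>
    real (N n i) powr (1 - p) * exp (real n * a i / 2 * Q) \<le> \<rho> n"
    using deep_decay[OF p \<kappa>(1)] by blast
  have T_open: "open T" using bounded_open_set.open_D[OF bounded_open_triangle[OF \<sigma>1_pos]] unfolding T_def .
  have nz: "\<beta> * of_real s0 \<noteq> 1" if "\<beta> \<in> T" for \<beta>
  proof
    assume "\<beta> * of_real s0 = 1"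
    then have "Re (\<beta> * of_real s0) = 1" by simp
    then have "Re \<beta> * s0 = 1" by simp
    then have "Re \<beta> = \<sigma>1" unfolding s0_def using \<sigma>1_pos by (simp add: field_simps)
    then show False using that unfolding T_def by auto
  qed
  have sub: "cball \<beta>0 (2 * R) \<subseteq> T" using box unfolding T_def by blast
  have main: "\<exists>r0. \<forall>r\<ge>r0. \<forall>\<^sub>F n in sequentially. \<exists>B\<in>sets (M n). measure (M n) B \<le> e \<and>
    (\<forall>\<omega>\<in>space (M n) - B. \<forall>z\<in>cball \<beta>0 R. norm (fluct n z \<omega> - cell_zeta r (count n r \<omega>) (z * of_real s0)) \<le> e)"
    if e: "0 < e" for e
  proof -
    \<comment> \<open>Together with \<eta> = e^2 / 4 this makes the exceptional probability
      2\<eta>/e + 2\<delta> at most e/2 + e/2; \<open>q\<close> divides \<eta> among the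
      contributions to the error.\<close>
    define \<delta> where "\<delta> = min 1 (e / 4)"
    have \<delta>: "0 < \<delta>" "\<delta> \<le> 1" "2 * \<delta> \<le> e / 2" unfolding \<delta>_def using e by auto
    define \<eta> where "\<eta> = e\<^sup>2 / 4"
    define q where "q = \<eta> / (2 * real d + 4)"
    have q: "0 < q" "(2 * real d + 4) * q = \<eta>" unfolding q_def \<eta>_def using e by (auto simp: field_simps)
    \<comment> \<open>Half of the margin is reserved for the difference between \<open>sn n\<close>
      and its limit. That difference, times Re \<beta>, is later kept below \<kappa>/4, since the
      factor p \<le> 2 may double it.\<close>
    have \<kappa>2: "0 < \<kappa> / 2" using \<kappa> by simp
    have "(\<lambda>r. q powr (1 - p) * (96 / (\<kappa> / 2) * real r powr (- (\<kappa> / 2)))) \<longlonglongrightarrow> q powr (1 - p) * (96 / (\<kappa> / 2) * 0)"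
    proof (intro tendsto_mult tendsto_const)
      show "(\<lambda>r. real r powr (- (\<kappa> / 2))) \<longlonglongrightarrow> 0" using \<kappa>2 by real_asymp
    qed
    then have ev1: "\<forall>\<^sub>F r in sequentially. q powr (1 - p) * (96 / (\<kappa> / 2) * real r powr (- (\<kappa> / 2))) < q"
      using q(1) by (intro order_tendstoD(2)[of _ "q powr (1 - p) * (96 / (\<kappa> / 2) * 0)"]) auto
    \<comment> \<open>About r points, each moved by at most r^(-2), give an error of order 1/r. The
      slope is already replaced by its limit; n will remove the difference once r is fixed.\<close>
    have "(\<lambda>r. 2 * real r * (B / \<delta> * (s0 * (1 / (real r)\<^sup>2 / \<delta>)))) \<longlonglongrightarrow> 0" using B0 \<delta>(1) s0 by real_asymp
    then have ev2: "\<forall>\<^sub>F r in sequentially. 2 * real r * (B / \<delta> * (s0 * (1 / (real r)\<^sup>2 / \<delta>))) < q"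
      using q(1) by (intro order_tendstoD(2)[of _ 0]) auto
    obtain r0 where r0: "\<And>r. r \<ge> r0 \<Longrightarrow> 1 \<le> r \<and> q powr (1 - p) * (96 / (\<kappa> / 2) * real r powr (- (\<kappa> / 2))) < q
        \<and> 2 * real r * (B / \<delta> * (s0 * (1 / (real r)\<^sup>2 / \<delta>))) < q"
      using eventually_conj[OF eventually_ge_at_top[of 1] eventually_conj[OF ev1 ev2]] unfolding eventually_sequentially by blast
    have "\<forall>\<^sub>F n in sequentially. \<exists>B\<in>sets (M n). measure (M n) B \<le> e \<and>
      (\<forall>\<omega>\<in>space (M n) - B. \<forall>z\<in>cball \<beta>0 R. norm (fluct n z \<omega> - cell_zeta r (count n r \<omega>) (z * of_real s0)) \<le> e)"
      if rr: "r0 \<le> r" for r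
    proof -
      have r: "1 \<le> r" and t1: "q powr (1 - p) * (96 / (\<kappa> / 2) * real r powr (- (\<kappa> / 2))) \<le> q"
        and t2: "2 * real r * (B / \<delta> * (s0 * (1 / (real r)\<^sup>2 / \<delta>))) < q" using r0[OF rr] by auto
      have sl: "sn \<longlonglongrightarrow> s0" using s_tendsto unfolding sn_def s0_def .
      have "(\<lambda>n. 2 * real r * (B / \<delta> * (\<bar>sn n - s0\<bar> * (1 / \<delta> + real r) + s0 * (1 / (real r)\<^sup>2 / \<delta>))))
        \<longlonglongrightarrow> 2 * real r * (B / \<delta> * (\<bar>s0 - s0\<bar> * (1 / \<delta> + real r) + s0 * (1 / (real r)\<^sup>2 / \<delta>)))"
        by (intro tendsto_intros sl)
      then have n1: "\<forall>\<^sub>F n in sequentially. 2 * real r * (B / \<delta> * (\<bar>sn n - s0\<bar> * (1 / \<delta> + real r) + s0 * (1 / (real r)\<^sup>2 / \<delta>))) < q"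
        using t2 by (intro order_tendstoD(2)) simp_all
      have "(\<lambda>n. B * \<bar>sn n - s0\<bar>) \<longlonglongrightarrow> B * \<bar>s0 - s0\<bar>" by (intro tendsto_intros sl)
      then have n2: "\<forall>\<^sub>F n in sequentially. B * \<bar>sn n - s0\<bar> < \<kappa> / 4"
        using \<kappa> by (intro order_tendstoD(2)[of _ 0]) simp_all
      have n3: "\<forall>\<^sub>F n in sequentially. real (N n 1) * site_const (u n) < 2"
        by (rule order_tendstoD(2)[OF asymptotics(3)]) simp
      have "(\<lambda>n. q powr (1 - p) * (96 / (\<kappa> / 2 * \<delta>) * \<rho> n)) \<longlonglongrightarrow> q powr (1 - p) * (96 / (\<kappa> / 2 * \<delta>) * 0)"
        by (intro tendsto_intros \<rho>(1))
      then have n4: "\<forall>\<^sub>F n in sequentially. q powr (1 - p) * (96 / (\<kappa> / 2 * \<delta>) * \<rho> n) < q"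
        using q(1) by (intro order_tendstoD(2)) simp_all
      have n5: "\<forall>\<^sub>F n in sequentially. \<rho> n < 1" by (rule order_tendstoD(2)[OF \<rho>(1)]) simp
      note n6 = site_mean_limit[OF asymptotics(3) asymptotics(2) sl \<kappa>2 q(1), of B "ln (real r)"]
      show ?thesis using eventually_grem n1 n2 n3 n4 n5 n6 \<rho>(2)
      proof eventually_elim
        case (elim n)
        interpret g: grem "M n" d n a "N n" "\<xi> n" "u n" by (rule elim(1))
        have gs: "g.s = sn n" unfolding g.s_def sn_def ..
        have sn0: "0 \<le> sn n" unfolding sn_def using g.u_pos by (intro divide_nonneg_pos real_sqrt_ge_zero mult_nonneg_nonneg) (use a[OF one_d] in auto)
        have bound: "(\<integral>\<^sup>+\<omega>. norm (g.err r \<delta> s0 \<beta> \<omega>) \<partial>M n) \<le> ennreal \<eta>" if \<beta>: "\<beta> \<in> cball \<beta>0 (2 * R)" for \<beta>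
        proof -
          have b: "\<sigma>1 / 2 < Re \<beta>" "1 + \<kappa> < p * Re \<beta> * s0" "Re \<beta> * s0 < 1 - \<kappa>"
             "p\<^sup>2 * (Re \<beta>)\<^sup>2 - p * (Re \<beta>)\<^sup>2 + p * (Im \<beta>)\<^sup>2 + (1 - p) * \<sigma>1\<^sup>2 < - \<kappa>" using box[OF \<beta>] by auto
          have Re0: "0 < Re \<beta>" using b(1) \<sigma>1_pos by linarith
          have "\<bar>Re \<beta> * sn n - Re \<beta> * s0\<bar> = \<bar>Re \<beta>\<bar> * \<bar>sn n - s0\<bar>" by (simp add: abs_mult[symmetric] algebra_simps)
          also have "\<dots> \<le> B * \<bar>sn n - s0\<bar>" using abs_Re_le_cmod[of \<beta>] B[OF \<beta>] by (intro mult_right_mono) auto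
          finally have ds: "\<bar>Re \<beta> * sn n - Re \<beta> * s0\<bar> \<le> \<kappa> / 4" using elim(3) by linarith
          have rs: "0 \<le> Re \<beta> * sn n" "0 \<le> Re \<beta> * s0" using Re0 sn0 s0 by simp_all
          have rs1: "Re \<beta> * sn n \<le> 1 - \<kappa> / 2" using ds b(3) \<kappa> by linarith
          have "Re \<beta> * s0 - Re \<beta> * sn n \<le> \<kappa> / 4" using ds by linarith
          then have "p * (Re \<beta> * s0 - Re \<beta> * sn n) \<le> p * (\<kappa> / 4)" using p by (intro mult_left_mono) auto
          also have "\<dots> \<le> 2 * (\<kappa> / 4)" using p \<kappa> by (intro mult_right_mono) auto
          finally have "p * (Re \<beta> * s0 - Re \<beta> * sn n) \<le> 2 * (\<kappa> / 4)" .
          then have ps: "1 + \<kappa> / 2 \<le> p * Re \<beta> * sn n" using b(2) by (simp add: algebra_simps)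
          have "p * (Re \<beta> * sn n) \<le> 2 * 1" using p rs rs1 \<kappa> by (intro mult_mono) auto
          then have ps2: "p * Re \<beta> * sn n \<le> 2" by (simp add: mult.assoc)
          have gap: "norm (g.compensator_gap r s0 \<beta>) \<le> q"
            unfolding g.compensator_gap_def gs using elim(7) rs rs1 b(3) B[OF \<beta>] \<kappa> unfolding sn_def by auto
          have deep: "real (N n i) powr (1 - p) * g.mom p \<beta> i \<le> \<rho> n" if "i \<in> {2..d}" for i
            unfolding g.mom_def using elim(8) that b(4) by blast
          have "(\<integral>\<^sup>+\<omega>. norm (g.err r \<delta> s0 \<beta> \<omega>) \<partial>M n) \<le> ennreal ((2 * real d + 4) * q)"
          proof (rule g.err_small[OF p \<kappa>2, of \<beta> s0 B r \<delta> q "\<rho> n"])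
            show "1 + \<kappa> / 2 \<le> p * Re \<beta> * g.s" "p * Re \<beta> * g.s \<le> 2" "0 \<le> Re \<beta> * g.s" "Re \<beta> * g.s \<le> 1"
              unfolding gs using ps ps2 rs rs1 \<kappa> by linarith+
            show "2 * real r * (B / \<delta> * (\<bar>g.s - s0\<bar> * (1 / \<delta> + real r) + s0 * (1 / (real r)\<^sup>2 / \<delta>))) \<le> q"
              unfolding gs using elim(2) by linarith
          qed (use rs b(3) \<kappa> B[OF \<beta>] s0 elim(4,5,6) r \<delta> q(1) t1 gap deep in auto)
          then show ?thesis unfolding q(2) .
        qed
        have \<eta>0: "0 \<le> \<eta>" unfolding \<eta>_def by simp
        have ev: "\<exists>B\<in>g.events. g.prob B \<le> 2 * \<eta> / e + 2 * \<delta> \<and> (\<forall>\<omega>\<in>space (M n) - B. \<forall>z\<in>cball \<beta>0 R.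
            norm (fluct n z \<omega> - cell_zeta r (g.cell_count r \<omega>) (z * of_real s0)) \<le> e)"
          unfolding fluct_def
          by (rule g.approximation_event[OF r \<delta>(1,2) T_open sub R nz bound \<eta>0 e]) (use elim(4) in auto)
        have cc: "g.cell_count r \<omega> = count n r \<omega>" for \<omega>
          unfolding g.cell_count_def[abs_def] count_def[abs_def] g.V_def by simp
        have le: "2 * \<eta> / e + 2 * \<delta> \<le> e" using \<delta>(3) e unfolding \<eta>_def by (simp add: power2_eq_square)
        obtain B' where B': "B' \<in> g.events" "g.prob B' \<le> 2 * \<eta> / e + 2 * \<delta>" "\<forall>\<omega>\<in>space (M n) - B'. \<forall>z\<in>cball \<beta>0 R.
            norm (fluct n z \<omega> - cell_zeta r (count n r \<omega>) (z * of_real s0)) \<le> e"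
          using ev unfolding cc by (elim bexE conjE) (rule that)
        show ?case using order_trans[OF B'(2) le] B'(3) B'(1) by (intro bexI[of _ B'] conjI)
      qed
    qed
    then show ?thesis by blast
  qed
  from R show ?thesis using main unfolding s0_def by blast
qed

end

section \<open>Cell counts and the limit\<close>

text \<open>Counts are passed as a list because \<open>nat list\<close> is a countable type: every
  function of the counts is then measurable, and convergence of point masses suffices.\<close>

definition cell_field :: "complex set \<Rightarrow> real \<Rightarrow> nat \<Rightarrow> nat list \<Rightarrow> complex \<Rightarrow> complex" where
  "cell_field D s r c = restrict (\<lambda>\<beta>. cell_zeta r (\<lambda>i. c ! i) (\<beta> * of_real s)) D"

lemma cell_zeta_cong: "(\<And>i. i < r^3 \<Longrightarrow> c i = c' i) \<Longrightarrow> cell_zeta r c z = cell_zeta r c' z"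
  unfolding cell_zeta_def by (intro arg_cong2[of _ _ _ _ "(-)"] sum.cong refl) simp

lemma cell_field_map: "z \<in> D \<Longrightarrow> cell_field D s r (map f [0..<r^3]) z = cell_zeta r f (z * of_real s)"
  unfolding cell_field_def by (simp, rule cell_zeta_cong) simp

lemma measure_cell: "0 < r \<Longrightarrow> measure lborel (cell r i) = 1 / (real r)\<^sup>2"
proof -
  assume r: "0 < r"
  have "real i / (real r)\<^sup>2 \<le> real (Suc i) / (real r)\<^sup>2" by (intro divide_right_mono) auto
  then have "measure lborel (cell r i) = real (Suc i) / (real r)\<^sup>2 - real i / (real r)\<^sup>2"
    unfolding cell_def by (rule measure_lborel_Ioc)
  then show ?thesis by (simp add: diff_divide_distrib[symmetric])
qed

lemma cell_lborel: "cell r i \<in> sets borel" "cell r i \<subseteq> {0<..}" "emeasure lborel (cell r i) < \<infinity>"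
proof -
  show "cell r i \<in> sets borel" unfolding cell_def by simp
  show "cell r i \<subseteq> {0<..}"
  proof
    fix x assume "x \<in> cell r i"
    then have "real i / (real r)\<^sup>2 < x" unfolding cell_def by simp
    moreover have "0 \<le> real i / (real r)\<^sup>2" by simp
    ultimately show "x \<in> {0<..}" unfolding greaterThan_iff by linarith
  qed
  have "real i / (real r)\<^sup>2 \<le> real (Suc i) / (real r)\<^sup>2" by (intro divide_right_mono) auto
  then show "emeasure lborel (cell r i) < \<infinity>" unfolding cell_def by (simp del: of_nat_Suc)
qed

lemma poisson_cell_counts:
  assumes M: "prob_space M" and P: "unit_poisson_points M P" and r: "0 < r"
  shows "(\<lambda>\<omega>. map (\<lambda>i. card {k. P k \<omega> \<in> cell r i}) [0..<r^3]) \<in> measurable M (count_space UNIV)"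
    and "measure M {\<omega>\<in>space M. \<forall>i<r^3. card {k. P k \<omega> \<in> cell r i} = c i}
      = (\<Prod>i<r^3. (1 / (real r)\<^sup>2) ^ c i / fact (c i) * exp (- (1 / (real r)\<^sup>2)))"
proof -
  interpret prob_space M by (rule M)
  let ?L = "r ^ 3"
  define A where "A i = (if i < ?L then cell r i else {})" for i
  have ind: "indep_vars (\<lambda>_. count_space UNIV) (\<lambda>i \<omega>. card {k. P k \<omega> \<in> A i}) UNIV"
  proof (rule unit_poisson_points_indep[OF P])
    show "A i \<in> sets borel" for i unfolding A_def by (cases "i < ?L") (auto simp: cell_lborel)
    show "A i \<subseteq> {0<..}" for i unfolding A_def using cell_lborel(2)[of r i] by (cases "i < ?L") auto
    show "emeasure lborel (A i) < \<infinity>" for i unfolding A_def using cell_lborel(3)[of r i] by (cases "i < ?L") auto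
    show "disjoint_family A" unfolding disjoint_family_on_def A_def using cell_disjoint[OF _ r] by auto
  qed
  have cm: "(\<lambda>\<omega>. card {k. P k \<omega> \<in> cell r i}) \<in> measurable M (count_space UNIV)" if "i < ?L" for i
  proof -
    have "(\<lambda>\<omega>. card {k. P k \<omega> \<in> A i}) \<in> measurable M (count_space UNIV)" using ind unfolding indep_vars_def by auto
    then show ?thesis unfolding A_def using that by simp
  qed
  then show "(\<lambda>\<omega>. map (\<lambda>i. card {k. P k \<omega> \<in> cell r i}) [0..<?L]) \<in> measurable M (count_space UNIV)"
    by (rule measurable_map_count_space)
  have ne: "{..<?L} \<noteq> {}" using r by (simp add: lessThan_empty_iff)
  have "{\<omega>\<in>space M. \<forall>i<?L. card {k. P k \<omega> \<in> cell r i} = c i} = (\<Inter>i\<in>{..<?L}. (\<lambda>\<omega>. card {k. P k \<omega> \<in> A i}) -` {c i} \<inter> space M)" (is "?X = ?Y")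
  proof (intro set_eqI iffI)
    fix \<omega> assume "\<omega> \<in> ?X" then show "\<omega> \<in> ?Y" unfolding A_def by simp
  next
    fix \<omega> assume y: "\<omega> \<in> ?Y"
    have i: "card {k. P k \<omega> \<in> cell r i} = c i \<and> \<omega> \<in> space M" if "i < ?L" for i
    proof -
      have "\<omega> \<in> (\<lambda>\<omega>. card {k. P k \<omega> \<in> A i}) -` {c i} \<inter> space M" using y that by blast
      then show ?thesis unfolding A_def using that by simp
    qed
    have "0 < ?L" using r by simp
    then show "\<omega> \<in> ?X" using i by blast
  qed
  then have "prob ?X = prob (\<Inter>i\<in>{..<?L}. (\<lambda>\<omega>. card {k. P k \<omega> \<in> A i}) -` {c i} \<inter> space M)" by simp
  also have "\<dots> = (\<Prod>i<?L. prob ((\<lambda>\<omega>. card {k. P k \<omega> \<in> A i}) -` {c i} \<inter> space M))"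
    by (rule indep_varsD[OF ind ne]) auto
  also have "\<dots> = (\<Prod>i<?L. (1 / (real r)\<^sup>2) ^ c i / fact (c i) * exp (- (1 / (real r)\<^sup>2)))"
  proof (rule prod.cong[OF refl])
    fix i assume i: "i \<in> {..<?L}"
    have "(\<lambda>\<omega>. card {k. P k \<omega> \<in> A i}) -` {c i} \<inter> space M = {\<omega>\<in>space M. card {k. P k \<omega> \<in> cell r i} = c i}"
      unfolding A_def using i by auto
    then show "prob ((\<lambda>\<omega>. card {k. P k \<omega> \<in> A i}) -` {c i} \<inter> space M) = (1 / (real r)\<^sup>2) ^ c i / fact (c i) * exp (- (1 / (real r)\<^sup>2))"
      using unit_poisson_pointsD(2)[OF P cell_lborel, where r1=r and i1=i] measure_cell[OF r, of i] by simp
  qed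
  finally show "prob ?X = (\<Prod>i<?L. (1 / (real r)\<^sup>2) ^ c i / fact (c i) * exp (- (1 / (real r)\<^sup>2)))" .
qed

section \<open>Weak convergence on the triangle\<close>

context grem_sequence
begin

lemma bounded_open_T: "bounded_open_set T"
  unfolding T_def by (rule bounded_open_triangle[OF \<sigma>1_pos])

lemma T_scaled:
  assumes "\<beta> \<in> T" shows "1/2 < Re (\<beta> * of_real (1 / \<sigma>1))" "Re (\<beta> * of_real (1 / \<sigma>1)) < 1" "1 - \<beta> * of_real (1 / \<sigma>1) \<noteq> 0"
proof -
  have *: "\<sigma>1 / 2 < Re \<beta>" "Re \<beta> < \<sigma>1" using assms unfolding T_def by auto
  have R: "Re (\<beta> * of_real (1 / \<sigma>1)) = Re \<beta> / \<sigma>1" by simp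
  show "1/2 < Re (\<beta> * of_real (1 / \<sigma>1))" unfolding R using * \<sigma>1_pos by (simp add: field_simps)
  show l: "Re (\<beta> * of_real (1 / \<sigma>1)) < 1" unfolding R using * \<sigma>1_pos by (simp add: field_simps)
  show "1 - \<beta> * of_real (1 / \<sigma>1) \<noteq> 0"
  proof
    assume "1 - \<beta> * of_real (1 / \<sigma>1) = 0"
    then have "\<beta> * of_real (1 / \<sigma>1) = 1" by simp
    then show False using l by (simp only: one_complex.simps)
  qed
qed

lemma cell_field_analytic: "cell_field T (1 / \<sigma>1) r c \<in> analytic_functions T"
  unfolding cell_field_def
proof (rule bounded_open_set.restrict_analytic[OF bounded_open_T])
  have l: "(\<lambda>\<beta>. \<beta> * complex_of_real (1 / \<sigma>1)) holomorphic_on T" by (intro holomorphic_intros)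
  have 1: "(\<lambda>\<beta>. of_nat (c ! i) * rpow x (- (\<beta> * complex_of_real (1 / \<sigma>1)))) holomorphic_on T" for i x
    by (rule holomorphic_on_mult[OF holomorphic_on_const holomorphic_rpow[OF holomorphic_on_minus[OF l]]])
  have 2: "(\<lambda>\<beta>. 1 - \<beta> * complex_of_real (1 / \<sigma>1)) holomorphic_on T" by (rule holomorphic_on_diff[OF holomorphic_on_const l])
  show "(\<lambda>\<beta>. cell_zeta r (\<lambda>i. c ! i) (\<beta> * of_real (1 / \<sigma>1))) holomorphic_on T"
    unfolding cell_zeta_def
    by (rule holomorphic_on_diff[OF holomorphic_on_sum[OF 1] holomorphic_on_divide[OF holomorphic_rpow[OF 2] 2 T_scaled(3)]])
qed

text \<open>Random elements are required for every n, including small ones where a level may be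
  empty or n = 0; hence the degenerate cases.\<close>

lemma expectation_holomorphic:
  "(\<lambda>\<beta>. \<integral>\<omega>'. grem_partition d a (N n) (\<xi> n) n \<beta> \<omega>' \<partial>M n) holomorphic_on T"
proof -
  interpret prob_space "M n" by (rule M)
  consider "n = 0" | j where "j \<in> {1..d}" "N n j = 0" | "0 < n" "\<And>j. j \<in> {1..d} \<Longrightarrow> 0 < N n j" by blast
  then show ?thesis
  proof cases
    case 1
    then have "grem_partition d a (N n) (\<xi> n) n \<beta> \<omega> = of_nat (card (grem_level d (N n)))" for \<beta> \<omega>
      unfolding grem_partition_def by simp
    then show ?thesis by simp
  next
    case 2
    have "grem_level d (N n) = {}"
    proof (rule ccontr)
      assume "grem_level d (N n) \<noteq> {}"
      then obtain \<epsilon> where "\<epsilon> \<in> grem_level d (N n)" by blast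
      then have "1 \<le> \<epsilon> ! (j - 1)" "\<epsilon> ! (j - 1) \<le> N n j" using 2(1) unfolding grem_level_def by auto
      then show False using 2(2) by simp
    qed
    then show ?thesis unfolding grem_partition_def by simp
  next
    case 3
    \<comment> \<open>The mean does not involve \<open>u\<close>, so the value 1 stands in for
      \<open>u n\<close>, which may fail to be positive for small n.\<close>
    have g: "grem (M n) d n a (N n) (\<xi> n) 1" by (rule gremI) (use 3 in auto)
    show ?thesis unfolding grem.expectation_partition[OF g] by (intro holomorphic_intros)
  qed
qed

lemma fluct_measurable: "(\<lambda>\<omega>. restrict (\<lambda>\<beta>. fluct n \<beta> \<omega>) T) \<in> measurable (M n) (borel_of (locally_uniform_topology T))"
proof -
  interpret T: bounded_open_set T by (rule bounded_open_T)
  define x where "x \<epsilon> \<omega> = sqrt (real n) * grem_field d a (\<xi> n) \<epsilon> \<omega>" for \<epsilon> \<omega>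
  define h where "h \<beta> = 1 / exp (\<beta> * of_real (sqrt (real n * a 1) * u n) + grem_c_tilde d a (N n) n \<beta>)" for \<beta>
  define f0 where "f0 \<beta> = - (\<integral>\<omega>'. grem_partition d a (N n) (\<xi> n) n \<beta> \<omega>' \<partial>M n) * h \<beta>" for \<beta>
  have h: "h holomorphic_on T" unfolding h_def[abs_def] grem_c_tilde_def by (intro holomorphic_intros) auto
  have f0: "f0 holomorphic_on T" unfolding f0_def[abs_def]
    by (rule holomorphic_on_mult[OF holomorphic_on_minus[OF expectation_holomorphic] h])
  have xm: "x \<epsilon> \<in> borel_measurable (M n)" if \<epsilon>: "\<epsilon> \<in> grem_level d (N n)" for \<epsilon>
  proof -
    have "\<xi> n (take j \<epsilon>) \<in> borel_measurable (M n)" if j: "j \<in> {1..d}" for j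
    proof -
      have "take j \<epsilon> \<in> (\<Union>j\<in>{1..d}. grem_level j (N n))" using take_grem_level[OF \<epsilon>, of j] j by auto
      from distributed_measurable[OF normal[OF this]] show ?thesis by simp
    qed
    then show ?thesis unfolding x_def[abs_def] grem_field_def
      by (intro borel_measurable_times borel_measurable_sum borel_measurable_const)
  qed
  have "fluct n \<beta> \<omega> = h \<beta> * (\<Sum>\<epsilon>\<in>grem_level d (N n). exp (\<beta> * of_real (x \<epsilon> \<omega>))) + f0 \<beta>" for \<beta> \<omega>
    unfolding fluct_def grem_partition_def h_def f0_def x_def by (simp add: diff_divide_distrib)
  then show ?thesis using T.exp_sum_measurable[OF finite_grem_level xm h f0] by simp
qed

text \<open>The dummy value 0 covers the finitely many n at which the hypotheses of
  \<open>grem\<close> may fail and keeps the map measurable there.\<close>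

definition counts :: "nat \<Rightarrow> nat \<Rightarrow> 'a \<Rightarrow> nat list" where
  "counts n r \<omega> = map (\<lambda>i. if grem (M n) d n a (N n) (\<xi> n) (u n) then count n r \<omega> i else 0) [0..<r^3]"

lemma cell_count_eq_count: "grem (M n) d n a (N n) (\<xi> n) (u n) \<Longrightarrow> grem.cell_count (N n) (\<xi> n) (u n) r \<omega> = count n r \<omega>"
proof -
  assume "grem (M n) d n a (N n) (\<xi> n) (u n)"
  then interpret g: grem "M n" d n a "N n" "\<xi> n" "u n" .
  show ?thesis unfolding g.cell_count_def[abs_def] count_def[abs_def] g.V_def by simp
qed

lemma counts_measurable: "counts n r \<in> measurable (M n) (count_space UNIV)"
proof -
  have "(\<lambda>\<omega>. if grem (M n) d n a (N n) (\<xi> n) (u n) then count n r \<omega> i else 0) \<in> measurable (M n) (count_space UNIV)" for i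
  proof (cases "grem (M n) d n a (N n) (\<xi> n) (u n)")
    case True
    then show ?thesis using grem.cell_count_measurable[OF True, of r i] unfolding cell_count_eq_count[OF True] by simp
  qed simp
  then show ?thesis unfolding counts_def[abs_def] by (rule measurable_map_count_space)
qed

lemma counts_tendsto:
  assumes M': "prob_space M'" and P: "unit_poisson_points M' P" and r: "0 < r"
  shows "(\<lambda>n. measure (M n) {\<omega>\<in>space (M n). counts n r \<omega> = xs})
    \<longlonglongrightarrow> measure M' {\<omega>\<in>space M'. map (\<lambda>i. card {k. P k \<omega> \<in> cell r i}) [0..<r^3] = xs}"
proof (cases "length xs = r^3")
  case False
  then have e: "{\<omega>\<in>space (M n). counts n r \<omega> = xs} = {}" "{\<omega>\<in>space M'. map (\<lambda>i. card {k. P k \<omega> \<in> cell r i}) [0..<r^3] = xs} = {}" for n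
    unfolding counts_def by auto
  show ?thesis unfolding e measure_empty by (rule tendsto_const)
next
  case True
  let ?L = "r ^ 3"
  have r1: "1 \<le> r" using r by simp
  have eq: "(map f [0..<?L] = xs) = (\<forall>i<?L. f i = xs ! i)" for f :: "nat \<Rightarrow> nat"
    unfolding list_eq_iff_nth_eq using True by simp
  \<comment> \<open>The cell probability where \<open>u n\<close> is positive; the dummy 0 elsewhere
    keeps it nonnegative for all n, as \<open>multinomial_poisson_limit\<close> asks.\<close>
  define q where "q n i = (if 0 < u n then site_const (u n) * (\<integral>v. indicator (cell r i) (exp v) * exp (v - v\<^sup>2 / (2 * (u n)\<^sup>2)) \<partial>lborel) else 0)" for n i
  have q0: "0 \<le> q n i" for n i
    unfolding q_def using site_const_pos[of "u n"]
    by (auto intro!: mult_nonneg_nonneg Bochner_Integration.integral_nonneg simp: indicator_def)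
  have ql: "(\<lambda>n. real (N n 1) * q n i) \<longlonglongrightarrow> 1 / (real r)\<^sup>2" for i
  proof -
    have ab: "0 \<le> real i / (real r)\<^sup>2" "real i / (real r)\<^sup>2 < real (Suc i) / (real r)\<^sup>2" using r by (auto intro!: divide_strict_right_mono)
    have lim: "(\<lambda>n. real (N n 1) * site_const (u n) * (\<integral>v. indicator (cell r i) (exp v) * exp (v - v\<^sup>2 / (2 * (u n)\<^sup>2)) \<partial>lborel)) \<longlonglongrightarrow> 1 / (real r)\<^sup>2"
      using site_cell_limit[OF asymptotics(3,2) ab] by (simp add: cell_def diff_divide_distrib[symmetric])
    have "\<forall>\<^sub>F n in sequentially. real (N n 1) * site_const (u n) * (\<integral>v. indicator (cell r i) (exp v) * exp (v - v\<^sup>2 / (2 * (u n)\<^sup>2)) \<partial>lborel) = real (N n 1) * q n i"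
      using asymptotics(1) by eventually_elim (simp add: q_def)
    then show ?thesis by (rule Lim_transform_eventually[OF lim])
  qed
  define c where "c i = xs ! i" for i
  have lim: "(\<lambda>n. fact (N n 1) / (fact (N n 1 - (\<Sum>i<?L. c i)) * (\<Prod>i<?L. fact (c i))) *
     ((\<Prod>i<?L. q n i ^ c i) * (1 - (\<Sum>i<?L. q n i)) ^ (N n 1 - (\<Sum>i<?L. c i))))
     \<longlonglongrightarrow> (\<Prod>i<?L. (1 / (real r)\<^sup>2) ^ c i / fact (c i) * exp (- (1 / (real r)\<^sup>2)))"
    by (rule multinomial_poisson_limit[OF asymptotics(5) ql q0])
  have ev: "\<forall>\<^sub>F n in sequentially. fact (N n 1) / (fact (N n 1 - (\<Sum>i<?L. c i)) * (\<Prod>i<?L. fact (c i))) *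
     ((\<Prod>i<?L. q n i ^ c i) * (1 - (\<Sum>i<?L. q n i)) ^ (N n 1 - (\<Sum>i<?L. c i))) = measure (M n) {\<omega>\<in>space (M n). counts n r \<omega> = xs}"
    using eventually_grem filterlim_at_top[THEN iffD1, OF asymptotics(5), rule_format, of "\<Sum>i<?L. c i"]
  proof eventually_elim
    case (elim n)
    interpret g: grem "M n" d n a "N n" "\<xi> n" "u n" by (rule elim(1))
    have qg: "g.cell_prob r i = q n i" for i unfolding g.cell_prob_def q_def using g.u_pos by simp
    show ?case using g.cell_count_pmf[OF r1 elim(2)] elim(1)
      unfolding counts_def eq c_def[symmetric] qg cell_count_eq_count[OF elim(1)] by simp
  qed
  show ?thesis unfolding eq c_def[symmetric] poisson_cell_counts(2)[OF M' P r]
    by (rule Lim_transform_eventually[OF lim ev])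
qed

lemma cell_field_expectation:
  fixes \<phi> :: "(complex \<Rightarrow> complex) \<Rightarrow> real"
  assumes M': "prob_space M'" and P: "unit_poisson_points M' P" and r: "0 < r"
    and B: "\<And>f. f \<in> analytic_functions T \<Longrightarrow> \<bar>\<phi> f\<bar> \<le> B"
  shows "(\<lambda>n. \<integral>\<omega>. \<phi> (cell_field T (1 / \<sigma>1) r (counts n r \<omega>)) \<partial>M n)
    \<longlonglongrightarrow> (\<integral>\<omega>. \<phi> (cell_field T (1 / \<sigma>1) r (map (\<lambda>i. card {k. P k \<omega> \<in> cell r i}) [0..<r^3])) \<partial>M')"
  by (rule expectation_tendsto_of_point_masses[OF M M' counts_measurable poisson_cell_counts(1)[OF M' P r] counts_tendsto[OF M' P r],
        of "\<lambda>c. \<phi> (cell_field T (1 / \<sigma>1) r c)" B])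
     (rule B[OF cell_field_analytic])

text \<open>A finite cover of the compact core by the local discs turns the local estimates into one
  for the metric, outside the union of the exceptional events.\<close>

lemma approximation:
  assumes e: "0 < e"
  shows "\<exists>r0. \<forall>r\<ge>r0. \<forall>\<^sub>F n in sequentially. \<exists>B\<in>sets (M n). measure (M n) B \<le> e \<and>
    (\<forall>\<omega>\<in>space (M n) - B. hol_dist T (restrict (\<lambda>\<beta>. fluct n \<beta> \<omega>) T) (cell_field T (1 / \<sigma>1) r (counts n r \<omega>)) \<le> e)"
proof -
  interpret T: bounded_open_set T by (rule bounded_open_T)
  let ?G = "\<lambda>b R e r n B. measure (M n) B \<le> e \<and>
    (\<forall>\<omega>\<in>space (M n) - B. \<forall>z\<in>cball b R. norm (fluct n z \<omega> - cell_zeta r (count n r \<omega>) (z * of_real (1 / \<sigma>1))) \<le> e)"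
  have "\<forall>b\<in>T. \<exists>R. 0 < R \<and> (\<forall>e>0. \<exists>r0. \<forall>r\<ge>r0. \<forall>\<^sub>F n in sequentially. \<exists>B\<in>sets (M n). ?G b R e r n B)"
    using local_approximation by blast
  from bchoice[OF this] obtain R where R: "\<And>b. b \<in> T \<Longrightarrow> 0 < R b"
    and G: "\<And>b e. b \<in> T \<Longrightarrow> 0 < e \<Longrightarrow> \<exists>r0. \<forall>r\<ge>r0. \<forall>\<^sub>F n in sequentially. \<exists>B\<in>sets (M n). ?G b (R b) e r n B" by auto
  have K: "T.core e \<subseteq> T" by (rule T.core_subset[OF e])
  have "T.core e \<subseteq> (\<Union>b\<in>T.core e. ball b (R b))" using R K by force
  from compactE_image[OF T.compact_core[OF e] _ this] obtain C where C: "C \<subseteq> T.core e" "finite C" "T.core e \<subseteq> (\<Union>b\<in>C. ball b (R b))"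
    by (metis open_ball)
  \<comment> \<open>The union bound adds card C probabilities of size e'; the + 1 guards against an
    empty cover.\<close>
  define e' where "e' = e / (real (card C) + 1)"
  have e': "0 < e'" "e' \<le> e" "real (card C) * e' \<le> e" unfolding e'_def using e by (auto simp: field_simps)
  have "\<forall>b\<in>C. \<forall>\<^sub>F r in sequentially. \<forall>\<^sub>F n in sequentially. \<exists>B\<in>sets (M n). ?G b (R b) e' r n B"
    using G[OF _ e'(1)] C(1) K unfolding eventually_sequentially[of "\<lambda>r. \<forall>\<^sub>F n in sequentially. \<exists>B\<in>sets (M n). ?G b (R b) e' r n B" for b] by blast
  then have "\<forall>\<^sub>F r in sequentially. \<forall>b\<in>C. \<forall>\<^sub>F n in sequentially. \<exists>B\<in>sets (M n). ?G b (R b) e' r n B"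
    by (rule eventually_ball_finite[OF C(2)])
  then obtain r0 where r0: "\<And>r. r0 \<le> r \<Longrightarrow> \<forall>b\<in>C. \<forall>\<^sub>F n in sequentially. \<exists>B\<in>sets (M n). ?G b (R b) e' r n B"
    unfolding eventually_sequentially[of "\<lambda>r. \<forall>b\<in>C. \<forall>\<^sub>F n in sequentially. \<exists>B\<in>sets (M n). ?G b (R b) e' r n B"] by blast
  have "\<forall>\<^sub>F n in sequentially. \<exists>B\<in>sets (M n). measure (M n) B \<le> e \<and>
    (\<forall>\<omega>\<in>space (M n) - B. hol_dist T (restrict (\<lambda>\<beta>. fluct n \<beta> \<omega>) T) (cell_field T (1 / \<sigma>1) r (counts n r \<omega>)) \<le> e)" if r: "r0 \<le> r" for r
    using eventually_ball_finite[OF C(2) r0[OF r]] eventually_grem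
  proof eventually_elim
    case (elim n)
    interpret prob_space "M n" by (rule M)
    have "\<forall>b\<in>C. \<exists>B. B \<in> events \<and> ?G b (R b) e' r n B" using elim(1) by (simp only: Bex_def)
    from bchoice[OF this] obtain B where B: "\<forall>b\<in>C. B b \<in> events \<and> ?G b (R b) e' r n (B b)" by blast
    have Bm: "\<And>b. b \<in> C \<Longrightarrow> B b \<in> events" using B by blast
    have "prob (\<Union>b\<in>C. B b) \<le> (\<Sum>b\<in>C. prob (B b))" by (rule measure_UNION_le[OF C(2) Bm])
    also have "\<dots> \<le> (\<Sum>b\<in>C. e')" using B by (intro sum_mono) blast
    also have "\<dots> \<le> e" using e'(3) by simp
    finally have pB: "prob (\<Union>b\<in>C. B b) \<le> e" .
    have "hol_dist T (restrict (\<lambda>\<beta>. fluct n \<beta> \<omega>) T) (cell_field T (1 / \<sigma>1) r (counts n r \<omega>)) \<le> e"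
      if \<omega>: "\<omega> \<in> space (M n) - (\<Union>b\<in>C. B b)" for \<omega>
    proof (rule T.hol_dist_le_on_core)
      fix z assume z: "z \<in> T" "e \<le> infdist z (- T)"
      then have "z \<in> T.core e" unfolding T.core_def by simp
      then obtain b where b: "b \<in> C" "z \<in> ball b (R b)" using C(3) by blast
      have "cell_field T (1 / \<sigma>1) r (counts n r \<omega>) z = cell_zeta r (count n r \<omega>) (z * of_real (1 / \<sigma>1))"
        unfolding counts_def cell_field_map[OF z(1)] using elim(2) by simp
      moreover have "norm (fluct n z \<omega> - cell_zeta r (count n r \<omega>) (z * of_real (1 / \<sigma>1))) \<le> e'"
      proof -
        have "z \<in> cball b (R b)" "\<omega> \<in> space (M n) - B b" using b \<omega> by auto
        then show ?thesis using B b(1) by blast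
      qed
      ultimately show "norm (restrict (\<lambda>\<beta>. fluct n \<beta> \<omega>) T z - cell_field T (1 / \<sigma>1) r (counts n r \<omega>) z) \<le> e"
        using z(1) e'(2) by simp
    qed
    moreover have "(\<Union>b\<in>C. B b) \<in> events" using Bm C(2) by (intro sets.finite_UN) auto
    ultimately show ?case using pB by blast
  qed
  then show ?thesis by blast
qed

text \<open>On a compact set the real part of \<beta> s attains its bounds, strictly between 1/2 and
  1; they provide the abscissa \<open>a\<close> and the distance \<open>b\<close> from the pole.
  \<open>Suc r\<close> avoids the degenerate cells of r = 0.\<close>

lemma (in regular_sequence) cell_field_tendsto:
  assumes T: "\<And>\<beta>. \<beta> \<in> D \<Longrightarrow> 1/2 < Re (\<beta> * of_real s) \<and> Re (\<beta> * of_real s) < 1" and D: "bounded_open_set D"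
  shows "(\<lambda>r. hol_dist D (cell_field D s (Suc r) (map (\<lambda>i. card {k. p k \<in> cell (Suc r) i}) [0..<Suc r ^ 3])) (restrict (\<lambda>\<beta>. poisson_zeta p (\<beta> * of_real s)) D)) \<longlonglongrightarrow> 0"
proof (rule bounded_open_set.tendsto_hol_distI[OF D])
  fix K and e :: real assume K: "compact K" "K \<subseteq> D" and e: "0 < e"
  show "\<forall>\<^sub>F r in sequentially. \<forall>z\<in>K. norm (cell_field D s (Suc r) (map (\<lambda>i. card {k. p k \<in> cell (Suc r) i}) [0..<Suc r ^ 3]) z
      - restrict (\<lambda>\<beta>. poisson_zeta p (\<beta> * of_real s)) D z) \<le> e"
  proof (cases "K = {}")
    case False
    have cont: "continuous_on K (\<lambda>\<beta>. Re (\<beta> * of_real s))" by (intro continuous_intros)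
    obtain x0 where x0: "x0 \<in> K" "\<forall>y\<in>K. Re (x0 * of_real s) \<le> Re (y * of_real s)"
      using continuous_attains_inf[OF K(1) False cont] by blast
    obtain x1 where x1: "x1 \<in> K" "\<forall>y\<in>K. Re (y * of_real s) \<le> Re (x1 * of_real s)"
      using continuous_attains_sup[OF K(1) False cont] by blast
    have "compact ((\<lambda>\<beta>. \<beta> * complex_of_real s) ` K)" by (intro compact_continuous_image continuous_intros K(1))
    from compact_imp_bounded[OF this] obtain B where "\<forall>w\<in>(\<lambda>\<beta>. \<beta> * complex_of_real s) ` K. norm w \<le> B"
      unfolding bounded_iff by (elim exE) (rule that)
    then have B: "norm (z * of_real s) \<le> B" if "z \<in> K" for z using that by simp
    define a where "a = Re (x0 * of_real s)"
    define b where "b = 1 - Re (x1 * of_real s)"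
    have a: "1/2 < a" "a < 1" unfolding a_def using T[of x0] x0(1) K(2) by auto
    have b: "0 < b" unfolding b_def using T[of x1] x1(1) K(2) by auto
    have "\<forall>\<^sub>F r in sequentially. \<forall>z. a \<le> Re z \<and> norm z \<le> B \<and> b \<le> norm (z - 1) \<longrightarrow>
       norm (cell_zeta (Suc r) (\<lambda>i. card {k. p k \<in> cell (Suc r) i}) z - zeta_cont z) \<le> e"
      using eventually_sequentially_Suc[THEN iffD2, OF cell_zeta_tendsto[OF a b e]] .
    then show ?thesis
    proof eventually_elim
      case (elim r)
      show ?case
      proof
        fix z assume z: "z \<in> K"
        have zD: "z \<in> D" using z K by auto
        have "b \<le> \<bar>Re (z * of_real s - 1)\<bar>" unfolding b_def using x1(2) z T[OF zD] by (simp add: abs_if)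
        also have "\<dots> \<le> norm (z * of_real s - 1)" by (rule abs_Re_le_cmod)
        finally have "norm (cell_zeta (Suc r) (\<lambda>i. card {k. p k \<in> cell (Suc r) i}) (z * of_real s) - zeta_cont (z * of_real s)) \<le> e"
          using elim x0(2) z B[OF z] unfolding a_def by blast
        then show "norm (cell_field D s (Suc r) (map (\<lambda>i. card {k. p k \<in> cell (Suc r) i}) [0..<Suc r ^ 3]) z
            - restrict (\<lambda>\<beta>. poisson_zeta p (\<beta> * of_real s)) D z) \<le> e"
          unfolding cell_field_map[OF zD] restrict_apply'[OF zD] using T[OF zD] by (subst poisson_zeta_eq) auto
      qed
    qed
  qed simp
qed

lemma (in regular_sequence) poisson_zeta_analytic:
  assumes T: "\<And>\<beta>. \<beta> \<in> D \<Longrightarrow> 1/2 < Re (\<beta> * of_real s) \<and> Re (\<beta> * of_real s) < 1" and D: "bounded_open_set D"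
  shows "restrict (\<lambda>\<beta>. poisson_zeta p (\<beta> * of_real s)) D \<in> analytic_functions D"
proof (rule bounded_open_set.restrict_analytic[OF D])
  have l: "(\<lambda>\<beta>. \<beta> * complex_of_real s) holomorphic_on D" by (intro holomorphic_intros)
  have im: "(\<lambda>\<beta>. \<beta> * complex_of_real s) ` D \<subseteq> {z. 1/2 < Re z}" using T by auto
  have n: "(\<lambda>\<beta>. zeta_num (\<beta> * complex_of_real s)) holomorphic_on D"
    using holomorphic_on_compose_gen[OF l holomorphic_zeta_num im] unfolding o_def .
  have nz: "\<beta> * complex_of_real s - 1 \<noteq> 0" if "\<beta> \<in> D" for \<beta>
  proof
    assume "\<beta> * complex_of_real s - 1 = 0"
    then have "Re (\<beta> * complex_of_real s) = 1" by (simp only: right_minus_eq one_complex.simps)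
    then show False using T[OF that] by linarith
  qed
  have "(\<lambda>\<beta>. zeta_num (\<beta> * complex_of_real s) / (\<beta> * complex_of_real s - 1)) holomorphic_on D"
    by (rule holomorphic_on_divide[OF n holomorphic_on_diff[OF l holomorphic_on_const] nz])
  then show "(\<lambda>\<beta>. poisson_zeta p (\<beta> * of_real s)) holomorphic_on D"
    by (rule holomorphic_transform) (use T in \<open>simp add: poisson_zeta_eq zeta_cont_def\<close>)
qed

theorem convergence:
  assumes M': "prob_space M'" and P: "unit_poisson_points M' P"
  shows "converges_in_distribution (locally_uniform_topology T) M (\<lambda>n \<omega>. restrict (\<lambda>\<beta>. fluct n \<beta> \<omega>) T)
     M' (\<lambda>\<omega>. restrict (\<lambda>\<beta>. poisson_zeta (\<lambda>k. P k \<omega>) (\<beta> * of_real (1 / \<sigma>1))) T)"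
proof -
  interpret T: bounded_open_set T by (rule bounded_open_T)
  interpret M': prob_space M' by (rule M')
  let ?C' = "\<lambda>r \<omega>. map (\<lambda>i. card {k. P k \<omega> \<in> cell (Suc r) i}) [0..<Suc r ^ 3]"
  let ?Z' = "\<lambda>r \<omega>. cell_field T (1 / \<sigma>1) (Suc r) (?C' r \<omega>)"
  let ?X' = "\<lambda>\<omega>. restrict (\<lambda>\<beta>. poisson_zeta (\<lambda>k. P k \<omega>) (\<beta> * of_real (1 / \<sigma>1))) T"
  have ts: "1/2 < Re (\<beta> * of_real (1 / \<sigma>1)) \<and> Re (\<beta> * of_real (1 / \<sigma>1)) < 1" if "\<beta> \<in> T" for \<beta>
    using T_scaled[OF that] by blast
  obtain N0 where N0: "\<And>\<omega>. \<omega> \<in> space M' - N0 \<Longrightarrow> regular_sequence (\<lambda>k. P k \<omega>)" "N0 \<in> null_sets M'"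
    using AE_E3[OF M'.AE_regular_sequence[OF P]] by blast
  have N0s: "N0 \<inter> space M' \<in> sets M'" using N0(2) by auto
  define zero where "zero = restrict (\<lambda>_. 0 :: complex) T"
  have zero: "zero \<in> analytic_functions T" unfolding zero_def by (rule T.restrict_analytic) (rule holomorphic_on_const)
  \<comment> \<open>On the null set where the points may fail to be regular the limit is replaced by
    zero; it is then everywhere a pointwise limit of functions of finitely many counts off that set,
    hence measurable.\<close>
  define Y' where "Y' \<omega> = (if \<omega> \<in> N0 then zero else ?X' \<omega>)" for \<omega>
  have lim: "(\<lambda>r. hol_dist T (?Z' r \<omega>) (Y' \<omega>)) \<longlonglongrightarrow> 0" and an: "Y' \<omega> \<in> analytic_functions T" if "\<omega> \<in> space M' - N0" for \<omega>
    using regular_sequence.cell_field_tendsto[OF N0(1)[OF that] ts bounded_open_T]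
      regular_sequence.poisson_zeta_analytic[OF N0(1)[OF that] ts bounded_open_T] that unfolding Y'_def by auto
  have Y'A: "Y' \<omega> \<in> analytic_functions T" if "\<omega> \<in> space M'" for \<omega>
    using an[of \<omega>] that zero unfolding Y'_def by (cases "\<omega> \<in> N0") auto
  have AE_N0: "AE \<omega> in M'. \<omega> \<in> space M' - N0"
    using AE_not_in[OF N0(2)] by (auto intro: AE_mp)
  have Z'm: "(\<lambda>\<omega>. \<phi> (?Z' r \<omega>)) \<in> borel_measurable M'" for r and \<phi> :: "(complex \<Rightarrow> complex) \<Rightarrow> real"
    by (rule measurable_compose[OF poisson_cell_counts(1)[OF M' P zero_less_Suc]]) simp
  have Zm: "(\<lambda>\<omega>. \<phi> (cell_field T (1 / \<sigma>1) (Suc r) (counts n (Suc r) \<omega>))) \<in> borel_measurable (M n)" for r n and \<phi> :: "(complex \<Rightarrow> complex) \<Rightarrow> real"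
    by (rule measurable_compose[OF counts_measurable]) simp
  have Y'm: "Y' \<in> measurable M' (borel_of T.hol.mtopology)"
  proof (rule T.hol.measurable_borel_ofI)
    show "Y' \<omega> \<in> analytic_functions T" if "\<omega> \<in> space M'" for \<omega> by (rule Y'A[OF that])
    fix \<phi> :: "(complex \<Rightarrow> complex) \<Rightarrow> real" assume \<phi>: "continuous_map T.hol.mtopology euclideanreal \<phi>"
    have m: "(\<lambda>\<omega>. if \<omega> \<in> N0 then \<phi> zero else \<phi> (?Z' r \<omega>)) \<in> borel_measurable M'" for r
      by (rule measurable_If_set[OF _ Z'm N0s]) simp
    show "(\<lambda>\<omega>. \<phi> (Y' \<omega>)) \<in> borel_measurable M'"
    proof (rule borel_measurable_LIMSEQ_real[OF _ m])
      fix \<omega> assume w: "\<omega> \<in> space M'"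
      show "(\<lambda>r. if \<omega> \<in> N0 then \<phi> zero else \<phi> (?Z' r \<omega>)) \<longlonglongrightarrow> \<phi> (Y' \<omega>)"
      proof (cases "\<omega> \<in> N0")
        case False
        have "(\<lambda>r. \<phi> (?Z' r \<omega>)) \<longlonglongrightarrow> \<phi> (Y' \<omega>)"
          using lim[of \<omega>] w False
          by (intro T.continuous_map_tendsto[OF \<phi>[folded T.locally_uniform_topology_eq] cell_field_analytic Y'A[OF w]]) auto
        then show ?thesis using False by simp
      qed (simp add: Y'_def)
    qed
  qed
  have conv: "(\<lambda>n. \<integral>\<omega>. \<phi> (restrict (\<lambda>\<beta>. fluct n \<beta> \<omega>) T) \<partial>M n) \<longlonglongrightarrow> (\<integral>\<omega>. \<phi> (Y' \<omega>) \<partial>M')"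
    if \<phi>: "continuous_map T.hol.mtopology euclideanreal \<phi>" "bounded (\<phi> ` analytic_functions T)" for \<phi>
  proof (rule T.hol.converging_together[where Z = "\<lambda>r n \<omega>. cell_field T (1 / \<sigma>1) (Suc r) (counts n (Suc r) \<omega>)" and Z' = ?Z', OF M M' _ Y'm])
    show "(\<lambda>\<omega>. restrict (\<lambda>\<beta>. fluct n \<beta> \<omega>) T) \<in> measurable (M n) (borel_of T.hol.mtopology)" for n
      using fluct_measurable unfolding T.locally_uniform_topology_eq .
    show "(\<lambda>\<omega>. cell_field T (1 / \<sigma>1) (Suc r) (counts n (Suc r) \<omega>)) \<in> measurable (M n) (borel_of T.hol.mtopology)" for r n
      by (rule T.hol.measurable_borel_ofI) (rule cell_field_analytic, rule Zm)
    show "?Z' r \<in> measurable M' (borel_of T.hol.mtopology)" for r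
      by (rule T.hol.measurable_borel_ofI) (rule cell_field_analytic, rule Z'm)
    show "AE \<omega> in M'. (\<lambda>r. hol_dist T (?Z' r \<omega>) (Y' \<omega>)) \<longlonglongrightarrow> 0"
      using AE_N0 by eventually_elim (rule lim)
    show "\<exists>r0. \<forall>r\<ge>r0. \<forall>\<^sub>F n in sequentially. \<exists>B\<in>sets (M n). measure (M n) B \<le> e \<and>
      (\<forall>\<omega>\<in>space (M n) - B. hol_dist T (restrict (\<lambda>\<beta>. fluct n \<beta> \<omega>) T) (cell_field T (1 / \<sigma>1) (Suc r) (counts n (Suc r) \<omega>)) \<le> e)"
      if e: "0 < e" for e
    proof -
      obtain r0 where r0: "\<forall>r\<ge>r0. \<forall>\<^sub>F n in sequentially. \<exists>B\<in>sets (M n). measure (M n) B \<le> e \<and>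
          (\<forall>\<omega>\<in>space (M n) - B. hol_dist T (restrict (\<lambda>\<beta>. fluct n \<beta> \<omega>) T) (cell_field T (1 / \<sigma>1) r (counts n r \<omega>)) \<le> e)"
        using approximation[OF e] by (elim exE) (rule that)
      show ?thesis
      proof (intro exI[of _ r0] allI impI)
        fix r assume "r0 \<le> r"
        then have "r0 \<le> Suc r" by simp
        from r0[rule_format, OF this] show "\<forall>\<^sub>F n in sequentially. \<exists>B\<in>sets (M n). measure (M n) B \<le> e \<and>
          (\<forall>\<omega>\<in>space (M n) - B. hol_dist T (restrict (\<lambda>\<beta>. fluct n \<beta> \<omega>) T) (cell_field T (1 / \<sigma>1) (Suc r) (counts n (Suc r) \<omega>)) \<le> e)" .
      qed
    qed
    show "(\<lambda>n. \<integral>\<omega>. \<psi> (cell_field T (1 / \<sigma>1) (Suc r) (counts n (Suc r) \<omega>)) \<partial>M n) \<longlonglongrightarrow> (\<integral>\<omega>. \<psi> (?Z' r \<omega>) \<partial>M')"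
      if \<psi>: "continuous_map T.hol.mtopology euclideanreal \<psi>" "bounded (\<psi> ` analytic_functions T)" for r \<psi>
    proof -
      obtain B where "\<And>f. f \<in> analytic_functions T \<Longrightarrow> \<bar>\<psi> f\<bar> \<le> B" using \<psi>(2) unfolding bounded_iff by auto
      from cell_field_expectation[OF M' P zero_less_Suc this] show ?thesis .
    qed
  qed (rule \<phi>)+
  show ?thesis
    unfolding converges_in_distribution_def random_element_version_def T.locally_uniform_topology_eq
  proof (intro exI[of _ "\<lambda>n \<omega>. restrict (\<lambda>\<beta>. fluct n \<beta> \<omega>) T"] exI[of _ Y'] conjI allI impI)
    show "(\<lambda>\<omega>. restrict (\<lambda>\<beta>. fluct n \<beta> \<omega>) T) \<in> measurable (M n) (borel_of T.hol.mtopology)" for n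
      using fluct_measurable unfolding T.locally_uniform_topology_eq .
    show "AE \<omega> in M'. ?X' \<omega> = Y' \<omega>" using AE_N0 by eventually_elim (simp add: Y'_def)
    show "(\<lambda>n. \<integral>\<omega>. \<phi> (restrict (\<lambda>\<beta>. fluct n \<beta> \<omega>) T) \<partial>M n) \<longlonglongrightarrow> (\<integral>\<omega>. \<phi> (Y' \<omega>) \<partial>M')"
      if "continuous_map T.hol.mtopology euclideanreal \<phi> \<and> bounded (\<phi> ` topspace T.hol.mtopology)" for \<phi>
      using that by (intro conv) auto
  qed (use Y'm in auto)
qed

end

theorem theorem2p21:
  fixes d :: nat
    and a \<alpha> :: "nat \<Rightarrow> real"
    and N :: "nat \<Rightarrow> nat \<Rightarrow> nat"
    and M :: "nat \<Rightarrow> 'a measure"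
    and \<xi> :: "nat \<Rightarrow> nat list \<Rightarrow> 'a \<Rightarrow> real"
    and u :: "nat \<Rightarrow> real"
    and M' :: "'b measure"
    and P :: "nat \<Rightarrow> 'b \<Rightarrow> real"
    and \<sigma>\<^sub>1 :: real
    and D :: "complex set"
  assumes d: "1 \<le> d"
    and a: "\<And>j. j \<in> {1..d} \<Longrightarrow> 0 < a j"
    and alpha: "\<And>j. j \<in> {1..d} \<Longrightarrow> 1 < \<alpha> j"
    and N: "\<And>j. j \<in> {1..d} \<Longrightarrow> (\<lambda>n. real (N n j) / \<alpha> j ^ n) \<longlonglongrightarrow> 1"
    and sigma: "strict_mono_on {1..d} (grem_sigma a \<alpha>)"
    and M: "\<And>n. prob_space (M n)"
    and normal: "\<And>n \<eta>. \<eta> \<in> (\<Union>j\<in>{1..d}. grem_level j (N n)) \<Longrightarrow>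
          distributed (M n) lborel (\<xi> n \<eta>) std_normal_density"
    and indep: "\<And>n. prob_space.indep_vars (M n) (\<lambda>_. borel) (\<xi> n)
          (\<Union>j\<in>{1..d}. grem_level j (N n))"
    and u: "(\<lambda>n. real (N n 1)) \<sim>[sequentially] (\<lambda>n. sqrt (2 * pi) * u n * exp ((u n)\<^sup>2 / 2))"
    and M': "prob_space M'"
    and P: "unit_poisson_points M' P"
    and sigma1: "\<sigma>\<^sub>1 = grem_sigma a \<alpha> 1"
    and D: "D = expectation_phase \<sigma>\<^sub>1 \<inter> {\<beta>. Re \<beta> > \<sigma>\<^sub>1 / 2}"
  shows "converges_in_distribution (locally_uniform_topology D)
     M (\<lambda>n \<omega>. restrict (\<lambda>\<beta>.
          (grem_partition d a (N n) (\<xi> n) n \<beta> \<omega> - (\<integral>\<omega>'. grem_partition d a (N n) (\<xi> n) n \<beta> \<omega>' \<partial>M n))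
          / exp (\<beta> * complex_of_real (sqrt (real n * a 1) * u n) + grem_c_tilde d a (N n) n \<beta>)) D)
     M' (\<lambda>\<omega>. restrict (\<lambda>\<beta>. poisson_zeta (\<lambda>k. P k \<omega>) (\<beta> / complex_of_real \<sigma>\<^sub>1)) D)"
proof -
  interpret grem_sequence d a \<alpha> N M \<xi> u
    by (rule grem_sequence.intro)
      (rule d, erule a, erule alpha, erule N, rule sigma, rule M, erule normal, rule indep, rule u)
  have s: "\<sigma>\<^sub>1 = \<sigma>1" unfolding sigma1 \<sigma>1_def ..
  \<comment> \<open>In the half-plane Re \<beta> > \<sigma>_1 / 2 the expectation phase is an open
    triangle, bounded as the metric requires.\<close>
  have T: "D = T" unfolding D s T_def by (rule expectation_triangle[OF \<sigma>1_pos])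
  have eq: "\<beta> * complex_of_real (1 / \<sigma>1) = \<beta> / complex_of_real \<sigma>1" for \<beta> by simp
  show ?thesis using convergence[OF M' P] unfolding fluct_def eq T s .
qed

end
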